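(* Let $H \in \{P_2+P_4,\ P_1+P_5\}$. Then the class of $(K_3,H)$-free graphs is well-quasi-ordered by the labelled induced subgraph relation and has bounded clique-width.
   Context: All graphs are finite, simple and undirected. $P_r$ denotes the path on $r$ vertices, $K_3$ the triangle, and $G+H$ the disjoint union of graphs $G$ and $H$. For a set of graphs $\{H_1,\dots,H_p\}$, a graph is $(H_1,\dots,H_p)$-free if it has no induced subgraph isomorphic to any $H_i$. A class of graphs has bounded clique-width if there is a constant $c$ such that every graph in the class has clique-width at most $c$. Labelled graphs: given a quasi-order $(W,\le)$, a labelled graph is a graph $G$ with a map $l_G:V(G)\to W$; $G$ is a labelled induced subgraph of a labelled graph $H$ if there is an isomorphism from $G$ onto an induced subgraph of $H$ mapping each vertex $v$ to a vertex $w$ with $l_G(v)\le l_H(w)$. A class $X$ is well-quasi-ordered by the labelled induced subgraph relation if, for every well-quasi-order $(W,\le)$, there is no infinite antichain (with respect to the labelled induced subgraph relation) of graphs from $X$ labelled with elements of $W$. *)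

theory Defs
  imports Main
begin

datatype 'a graph = Graph (verts: "'a set") (edges: "'a set set")

definition simple_graph :: "'a graph \<Rightarrow> bool" where
  "simple_graph G \<longleftrightarrow> finite (verts G) \<and>
     edges G \<subseteq> {{u, v} | u v. u \<in> verts G \<and> v \<in> verts G \<and> u \<noteq> v}"

definition path_graph :: "nat \<Rightarrow> nat graph" where
  "path_graph r = Graph {..<r} {{i, Suc i} | i. Suc i < r}"

definition complete_graph :: "nat \<Rightarrow> nat graph" where
  "complete_graph n = Graph {..<n} {{i, j} | i j. i < n \<and> j < n \<and> i \<noteq> j}"

definition disjoint_union :: "'a graph \<Rightarrow> 'b graph \<Rightarrow> ('a + 'b) graph" where
  "disjoint_union G H =
     Graph (Inl ` verts G \<union> Inr ` verts H) ((`) Inl ` edges G \<union> (`) Inr ` edges H)"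

definition graph_iso :: "('a \<Rightarrow> 'b) \<Rightarrow> 'a graph \<Rightarrow> 'b graph \<Rightarrow> bool" where
  "graph_iso f G H \<longleftrightarrow> bij_betw f (verts G) (verts H) \<and>
     (\<forall>u\<in>verts G. \<forall>v\<in>verts G. {u, v} \<in> edges G \<longleftrightarrow> {f u, f v} \<in> edges H)"

definition induced_subgraph :: "'a graph \<Rightarrow> 'a set \<Rightarrow> 'a graph" where
  "induced_subgraph G S = Graph S {e \<in> edges G. e \<subseteq> S}"

definition free_of :: "'b graph \<Rightarrow> 'a graph \<Rightarrow> bool" where
  "free_of H G \<longleftrightarrow> \<not> (\<exists>S f. S \<subseteq> verts G \<and> graph_iso f H (induced_subgraph G S))"

text \<open>The two forbidden graphs may have different vertex types, so they are two
  arguments rather than a set.\<close>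

definition free_graphs :: "'b graph \<Rightarrow> 'c graph \<Rightarrow> 'a graph set" where
  "free_graphs H1 H2 = {G. simple_graph G \<and> free_of H1 G \<and> free_of H2 G}"

definition quasi_order_on :: "'w set \<Rightarrow> ('w \<Rightarrow> 'w \<Rightarrow> bool) \<Rightarrow> bool" where
  "quasi_order_on W le \<longleftrightarrow> reflp_on W le \<and> transp_on W le"

definition well_quasi_order_on :: "'w set \<Rightarrow> ('w \<Rightarrow> 'w \<Rightarrow> bool) \<Rightarrow> bool" where
  "well_quasi_order_on W le \<longleftrightarrow> quasi_order_on W le \<and>
     (\<forall>x :: nat \<Rightarrow> 'w. range x \<subseteq> W \<longrightarrow> (\<exists>i j. i < j \<and> le (x i) (x j)))"

text \<open>A labelled graph is a pair of a graph and a labelling, whose values off the vertex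
  set are irrelevant: two labelled graphs that differ only there embed into each other.\<close>

definition labelled_graphs ::
  "'a graph set \<Rightarrow> 'w set \<Rightarrow> ('a graph \<times> ('a \<Rightarrow> 'w)) set" where
  "labelled_graphs X W = {(G, l). G \<in> X \<and> l ` verts G \<subseteq> W}"

definition labelled_induced_subgraph ::
  "('w \<Rightarrow> 'w \<Rightarrow> bool) \<Rightarrow> 'a graph \<times> ('a \<Rightarrow> 'w) \<Rightarrow> 'a graph \<times> ('a \<Rightarrow> 'w) \<Rightarrow> bool" where
  "labelled_induced_subgraph le = (\<lambda>(G, lG) (H, lH).
     \<exists>S f. S \<subseteq> verts H \<and> graph_iso f G (induced_subgraph H S) \<and>
           (\<forall>v\<in>verts G. le (lG v) (lH (f v))))"

definition antichain_wrt :: "('b \<Rightarrow> 'b \<Rightarrow> bool) \<Rightarrow> 'b set \<Rightarrow> bool" where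
  "antichain_wrt r A \<longleftrightarrow> (\<forall>x\<in>A. \<forall>y\<in>A. x \<noteq> y \<longrightarrow> \<not> r x y)"

text \<open>A definition cannot quantify over types; the label type is therefore a type
  argument, and ``every well-quasi-order'' is obtained by leaving \<open>'w\<close> arbitrary.\<close>

definition labelled_wqo :: "'w itself \<Rightarrow> 'a graph set \<Rightarrow> bool" where
  "labelled_wqo _ X \<longleftrightarrow>
     (\<forall>(W :: 'w set) le. well_quasi_order_on W le \<longrightarrow>
        \<not> (\<exists>A. A \<subseteq> labelled_graphs X W \<and> infinite A \<and>
               antichain_wrt (labelled_induced_subgraph le) A))"

text \<open>\<open>cw_construct k G l\<close>: the graph \<open>G\<close> with labelling \<open>l\<close> can be built with the labels
  \<open>1, \<dots>, k\<close> by creating a labelled vertex, taking a disjoint union, joining all vertices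
  labelled \<open>i\<close> to all vertices labelled \<open>j \<noteq> i\<close>, and renaming label \<open>i\<close> to \<open>j\<close>.\<close>

inductive cw_construct :: "nat \<Rightarrow> 'a graph \<Rightarrow> ('a \<Rightarrow> nat) \<Rightarrow> bool" for k :: nat where
  create: "i \<in> {1..k} \<Longrightarrow> cw_construct k (Graph {v} {}) (\<lambda>_. i)"
| union: "cw_construct k G l \<Longrightarrow> cw_construct k H m \<Longrightarrow> verts G \<inter> verts H = {} \<Longrightarrow>
    cw_construct k (Graph (verts G \<union> verts H) (edges G \<union> edges H))
      (\<lambda>v. if v \<in> verts G then l v else m v)"
| join: "cw_construct k G l \<Longrightarrow> i \<in> {1..k} \<Longrightarrow> j \<in> {1..k} \<Longrightarrow> i \<noteq> j \<Longrightarrow>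
    cw_construct k
      (Graph (verts G)
        (edges G \<union> {{u, v} | u v. u \<in> verts G \<and> v \<in> verts G \<and> l u = i \<and> l v = j})) l"
| relabel: "cw_construct k G l \<Longrightarrow> i \<in> {1..k} \<Longrightarrow> j \<in> {1..k} \<Longrightarrow>
    cw_construct k G (\<lambda>v. if l v = i then j else l v)"

lemma cw_construct_edgeless:
  assumes "finite V" "V \<noteq> {}" "l ` V \<subseteq> {1..k}"
  shows "\<exists>m. cw_construct k (Graph V {}) m \<and> (\<forall>v\<in>V. m v = l v)"
  using assms
proof (induction V rule: finite_ne_induct)
  case (singleton x)
  then show ?case
    by (auto intro!: exI[of _ "\<lambda>_. l x"] cw_construct.create)
next
  case (insert x F)
  then obtain m where m: "cw_construct k (Graph F {}) m" "\<forall>v\<in>F. m v = l v"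
    by auto
  have "cw_construct k (Graph {x} {}) (\<lambda>_. l x)"
    using insert.prems by (intro cw_construct.create) auto
  from cw_construct.union[OF this m(1)] insert.hyps m(2) show ?case
    by (auto intro!: exI)
qed

text \<open>The minimum in the definition of clique-width below ranges over a nonempty set.\<close>

lemma cw_construct_exists:
  assumes G: "simple_graph G" and ne: "verts G \<noteq> {}"
  shows "\<exists>k l. cw_construct k G l"
proof -
  have fin: "finite (verts G)" using G by (simp add: simple_graph_def)
  then obtain h where h: "bij_betw h (verts G) {1..card (verts G)}"
    using finite_same_card_bij[of "verts G" "{1..card (verts G)}"] by auto
  define k where "k = card (verts G)"
  have hk: "h ` verts G \<subseteq> {1..k}" and inj: "inj_on h (verts G)"
    using h by (auto simp: bij_betw_def k_def)
  obtain m where m: "cw_construct k (Graph (verts G) {}) m" "\<forall>v\<in>verts G. m v = h v"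
    using cw_construct_edgeless[OF fin ne hk] by blast
  have "edges G \<subseteq> Pow (verts G)" using G by (auto simp: simple_graph_def)
  then have "finite (edges G)" using fin finite_subset by blast
  moreover have "edges G \<subseteq> edges G" by simp
  ultimately have "cw_construct k (Graph (verts G) (edges G)) m"
  proof (induction rule: finite_subset_induct)
    case empty
    then show ?case by (rule m(1))
  next
    case (insert e F)
    obtain u v where uv: "e = {u, v}" "u \<in> verts G" "v \<in> verts G" "u \<noteq> v"
      using insert.hyps G by (auto simp: simple_graph_def)
    have eq: "{{x, y} | x y. x \<in> verts G \<and> y \<in> verts G \<and> m x = m u \<and> m y = m v} = {e}"
      using uv m(2) inj_onD[OF inj] by auto
    have ij: "m u \<in> {1..k}" "m v \<in> {1..k}" "m u \<noteq> m v"
      using uv m(2) hk inj_onD[OF inj] by auto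
    show ?case
      using cw_construct.join[OF insert.IH ij] unfolding graph.sel eq by simp
  qed
  then show ?thesis by auto
qed

text \<open>The operations never produce the graph without vertices; it gets clique-width \<open>0\<close>.\<close>

definition clique_width :: "'a graph \<Rightarrow> nat" where
  "clique_width G =
     (if verts G = {} then 0 else (LEAST k. \<exists>l. cw_construct k G l))"

definition bounded_clique_width :: "'a graph set \<Rightarrow> bool" where
  "bounded_clique_width X \<longleftrightarrow> (\<exists>c. \<forall>G\<in>X. clique_width G \<le> c)"

end

theory Submission
  imports Defs "HOL-Library.Ramsey"
begin

text \<open>Call a colouring of a graph decomposable if every set of at least two vertices splits into two
  nonempty parts such that adjacency across the split depends only on the colours of the two ends. Building
  the graph along iterated splits needs at most twice as many labels as colours, and a minimal bad sequence
  argument over the splits gives well-quasi-ordering of the labelled graphs. So it is enough to colour every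
  triangle-free graph without induced \<open>H\<close> decomposably with boundedly many colours.

  A connected such graph is bipartite, or a blow-up of a cycle of length seven, or contains a cycle of length
  five. In the last case, colour each vertex by its neighbours in a base, consisting of that cycle and at most
  two further vertices, and by the classes (vertices with the same neighbours in the base) in which it has a
  neighbour, respectively a non-neighbour. The adjacency of two vertices is then undetermined only if each of
  them distinguishes vertices in the class of the other. For \<open>P\<^sub>1 + P\<^sub>5\<close> an orientation of the undetermined pairs
  always has a source, which splits off. For \<open>P\<^sub>2 + P\<^sub>4\<close> the undetermined pairs fall into worlds
  that are bipartite, or consist of three independent classes without rainbow triangles and
  co-triangles.\<close>

section \<open>Decomposing a graph along a colouring\<close>

text \<open>Bounded clique-width alone gives no well-quasi-ordering: all cycles have small
  clique-width and form an antichain. What helps is that the colouring is chosen once and survives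
  every split. Colour-preserving embeddings of the two parts then glue together, since no
  relabelling intervenes. The price is that a bounded amount of information per vertex must serve
  the whole graph. Around a five-cycle, triangle-freeness leaves eleven attachments (nothing, one
  vertex, two vertices at distance two). They do not determine adjacency between classes, and even
  the refined colours leave pairs open. For P1+P5 the obstacle is that the open pairs of classes are
  arranged in a circle around the cycle, and an orientation of a circular structure may have no
  source. A vertex with exactly one neighbour on the cycle, added to the base, cuts the circle into
  a line; without such a vertex the graph is a blow-up of the cycle. For P2+P4 the case distinction
  is whether a non-isolated vertex can miss a whole five-cycle. If not, exchanging cycle vertices
  yields strong exclusions; if so, that vertex and a neighbour of it complete the base.\<close>

definition splits :: "('a \<Rightarrow> 'a \<Rightarrow> bool) \<Rightarrow> ('a \<Rightarrow> 'c) \<Rightarrow> 'a set \<Rightarrow> bool" where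
  "splits E c S \<longleftrightarrow> (\<exists>X Y. X \<noteq> {} \<and> Y \<noteq> {} \<and> X \<inter> Y = {} \<and> X \<union> Y = S \<and>
     (\<forall>x\<in>X. \<forall>y\<in>Y. \<forall>x'\<in>X. \<forall>y'\<in>Y. c x = c x' \<longrightarrow> c y = c y' \<longrightarrow> E x y = E x' y'))"

definition decomposable :: "('a \<Rightarrow> 'a \<Rightarrow> bool) \<Rightarrow> ('a \<Rightarrow> 'c) \<Rightarrow> 'a set \<Rightarrow> bool" where
  "decomposable E c V \<longleftrightarrow> (\<forall>S\<subseteq>V. \<forall>x\<in>S. \<forall>y\<in>S. x \<noteq> y \<longrightarrow> splits E c S)"

definition bounded_decomposable :: "nat \<Rightarrow> ('a \<Rightarrow> 'a \<Rightarrow> bool) \<Rightarrow> 'a set \<Rightarrow> bool" where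
  "bounded_decomposable N E V \<longleftrightarrow> (\<exists>c :: 'a \<Rightarrow> nat. c ` V \<subseteq> {..<N} \<and> decomposable E c V)"

lemma splitsI:
  assumes "x \<in> X" "y \<in> Y" "X \<inter> Y = {}" "X \<union> Y = S"
    and det: "\<And>x y x' y'. \<lbrakk>x \<in> X; y \<in> Y; x' \<in> X; y' \<in> Y; c x = c x'; c y = c y'\<rbrakk> \<Longrightarrow> E x y = E x' y'"
  shows "splits E c S"
proof -
  have "\<forall>x\<in>X. \<forall>y\<in>Y. \<forall>x'\<in>X. \<forall>y'\<in>Y. c x = c x' \<longrightarrow> c y = c y' \<longrightarrow> E x y = E x' y'"
    by (intro ballI impI) (rule det)
  moreover have "X \<noteq> {}" "Y \<noteq> {}" using assms(1,2) by auto
  ultimately have "X \<noteq> {} \<and> Y \<noteq> {} \<and> X \<inter> Y = {} \<and> X \<union> Y = S \<and>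
     (\<forall>x\<in>X. \<forall>y\<in>Y. \<forall>x'\<in>X. \<forall>y'\<in>Y. c x = c x' \<longrightarrow> c y = c y' \<longrightarrow> E x y = E x' y')"
    using assms(3,4) by (intro conjI)
  then show ?thesis unfolding splits_def by (rule exI[of _ X, OF exI[of _ Y]])
qed

lemma splitsE:
  assumes "splits E c S"
  obtains X Y where "X \<noteq> {}" "Y \<noteq> {}" "X \<inter> Y = {}" "X \<union> Y = S"
    "\<And>x y x' y'. \<lbrakk>x \<in> X; y \<in> Y; x' \<in> X; y' \<in> Y; c x = c x'; c y = c y'\<rbrakk> \<Longrightarrow> E x y = E x' y'"
proof -
  obtain X Y where XY: "X \<noteq> {}" "Y \<noteq> {}" "X \<inter> Y = {}" "X \<union> Y = S"
     "\<forall>x\<in>X. \<forall>y\<in>Y. \<forall>x'\<in>X. \<forall>y'\<in>Y. c x = c x' \<longrightarrow> c y = c y' \<longrightarrow> E x y = E x' y'"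
    using assms unfolding splits_def by (elim exE conjE)
  show thesis
  proof (rule that[OF XY(1-4)])
    fix x y x' y' assume "x \<in> X" "y \<in> Y" "x' \<in> X" "y' \<in> Y" "c x = c x'" "c y = c y'"
    then show "E x y = E x' y'" using XY(5)[rule_format, of x y x' y'] by simp
  qed
qed

lemma decomposableD:
  "decomposable E c V \<Longrightarrow> S \<subseteq> V \<Longrightarrow> x \<in> S \<Longrightarrow> y \<in> S \<Longrightarrow> x \<noteq> y \<Longrightarrow> splits E c S"
  by (auto simp: decomposable_def)

lemma decomposable_subset: "decomposable E c V \<Longrightarrow> U \<subseteq> V \<Longrightarrow> decomposable E c U"
  by (auto simp: decomposable_def)

lemma splits_refine:
  assumes "splits E c S" and ref: "\<And>x y. \<lbrakk>x \<in> S; y \<in> S; c' x = c' y\<rbrakk> \<Longrightarrow> c x = c y"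
  shows "splits E c' S"
proof (rule splitsE[OF assms(1)])
  fix X Y assume XY: "X \<noteq> {}" "Y \<noteq> {}" "X \<inter> Y = {}" "X \<union> Y = S"
    and det: "\<And>x y x' y'. \<lbrakk>x \<in> X; y \<in> Y; x' \<in> X; y' \<in> Y; c x = c x'; c y = c y'\<rbrakk> \<Longrightarrow> E x y = E x' y'"
  obtain a b where "a \<in> X" "b \<in> Y" using XY(1,2) by auto
  then show ?thesis
  proof (rule splitsI[OF _ _ XY(3,4)])
    fix x y x' y' assume *: "x \<in> X" "y \<in> Y" "x' \<in> X" "y' \<in> Y" "c' x = c' x'" "c' y = c' y'"
    then show "E x y = E x' y'"
      using det[OF *(1-4)] ref[of x x'] ref[of y y'] XY(4) by auto
  qed
qed

lemma decomposable_refine: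
  assumes "decomposable E c V" "\<And>x y. \<lbrakk>x \<in> V; y \<in> V; c' x = c' y\<rbrakk> \<Longrightarrow> c x = c y"
  shows "decomposable E c' V"
  unfolding decomposable_def
proof (intro allI impI ballI)
  fix S x y assume S: "S \<subseteq> V" and "x \<in> S" "y \<in> S" "x \<noteq> y"
  then have "splits E c S" by (rule decomposableD[OF assms(1)])
  then show "splits E c' S"
    by (rule splits_refine) (meson S assms(2) subsetD)
qed

lemma splits_flip:
  assumes "splits E c S"
    and flip: "\<And>x y. \<lbrakk>x \<in> S; y \<in> S\<rbrakk> \<Longrightarrow> E' x y = (E x y \<noteq> M (c x) (c y))"
  shows "splits E' c S"
proof (rule splitsE[OF assms(1)])
  fix X Y assume XY: "X \<noteq> {}" "Y \<noteq> {}" "X \<inter> Y = {}" "X \<union> Y = S"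
    and det: "\<And>x y x' y'. \<lbrakk>x \<in> X; y \<in> Y; x' \<in> X; y' \<in> Y; c x = c x'; c y = c y'\<rbrakk> \<Longrightarrow> E x y = E x' y'"
  obtain a b where "a \<in> X" "b \<in> Y" using XY(1,2) by auto
  then show ?thesis
  proof (rule splitsI[OF _ _ XY(3,4)])
    fix x y x' y' assume *: "x \<in> X" "y \<in> Y" "x' \<in> X" "y' \<in> Y" "c x = c x'" "c y = c y'"
    then have "x \<in> S" "y \<in> S" "x' \<in> S" "y' \<in> S" using XY(4) by auto
    then show "E' x y = E' x' y'"
      using det[OF *] *(5,6) flip[of x y] flip[of x' y'] by simp
  qed
qed

lemma splits_cong:
  assumes "splits E c S" "\<And>x y. \<lbrakk>x \<in> S; y \<in> S\<rbrakk> \<Longrightarrow> E x y = E' x y"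
  shows "splits E' c S"
  by (rule splits_flip[OF assms(1), of _ "\<lambda>_ _. False"]) (use assms(2) in auto)

lemma splits_homogeneous:
  assumes "x \<in> S" "y \<in> S" "x \<noteq> y"
    and hom: "\<And>u v. \<lbrakk>u \<in> S; v \<in> S; u \<noteq> x; v \<noteq> x; c u = c v\<rbrakk> \<Longrightarrow> E x u = E x v"
  shows "splits E c S"
proof (rule splitsI[of x "{x}" y "S - {x}"])
  fix u v u' v' assume "u \<in> {x}" "v \<in> S - {x}" "u' \<in> {x}" "v' \<in> S - {x}" "c v = c v'"
  then show "E u v = E u' v'" using hom[of v v'] by simp
qed (use assms(1-3) in auto)

lemma bounded_decomposableI:
  assumes "finite K" "c ` V \<subseteq> K" "decomposable E c V" "card K \<le> N"
  shows "bounded_decomposable N E V"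
proof -
  obtain h where h: "bij_betw h K {0..<card K}"
    using ex_bij_betw_finite_nat[OF assms(1)] by blast
  have "decomposable E (h \<circ> c) V"
  proof (rule decomposable_refine[OF assms(3)])
    fix x y assume "x \<in> V" "y \<in> V" "(h \<circ> c) x = (h \<circ> c) y"
    then show "c x = c y"
      using inj_onD[OF bij_betw_imp_inj_on[OF h], of "c x" "c y"] assms(2) by auto
  qed
  moreover have "(h \<circ> c) ` V \<subseteq> {..<N}"
  proof
    fix n assume "n \<in> (h \<circ> c) ` V"
    then obtain x where "x \<in> V" "n = h (c x)" by auto
    then have "n \<in> h ` K" using assms(2) by auto
    then show "n \<in> {..<N}" using h assms(4) by (auto simp: bij_betw_def)
  qed
  ultimately show ?thesis unfolding bounded_decomposable_def by blast
qed

lemma bounded_decomposable_mono: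
  "bounded_decomposable M E V \<Longrightarrow> M \<le> N \<Longrightarrow> bounded_decomposable N E V"
  unfolding bounded_decomposable_def by force

lemma bounded_decomposable_cong:
  assumes "bounded_decomposable N E V" "\<And>x y. \<lbrakk>x \<in> V; y \<in> V\<rbrakk> \<Longrightarrow> E x y = E' x y"
  shows "bounded_decomposable N E' V"
proof -
  obtain c :: "'a \<Rightarrow> nat" where c: "c ` V \<subseteq> {..<N}" "decomposable E c V"
    using assms(1) unfolding bounded_decomposable_def by blast
  have "decomposable E' c V"
    unfolding decomposable_def
  proof (intro allI impI ballI)
    fix S x y assume S: "S \<subseteq> V" and "x \<in> S" "y \<in> S" "x \<noteq> y"
    then have "splits E c S" by (rule decomposableD[OF c(2)])
    then show "splits E' c S"
      by (rule splits_cong) (meson S assms(2) subsetD)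
  qed
  with c(1) show ?thesis unfolding bounded_decomposable_def by blast
qed

text \<open>Both parts may use the same colours: a set that meets both is split along them with no
  edge across, and any other set lies in one part. So the bound is independent of the number of
  components.\<close>

lemma bounded_decomposable_disjoint_union:
  assumes "bounded_decomposable N E A" "bounded_decomposable N E B" "A \<inter> B = {}"
    and "\<And>x y. \<lbrakk>x \<in> A; y \<in> B\<rbrakk> \<Longrightarrow> \<not> E x y \<and> \<not> E y x"
  shows "bounded_decomposable N E (A \<union> B)"
proof -
  obtain c d :: "'a \<Rightarrow> nat" where c: "c ` A \<subseteq> {..<N}" "decomposable E c A"
    and d: "d ` B \<subseteq> {..<N}" "decomposable E d B"
    using assms(1,2) unfolding bounded_decomposable_def by blast
  define e where "e = (\<lambda>x. if x \<in> A then c x else d x)"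
  have A: "decomposable E e A"
    by (rule decomposable_refine[OF c(2)]) (auto simp: e_def)
  have B: "decomposable E e B"
    by (rule decomposable_refine[OF d(2)]) (use assms(3) in \<open>auto simp: e_def disjoint_iff split: if_splits\<close>)
  have "splits E e S" if S: "S \<subseteq> A \<union> B" "x \<in> S" "y \<in> S" "x \<noteq> y" for S x y
  proof -
    consider "S \<subseteq> A" | "S \<subseteq> B" | a b where "a \<in> S" "a \<in> A" "b \<in> S" "b \<in> B"
      using S(1) by blast
    then show ?thesis
    proof cases
      case 1 then show ?thesis by (rule decomposableD[OF A _ S(2-4)])
    next
      case 2 then show ?thesis by (rule decomposableD[OF B _ S(2-4)])
    next
      case 3
      show ?thesis
      proof (rule splitsI[of a "S \<inter> A" b "S \<inter> B"])
        fix u v u' v' assume "u \<in> S \<inter> A" "v \<in> S \<inter> B" "u' \<in> S \<inter> A" "v' \<in> S \<inter> B"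
        then show "E u v = E u' v'" using assms(4) by simp
      qed (use 3 S assms(3) in auto)
    qed
  qed
  then have "decomposable E e (A \<union> B)" by (simp add: decomposable_def)
  moreover have "e ` (A \<union> B) \<subseteq> {..<N}" using c(1) d(1) by (auto simp: e_def)
  ultimately show ?thesis unfolding bounded_decomposable_def by (intro exI conjI)
qed

text \<open>One whole world is cut off from the rest. The premise compares only pairs that leave one
  and the same world, so the colours need not reveal the world and there may be arbitrarily many of
  them.\<close>

lemma splits_worlds:
  assumes "x \<in> S" "y \<in> S" "w x \<noteq> w y"
    and det: "\<And>x y x' y'. \<lbrakk>x \<in> S; y \<in> S; x' \<in> S; y' \<in> S; w x \<noteq> w y; w x' = w x; w x' \<noteq> w y'; c x = c x'; c y = c y'\<rbrakk>
      \<Longrightarrow> E x y = E x' y'"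
  shows "splits E c S"
proof (rule splitsI[of x "{s \<in> S. w s = w x}" y "{s \<in> S. w s \<noteq> w x}"])
  fix a b a' b'
  assume "a \<in> {s \<in> S. w s = w x}" "b \<in> {s \<in> S. w s \<noteq> w x}" "a' \<in> {s \<in> S. w s = w x}"
    "b' \<in> {s \<in> S. w s \<noteq> w x}" "c a = c a'" "c b = c b'"
  then show "E a b = E a' b'" by (intro det) auto
qed (use assms(1-3) in auto)

section \<open>Bipartite graphs\<close>

text \<open>The forbidden pattern is an induced path b1 a1 b2 a2 b3 a3. Three kinds of split occur:
  no edges across (\<open>F\<close> is disconnected), all edges across (its bipartite complement is
  disconnected), or \<open>p\<close> and \<open>q\<close> differ. The split grows around a vertex
  \<open>x\<close> of \<open>A\<close> of maximal degree, by comparing what the other vertices see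
  inside and outside the neighbourhood of \<open>x\<close>.\<close>

lemma P6_free_bipartite_split:
  fixes F :: "'a \<Rightarrow> 'a \<Rightarrow> bool"
  assumes fin: "finite A" "finite B" and disj: "A \<inter> B = {}" and two: "u \<in> A \<union> B" "v \<in> A \<union> B" "u \<noteq> v"
    and P6: "\<And>b1 a1 b2 a2 b3 a3. \<lbrakk>a1 \<in> A; a2 \<in> A; a3 \<in> A; b1 \<in> B; b2 \<in> B; b3 \<in> B;
      F a1 b1; F a1 b2; F a2 b2; F a2 b3; F a3 b3; \<not> F a2 b1; \<not> F a3 b1; \<not> F a1 b3; \<not> F a3 b2\<rbrakk> \<Longrightarrow> False"
  shows "\<exists>X Y p q. X \<noteq> {} \<and> Y \<noteq> {} \<and> X \<inter> Y = {} \<and> X \<union> Y = A \<union> B \<and>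
    (\<forall>a\<in>X \<inter> A. \<forall>b\<in>Y \<inter> B. F a b = p) \<and> (\<forall>a\<in>Y \<inter> A. \<forall>b\<in>X \<inter> B. F a b = q)" (is "?goal")
proof -
  have goal: ?goal if "x \<in> X" "x \<in> A \<union> B" "X \<subseteq> A \<union> B" "y \<in> A \<union> B" "y \<notin> X"
     "\<And>a b. \<lbrakk>a \<in> A; b \<in> B; a \<in> X; b \<notin> X\<rbrakk> \<Longrightarrow> F a b = p"
     "\<And>a b. \<lbrakk>a \<in> A; b \<in> B; a \<notin> X; b \<in> X\<rbrakk> \<Longrightarrow> F a b = q" for x X y p q
    by (rule exI[of _ X], rule exI[of _ "(A \<union> B) - X"], rule exI[of _ p], rule exI[of _ q])
      (use that in auto)
  have other: "\<exists>y\<in>A \<union> B. y \<noteq> x" for x using two by (cases "u = x") auto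
  show ?goal
  proof (cases "A = {}")
    case True
    then show ?thesis using two by (intro goal[of u "{u}" v False False]) auto
  next
    case False
    obtain x where x: "x \<in> A" and max: "\<And>a. a \<in> A \<Longrightarrow> card {b\<in>B. F a b} \<le> card {b\<in>B. F x b}"
    proof -
      have "finite ((\<lambda>a. card {b\<in>B. F a b}) ` A)" "(\<lambda>a. card {b\<in>B. F a b}) ` A \<noteq> {}" using fin False by auto
      from Max_in[OF this] obtain x where "x \<in> A" "Max ((\<lambda>a. card {b\<in>B. F a b}) ` A) = card {b\<in>B. F x b}" by auto
      then show thesis using Max_ge[OF \<open>finite ((\<lambda>a. card {b\<in>B. F a b}) ` A)\<close>] by (intro that[of x]) auto
    qed
    obtain y where y: "y \<in> A \<union> B" "y \<noteq> x" using other by blast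
    have xB: "x \<notin> B" using x disj by auto
    have miss: "\<exists>p\<in>B. F x p \<and> \<not> F a p" if "a \<in> A" "r \<in> B" "F a r" "\<not> F x r" for a r
    proof (rule ccontr)
      assume "\<not> ?thesis"
      then have "{b\<in>B. F x b} \<subset> {b\<in>B. F a b}" using that by blast
      then have "card {b\<in>B. F x b} < card {b\<in>B. F a b}" by (intro psubset_card_mono) (use fin in auto)
      then show False using max[OF that(1)] by simp
    qed
    consider (dom) "\<forall>b\<in>B. F x b" | (isol) "\<forall>b\<in>B. \<not> F x b" | (iso_b) r where "r \<in> B" "\<forall>a\<in>A. \<not> F a r"
      | (far) q0 a0 where "q0 \<in> B" "F x q0" "a0 \<in> A" "\<forall>q\<in>B. F x q \<longrightarrow> \<not> F a0 q"
      | (main) "\<exists>r\<in>B. \<not> F x r" "\<forall>r\<in>B. \<exists>a\<in>A. F a r" "\<forall>a\<in>A. \<exists>q\<in>B. F x q \<and> F a q"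
      by blast
    then show ?thesis
    proof cases
      case dom then show ?thesis using x y xB by (intro goal[of x "{x}" y True False]) auto
    next
      case isol then show ?thesis using x y xB by (intro goal[of x "{x}" y False False]) auto
    next
      case (iso_b r)
      then show ?thesis using x xB disj by (intro goal[of r "{r}" x False False]) auto
    next
      case (far q0 a0)
      \<comment> \<open>These sets form a union of components. An edge entering it at
        \<open>b\<close> from a vertex \<open>a\<close> outside would complete the path p x q a b
        a1, where \<open>miss\<close> provides the neighbour \<open>p\<close> of \<open>x\<close>
        that \<open>a\<close> does not see.\<close>
      let ?A0 = "{a\<in>A. \<forall>q\<in>B. F x q \<longrightarrow> \<not> F a q}"
      let ?R1 = "{r\<in>B. \<not> F x r \<and> (\<exists>a\<in>?A0. F a r)}"
      show ?thesis
      proof (rule goal[of a0 "?A0 \<union> ?R1" x])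
        show "F a b = False" if "a \<in> A" "b \<in> B" "a \<in> ?A0 \<union> ?R1" "b \<notin> ?A0 \<union> ?R1" for a b
          using that disj by blast
        show "F a b = False" if ab: "a \<in> A" "b \<in> B" "a \<notin> ?A0 \<union> ?R1" "b \<in> ?A0 \<union> ?R1" for a b
        proof (rule ccontr)
          assume "F a b \<noteq> False"
          then have "F a b" by simp
          have "b \<in> ?R1" using ab(2,4) disj by auto
          then obtain a1 where a1: "a1 \<in> A" "\<forall>q\<in>B. F x q \<longrightarrow> \<not> F a1 q" "F a1 b" "\<not> F x b" by auto
          obtain q where q: "q \<in> B" "F x q" "F a q" using ab(1,3) by blast
          obtain p where p: "p \<in> B" "F x p" "\<not> F a p" using miss[OF ab(1,2) \<open>F a b\<close> a1(4)] by blast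
          show False using P6[of x a a1 p q b] x ab(1,2) a1 q p \<open>F a b\<close> by blast
        qed
      qed (use far x xB in auto)
    next
      case main
      define T where "T = {a\<in>A. \<exists>r\<in>B. \<not> F x r \<and> F a r}"
      have TA: "t \<in> A" if "t \<in> T" for t using that by (simp add: T_def)
      \<comment> \<open>Vertices with incomparable traces on the neighbourhood of \<open>x\<close>
        agree outside it: if \<open>t\<close> alone saw \<open>r\<close>, then r t b x b' a would be
        a forbidden path.\<close>
      have inc: "F t r \<longleftrightarrow> F a r" if "t \<in> A" "a \<in> A" "b \<in> B" "F x b" "F t b" "\<not> F a b" "b' \<in> B" "F x b'" "F a b'" "\<not> F t b'"
        "r \<in> B" "\<not> F x r" for t a b b' r
        using P6[of t x a r b b'] P6[of a x t r b' b] x that by blast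
      \<comment> \<open>The path is p x b t r t'. Two vertices with different traces and a common
        neighbour outside therefore cover the whole neighbourhood of \<open>x\<close> between
        them.\<close>
      have un: False if "t \<in> A" "t' \<in> A" "b \<in> B" "F x b" "F t b" "\<not> F t' b" "r \<in> B" "\<not> F x r" "F t r" "F t' r"
        "p \<in> B" "F x p" "\<not> F t p" "\<not> F t' p" for t t' b r p
        using P6[of x t t' p b r] x that by blast
      obtain r0 where r0: "r0 \<in> B" "\<not> F x r0" using main(1) by blast
      obtain a0 where a0: "a0 \<in> A" "F a0 r0" using main(2) r0(1) by blast
      have "a0 \<in> T" using a0 r0 by (auto simp: T_def)
      let ?Qs = "{q\<in>B. F x q \<and> (\<forall>t\<in>T. F t q)}"
      show ?thesis
      proof (cases "?Qs = {}")
        case False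
        then obtain q0 where q0: "q0 \<in> ?Qs" by blast
        \<comment> \<open>The mixed split: all edges in one direction, none in the other. A vertex
          \<open>a\<close> that misses part of \<open>?Qs\<close> but sees some \<open>b\<close>
          outside \<open>?Qs\<close> is incomparable with a vertex of \<open>T\<close>, so
          \<open>inc\<close> would put it into \<open>T\<close>, which is complete to
          \<open>?Qs\<close>.\<close>
        let ?X = "{a\<in>A. \<forall>q\<in>?Qs. F a q} \<union> {b\<in>B. b \<notin> ?Qs}"
        show ?thesis
        proof (rule goal[of x ?X q0])
          show "F a b = True" if "a \<in> A" "b \<in> B" "a \<in> ?X" "b \<notin> ?X" for a b
            using that disj by blast
          show "F a b = False" if ab: "a \<in> A" "b \<in> B" "a \<notin> ?X" "b \<in> ?X" for a b
          proof (rule ccontr)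
            assume "F a b \<noteq> False"
            then have F: "F a b" by simp
            obtain s where s: "s \<in> ?Qs" "\<not> F a s" using ab(1,3) by blast
            have aT: "a \<notin> T" using s by blast
            then have "F x b" using ab(1,2) F by (auto simp: T_def)
            have "b \<notin> ?Qs" using ab(2,4) disj by auto
            then obtain t where t: "t \<in> T" "\<not> F t b" using ab(2) \<open>F x b\<close> by blast
            obtain r where r: "r \<in> B" "\<not> F x r" "F t r" using t(1) by (auto simp: T_def)
            have "F a r" using inc[of t a s b r] TA[OF t(1)] ab(1,2) s t r F \<open>F x b\<close> by blast
            then show False using aT ab(1) r by (auto simp: T_def)
          qed
        qed (use x q0 disj xB in auto)
      next
        case True
        \<comment> \<open>The aim is now a disconnected bipartite complement: vertices outside
          \<open>T\<close> see the whole neighbourhood of \<open>x\<close>, and \<open>T\<close>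
          sees everything outside it. A smallest trace \<open>t0\<close> and the trace of a vertex
          \<open>t1\<close> missing one of its elements are incomparable, and by \<open>un\<close>
          they cover the neighbourhood of \<open>x\<close>.\<close>
        define NQ where "NQ = (\<lambda>a. {q\<in>B. F x q \<and> F a q})"
        have NQ: "q \<in> NQ a \<longleftrightarrow> q \<in> B \<and> F x q \<and> F a q" for q a by (simp add: NQ_def)
        have finNQ: "finite (NQ a)" for a using fin by (simp add: NQ_def)
        have ne: "NQ a \<noteq> {}" if "a \<in> A" for a using main(3) that by (auto simp: NQ_def)
        obtain t0 where t0: "t0 \<in> T" and min: "\<And>t. t \<in> T \<Longrightarrow> card (NQ t0) \<le> card (NQ t)"
        proof -
          have T: "finite ((\<lambda>a. card (NQ a)) ` T)" "(\<lambda>a. card (NQ a)) ` T \<noteq> {}"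
            using fin \<open>a0 \<in> T\<close> by (auto simp: T_def)
          from Min_in[OF this] obtain x where "x \<in> T" "Min ((\<lambda>a. card (NQ a)) ` T) = card (NQ x)" by auto
          then show thesis using Min_le[OF T(1)] by (intro that[of x]) auto
        qed
        have mins: "NQ t0 \<subseteq> NQ t" if "t \<in> T" "NQ t \<subseteq> NQ t0" for t
          using card_seteq[OF finNQ that(2) min[OF that(1)]] by simp
        obtain s where s: "s \<in> NQ t0" using ne[OF TA[OF t0]] by blast
        then obtain t1 where t1: "t1 \<in> T" "\<not> F t1 s" using True by (auto simp: NQ)
        have n01: "\<not> NQ t0 \<subseteq> NQ t1" using s t1 by (auto simp: NQ)
        have n10: "\<not> NQ t1 \<subseteq> NQ t0" using mins[OF t1(1)] n01 by blast
        have sameR: "F t r \<longleftrightarrow> F a r" if "t \<in> A" "a \<in> A" "\<not> NQ t \<subseteq> NQ a" "\<not> NQ a \<subseteq> NQ t" "r \<in> B" "\<not> F x r" for t a r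
          using inc[OF that(1,2) _ _ _ _ _ _ _ _ that(5,6)] that(3,4) by (auto simp: NQ subset_iff)
        have full: "F t0 p \<or> F t1 p" if "p \<in> B" "F x p" for p
        proof (rule ccontr)
          assume np: "\<not> (F t0 p \<or> F t1 p)"
          obtain r where r: "r \<in> B" "\<not> F x r" "F t0 r" using t0 by (auto simp: T_def)
          then have "F t1 r" using sameR[OF TA[OF t0] TA[OF t1(1)] n01 n10] by blast
          then show False using un[of t0 t1 s r p] TA[OF t0] TA[OF t1(1)] s t1(2) r np that by (auto simp: NQ)
        qed
        have nonT: "F a q" if a: "a \<in> A" "a \<notin> T" and q: "q \<in> B" "F x q" for a q
        proof -
          have comp: "NQ t \<subseteq> NQ a \<or> NQ a \<subseteq> NQ t" if t: "t \<in> T" for t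
          proof (rule ccontr)
            assume "\<not> ?thesis"
            then have n: "\<not> NQ t \<subseteq> NQ a" "\<not> NQ a \<subseteq> NQ t" by auto
            obtain r where r: "r \<in> B" "\<not> F x r" "F t r" using t by (auto simp: T_def)
            then have "F a r" using sameR[OF TA[OF t] a(1) n] by blast
            then show False using a r by (auto simp: T_def)
          qed
          obtain q' where q': "q' \<in> NQ a" using ne[OF a(1)] by blast
          then obtain t where t: "t \<in> T" "\<not> F t q'" using True by (auto simp: NQ)
          then have "NQ t \<subseteq> NQ a" using comp[OF t(1)] q' by (auto simp: NQ)
          have A0: "NQ t0 \<subseteq> NQ a"
          proof (rule ccontr)
            assume n: "\<not> NQ t0 \<subseteq> NQ a"
            then have "NQ t \<subseteq> NQ t0" using comp[OF t0] \<open>NQ t \<subseteq> NQ a\<close> by blast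
            then show False using mins[OF t(1)] \<open>NQ t \<subseteq> NQ a\<close> n by blast
          qed
          moreover have "NQ t1 \<subseteq> NQ a" using comp[OF t1(1)] A0 n01 by blast
          ultimately show "F a q" using full[OF q] q by (auto simp: NQ)
        qed
        have TR: "F t r" if t: "t \<in> T" and r: "r \<in> B" "\<not> F x r" for t r
        proof -
          have eq: "F t' r \<longleftrightarrow> F t0 r" if t': "t' \<in> T" for t'
          proof (cases "NQ t0 \<subseteq> NQ t'")
            case False
            then have "\<not> NQ t' \<subseteq> NQ t0" using mins[OF t'] by blast
            then show ?thesis using sameR[OF TA[OF t'] TA[OF t0] _ False r] by blast
          next
            case True
            obtain r' where r': "r' \<in> B" "\<not> F x r'" "F t' r'" using t' by (auto simp: T_def)
            obtain p where p: "p \<in> B" "F x p" "\<not> F t' p" using miss[OF TA[OF t'] r'(1,3,2)] by blast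
            have n1: "\<not> NQ t' \<subseteq> NQ t1" using True n01 by blast
            have n2: "\<not> NQ t1 \<subseteq> NQ t'" using True full[OF p(1,2)] p by (auto simp: NQ)
            have "F t' r \<longleftrightarrow> F t1 r" by (rule sameR[OF TA[OF t'] TA[OF t1(1)] n1 n2 r])
            also have "\<dots> \<longleftrightarrow> F t0 r" by (rule sameR[OF TA[OF t1(1)] TA[OF t0] n10 n01 r])
            finally show ?thesis .
          qed
          obtain a where a: "a \<in> A" "F a r" using main(2) r(1) by blast
          then have "a \<in> T" using r by (auto simp: T_def)
          then show ?thesis using eq[of a] eq[OF t] a(2) by simp
        qed
        let ?X = "(A - T) \<union> {b\<in>B. \<not> F x b}"
        show ?thesis
        proof (rule goal[of r0 ?X t0])
          show "F a b = True" if "a \<in> A" "b \<in> B" "a \<in> ?X" "b \<notin> ?X" for a b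
            using that disj nonT[of a b] by blast
          show "F a b = True" if "a \<in> A" "b \<in> B" "a \<notin> ?X" "b \<in> ?X" for a b
            using that disj TR[of a b] by blast
        qed (use r0 t0 TA disj in auto)
      qed
    qed
  qed
qed

text \<open>Across a bipartition into three and three vertices, the complement of the six-vertex
  path is P2+P4: the non-edges of the pattern form the path a2 b1 a3 b2 and the edge a1 b3. The
  split is therefore found in the bipartite complement, which only negates the constants.\<close>

lemma bipartite_P2_P4_free_splits:
  fixes E :: "'a \<Rightarrow> 'a \<Rightarrow> bool" and P :: "'a \<Rightarrow> bool"
  assumes sym: "\<And>x y. E x y \<Longrightarrow> E y x"
    and P24: "\<And>a b c d e f. \<lbrakk>E a b; E b c; E c d; E e f; \<not> E a c; \<not> E a d; \<not> E b d;
      \<not> E a e; \<not> E a f; \<not> E b e; \<not> E b f; \<not> E c e; \<not> E c f; \<not> E d e; \<not> E d f\<rbrakk> \<Longrightarrow> False"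
    and fin: "finite S" and two: "u \<in> S" "v \<in> S" "u \<noteq> v"
    and indep: "\<And>x y. \<lbrakk>x \<in> S; y \<in> S; P x = P y\<rbrakk> \<Longrightarrow> \<not> E x y"
    and col: "\<And>x y. \<lbrakk>x \<in> S; y \<in> S; c x = c y\<rbrakk> \<Longrightarrow> P x = P y"
  shows "splits E c S"
proof -
  let ?A = "{x\<in>S. P x}" and ?B = "{x\<in>S. \<not> P x}"
  have U: "?A \<union> ?B = S" by auto
  have "\<exists>X Y p q. X \<noteq> {} \<and> Y \<noteq> {} \<and> X \<inter> Y = {} \<and> X \<union> Y = ?A \<union> ?B \<and>
    (\<forall>a\<in>X \<inter> ?A. \<forall>b\<in>Y \<inter> ?B. (\<not> E a b) = p) \<and> (\<forall>a\<in>Y \<inter> ?A. \<forall>b\<in>X \<inter> ?B. (\<not> E a b) = q)"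
  proof (rule P6_free_bipartite_split[where F = "\<lambda>a b. \<not> E a b" and u = u and v = v])
    fix b1 a1 b2 a2 b3 a3
    assume a: "a1 \<in> ?A" "a2 \<in> ?A" "a3 \<in> ?A" and b: "b1 \<in> ?B" "b2 \<in> ?B" "b3 \<in> ?B"
      and n: "\<not> E a1 b1" "\<not> E a1 b2" "\<not> E a2 b2" "\<not> E a2 b3" "\<not> E a3 b3"
      and e: "\<not> \<not> E a2 b1" "\<not> \<not> E a3 b1" "\<not> \<not> E a1 b3" "\<not> \<not> E a3 b2"
    have i: "\<not> E a2 a3" "\<not> E a2 a1" "\<not> E a3 a1" "\<not> E b1 b2" "\<not> E b1 b3" "\<not> E b2 b3" "\<not> E b2 b1"
      using a b by (simp_all add: indep)
    have s: "E x y = E y x" for x y using sym by blast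
    show False
      by (rule P24[of a2 b1 a3 b2 a1 b3])
        (simp_all only: i n e[unfolded not_not] s[of b1 a1] s[of b1 a3] s[of b2 a1] not_False_eq_True)
  next
    show "finite ?A" using fin by simp
  next
    show "finite ?B" using fin by simp
  next
    show "?A \<inter> ?B = {}" by blast
  next
    show "u \<in> ?A \<union> ?B" using two(1) by simp
  next
    show "v \<in> ?A \<union> ?B" using two(2) by simp
  next
    show "u \<noteq> v" by (rule two(3))
  qed
  then obtain X Y p q where XY: "X \<noteq> {}" "Y \<noteq> {}" "X \<inter> Y = {}" "X \<union> Y = S"
    and p: "\<forall>a\<in>X \<inter> ?A. \<forall>b\<in>Y \<inter> ?B. (\<not> E a b) = p" and q: "\<forall>a\<in>Y \<inter> ?A. \<forall>b\<in>X \<inter> ?B. (\<not> E a b) = q"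
    unfolding U by (elim exE conjE)
  obtain x y where "x \<in> X" "y \<in> Y" using XY by auto
  then show ?thesis
  proof (rule splitsI[OF _ _ XY(3,4)])
    fix x y x' y' assume *: "x \<in> X" "y \<in> Y" "x' \<in> X" "y' \<in> Y" "c x = c x'" "c y = c y'"
    then have S: "x \<in> S" "y \<in> S" "x' \<in> S" "y' \<in> S" using XY(4) by auto
    have P: "P x = P x'" "P y = P y'" by (rule col[OF S(1,3) *(5)], rule col[OF S(2,4) *(6)])
    have det: "E s t \<longleftrightarrow> P s \<noteq> P t \<and> (if P s then \<not> p else \<not> q)" if st: "s \<in> X" "t \<in> Y" for s t
    proof -
      have stS: "s \<in> S" "t \<in> S" using st XY(4) by auto
      have ss: "E t s = E s t" using sym by blast
      consider "P s = P t" | "P s" "\<not> P t" | "\<not> P s" "P t" by auto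
      then show ?thesis
      proof cases
        case 1 then show ?thesis using indep[OF stS] by simp
      next
        case 2
        then have "(\<not> E s t) = p" using p[rule_format, of s t] st stS by simp
        then show ?thesis using 2 by auto
      next
        case 3
        then have "(\<not> E t s) = q" using q[rule_format, of t s] st stS by simp
        then show ?thesis using 3 ss by auto
      qed
    qed
    show "E x y = E x' y'" using det[OF *(1,2)] det[OF *(3,4)] P by simp
  qed
qed

text \<open>Fix \<open>b0\<close> on one side and complement the adjacency of each of its neighbours
  to that side. In the flipped relation \<open>N\<close> the vertex \<open>b0\<close> is isolated,
  and the neighbourhoods of any two vertices of the other side are disjoint or nested, so a largest
  neighbourhood yields a split. Side and adjacency to \<open>b0\<close> make up the four
  colours.\<close>

lemma bipartite_P1_P5_free:
  fixes E :: "'a \<Rightarrow> 'a \<Rightarrow> bool" and P :: "'a \<Rightarrow> bool"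
  assumes sym: "\<And>x y. E x y \<Longrightarrow> E y x"
    and P15: "\<And>a b c d e f. \<lbrakk>E a b; E b c; E c d; E d e; \<not> E a c; \<not> E a d; \<not> E a e; \<not> E b d; \<not> E b e; \<not> E c e;
      \<not> E a f; \<not> E b f; \<not> E c f; \<not> E d f; \<not> E e f\<rbrakk> \<Longrightarrow> False"
    and fin: "finite V"
    and indep: "\<And>x y. \<lbrakk>x \<in> V; y \<in> V; P x = P y\<rbrakk> \<Longrightarrow> \<not> E x y"
  shows "bounded_decomposable 4 E V"
proof -
  define b0 where "b0 = (SOME b. b \<in> V \<and> \<not> P b)"
  have b0: "b0 \<in> V" "\<not> P b0" if "b \<in> V" "\<not> P b" for b
    using someI[of "\<lambda>b. b \<in> V \<and> \<not> P b" b] that by (simp_all add: b0_def)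
  define N where "N = (\<lambda>a b. E a b \<noteq> E a b0)"
  \<comment> \<open>A path b1 a1 b2 a2 b3 of \<open>N\<close> is undone in four ways, according to
    the adjacency of \<open>a1\<close> and \<open>a2\<close> to \<open>b0\<close>. Each time an
    induced P1+P5 arises, in which \<open>b0\<close> is the isolated vertex, the middle or an end of
    the path.\<close>
  have lam: False if "a1 \<in> V" "a2 \<in> V" "P a1" "P a2" "b1 \<in> V" "b2 \<in> V" "b3 \<in> V" "\<not> P b1" "\<not> P b2" "\<not> P b3"
    "N a1 b1" "\<not> N a2 b1" "N a1 b2" "N a2 b2" "\<not> N a1 b3" "N a2 b3" for a1 a2 b1 b2 b3
  proof -
    have b: "b0 \<in> V" "\<not> P b0" using b0[of b1] that by auto
    have s: "E b1 a1 = E a1 b1" "E b1 a2 = E a2 b1" "E b2 a1 = E a1 b2" "E b2 a2 = E a2 b2"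
      "E b3 a1 = E a1 b3" "E b3 a2 = E a2 b3" "E b0 a1 = E a1 b0" "E b0 a2 = E a2 b0"
      using sym by blast+
    have i: "\<not> E a1 a2" "\<not> E a2 a1" "\<not> E b1 b2" "\<not> E b2 b1" "\<not> E b1 b3" "\<not> E b3 b1" "\<not> E b2 b3" "\<not> E b3 b2"
      "\<not> E b1 b0" "\<not> E b0 b1" "\<not> E b2 b0" "\<not> E b0 b2" "\<not> E b3 b0" "\<not> E b0 b3"
      using that b by (simp_all add: indep)
    consider "\<not> E a1 b0" "\<not> E a2 b0" | "E a1 b0" "E a2 b0" | "E a1 b0" "\<not> E a2 b0" | "\<not> E a1 b0" "E a2 b0" by blast
    then show False
    proof cases
      case 1 then show False using that s i by (intro P15[of b1 a1 b2 a2 b3 b0]) (auto simp: N_def)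
    next
      case 2 then show False using that s i by (intro P15[of b3 a1 b0 a2 b1 b2]) (auto simp: N_def)
    next
      case 3 then show False using that s i by (intro P15[of b0 a1 b3 a2 b2 b1]) (auto simp: N_def)
    next
      case 4 then show False using that s i by (intro P15[of b0 a2 b1 a1 b2 b3]) (auto simp: N_def)
    qed
  qed
  let ?c = "\<lambda>x. (P x, E x b0)"
  have "splits E ?c S" if S: "S \<subseteq> V" and uv: "u \<in> S" "v \<in> S" "u \<noteq> v" for S u v
  proof (cases "\<exists>a\<in>S. P a")
    case False
    then have "\<not> E x y" if "x \<in> S" "y \<in> S" for x y using that S by (intro indep) auto
    then show ?thesis using uv by (intro splits_homogeneous[OF uv]) auto
  next
    case True
    have finS: "finite S" using S fin by (rule finite_subset)
    let ?A = "{a\<in>S. P a}"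
    let ?n = "\<lambda>a. card {b\<in>S. \<not> P b \<and> N a b}"
    have A: "finite (?n ` ?A)" "?n ` ?A \<noteq> {}" using True finS by auto
    from Max_in[OF this] obtain a where a: "a \<in> S" "P a" "Max (?n ` ?A) = ?n a" by auto
    have max: "?n a' \<le> ?n a" if "a' \<in> S" "P a'" for a' using Max_ge[OF A(1), of "?n a'"] that a(3) by auto
    show ?thesis
    proof (cases "\<forall>b\<in>S. \<not> P b \<longrightarrow> N a b")
      case True
      obtain y where "y \<in> S" "a \<noteq> y" using uv by auto
      then show ?thesis
      proof (rule splits_homogeneous[OF a(1)])
        fix u v assume uv: "u \<in> S" "v \<in> S" "?c u = ?c v"
        show "E a u = E a v"
        proof (cases "P u")
          case True then show ?thesis using uv a indep[of a u] indep[of a v] S by auto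
        next
          case False
          then have "N a u" "N a v" using uv \<open>\<forall>b\<in>S. \<not> P b \<longrightarrow> N a b\<close> by auto
          then show ?thesis by (auto simp: N_def)
        qed
      qed
    next
      case False
      then obtain b where b: "b \<in> S" "\<not> P b" "\<not> N a b" by blast
      \<comment> \<open>No pair of \<open>N\<close> crosses: a vertex that meets the neighbourhood
        of \<open>a\<close> and reaches beyond it contains it properly by \<open>lam\<close>,
        against the maximality of \<open>a\<close>.\<close>
      let ?X = "{a'\<in>S. P a' \<and> (\<forall>b\<in>S. \<not> P b \<longrightarrow> N a' b \<longrightarrow> N a b)} \<union> {b\<in>S. \<not> P b \<and> N a b}"
      have XY: "\<not> N x y" if "x \<in> ?X" "y \<in> S - ?X" "P x" "\<not> P y" for x y using that by blast
      have YX: "\<not> N y x" if y: "y \<in> S - ?X" "P y" and x: "x \<in> ?X" "\<not> P x" for x y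
      proof
        assume Nyx: "N y x"
        obtain b1 where b1: "b1 \<in> S" "\<not> P b1" "N y b1" "\<not> N a b1" using y by blast
        have "N y b3" if "b3 \<in> S" "\<not> P b3" "N a b3" for b3
          using lam[of y a b1 x b3] y x b1 that a S Nyx by blast
        then have "{b\<in>S. \<not> P b \<and> N a b} \<subset> {b\<in>S. \<not> P b \<and> N y b}" using b1 by blast
        then have "?n a < ?n y" by (intro psubset_card_mono) (use finS in auto)
        then show False using max[of y] y by auto
      qed
      show ?thesis
      proof (rule splitsI[of a ?X b "S - ?X"])
        fix x y x' y' assume *: "x \<in> ?X" "y \<in> S - ?X" "x' \<in> ?X" "y' \<in> S - ?X" "?c x = ?c x'" "?c y = ?c y'"
        have det: "E s t \<longleftrightarrow> P s \<noteq> P t \<and> (if P s then E s b0 else E t b0)" if st: "s \<in> ?X" "t \<in> S - ?X" for s t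
        proof -
          have stS: "s \<in> V" "t \<in> V" using st S by auto
          consider "P s = P t" | "P s" "\<not> P t" | "\<not> P s" "P t" by auto
          then show ?thesis
          proof cases
            case 1 then show ?thesis using indep[OF stS] by simp
          next
            case 2 then show ?thesis using XY[OF st] by (auto simp: N_def)
          next
            case 3 then show ?thesis using YX[OF st(2) 3(2) st(1) 3(1)] sym[of s t] sym[of t s] by (auto simp: N_def)
          qed
        qed
        show "E x y = E x' y'" using det[OF *(1,2)] det[OF *(3,4)] *(5,6) by simp
      qed (use a b in auto)
    qed
  qed
  then have "decomposable E ?c V" by (simp add: decomposable_def)
  then show ?thesis
    by (rule bounded_decomposableI[where K = "{True, False} \<times> {True, False}", rotated 2]) (auto simp: card_cartesian_product)
qed

text \<open>Directed along the cyclic order of the classes, with edges forward and non-edges backward, the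
  three classes form a tournament without rainbow directed triangle; such a tournament is not
  strongly connected.\<close>

lemma curious_splits:
  assumes sym: "\<And>x y. E x y \<Longrightarrow> E y x" and fin: "finite S"
    and K: "\<And>x. x \<in> S \<Longrightarrow> k x < (3::nat)"
    and indep: "\<And>x y. \<lbrakk>x \<in> S; y \<in> S; k x = k y\<rbrakk> \<Longrightarrow> \<not> E x y"
    and meets: "\<And>i. i < 3 \<Longrightarrow> \<exists>x\<in>S. k x = i"
    and tri: "\<And>x y z. \<lbrakk>x \<in> S; y \<in> S; z \<in> S; k x = 0; k y = 1; k z = 2; E x y; E y z; E x z\<rbrakk> \<Longrightarrow> False"
    and anti: "\<And>x y z. \<lbrakk>x \<in> S; y \<in> S; z \<in> S; k x = 0; k y = 1; k z = 2; \<not> E x y; \<not> E y z; \<not> E x z\<rbrakk> \<Longrightarrow> False"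
    and col: "\<And>x y. \<lbrakk>x \<in> S; y \<in> S; c x = c y\<rbrakk> \<Longrightarrow> k x = k y"
  shows "splits E c S"
proof -
  define nx :: "nat \<Rightarrow> nat" where "nx = (\<lambda>i. if i = 0 then 1 else if i = 1 then 2 else 0)"
  define D where "D = (\<lambda>x y. k x \<noteq> k y \<and> (E x y \<longleftrightarrow> k y = nx (k x)))"
  have k3: "k x = 0 \<or> k x = 1 \<or> k x = 2" if "x \<in> S" for x using K[OF that] by auto
  have tot: "D x y \<longleftrightarrow> \<not> D y x" if "x \<in> S" "y \<in> S" "k x \<noteq> k y" for x y
    using k3[OF that(1)] k3[OF that(2)] that(3) sym[of x y] sym[of y x]
    by (elim disjE) (simp_all add: D_def nx_def, blast+)
  \<comment> \<open>A rainbow directed triangle that runs with the cyclic order of the classes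
    consists of three edges, one that runs against it of three non-edges. Both are excluded.\<close>
  have cyc: False if xyz: "x \<in> S" "y \<in> S" "z \<in> S" "k x \<noteq> k z" "D x y" "D y z" "D z x" for x y z
  proof -
    have ks: "k x \<noteq> k y" "k y \<noteq> k z" using xyz by (auto simp: D_def)
    have s: "E x y = E y x" "E y z = E z y" "E x z = E z x" using sym by blast+
    have E: "(E x y \<longleftrightarrow> k y = nx (k x))" "(E y z \<longleftrightarrow> k z = nx (k y))" "(E z x \<longleftrightarrow> k x = nx (k z))"
      using xyz by (simp_all add: D_def)
    consider "k x = 0" "k y = 1" "k z = 2" | "k x = 0" "k y = 2" "k z = 1" | "k x = 1" "k y = 0" "k z = 2"
      | "k x = 1" "k y = 2" "k z = 0" | "k x = 2" "k y = 0" "k z = 1" | "k x = 2" "k y = 1" "k z = 0"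
      using k3[OF xyz(1)] k3[OF xyz(2)] k3[OF xyz(3)] ks xyz(4) by auto
    then show False
    proof cases
      case 1 then show False using tri[of x y z] xyz(1-3) E s by (simp add: nx_def)
    next
      case 2 then show False using anti[of x z y] xyz(1-3) E s by (simp add: nx_def)
    next
      case 3 then show False using anti[of y x z] xyz(1-3) E s by (simp add: nx_def)
    next
      case 4 then show False using tri[of z x y] xyz(1-3) E s by (simp add: nx_def)
    next
      case 5 then show False using tri[of y z x] xyz(1-3) E s by (simp add: nx_def)
    next
      case 6 then show False using anti[of z y x] xyz(1-3) E s by (simp add: nx_def)
    qed
  qed
  have fwd: "splits E c S" if X: "X \<subseteq> S" "u \<in> X" "v \<in> S" "v \<notin> X"
    and D: "\<And>x y. \<lbrakk>x \<in> X; y \<in> S; y \<notin> X; k x \<noteq> k y\<rbrakk> \<Longrightarrow> D x y" for X u v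
  proof (rule splitsI[of u X v "S - X"])
    fix x y x' y' assume *: "x \<in> X" "y \<in> S - X" "x' \<in> X" "y' \<in> S - X" "c x = c x'" "c y = c y'"
    have det: "E s t \<longleftrightarrow> k s \<noteq> k t \<and> k t = nx (k s)" if "s \<in> X" "t \<in> S - X" for s t
      using D[of s t] indep[of s t] that X(1) by (cases "k s = k t") (auto simp: D_def)
    have "k x = k x'" "k y = k y'" using * X(1) col by auto
    then show "E x y = E x' y'" using det[OF *(1,2)] det[OF *(3,4)] by simp
  qed (use X in auto)
  \<comment> \<open>If some vertex points to all of another class, or is pointed to by all of it, an
    initial set can be built from that class. Otherwise every vertex has an in-neighbour in each
    other class, which turns out to be impossible.\<close>
  show ?thesis
  proof (cases "\<exists>i<3. \<exists>v\<in>S. k v \<noteq> i \<and> ((\<forall>w\<in>S. k w = i \<longrightarrow> D w v) \<or> (\<forall>w\<in>S. k w = i \<longrightarrow> D v w))")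
    case True
    then obtain i v where i: "i < 3" and v: "v \<in> S" "k v \<noteq> i"
      and "(\<forall>w\<in>S. k w = i \<longrightarrow> D w v) \<or> (\<forall>w\<in>S. k w = i \<longrightarrow> D v w)" by blast
    obtain w0 where w0: "w0 \<in> S" "k w0 = i" using meets[OF i] by blast
    from \<open>(\<forall>w\<in>S. k w = i \<longrightarrow> D w v) \<or> (\<forall>w\<in>S. k w = i \<longrightarrow> D v w)\<close> show ?thesis
    proof
      assume after: "\<forall>w\<in>S. k w = i \<longrightarrow> D w v"
      let ?X = "{x\<in>S. k x = i \<or> (\<exists>w\<in>S. k w = i \<and> D x w)}"
      show ?thesis
      proof (rule fwd[of ?X w0 v])
        have "\<not> D v w" if "w \<in> S" "k w = i" for w using after tot[of w v] that v by auto
        then show "v \<notin> ?X" using v(2) by auto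
        fix x y assume x: "x \<in> ?X" and y: "y \<in> S" "y \<notin> ?X" and ne: "k x \<noteq> k y"
        have wy: "D w y" if "w \<in> S" "k w = i" for w using y that tot[of w y] by auto
        show "D x y"
        proof (cases "k x = i")
          case False
          then obtain w where w: "w \<in> S" "k w = i" "D x w" using x by blast
          have "\<not> D y x" using cyc[of x w y] x y w wy[OF w(1,2)] ne by auto
          then show ?thesis using tot[of x y] x y ne by auto
        qed (use wy x in auto)
      qed (use w0 v in auto)
    next
      assume before: "\<forall>w\<in>S. k w = i \<longrightarrow> D v w"
      let ?X = "{x\<in>S. k x \<noteq> i \<and> (\<forall>w\<in>S. k w = i \<longrightarrow> D x w)}"
      show ?thesis
      proof (rule fwd[of ?X v w0])
        fix x y assume x: "x \<in> ?X" and y: "y \<in> S" "y \<notin> ?X" and ne: "k x \<noteq> k y"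
        show "D x y"
        proof (cases "k y = i")
          case False
          then obtain w where w: "w \<in> S" "k w = i" "\<not> D y w" using y by auto
          then have "D w y" using tot[of w y] y False by auto
          then have "\<not> D y x" using cyc[of x w y] x y w ne by auto
          then show ?thesis using tot[of x y] x y ne by auto
        qed (use x y in auto)
      qed (use w0 v before in auto)
    qed
  next
    case False
    have inn: "\<exists>w\<in>S. k w = i \<and> D w v" if iv: "i < 3" "v \<in> S" "k v \<noteq> i" for i v
    proof -
      obtain w where "w \<in> S" "k w = i" "\<not> D v w" using False iv by auto
      then show ?thesis using tot[of w v] iv by auto
    qed
    let ?A = "{a\<in>S. k a = 0}"
    \<comment> \<open>With \<open>a\<close> of maximal out-degree into class 1, stepping back along
      in-neighbours leads to \<open>b\<close>, \<open>w\<close> and finally \<open>a'\<close> in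
      class 0. Without rainbow directed triangles, every out-neighbour of \<open>a\<close> in class
      1 is passed on to \<open>w\<close> and then to \<open>a'\<close>. If \<open>a'\<close> also
      points to \<open>b\<close>, it beats \<open>a\<close>; if not, a', w, b is a directed
      triangle.\<close>
    let ?n = "\<lambda>a. card {b\<in>S. k b = 1 \<and> D a b}"
    have A: "finite (?n ` ?A)" "?n ` ?A \<noteq> {}" using meets[of 0] fin by auto
    from Max_in[OF this] obtain a where a: "a \<in> S" "k a = 0" "Max (?n ` ?A) = ?n a" by auto
    have max: "?n a' \<le> ?n a" if "a' \<in> S" "k a' = 0" for a' using Max_ge[OF A(1), of "?n a'"] that a(3) by auto
    obtain b where b: "b \<in> S" "k b = 1" "D b a" using inn[of 1 a] a by auto
    obtain w where w: "w \<in> S" "k w = 2" "D w b" using inn[of 2 b] b by auto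
    have "D w a" using cyc[of w b a] tot[of w a] a b w by auto
    obtain a' where a': "a' \<in> S" "k a' = 0" "D a' w" using inn[of 0 w] w by auto
    have sub: "D a' b'" if b': "b' \<in> S" "k b' = 1" "D a b'" for b'
    proof -
      have "D w b'" using cyc[of w a b'] tot[of w b'] w a b' \<open>D w a\<close> by auto
      then show ?thesis using cyc[of a' w b'] tot[of a' b'] w a' b' by auto
    qed
    have "\<not> D a' b"
      proof
      assume "D a' b"
      then have "{b\<in>S. k b = 1 \<and> D a b} \<subset> {b\<in>S. k b = 1 \<and> D a' b}"
        using sub b tot[of a b] a by auto
      then have "?n a < ?n a'" by (intro psubset_card_mono) (use fin in auto)
      then show False using max[OF a'(1,2)] by simp
    qed
    then have "D b a'" using tot[of b a'] b a' by auto
    then have False using cyc[of a' w b] a' w b by auto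
    then show ?thesis ..
  qed
qed

section \<open>Well-quasi-ordering of decomposable labelled graphs\<close>

definition good_seq :: "('b \<Rightarrow> 'b \<Rightarrow> bool) \<Rightarrow> (nat \<Rightarrow> 'b) \<Rightarrow> bool" where
  "good_seq le f \<longleftrightarrow> (\<exists>i j. i < j \<and> le (f i) (f j))"

text \<open>Ramsey's theorem on pairs of indices, coloured by whether the pair ascends. A
  homogeneous set of the other colour would enumerate a sequence that is not good.\<close>

lemma increasing_subsequence:
  assumes "\<And>g. range g \<subseteq> A \<Longrightarrow> good_seq le g" "range f \<subseteq> A"
  shows "\<exists>\<phi> :: nat \<Rightarrow> nat. strict_mono \<phi> \<and> (\<forall>i j. i < j \<longrightarrow> le (f (\<phi> i)) (f (\<phi> j)))"
proof -
  define col where "col = (\<lambda>e. if le (f (Min e)) (f (Max e)) then 0 else (1::nat))"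
  have "\<forall>x\<in>UNIV. \<forall>y\<in>UNIV. x \<noteq> y \<longrightarrow> col {x, y} < 2" by (simp add: col_def)
  from Ramsey2[OF infinite_UNIV_nat this] obtain Y t where
    Y: "infinite Y" "\<forall>x\<in>Y. \<forall>y\<in>Y. x \<noteq> y \<longrightarrow> col {x, y} = t" by blast
  let ?e = "enumerate Y"
  have mem: "?e i \<in> Y" for i by (rule enumerate_in_set[OF Y(1)])
  have less: "?e i < ?e j" if "i < j" for i j by (rule enumerate_mono[OF that Y(1)])
  have iff: "le (f (?e i)) (f (?e j)) \<longleftrightarrow> t = 0" if "i < j" for i j
  proof -
    have "?e i \<noteq> ?e j" using less[OF that] by simp
    then have "col {?e i, ?e j} = t" by (rule Y(2)[rule_format, OF mem mem])
    then show ?thesis using less[OF that] by (auto simp: col_def split: if_splits)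
  qed
  have "range (\<lambda>n. f (?e n)) \<subseteq> A" using assms(2) by auto
  from assms(1)[OF this] obtain i j where "i < j" "le (f (?e i)) (f (?e j))"
    by (auto simp: good_seq_def)
  then have "t = 0" by (simp add: iff)
  show ?thesis
  proof (rule exI[of _ ?e], intro conjI allI impI)
    show "strict_mono ?e" using less by (simp add: strict_mono_def)
    show "le (f (?e i)) (f (?e j))" if "i < j" for i j using iff[OF that] \<open>t = 0\<close> by simp
  qed
qed

text \<open>Nash-Williams: \<open>G n\<close> is minimal at position \<open>n\<close> among the bad
  sequences with the same first \<open>n\<close> entries, and \<open>G (Suc n)\<close> keeps the
  entries up to \<open>n\<close>. Any good pair of the diagonal would already occur in a single
  \<open>G j\<close>.\<close>

lemma minimal_bad_sequence:
  fixes sz :: "'b \<Rightarrow> nat"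
  assumes "range f \<subseteq> A" "\<not> good_seq le f"
  shows "\<exists>m. range m \<subseteq> A \<and> \<not> good_seq le m \<and>
    (\<forall>g n. range g \<subseteq> A \<longrightarrow> \<not> good_seq le g \<longrightarrow> (\<forall>i<n. g i = m i) \<longrightarrow> sz (m n) \<le> sz (g n))"
proof -
  define bad where "bad = (\<lambda>g. range g \<subseteq> A \<and> \<not> good_seq le g)"
  define P where "P = (\<lambda>n g. bad g \<and> (\<forall>h. bad h \<longrightarrow> (\<forall>i<n. h i = g i) \<longrightarrow> sz (g n) \<le> sz (h n)))"
  have step: "\<exists>g'. P n g' \<and> (\<forall>i<n. g' i = g i)" if "bad g" for n g
  proof -
    have "bad g \<and> (\<forall>i<n. g i = g i)" using that by simp
    from ex_has_least_nat[of "\<lambda>h. bad h \<and> (\<forall>i<n. h i = g i)", OF this, of "\<lambda>h. sz (h n)"]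
    obtain g' where g': "bad g'" "\<forall>i<n. g' i = g i"
      and least: "\<forall>h. bad h \<and> (\<forall>i<n. h i = g i) \<longrightarrow> sz (g' n) \<le> sz (h n)"
      by (elim exE conjE)
    have "P n g'"
      unfolding P_def
    proof (intro conjI allI impI)
      fix h assume "bad h" "\<forall>i<n. h i = g' i"
      then show "sz (g' n) \<le> sz (h n)" using least[rule_format, of h] g'(2) by simp
    qed (rule g'(1))
    with g'(2) show ?thesis by (intro exI[of _ g'] conjI)
  qed
  have P_bad: "bad g" if "P n g" for n g using that by (simp add: P_def)
  have "\<exists>G. \<forall>n. P n (G n) \<and> (\<forall>i<Suc n. G (Suc n) i = G n i)"
  proof (rule dependent_nat_choice)
    have "bad f" using assms by (simp add: bad_def)
    from step[OF this, of 0] show "\<exists>g. P 0 g" by (elim exE conjE) (rule exI)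
    show "\<exists>y. P (Suc n) y \<and> (\<forall>i<Suc n. y i = x i)" if "P n x" for x n
      by (rule step[OF P_bad[OF that]])
  qed
  then obtain G where G: "\<And>n. P n (G n)" "\<And>n i. i < Suc n \<Longrightarrow> G (Suc n) i = G n i" by blast
  have eq: "G (i + k) i = G i i" for i k by (induction k) (simp_all add: G(2))
  then have eq': "G n i = G i i" if "i \<le> n" for i n using that by (metis le_add_diff_inverse)
  show ?thesis
  proof (rule exI[of _ "\<lambda>n. G n n"], intro conjI allI impI)
    show "range (\<lambda>n. G n n) \<subseteq> A" using P_bad[OF G(1)] by (auto simp: bad_def)
    show "\<not> good_seq le (\<lambda>n. G n n)"
    proof
      assume "good_seq le (\<lambda>n. G n n)"
      then obtain i j where "i < j" "le (G i i) (G j j)" by (auto simp: good_seq_def)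
      then have "i < j" "le (G j i) (G j j)" using eq'[of i j] by auto
      then have "good_seq le (G j)" unfolding good_seq_def by blast
      then show False using P_bad[OF G(1)[of j]] by (simp add: bad_def)
    qed
    fix g n assume g: "range g \<subseteq> A" "\<not> good_seq le g" "\<forall>i<n. g i = G i i"
    have "bad g" using g(1,2) by (simp add: bad_def)
    moreover have "\<forall>i<n. g i = G n i" using g(3) eq'[of _ n] by simp
    ultimately show "sz (G n n) \<le> sz (g n)" using G(1)[of n] by (simp add: P_def)
  qed
qed

type_synonym ('a, 'w) obj = "('a \<Rightarrow> 'a \<Rightarrow> bool) \<times> ('a \<Rightarrow> nat) \<times> ('a \<Rightarrow> 'w) \<times> 'a set"

text \<open>The relation lives on the whole type and the vertex set is carried separately, so a part
  of a split is the same object with a smaller set.\<close>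

definition objs :: "nat \<Rightarrow> 'w set \<Rightarrow> ('a, 'w) obj set" where
  "objs N W = {(E, c, l, S). symp E \<and> finite S \<and> S \<noteq> {} \<and> c ` S \<subseteq> {..<N} \<and> l ` S \<subseteq> W \<and> decomposable E c S}"

text \<open>Labels may grow along \<open>le\<close>, but colours are kept exactly; exactness is what
  allows embeddings of two parts to be glued.\<close>

definition obj_emb :: "('w \<Rightarrow> 'w \<Rightarrow> bool) \<Rightarrow> ('a, 'w) obj \<Rightarrow> ('a, 'w) obj \<Rightarrow> bool" where
  "obj_emb le = (\<lambda>(E, c, l, S) (E', c', l', S'). \<exists>h. inj_on h S \<and> h ` S \<subseteq> S' \<and>
     (\<forall>x\<in>S. c' (h x) = c x \<and> le (l x) (l' (h x))) \<and>
     (\<forall>x\<in>S. \<forall>y\<in>S. x \<noteq> y \<longrightarrow> E x y = E' (h x) (h y)))"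

definition obj_size :: "('a, 'w) obj \<Rightarrow> nat" where
  "obj_size = (\<lambda>(E, c, l, S). card S)"

lemma obj_emb_superset:
  assumes "obj_emb le q (E, c, l, X)" "X \<subseteq> S"
  shows "obj_emb le q (E, c, l, S)"
  using assms by (cases q) (fastforce simp: obj_emb_def)

text \<open>Both splits use the same set \<open>F\<close> of adjacent colour pairs and both
  embeddings keep colours, so the adjacencies across the split agree for the glued map.\<close>

lemma obj_emb_union:
  assumes X: "obj_emb le (E, c, l, X) (E', c', l', X')" and Y: "obj_emb le (E, c, l, Y) (E', c', l', Y')"
    and disj: "X \<inter> Y = {}" "X' \<inter> Y' = {}" and sym: "symp E" "symp E'"
    and F: "\<And>x y. \<lbrakk>x \<in> X; y \<in> Y\<rbrakk> \<Longrightarrow> E x y \<longleftrightarrow> (c x, c y) \<in> F"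
    and F': "\<And>x y. \<lbrakk>x \<in> X'; y \<in> Y'\<rbrakk> \<Longrightarrow> E' x y \<longleftrightarrow> (c' x, c' y) \<in> F"
  shows "obj_emb le (E, c, l, X \<union> Y) (E', c', l', X' \<union> Y')"
proof -
  obtain h where h: "inj_on h X" "h ` X \<subseteq> X'" "\<And>x. x \<in> X \<Longrightarrow> c' (h x) = c x \<and> le (l x) (l' (h x))"
    "\<And>x y. \<lbrakk>x \<in> X; y \<in> X; x \<noteq> y\<rbrakk> \<Longrightarrow> E x y = E' (h x) (h y)"
    using X by (auto simp: obj_emb_def)
  obtain k where k: "inj_on k Y" "k ` Y \<subseteq> Y'" "\<And>x. x \<in> Y \<Longrightarrow> c' (k x) = c x \<and> le (l x) (l' (k x))"
    "\<And>x y. \<lbrakk>x \<in> Y; y \<in> Y; x \<noteq> y\<rbrakk> \<Longrightarrow> E x y = E' (k x) (k y)"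
    using Y by (auto simp: obj_emb_def)
  define g where "g = (\<lambda>x. if x \<in> X then h x else k x)"
  have gX: "g x = h x" if "x \<in> X" for x using that by (simp add: g_def)
  have gY: "g x = k x" if "x \<in> Y" for x using that disj(1) by (auto simp: g_def)
  have mixed: "E x y = E' (g x) (g y)" if "x \<in> X" "y \<in> Y" for x y
  proof -
    have "h x \<in> X'" "k y \<in> Y'" using that h(2) k(2) by auto
    then show ?thesis using that F[OF that] F'[of "h x" "k y"] h(3)[of x] k(3)[of y] by (simp add: gX gY)
  qed
  have "inj_on g (X \<union> Y)"
  proof (rule inj_onI)
    fix x y assume "x \<in> X \<union> Y" "y \<in> X \<union> Y" and eq: "g x = g y"
    then consider "x \<in> X" "y \<in> X" | "x \<in> Y" "y \<in> Y" | "x \<in> X" "y \<in> Y" | "x \<in> Y" "y \<in> X" by blast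
    then show "x = y"
    proof cases
      case 1 then show ?thesis using eq h(1) by (simp add: gX inj_on_eq_iff)
    next
      case 2 then show ?thesis using eq k(1) by (simp add: gY inj_on_eq_iff)
    next
      case 3
      then have "h x \<in> X'" "k y \<in> Y'" using h(2) k(2) by auto
      then show ?thesis using 3 eq disj(2) by (auto simp: gX gY)
    next
      case 4
      then have "k x \<in> Y'" "h y \<in> X'" using h(2) k(2) by auto
      then show ?thesis using 4 eq disj(2) by (auto simp: gX gY)
    qed
  qed
  moreover have "g ` (X \<union> Y) \<subseteq> X' \<union> Y'" using h(2) k(2) by (auto simp: gX gY)
  moreover have "c' (g x) = c x \<and> le (l x) (l' (g x))" if "x \<in> X \<union> Y" for x
    using that h(3) k(3) by (auto simp: gX gY)
  moreover have "E x y = E' (g x) (g y)" if xy: "x \<in> X \<union> Y" "y \<in> X \<union> Y" "x \<noteq> y" for x y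
  proof -
    consider "x \<in> X" "y \<in> X" | "x \<in> Y" "y \<in> Y" | "x \<in> X" "y \<in> Y" | "x \<in> Y" "y \<in> X" using xy by blast
    then show ?thesis
    proof cases
      case 1 then show ?thesis using h(4) xy(3) by (simp add: gX)
    next
      case 2 then show ?thesis using k(4) xy(3) by (simp add: gY)
    next
      case 3 then show ?thesis by (rule mixed)
    next
      case 4
      then show ?thesis using mixed[of y x] sym by (metis sympD)
    qed
  qed
  ultimately have "inj_on g (X \<union> Y) \<and> g ` (X \<union> Y) \<subseteq> X' \<union> Y' \<and>
     (\<forall>x\<in>X \<union> Y. c' (g x) = c x \<and> le (l x) (l' (g x))) \<and>
     (\<forall>x\<in>X \<union> Y. \<forall>y\<in>X \<union> Y. x \<noteq> y \<longrightarrow> E x y = E' (g x) (g y))"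
    by (intro conjI ballI impI) auto
  then show ?thesis unfolding obj_emb_def prod.case by (rule exI[of _ g])
qed

lemma infinite_subsequence:
  "infinite {n :: nat. P n} \<Longrightarrow> \<exists>r :: nat \<Rightarrow> nat. strict_mono r \<and> (\<forall>n. P (r n))"
  using infinite_enumerate[of "{n. P n}"] by simp

lemma finite_range_subsequence:
  fixes g :: "nat \<Rightarrow> 'b"
  assumes "finite (range g)"
  shows "\<exists>(r :: nat \<Rightarrow> nat) k. strict_mono r \<and> (\<forall>n. g (r n) = k)"
proof -
  from pigeonhole_infinite[OF infinite_UNIV_nat assms]
  obtain a where "infinite {n \<in> UNIV. g n = g a}" by (elim bexE)
  then have "infinite {n. g n = g a}" by simp
  from infinite_subsequence[OF this] show ?thesis by (elim ex_forward) (rule exI)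
qed

text \<open>The scheme of Kruskal's tree theorem: in a minimal bad sequence the proper parts of the
  members are well-quasi-ordered, and a large member is a pair of parts joined by one of finitely
  many patterns \<open>F\<close>. Two members with comparable parts and the same pattern contradict
  badness.\<close>

lemma objs_good:
  fixes f :: "nat \<Rightarrow> ('a, 'w) obj"
  assumes W: "well_quasi_order_on W le" and f: "range f \<subseteq> objs N W"
  shows "good_seq (obj_emb le) f"
proof (rule ccontr)
  assume "\<not> good_seq (obj_emb le) f"
  from minimal_bad_sequence[OF f this, of obj_size]
  obtain m :: "nat \<Rightarrow> ('a, 'w) obj" where m: "range m \<subseteq> objs N W" "\<not> good_seq (obj_emb le) m"
    and min: "\<forall>g n. range g \<subseteq> objs N W \<longrightarrow> \<not> good_seq (obj_emb le) g \<longrightarrow> (\<forall>i<n. g i = m i) \<longrightarrow>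
      obj_size (m n) \<le> obj_size (g n)"
    by blast
  define E where "E = (\<lambda>n. fst (m n))"
  define c where "c = (\<lambda>n. fst (snd (m n)))"
  define l where "l = (\<lambda>n. fst (snd (snd (m n))))"
  define S where "S = (\<lambda>n. snd (snd (snd (m n))))"
  have mEq: "m n = (E n, c n, l n, S n)" for n by (simp add: E_def c_def l_def S_def)
  have obj: "symp (E n)" "finite (S n)" "S n \<noteq> {}" "c n ` S n \<subseteq> {..<N}" "l n ` S n \<subseteq> W"
    "decomposable (E n) (c n) (S n)" for n
  proof -
    have "m n \<in> objs N W" using m(1) by auto
    then show "symp (E n)" "finite (S n)" "S n \<noteq> {}" "c n ` S n \<subseteq> {..<N}" "l n ` S n \<subseteq> W"
      "decomposable (E n) (c n) (S n)"
      by (simp_all add: mEq objs_def)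
  qed
  have wqo: "\<exists>i j. i < j \<and> le (g i) (g j)" if "range g \<subseteq> W" for g :: "nat \<Rightarrow> 'w"
    using W that by (simp add: well_quasi_order_on_def)
  define sub where "sub = {(E n, c n, l n, X) | n X. X \<subseteq> S n \<and> X \<noteq> {} \<and> X \<noteq> S n}"
  have sub_objs: "sub \<subseteq> objs N W"
  proof
    fix q assume "q \<in> sub"
    then obtain n X where q: "q = (E n, c n, l n, X)" "X \<subseteq> S n" "X \<noteq> {}" by (auto simp: sub_def)
    have "finite X" using q(2) obj(2) by (rule finite_subset)
    moreover have "c n ` X \<subseteq> {..<N}" "l n ` X \<subseteq> W" using q(2) obj(4,5)[of n] by blast+
    moreover have "decomposable (E n) (c n) X" by (rule decomposable_subset[OF obj(6) q(2)])
    ultimately show "q \<in> objs N W" using q(1,3) obj(1) by (simp add: objs_def)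
  qed
  have sub_good: "good_seq (obj_emb le) b" if b: "range b \<subseteq> sub" for b
  proof (rule ccontr)
    assume bad: "\<not> good_seq (obj_emb le) b"
    have "\<exists>t. b k = (E (fst t), c (fst t), l (fst t), snd t) \<and> snd t \<subseteq> S (fst t) \<and> snd t \<noteq> S (fst t)" for k
    proof -
      have "b k \<in> sub" using b by auto
      then obtain n X where "b k = (E n, c n, l n, X)" "X \<subseteq> S n" "X \<noteq> S n" by (auto simp: sub_def)
      then show ?thesis by (intro exI[of _ "(n, X)"]) simp
    qed
    then have "\<forall>k. \<exists>t. b k = (E (fst t), c (fst t), l (fst t), snd t) \<and> snd t \<subseteq> S (fst t) \<and> snd t \<noteq> S (fst t)"
      by (rule allI)
    from choice[OF this] obtain t where t: "\<And>k. b k = (E (fst (t k)), c (fst (t k)), l (fst (t k)), snd (t k)) \<and>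
        snd (t k) \<subseteq> S (fst (t k)) \<and> snd (t k) \<noteq> S (fst (t k))"
      by blast
    define p where "p = (\<lambda>k. fst (t k))"
    define X where "X = (\<lambda>k. snd (t k))"
    have pX: "b k = (E (p k), c (p k), l (p k), X k)" "X k \<subseteq> S (p k)" "X k \<noteq> S (p k)" for k
      using t[of k] by (simp_all add: p_def X_def)
    \<comment> \<open>The bad sequence of parts is started at its part of least origin
      \<open>p k0\<close> and placed behind the first \<open>p k0\<close> members of
      \<open>m\<close>. By the choice of \<open>k0\<close> every part used comes from a member not
      before that position, so an embedding of a prefix member into a part would give a good pair of
      \<open>m\<close>. The spliced sequence is bad and smaller at position
      \<open>p k0\<close>.\<close>
    obtain k0 where k0: "\<And>k. p k0 \<le> p k"
      using ex_has_least_nat[of "\<lambda>_. True" 0 p] by auto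
    define g where "g = (\<lambda>i. if i < p k0 then m i else b (k0 + (i - p k0)))"
    have "range g \<subseteq> objs N W" using m(1) b sub_objs by (auto simp: g_def)
    moreover have "\<not> good_seq (obj_emb le) g"
    proof
      assume "good_seq (obj_emb le) g"
      then obtain i j where ij: "i < j" "obj_emb le (g i) (g j)" by (auto simp: good_seq_def)
      consider "j < p k0" | "i < p k0" "p k0 \<le> j" | "p k0 \<le> i" by linarith
      then show False
      proof cases
        case 1 then show False using ij m(2) by (auto simp: g_def good_seq_def)
      next
        case 2
        let ?k = "k0 + (j - p k0)"
        have "obj_emb le (m i) (b ?k)" using ij 2 by (simp add: g_def)
        then have "obj_emb le (m i) (m (p ?k))"
          unfolding pX(1) mEq[of "p ?k"] by (rule obj_emb_superset) (rule pX(2))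
        moreover have "i < p ?k" using 2 k0[of ?k] by linarith
        ultimately show False using m(2) by (auto simp: good_seq_def)
      next
        case 3
        then have "obj_emb le (b (k0 + (i - p k0))) (b (k0 + (j - p k0)))" "k0 + (i - p k0) < k0 + (j - p k0)"
          using ij by (auto simp: g_def)
        then show False using bad by (auto simp: good_seq_def)
      qed
    qed
    ultimately have "obj_size (m (p k0)) \<le> obj_size (g (p k0))"
      by (rule min[rule_format, of g "p k0"]) (simp add: g_def)
    moreover have "card (X k0) < card (S (p k0))"
      using pX(2,3)[of k0] obj(2) by (meson psubset_card_mono psubsetI)
    ultimately show False by (simp add: g_def mEq pX(1) obj_size_def)
  qed
  \<comment> \<open>Single vertices do not split. Infinitely many of them would contain a
    subsequence of one colour, in which some two labels ascend; hence all members from some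
    \<open>n0\<close> on split.\<close>
  let ?single = "\<lambda>n. \<exists>x. S n = {x}"
  have fin: "finite {n. ?single n}"
  proof (rule ccontr)
    assume "infinite {n. ?single n}"
    from infinite_subsequence[OF this]
    obtain \<psi> :: "nat \<Rightarrow> nat" where \<psi>: "strict_mono \<psi>" "\<forall>n. ?single (\<psi> n)"
      by (elim exE conjE)
    define x where "x = (\<lambda>n. the_elem (S (\<psi> n)))"
    have x: "S (\<psi> n) = {x n}" for n
    proof -
      from \<psi>(2)[THEN spec, of n] obtain y where "S (\<psi> n) = {y}" by (elim exE)
      then show ?thesis by (simp only: x_def the_elem_eq)
    qed
    have "c (\<psi> n) (x n) \<in> {..<N}" for n using obj(4)[of "\<psi> n"] x[of n] by simp
    then have "range (\<lambda>n. c (\<psi> n) (x n)) \<subseteq> {..<N}" by auto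
    then have "finite (range (\<lambda>n. c (\<psi> n) (x n)))" by (rule finite_subset) simp
    from finite_range_subsequence[OF this]
    obtain \<chi> :: "nat \<Rightarrow> nat" and k where \<chi>: "strict_mono \<chi>" "\<forall>n. c (\<psi> (\<chi> n)) (x (\<chi> n)) = k"
      by (elim exE conjE)
    have "l (\<psi> n) (x n) \<in> W" for n using obj(5)[of "\<psi> n"] x[of n] by simp
    then have "range (\<lambda>n. l (\<psi> (\<chi> n)) (x (\<chi> n))) \<subseteq> W" by auto
    from wqo[OF this] obtain i j where ij: "i < j" "le (l (\<psi> (\<chi> i)) (x (\<chi> i))) (l (\<psi> (\<chi> j)) (x (\<chi> j)))"
      by blast
    have "obj_emb le (m (\<psi> (\<chi> i))) (m (\<psi> (\<chi> j)))"
      unfolding mEq obj_emb_def prod.case x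
      by (rule exI[of _ "\<lambda>_. x (\<chi> j)"]) (simp add: \<chi>(2) ij(2))
    moreover have "\<psi> (\<chi> i) < \<psi> (\<chi> j)" using ij(1) \<psi>(1) \<chi>(1) by (simp add: strict_mono_less)
    ultimately show False using m(2) by (auto simp: good_seq_def)
  qed
  then obtain n0 where bound: "\<forall>n\<in>{n. ?single n}. n < n0"
    unfolding finite_nat_set_iff_bounded by (elim exE)
  have n0: "\<not> ?single n" if "n \<ge> n0" for n
  proof
    assume "?single n"
    then have "n < n0" by (intro bspec[OF bound]) simp
    with that show False by simp
  qed
  define spl where "spl = (\<lambda>n (X, Y, F). X \<noteq> {} \<and> Y \<noteq> {} \<and> X \<inter> Y = {} \<and> X \<union> Y = S n \<and>
     F \<subseteq> {..<N} \<times> {..<N} \<and> (\<forall>x\<in>X. \<forall>y\<in>Y. E n x y \<longleftrightarrow> (c n x, c n y) \<in> F))"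
  have "\<exists>t. spl n t" if ge: "n \<ge> n0" for n
  proof -
    obtain x y where "x \<in> S n" "y \<in> S n" "x \<noteq> y" using obj(3)[of n] n0[OF ge] by blast
    then have "splits (E n) (c n) (S n)" by (rule decomposableD[OF obj(6) order_refl])
    then show ?thesis
    proof (rule splitsE)
      fix X Y assume XY: "X \<noteq> {}" "Y \<noteq> {}" "X \<inter> Y = {}" "X \<union> Y = S n"
        and det: "\<And>x y x' y'. \<lbrakk>x \<in> X; y \<in> Y; x' \<in> X; y' \<in> Y; c n x = c n x'; c n y = c n y'\<rbrakk> \<Longrightarrow> E n x y = E n x' y'"
      let ?F = "{(c n x, c n y) | x y. x \<in> X \<and> y \<in> Y \<and> E n x y}"
      have "?F \<subseteq> {..<N} \<times> {..<N}" using obj(4)[of n] XY(4) by auto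
      moreover have "E n x y \<longleftrightarrow> (c n x, c n y) \<in> ?F" if xy: "x \<in> X" "y \<in> Y" for x y
      proof
        assume "(c n x, c n y) \<in> ?F"
        then obtain x' y' where "x' \<in> X" "y' \<in> Y" "c n x = c n x'" "c n y = c n y'" "E n x' y'" by auto
        then show "E n x y" using det[OF xy, of x' y'] by simp
      qed (use xy in blast)
      ultimately have "spl n (X, Y, ?F)" unfolding spl_def prod.case using XY by (intro conjI ballI)
      then show ?thesis by (rule exI)
    qed
  qed
  then have "\<forall>n. \<exists>t. n \<ge> n0 \<longrightarrow> spl n t" by simp
  from choice[OF this] obtain t where t: "\<And>n. n \<ge> n0 \<Longrightarrow> spl n (t n)" by blast
  define X where "X = (\<lambda>n. fst (t n))"
  define Y where "Y = (\<lambda>n. fst (snd (t n)))"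
  define F where "F = (\<lambda>n. snd (snd (t n)))"
  have t_eq: "t n = (X n, Y n, F n)" for n by (simp add: X_def Y_def F_def)
  have split: "X n \<noteq> {}" "Y n \<noteq> {}" "X n \<inter> Y n = {}" "X n \<union> Y n = S n" "F n \<subseteq> {..<N} \<times> {..<N}"
    "\<And>x y. \<lbrakk>x \<in> X n; y \<in> Y n\<rbrakk> \<Longrightarrow> E n x y \<longleftrightarrow> (c n x, c n y) \<in> F n" if "n \<ge> n0" for n
    using t[OF that] by (simp_all add: t_eq spl_def)
  \<comment> \<open>There are only finitely many patterns of colour pairs, so a subsequence shares
    one pattern \<open>F0\<close>. On it the first parts are made ascending, and then one good pair
    of second parts suffices.\<close>
  have "F (n0 + n) \<subseteq> {..<N} \<times> {..<N}" for n by (rule split(5)) simp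
  then have "range (\<lambda>n. F (n0 + n)) \<subseteq> Pow ({..<N} \<times> {..<N})" by (intro image_subsetI PowI)
  then have "finite (range (\<lambda>n. F (n0 + n)))" by (rule finite_subset) simp
  from finite_range_subsequence[OF this]
  obtain \<psi> :: "nat \<Rightarrow> nat" and F0 where \<psi>: "strict_mono \<psi>" "\<forall>n. F (n0 + \<psi> n) = F0"
    by (elim exE conjE)
  define q where "q = (\<lambda>n. n0 + \<psi> n)"
  have q: "q n \<ge> n0" "F (q n) = F0" for n by (simp_all add: q_def \<psi>(2))
  let ?x = "\<lambda>n. (E (q n), c (q n), l (q n), X (q n))" and ?y = "\<lambda>n. (E (q n), c (q n), l (q n), Y (q n))"
  have "?x n \<in> sub" "?y n \<in> sub" for n
  proof -
    have "X (q n) \<subseteq> S (q n)" "Y (q n) \<subseteq> S (q n)" "X (q n) \<noteq> S (q n)" "Y (q n) \<noteq> S (q n)"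
      using split(1-4)[OF q(1)[of n]] by auto
    then show "?x n \<in> sub" "?y n \<in> sub" unfolding sub_def using split(1,2)[OF q(1)[of n]] by auto
  qed
  then have "range ?x \<subseteq> sub" "range ?y \<subseteq> sub" by auto
  have "\<exists>\<phi> :: nat \<Rightarrow> nat. strict_mono \<phi> \<and> (\<forall>i j. i < j \<longrightarrow> obj_emb le (?x (\<phi> i)) (?x (\<phi> j)))"
  proof (rule increasing_subsequence[of sub])
    fix g :: "nat \<Rightarrow> _" assume "range g \<subseteq> sub" then show "good_seq (obj_emb le) g" by (rule sub_good)
  qed fact
  then obtain \<phi> :: "nat \<Rightarrow> nat" where \<phi>: "strict_mono \<phi>" "\<forall>i j. i < j \<longrightarrow> obj_emb le (?x (\<phi> i)) (?x (\<phi> j))"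
    by (elim exE conjE)
  have "range (\<lambda>n. ?y (\<phi> n)) \<subseteq> sub" using \<open>range ?y \<subseteq> sub\<close> by auto
  from sub_good[OF this] obtain i j where ij: "i < j" "obj_emb le (?y (\<phi> i)) (?y (\<phi> j))"
    by (auto simp: good_seq_def)
  let ?i = "q (\<phi> i)" and ?j = "q (\<phi> j)"
  have "obj_emb le (E ?i, c ?i, l ?i, X ?i \<union> Y ?i) (E ?j, c ?j, l ?j, X ?j \<union> Y ?j)"
  proof (rule obj_emb_union[OF \<phi>(2)[rule_format, OF ij(1)] ij(2), of F0])
    show "E ?i x y \<longleftrightarrow> (c ?i x, c ?i y) \<in> F0" if "x \<in> X ?i" "y \<in> Y ?i" for x y
      using split(6)[OF q(1) that] by (simp add: q(2))
    show "E ?j x y \<longleftrightarrow> (c ?j x, c ?j y) \<in> F0" if "x \<in> X ?j" "y \<in> Y ?j" for x y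
      using split(6)[OF q(1) that] by (simp add: q(2))
  qed (rule split(3)[OF q(1)] obj(1))+
  then have "obj_emb le (m ?i) (m ?j)" using split(4)[OF q(1)] by (simp add: mEq)
  moreover have "?i < ?j" using ij(1) \<phi>(1) \<psi>(1) by (simp add: q_def strict_mono_less)
  ultimately show False using m(2) by (auto simp: good_seq_def)
qed

section \<open>Clique-width of decomposable graphs\<close>

text \<open>Only one label moves at a time, so the induction counts the labels already moved.
  Targets lie above \<open>n\<close>, hence a moved vertex is not caught again by a later
  step.\<close>

lemma cw_construct_relabel_map:
  assumes "cw_construct k G l" "p \<le> n" "n + n \<le> k" "\<And>v. v \<in> verts G \<Longrightarrow> l v \<in> {1..n}"
  shows "\<exists>m. cw_construct k G m \<and> (\<forall>v\<in>verts G. m v = (if l v \<le> p then l v + n else l v))"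
  using assms(2)
proof (induction p)
  case 0
  then show ?case using assms(1,4) by (intro exI[of _ l]) force
next
  case (Suc p)
  then obtain m where m: "cw_construct k G m" "\<forall>v\<in>verts G. m v = (if l v \<le> p then l v + n else l v)"
    by auto
  have "Suc p \<in> {1..k}" "Suc p + n \<in> {1..k}" using Suc.prems assms(3) by auto
  from cw_construct.relabel[OF m(1) this]
  have "cw_construct k G (\<lambda>v. if m v = Suc p then Suc p + n else m v)" .
  moreover have "(if m v = Suc p then Suc p + n else m v) = (if l v \<le> Suc p then l v + n else l v)"
    if "v \<in> verts G" for v
    using m(2) assms(4)[OF that] that Suc.prems by (auto simp: le_Suc_eq)
  ultimately show ?case by (intro exI conjI ballI)
qed

lemma cw_construct_unrelabel_map:
  assumes "cw_construct k G l" "p \<le> n" "n + n \<le> k" "\<And>v. v \<in> verts G \<Longrightarrow> l v \<in> {1..n + n}"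
  shows "\<exists>m. cw_construct k G m \<and> (\<forall>v\<in>verts G. m v = (if n < l v \<and> l v \<le> n + p then l v - n else l v))"
  using assms(2)
proof (induction p)
  case 0
  then show ?case using assms(1) by (intro exI[of _ l]) auto
next
  case (Suc p)
  then obtain m where m: "cw_construct k G m"
    "\<forall>v\<in>verts G. m v = (if n < l v \<and> l v \<le> n + p then l v - n else l v)"
    by auto
  have "Suc p \<in> {1..k}" "n + Suc p \<in> {1..k}" using Suc.prems assms(3) by auto
  from cw_construct.relabel[OF m(1) this(2,1)]
  have "cw_construct k G (\<lambda>v. if m v = n + Suc p then Suc p else m v)" .
  moreover have "(if m v = n + Suc p then Suc p else m v) = (if n < l v \<and> l v \<le> n + Suc p then l v - n else l v)"
    if "v \<in> verts G" for v
    using m(2) that Suc.prems by (auto simp: le_Suc_eq)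
  ultimately show ?case by (intro exI conjI ballI)
qed

lemma cw_construct_joins:
  assumes "cw_construct k G l" "finite P" "P \<subseteq> {1..k} \<times> {1..k}" "\<And>i. (i, i) \<notin> P"
  shows "cw_construct k (Graph (verts G)
    (edges G \<union> {{u, v} | u v. u \<in> verts G \<and> v \<in> verts G \<and> (l u, l v) \<in> P})) l"
  using assms(2,3,4)
proof (induction P rule: finite_induct)
  case empty
  have "Graph (verts G) (edges G) = G" by (rule graph.collapse)
  then show ?case using assms(1) by simp
next
  case (insert p P)
  obtain i j where p: "p = (i, j)" by (cases p)
  have ij: "i \<in> {1..k}" "j \<in> {1..k}" "i \<noteq> j" using insert.prems p by auto
  have "cw_construct k (Graph (verts G)
    (edges G \<union> {{u, v} | u v. u \<in> verts G \<and> v \<in> verts G \<and> (l u, l v) \<in> P})) l"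
    using insert by auto
  from cw_construct.join[OF this ij]
  have "cw_construct k (Graph (verts G)
    ((edges G \<union> {{u, v} | u v. u \<in> verts G \<and> v \<in> verts G \<and> (l u, l v) \<in> P}) \<union>
     {{u, v} | u v. u \<in> verts G \<and> v \<in> verts G \<and> l u = i \<and> l v = j})) l"
    by simp
  moreover have "(edges G \<union> {{u, v} | u v. u \<in> verts G \<and> v \<in> verts G \<and> (l u, l v) \<in> P}) \<union>
     {{u, v} | u v. u \<in> verts G \<and> v \<in> verts G \<and> l u = i \<and> l v = j} =
     edges G \<union> {{u, v} | u v. u \<in> verts G \<and> v \<in> verts G \<and> (l u, l v) \<in> insert p P}"
    unfolding p by blast
  ultimately show ?case by simp
qed

text \<open>Labels start at 1 and colours at 0, whence \<open>Suc (c v)\<close>. The upper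
  \<open>n\<close> labels are a second copy of the colours: the part \<open>Y\<close> is moved there
  before the union, so that a join affects only pairs across the split, and is moved back
  afterwards. Colours never change, so label and colour agree again at every stage.\<close>

lemma cw_construct_decomposable:
  assumes sym: "symp E" and irr: "irreflp E" and fin: "finite S" and "S \<noteq> {}"
    and dec: "decomposable E c S" and col: "c ` S \<subseteq> {..<n}"
  shows "\<exists>l. cw_construct (n + n) (Graph S {{u, v} | u v. u \<in> S \<and> v \<in> S \<and> E u v}) l \<and>
    (\<forall>v\<in>S. l v = Suc (c v))"
  using fin \<open>S \<noteq> {}\<close> dec col
proof (induction "card S" arbitrary: S rule: less_induct)
  case less
  let ?G = "\<lambda>S. Graph S {{u, v} | u v. u \<in> S \<and> v \<in> S \<and> E u v}"
  show ?case
  proof (cases "\<exists>x. S = {x}")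
    case True
    then obtain x where x: "S = {x}" by auto
    have "?G S = Graph {x} {}" using x irr by (auto simp: irreflp_def)
    moreover have "cw_construct (n + n) (Graph {x} {}) (\<lambda>_. Suc (c x))"
      using less.prems(4) x by (intro cw_construct.create) auto
    ultimately show ?thesis using x by (intro exI[of _ "\<lambda>_. Suc (c x)"]) simp
  next
    case False
    then obtain x y where "x \<in> S" "y \<in> S" "x \<noteq> y" using less.prems(2) by blast
    then have "splits E c S" by (rule decomposableD[OF less.prems(3) order_refl])
    then show ?thesis
    proof (rule splitsE)
      fix X Y assume XY: "X \<noteq> {}" "Y \<noteq> {}" "X \<inter> Y = {}" "X \<union> Y = S"
        and det: "\<And>x y x' y'. \<lbrakk>x \<in> X; y \<in> Y; x' \<in> X; y' \<in> Y; c x = c x'; c y = c y'\<rbrakk> \<Longrightarrow> E x y = E x' y'"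
      have sub: "X \<subseteq> S" "Y \<subseteq> S" "X \<subset> S" "Y \<subset> S" using XY by auto
      have fins: "finite X" "finite Y" using sub less.prems(1) by (auto intro: finite_subset)
      obtain lX where lX: "cw_construct (n + n) (?G X) lX" "\<forall>v\<in>X. lX v = Suc (c v)"
        using less.hyps[of X] psubset_card_mono[OF less.prems(1) sub(3)] fins(1) XY(1)
          decomposable_subset[OF less.prems(3) sub(1)] less.prems(4) sub(1) by blast
      obtain lY where lY: "cw_construct (n + n) (?G Y) lY" "\<forall>v\<in>Y. lY v = Suc (c v)"
        using less.hyps[of Y] psubset_card_mono[OF less.prems(1) sub(4)] fins(2) XY(2)
          decomposable_subset[OF less.prems(3) sub(2)] less.prems(4) sub(2) by blast
      have c_less: "c v < n" if "v \<in> S" for v using less.prems(4) that by auto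
      obtain mY where mY: "cw_construct (n + n) (?G Y) mY" "\<forall>v\<in>Y. mY v = Suc (c v) + n"
        using cw_construct_relabel_map[OF lY(1), of n n] lY(2) c_less sub(2) by (auto simp: Suc_le_eq subset_iff)
      let ?l = "\<lambda>v. if v \<in> X then lX v else mY v"
      let ?U = "Graph S ({{u, v} | u v. u \<in> X \<and> v \<in> X \<and> E u v} \<union> {{u, v} | u v. u \<in> Y \<and> v \<in> Y \<and> E u v})"
      have U: "cw_construct (n + n) ?U ?l"
        using cw_construct.union[OF lX(1) mY(1)] XY(3,4) by simp
      have lvals: "?l v = Suc (c v)" if "v \<in> X" for v using that lX(2) by simp
      have lvals': "?l v = Suc (c v) + n" if "v \<in> Y" for v using that mY(2) XY(3) by auto
      let ?P = "{(Suc (c x), Suc (c y) + n) | x y. x \<in> X \<and> y \<in> Y \<and> E x y}"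
      have P: "?P \<subseteq> {1..n + n} \<times> {1..n + n}" using c_less XY(4) by (fastforce simp: Suc_le_eq)
      have "finite ?P" by (rule finite_subset[OF P]) simp
      moreover have "(i, i) \<notin> ?P" for i using c_less XY(4) by fastforce
      ultimately have J: "cw_construct (n + n) (Graph S
        (edges ?U \<union> {{u, v} | u v. u \<in> S \<and> v \<in> S \<and> (?l u, ?l v) \<in> ?P})) ?l"
        using cw_construct_joins[OF U, of ?P] P by simp
      have cross: "(?l u, ?l v) \<in> ?P \<longleftrightarrow> u \<in> X \<and> v \<in> Y \<and> E u v" if uv: "u \<in> S" "v \<in> S" for u v
      proof
        assume "(?l u, ?l v) \<in> ?P"
        then obtain x y where xy: "x \<in> X" "y \<in> Y" "E x y" "?l u = Suc (c x)" "?l v = Suc (c y) + n" by auto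
        have "u \<in> X"
        proof (rule ccontr)
          assume "u \<notin> X"
          then have "u \<in> Y" using uv(1) XY(4) by auto
          then show False using lvals' xy(4) c_less[of x] xy(1) sub(1) by fastforce
        qed
        moreover have "v \<in> Y"
        proof (rule ccontr)
          assume "v \<notin> Y"
          then have "v \<in> X" using uv(2) XY(4) by auto
          then show False using lvals xy(5) c_less[OF uv(2)] by fastforce
        qed
        ultimately show "u \<in> X \<and> v \<in> Y \<and> E u v"
          using det[of u v x y] xy lvals[of u] lvals'[of v] by simp
      next
        assume *: "u \<in> X \<and> v \<in> Y \<and> E u v"
        then show "(?l u, ?l v) \<in> ?P" unfolding lvals[OF conjunct1[OF *]] lvals'[OF conjunct1[OF conjunct2[OF *]]] by auto
      qed
      have "edges ?U \<union> {{u, v} | u v. u \<in> S \<and> v \<in> S \<and> (?l u, ?l v) \<in> ?P} =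
        edges ?U \<union> {{u, v} | u v. u \<in> X \<and> v \<in> Y \<and> E u v}" (is "_ \<union> ?A = _ \<union> ?B")
      proof -
        have "?A = {{u, v} | u v. u \<in> S \<and> v \<in> S \<and> u \<in> X \<and> v \<in> Y \<and> E u v}"
          using cross by (intro Collect_cong) (metis (no_types, lifting))
        also have "\<dots> = ?B" using XY(4) by blast
        finally show ?thesis by simp
      qed
      also have "\<dots> = {{u, v} | u v. u \<in> S \<and> v \<in> S \<and> E u v}"
      proof
        show "{{u, v} | u v. u \<in> S \<and> v \<in> S \<and> E u v} \<subseteq> edges ?U \<union> {{u, v} | u v. u \<in> X \<and> v \<in> Y \<and> E u v}"
        proof
          fix e assume "e \<in> {{u, v} | u v. u \<in> S \<and> v \<in> S \<and> E u v}"
          then obtain u v where uv: "e = {u, v}" "u \<in> S" "v \<in> S" "E u v" by blast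
          have "E v u" using sym uv(4) by (rule sympD)
          consider "u \<in> X" "v \<in> X" | "u \<in> Y" "v \<in> Y" | "u \<in> X" "v \<in> Y" | "v \<in> X" "u \<in> Y"
            using uv(2,3) XY(4) by blast
          then show "e \<in> edges ?U \<union> {{u, v} | u v. u \<in> X \<and> v \<in> Y \<and> E u v}"
          proof cases
            case 4
            have "e = {v, u}" using uv(1) by (simp add: insert_commute)
            then show ?thesis using 4 \<open>E v u\<close> by blast
          qed (use uv in auto)
        qed
      qed (use XY(4) in auto)
      finally have J': "cw_construct (n + n) (?G S) ?l" using J by simp
      have "?l v \<in> {1..n + n}" if "v \<in> S" for v
        using that lvals[of v] lvals'[of v] c_less[OF that] XY(4) by fastforce
      then obtain m where "cw_construct (n + n) (?G S) m"
        "\<forall>v\<in>S. m v = (if n < ?l v \<and> ?l v \<le> n + n then ?l v - n else ?l v)"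
        using cw_construct_unrelabel_map[OF J', of n n] by auto
      moreover have "(if n < ?l v \<and> ?l v \<le> n + n then ?l v - n else ?l v) = Suc (c v)" if "v \<in> S" for v
      proof (cases "v \<in> X")
        case True then show ?thesis unfolding lvals[OF True] using c_less[OF that] by simp
      next
        case False
        then have "v \<in> Y" using that XY(4) by auto
        then show ?thesis unfolding lvals'[OF \<open>v \<in> Y\<close>] using c_less[OF that] by simp
      qed
      ultimately show ?thesis by (intro exI[of _ m]) simp
    qed
  qed
qed

section \<open>Colouring by adjacency to a small base\<close>

text \<open>The attachment is exact: listed base vertices are adjacent, unlisted ones are not. Lists
  of indices as names of the classes keep the later finite tables computable.\<close>

definition att :: "('a \<Rightarrow> 'a \<Rightarrow> bool) \<Rightarrow> 'a list \<Rightarrow> nat list \<Rightarrow> 'a \<Rightarrow> bool" where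
  "att E bs I x \<longleftrightarrow> map (E x) bs = map (\<lambda>j. j \<in> set I) [0..<length bs]"

lemma att_simps:
  "att E [a, b, c, d, e] I x \<longleftrightarrow> (E x a \<longleftrightarrow> 0 \<in> set I) \<and> (E x b \<longleftrightarrow> 1 \<in> set I) \<and> (E x c \<longleftrightarrow> 2 \<in> set I) \<and>
    (E x d \<longleftrightarrow> 3 \<in> set I) \<and> (E x e \<longleftrightarrow> 4 \<in> set I)"
  "att E [a, b, c, d, e, f] I x \<longleftrightarrow> (E x a \<longleftrightarrow> 0 \<in> set I) \<and> (E x b \<longleftrightarrow> 1 \<in> set I) \<and> (E x c \<longleftrightarrow> 2 \<in> set I) \<and>
    (E x d \<longleftrightarrow> 3 \<in> set I) \<and> (E x e \<longleftrightarrow> 4 \<in> set I) \<and> (E x f \<longleftrightarrow> 5 \<in> set I)"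
  "att E [a, b, c, d, e, f, g] I x \<longleftrightarrow> (E x a \<longleftrightarrow> 0 \<in> set I) \<and> (E x b \<longleftrightarrow> 1 \<in> set I) \<and> (E x c \<longleftrightarrow> 2 \<in> set I) \<and>
    (E x d \<longleftrightarrow> 3 \<in> set I) \<and> (E x e \<longleftrightarrow> 4 \<in> set I) \<and> (E x f \<longleftrightarrow> 5 \<in> set I) \<and> (E x g \<longleftrightarrow> 6 \<in> set I)"
  by (simp_all add: att_def upt_conv_Cons numeral_eq_Suc)

text \<open>A class in only one of the last two components is complete or anticomplete to
  \<open>x\<close>; a class in both is one that \<open>x\<close> distinguishes.\<close>

definition colour :: "('a \<Rightarrow> 'a \<Rightarrow> bool) \<Rightarrow> 'a list \<Rightarrow> 'a set \<Rightarrow> 'a \<Rightarrow> bool list \<times> bool list set \<times> bool list set" where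
  "colour E bs V x = (map (E x) bs, (\<lambda>y. map (E y) bs) ` {y \<in> V. E x y}, (\<lambda>y. map (E y) bs) ` {y \<in> V. \<not> E x y})"

text \<open>The vertex \<open>x\<close> distinguishes two vertices of \<open>V\<close> that have the same base neighbours as \<open>y\<close>.\<close>

definition mid :: "('a \<Rightarrow> 'a \<Rightarrow> bool) \<Rightarrow> 'a list \<Rightarrow> 'a set \<Rightarrow> 'a \<Rightarrow> 'a \<Rightarrow> bool" where
  "mid E bs V x y \<longleftrightarrow> (\<exists>s\<in>V. \<exists>t\<in>V. map (E s) bs = map (E y) bs \<and> map (E t) bs = map (E y) bs \<and> E x s \<and> \<not> E x t)"

definition palette :: "nat \<Rightarrow> nat" where
  "palette n = card ({xs :: bool list. length xs = n} \<times> Pow {xs :: bool list. length xs = n} \<times> Pow {xs :: bool list. length xs = n})"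

lemma colour_att: "colour E bs V x = colour E bs V y \<Longrightarrow> att E bs I x = att E bs I y"
  by (simp add: colour_def att_def del: map_eq_conv)

lemma colour_base: "colour E bs V x = colour E bs V y \<Longrightarrow> map (E x) bs = map (E y) bs"
  by (simp add: colour_def del: map_eq_conv)

lemma colour_nbr:
  assumes "colour E bs V x = colour E bs V x'"
  shows "(\<exists>y\<in>V. att E bs I y \<and> E x y) \<longleftrightarrow> (\<exists>y\<in>V. att E bs I y \<and> E x' y)"
    and "(\<exists>y\<in>V. att E bs I y \<and> \<not> E x y) \<longleftrightarrow> (\<exists>y\<in>V. att E bs I y \<and> \<not> E x' y)"
proof -
  have "(\<exists>y\<in>V. att E bs I y \<and> E x y) \<longleftrightarrow> map (\<lambda>j. j \<in> set I) [0..<length bs] \<in> fst (snd (colour E bs V x))" for x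
    by (auto simp: colour_def att_def image_iff simp del: map_eq_conv)
  then show "(\<exists>y\<in>V. att E bs I y \<and> E x y) \<longleftrightarrow> (\<exists>y\<in>V. att E bs I y \<and> E x' y)" using assms by simp
  have "(\<exists>y\<in>V. att E bs I y \<and> \<not> E x y) \<longleftrightarrow> map (\<lambda>j. j \<in> set I) [0..<length bs] \<in> snd (snd (colour E bs V x))" for x
    by (auto simp: colour_def att_def image_iff simp del: map_eq_conv)
  then show "(\<exists>y\<in>V. att E bs I y \<and> \<not> E x y) \<longleftrightarrow> (\<exists>y\<in>V. att E bs I y \<and> \<not> E x' y)" using assms by simp
qed

lemma colour_bounded:
  assumes "decomposable E (colour E bs V) V"
  shows "bounded_decomposable (palette (length bs)) E V"
proof (rule bounded_decomposableI[OF _ _ assms])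
  let ?L = "{xs :: bool list. length xs = length bs}"
  have "finite ?L" using finite_lists_length_eq[of "UNIV :: bool set" "length bs"] by simp
  then show "finite (?L \<times> Pow ?L \<times> Pow ?L)" by simp
  show "colour E bs V ` V \<subseteq> ?L \<times> Pow ?L \<times> Pow ?L" by (auto simp: colour_def)
qed (simp add: palette_def)

text \<open>If \<open>x\<close> does not distinguish the class of \<open>y\<close>, the colour of
  \<open>x\<close> records whether it sees that class entirely or not at all, and every vertex of
  the same colour does the same.\<close>

lemma colour_determines:
  assumes "colour E bs V x = colour E bs V x'" "map (E y) bs = map (E y') bs" "x \<in> V" "y \<in> V" "y' \<in> V" "\<not> mid E bs V x y"
  shows "E x y = E x' y'"
proof -
  let ?m = "map (E y) bs"
  have sets: "(\<lambda>y. map (E y) bs) ` {y \<in> V. E x y} = (\<lambda>y. map (E y) bs) ` {y \<in> V. E x' y}"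
    "(\<lambda>y. map (E y) bs) ` {y \<in> V. \<not> E x y} = (\<lambda>y. map (E y) bs) ` {y \<in> V. \<not> E x' y}"
    using assms(1) by (simp_all add: colour_def del: map_eq_conv)
  show ?thesis
  proof (cases "E x y")
    case True
    have "E x' y'"
    proof (rule ccontr)
      assume "\<not> E x' y'"
      then have "map (E y') bs \<in> (\<lambda>y. map (E y) bs) ` {y \<in> V. \<not> E x' y}" using assms(5) by blast
      then obtain t where "t \<in> V" "\<not> E x t" "map (E t) bs = ?m" unfolding sets[symmetric] using assms(2) by (auto simp del: map_eq_conv)
      then show False using assms(4,6) True unfolding mid_def by blast
    qed
    then show ?thesis using True by simp
  next
    case False
    have "\<not> E x' y'"
    proof
      assume "E x' y'"
      then have "map (E y') bs \<in> (\<lambda>y. map (E y) bs) ` {y \<in> V. E x' y}" using assms(5) by blast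
      then obtain t where "t \<in> V" "E x t" "map (E t) bs = ?m" unfolding sets[symmetric] using assms(2) by (auto simp del: map_eq_conv)
      then show False using assms(4,6) False unfolding mid_def by blast
    qed
    then show ?thesis using False by simp
  qed
qed

text \<open>The frame of both arguments about P2+P4 with a five-cycle. Pairs not distinguished in
  one direction are settled by the colours, so \<open>cross\<close> has to deal only with mutually
  distinguishing pairs in different worlds, and \<open>inner\<close> with sets inside one
  world.\<close>

lemma colour_worlds:
  assumes sym: "\<And>x y. E x y \<Longrightarrow> E y x"
    and cross: "\<And>x y x' y'. \<lbrakk>x \<in> V; y \<in> V; x' \<in> V; y' \<in> V; w x \<noteq> w y; w x' \<noteq> w y'; colour E bs V x = colour E bs V x'; colour E bs V y = colour E bs V y';
      mid E bs V x y; mid E bs V y x\<rbrakk> \<Longrightarrow> E x y = E x' y'"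
    and inner: "\<And>S u v. \<lbrakk>S \<subseteq> V; u \<in> S; v \<in> S; u \<noteq> v; \<And>x. x \<in> S \<Longrightarrow> w x = w u\<rbrakk> \<Longrightarrow> splits E (colour E bs V) S"
  shows "decomposable E (colour E bs V) V"
  unfolding decomposable_def
proof (intro allI impI ballI)
  fix S u v assume S: "S \<subseteq> V" and uv: "u \<in> S" "v \<in> S" "u \<noteq> v"
  show "splits E (colour E bs V) S"
  proof (cases "\<forall>x\<in>S. w x = w u")
    case True
    then show ?thesis using inner[OF S uv] by blast
  next
    case False
    then obtain x where x: "x \<in> S" "w u \<noteq> w x" by metis
    show ?thesis
    proof (rule splits_worlds[of u S x w])
      fix x y x' y' assume mem: "x \<in> S" "y \<in> S" "x' \<in> S" "y' \<in> S" and w: "w x \<noteq> w y" "w x' = w x" "w x' \<noteq> w y'"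
        and c: "colour E bs V x = colour E bs V x'" "colour E bs V y = colour E bs V y'"
      have V: "x \<in> V" "y \<in> V" "x' \<in> V" "y' \<in> V" using mem S by auto
      have m: "map (E x) bs = map (E x') bs" "map (E y) bs = map (E y') bs" using colour_base c by metis+
      consider "\<not> mid E bs V x y" | "\<not> mid E bs V y x" | "mid E bs V x y" "mid E bs V y x" by blast
      then show "E x y = E x' y'"
      proof cases
        case 1 then show ?thesis by (rule colour_determines[OF c(1) m(2) V(1,2,4)])
      next
        case 2
        then have "E y x = E y' x'" by (rule colour_determines[OF c(2) m(1) V(2,1,3)])
        then show ?thesis using sym by blast
      next
        case 3 then show ?thesis using cross[OF V w(1,3) c] by blast
      qed
    qed (use uv x in auto)
  qed
qed

text \<open>The relation is constrained on the whole type, which avoids membership conditions in the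
  many case analyses. Equal arguments are allowed in \<open>K3\<close>, so the relation is
  irreflexive.\<close>

locale triangle_free =
  fixes E :: "'a \<Rightarrow> 'a \<Rightarrow> bool"
  assumes sym: "E x y \<Longrightarrow> E y x"
    and K3: "E a b \<Longrightarrow> E b c \<Longrightarrow> E a c \<Longrightarrow> False"
begin

lemma commute: "E x y \<longleftrightarrow> E y x"
  using sym by blast

lemma irrefl: "\<not> E x x"
  using K3[of x x x] by blast

definition C5 where
  "C5 a b c d e \<longleftrightarrow> E a b \<and> E b c \<and> E c d \<and> E d e \<and> E e a"

lemma C5_induced:
  assumes "C5 a b c d e"
  shows "E a b" "E b c" "E c d" "E d e" "E a e" "\<not> E a c" "\<not> E a d" "\<not> E b d" "\<not> E b e" "\<not> E c e"
  using assms K3[of a b c] K3[of a e d] K3[of b c d] K3[of b a e] K3[of c d e] commute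
  unfolding C5_def by blast+

end

text \<open>Distinctness of the six vertices need not be said: any two of them are adjacent or have
  different neighbours in the pattern. The same applies to P1+P5.\<close>

locale P2_P4_free = triangle_free +
  assumes H: "\<lbrakk>E a b; E b c; E c d; E e f; \<not> E a c; \<not> E a d; \<not> E b d;
      \<not> E a e; \<not> E a f; \<not> E b e; \<not> E b f; \<not> E c e; \<not> E c f; \<not> E d e; \<not> E d f\<rbrakk> \<Longrightarrow> False"

locale P1_P5_free = triangle_free +
  assumes H: "\<lbrakk>E a b; E b c; E c d; E d e; \<not> E a c; \<not> E a d; \<not> E a e; \<not> E b d; \<not> E b e; \<not> E c e;
      \<not> E a f; \<not> E b f; \<not> E c f; \<not> E d f; \<not> E e f\<rbrakk> \<Longrightarrow> False"

section \<open>Graphs without a cycle of length five\<close>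

lemma base_determines:
  assumes det: "\<And>x y x' y'. \<lbrakk>x \<in> V; y \<in> V; x' \<in> V; y' \<in> V; map (E x) bs = map (E x') bs; map (E y) bs = map (E y') bs\<rbrakk> \<Longrightarrow> E x y = E x' y'"
  shows "bounded_decomposable (palette (length bs)) E V"
proof (rule colour_bounded, unfold decomposable_def, intro allI impI ballI)
  fix S x y assume S: "S \<subseteq> V" and xy: "x \<in> S" "y \<in> S" "x \<noteq> y"
  show "splits E (colour E bs V) S"
  proof (rule splits_homogeneous[OF xy])
    fix u v assume "u \<in> S" "v \<in> S" "colour E bs V u = colour E bs V v"
    then show "E x u = E x v" using det[of x u x v] S xy(1) colour_base[of E bs V u v] by blast
  qed
qed

lemma relpowp_segment:
  assumes "\<And>k. k < n \<Longrightarrow> P (f k) (f (Suc k))" "i \<le> j" "j \<le> n"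
  shows "(P ^^ (j - i)) (f i) (f j)"
  unfolding relpowp_fun_conv
  by (rule exI[of _ "\<lambda>k. f (i + k)"]) (use assms in auto)

context triangle_free
begin

lemma relpowp_sym: "(E ^^ n) x y \<Longrightarrow> (E ^^ n) y x"
proof (induction n arbitrary: y)
  case (Suc n)
  then obtain z where "(E ^^ n) x z" "E z y" by auto
  then show ?case using Suc.IH[of z] sym[of z y] relpowp_Suc_I2[of E y z n x] by blast
qed simp

text \<open>The sides are the parities of walk lengths from a root; an edge inside a side would
  close an odd walk. Walks may leave \<open>V\<close>, which is why odd closed walks are excluded on
  the whole type.\<close>

lemma bipartite_or_odd_closed_walk:
  assumes conn: "\<And>A B. \<lbrakk>A \<union> B = V; A \<inter> B = {}; A \<noteq> {}; B \<noteq> {}\<rbrakk> \<Longrightarrow> \<exists>a\<in>A. \<exists>b\<in>B. E a b"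
    and no: "\<And>n x. odd n \<Longrightarrow> \<not> (E ^^ n) x x"
  shows "\<exists>P :: 'a \<Rightarrow> bool. \<forall>x\<in>V. \<forall>y\<in>V. P x = P y \<longrightarrow> \<not> E x y"
proof (cases "V = {}")
  case False
  then obtain r where r: "r \<in> V" by blast
  let ?R = "{x \<in> V. \<exists>n. (E ^^ n) r x}"
  have reach: "\<exists>n. (E ^^ n) r x" if x: "x \<in> V" for x
  proof (rule ccontr)
    assume "\<not> ?thesis"
    then have "V - ?R \<noteq> {}" using x by blast
    moreover have "r \<in> ?R" using r relpowp_0_I[of E r] by blast
    ultimately obtain a b where ab: "a \<in> ?R" "b \<in> V - ?R" "E a b" using conn[of ?R "V - ?R"] by blast
    then obtain n where "(E ^^ n) r a" by blast
    then have "(E ^^ Suc n) r b" using ab(3) by (rule relpowp_Suc_I)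
    then show False using ab(2) by blast
  qed
  let ?P = "\<lambda>x. \<exists>n. even n \<and> (E ^^ n) r x"
  have "\<not> E x y" if xy: "x \<in> V" "y \<in> V" "?P x = ?P y" for x y
  proof
    assume "E x y"
    obtain n m where nm: "(E ^^ n) r x" "(E ^^ m) r y" "even n = even m"
      using reach[OF xy(1)] reach[OF xy(2)] xy(3) by blast
    have "(E ^^ Suc n) r y" using nm(1) \<open>E x y\<close> by (rule relpowp_Suc_I)
    then have "(E ^^ (Suc n + m)) r r" using relpowp_sym[OF nm(2)] by (rule relpowp_trans)
    moreover have "odd (Suc n + m)" using nm(3) by simp
    ultimately show False using no by blast
  qed
  then show ?thesis by (intro exI[of _ ?P] ballI impI)
qed simp

text \<open>A shortest odd closed walk is an induced cycle. A chord divides it into two closed walks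
  whose lengths add up to \<open>n + 2\<close>, so one of them is odd, and it is shorter than
  \<open>n\<close> unless the chord is an edge of the walk.\<close>

lemma odd_hole:
  assumes "odd n0" "(E ^^ n0) x0 x0"
  shows "(\<exists>a b c d e. C5 a b c d e) \<or> (\<exists>f n. n \<ge> 7 \<and> odd n \<and>
    (\<forall>i j. i < j \<longrightarrow> j < n \<longrightarrow> (E (f i) (f j) \<longleftrightarrow> j = Suc i \<or> i = 0 \<and> Suc j = n)))"
proof -
  define n where "n = (LEAST n. odd n \<and> (\<exists>x. (E ^^ n) x x))"
  have "odd n \<and> (\<exists>x. (E ^^ n) x x)" unfolding n_def by (rule LeastI[of _ n0]) (use assms in blast)
  then obtain x where odd: "odd n" and "(E ^^ n) x x" by blast
  have least: "n \<le> m" if "odd m" "(E ^^ m) y y" for m y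
    unfolding n_def by (rule Least_le) (use that in blast)
  obtain f where f: "f 0 = x" "f n = x" "\<And>i. i < n \<Longrightarrow> E (f i) (f (Suc i))"
    using \<open>(E ^^ n) x x\<close> unfolding relpowp_fun_conv by blast
  have chord: "E (f i) (f j) \<longleftrightarrow> j = Suc i \<or> i = 0 \<and> Suc j = n" if ij: "i < j" "j < n" for i j
  proof
    assume Eij: "E (f i) (f j)"
    have w1: "(E ^^ Suc (j - i)) (f i) (f i)"
      using relpowp_Suc_I[OF relpowp_segment[of n E f i j] sym[OF Eij]] f(3) ij by simp
    have "(E ^^ (n - j)) (f j) (f n)" "(E ^^ (i - 0)) (f 0) (f i)"
      by (rule relpowp_segment[of n]; use f(3) ij in simp)+
    then have "(E ^^ (n - j + i)) (f j) (f i)" using f(1,2) relpowp_trans[of "n - j" E "f j" x i "f i"] by simp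
    then have w2: "(E ^^ Suc (n - j + i)) (f j) (f j)" using Eij by (rule relpowp_Suc_I)
    show "j = Suc i \<or> i = 0 \<and> Suc j = n"
    proof (cases "odd (j - i)")
      case True
      then have "odd (Suc (n - j + i))" using odd ij by auto
      then have "n \<le> Suc (n - j + i)" using least w2 by blast
      then show ?thesis using ij by linarith
    next
      case False
      then have "n \<le> Suc (j - i)" using least[OF _ w1] by simp
      then show ?thesis using ij by linarith
    qed
  next
    assume "j = Suc i \<or> i = 0 \<and> Suc j = n"
    then show "E (f i) (f j)"
    proof
      assume "i = 0 \<and> Suc j = n"
      then show ?thesis using f(3)[of j] f(1,2) sym by auto
    qed (use f(3) ij in auto)
  qed
  have "n \<noteq> 1" using f(3)[of 0] f(1,2) irrefl by auto
  moreover have "n \<noteq> 3"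
  proof
    assume n: "n = 3"
    then show False using f(3)[of 0] f(3)[of 1] f(3)[of 2] f(1,2) K3[of x "f 1" "f 2"] sym[of "f 2" x]
      by (simp add: numeral_eq_Suc)
  qed
  moreover have "C5 (f 0) (f 1) (f 2) (f 3) (f 4)" if "n = 5"
    using f(3)[of 0] f(3)[of 1] f(3)[of 2] f(3)[of 3] f(3)[of 4] f(1,2) that
    by (simp add: C5_def numeral_eq_Suc)
  moreover have "n = 5 \<or> n \<ge> 7" using odd calculation by presburger
  ultimately consider "\<exists>a b c d e. C5 a b c d e" | "n \<ge> 7" by blast
  then show ?thesis using chord odd by cases blast+
qed

definition C7 where
  "C7 a b c d e f g \<longleftrightarrow> E a b \<and> E b c \<and> E c d \<and> E d e \<and> E e f \<and> E f g \<and> E g a \<and>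
    \<not> E a c \<and> \<not> E a d \<and> \<not> E a e \<and> \<not> E a f \<and> \<not> E b d \<and> \<not> E b e \<and> \<not> E b f \<and> \<not> E b g \<and>
    \<not> E c e \<and> \<not> E c f \<and> \<not> E c g \<and> \<not> E d f \<and> \<not> E d g \<and> \<not> E e g"

lemma C7_rotate: "C7 a b c d e f g \<Longrightarrow> C7 b c d e f g a"
  by (auto simp: C7_def commute)

end

context P2_P4_free
begin

lemma bipartite_splits:
  fixes P :: "'a \<Rightarrow> bool"
  assumes "finite S" "u \<in> S" "v \<in> S" "u \<noteq> v" "\<And>x y. \<lbrakk>x \<in> S; y \<in> S; P x = P y\<rbrakk> \<Longrightarrow> \<not> E x y"
    "\<And>x y. \<lbrakk>x \<in> S; y \<in> S; c x = c y\<rbrakk> \<Longrightarrow> P x = P y"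
  shows "splits E c S"
  by (rule bipartite_P2_P4_free_splits[where P = P and u = u and v = v])
    (erule sym, erule (14) H, rule assms(1), rule assms(2), rule assms(3), rule assms(4), erule (2) assms(5), erule (2) assms(6))

end

section \<open>Seven-cycles in graphs without P2+P4 and without five-cycles\<close>

context P2_P4_free
begin

context
  assumes noC5: "\<And>a b c d e. \<not> C5 a b c d e"
begin

lemma C7_far:
  assumes "C7 v0 v1 v2 v3 v4 v5 v6" "E x v0" "E x v3"
  shows False
  using assms noC5[of v0 v1 v2 v3 x]
  by (auto simp: C7_def C5_def commute)

lemma C7_far2:
  assumes "C7 v0 v1 v2 v3 v4 v5 v6" "E x v0" "E x v4"
  shows False
  using assms noC5[of v0 v6 v5 v4 x]
  by (auto simp: C7_def C5_def commute)

text \<open>A neighbour of \<open>v0\<close> with no second neighbour at distance two would end the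
  path v2 v1 v0 x, and the edge v4 v5 completes P2+P4.\<close>

lemma C7_single:
  assumes "C7 v0 v1 v2 v3 v4 v5 v6" "E x v0" "\<not> E x v2" "\<not> E x v5"
  shows False
  using assms K3[of v0 v1 x] noC5[of v0 v1 v2 v3 x] noC5[of v0 v6 v5 v4 x] H[of v2 v1 v0 x v4 v5]
  by (auto simp: C7_def C5_def commute)

lemma C7_double:
  assumes "C7 v0 v1 v2 v3 v4 v5 v6" "E x v0" "E x v2" "E x v5"
  shows False
  using assms noC5[of v2 v3 v4 v5 x]
  by (auto simp: C7_def C5_def commute)

lemma C7_adjacent:
  assumes "C7 v0 v1 v2 v3 v4 v5 v6" "E x v6" "E x v1" "E y v0" "\<not> E x y"
  shows False
  using assms K3[of v0 v1 x] K3[of v0 v1 y] K3[of v1 v2 x] noC5[of v3 v4 v5 v6 x] noC5[of v0 v1 v2 v3 y] noC5[of v1 v2 v3 v4 x] noC5[of v0 v6 v5 v4 y] H[of x v1 v0 y v3 v4]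
  by (auto simp: C7_def C5_def commute)

lemma C7_nonadjacent:
  assumes "C7 v0 v1 v2 v3 v4 v5 v6" "E x v6" "E x v1" "\<not> E y v0" "E x y"
  shows False
  using assms K3[of v0 v1 x] K3[of v1 x y] K3[of v1 v2 x] noC5[of v3 v4 v5 v6 x] noC5[of v1 v2 v3 y x] noC5[of v1 v2 v3 v4 x] noC5[of v4 v5 v6 x y] H[of v0 v1 x y v3 v4]
  by (auto simp: C7_def C5_def commute)

lemma C7_none:
  assumes "C7 v0 v1 v2 v3 v4 v5 v6" "\<not> E x v0" "\<not> E x v1" "\<not> E x v2" "\<not> E x v3" "\<not> E x v4" "\<not> E x v5" "\<not> E x v6" "E x y"
  shows False
  using assms K3[of v0 v1 y] noC5[of v0 v1 v2 v3 y] noC5[of v0 v6 v5 v4 y] H[of v1 v0 y x v3 v4] K3[of v1 v2 y] noC5[of v1 v2 v3 v4 y] noC5[of v0 v1 y v5 v6] H[of v0 v1 y x v4 v5] H[of v0 v1 y x v3 v4] K3[of v2 v3 y] H[of v3 v4 y x v0 v1] noC5[of v2 v3 v4 v5 y] H[of v0 v1 v2 y v4 v5] K3[of v3 v4 y] H[of v4 v3 y x v0 v1] H[of v0 v1 v2 v3 x y]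
  by (auto simp: C7_def C5_def commute)

lemma C7_neighbour:
  assumes "C7 v0 v1 v2 v3 v4 v5 v6" "E x v0"
  shows "(E x v2 \<longleftrightarrow> \<not> E x v5)" "\<not> E x v1" "\<not> E x v3" "\<not> E x v4" "\<not> E x v6"
  using C7_far[OF assms] C7_far2[OF assms] C7_single[OF assms] C7_double[OF assms] K3[of x v0 v1] K3[of x v0 v6] assms
  by (auto simp: C7_def commute)

text \<open>A vertex seeing both cycle neighbours of \<open>v0\<close> is a false twin of
  \<open>v0\<close>. Together with \<open>C7_neighbour\<close> and \<open>C7_none\<close> this makes
  the graph a blow-up of the seven-cycle, up to isolated vertices.\<close>

lemma C7_twin:
  assumes "C7 v0 v1 v2 v3 v4 v5 v6" "E x v6" "E x v1"
  shows "E x y \<longleftrightarrow> E y v0"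
  using C7_adjacent[OF assms] C7_nonadjacent[OF assms] by blast

lemma C7_decomposable:
  assumes C: "C7 v0 v1 v2 v3 v4 v5 v6"
  shows "bounded_decomposable (palette 7) E V"
proof -
  let ?bs = "[v0, v1, v2, v3, v4, v5, v6]"
  note C1 = C7_rotate[OF C]
  note C2 = C7_rotate[OF C1]
  note C3 = C7_rotate[OF C2]
  note C4 = C7_rotate[OF C3]
  note C5' = C7_rotate[OF C4]
  note C6 = C7_rotate[OF C5']
  have "bounded_decomposable (palette (length ?bs)) E V"
  proof (rule base_determines)
    fix x y x' y' assume "map (E x) ?bs = map (E x') ?bs" "map (E y) ?bs = map (E y') ?bs"
    then have x: "E x v = E x' v" "E y v = E y' v" if "v \<in> set ?bs" for v using that by auto
    have "E x v0 \<longrightarrow> E x v2 \<or> E x v5" "E x v1 \<longrightarrow> E x v3 \<or> E x v6" "E x v2 \<longrightarrow> E x v4 \<or> E x v0" "E x v3 \<longrightarrow> E x v5 \<or> E x v1"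
      "E x v4 \<longrightarrow> E x v6 \<or> E x v2" "E x v5 \<longrightarrow> E x v0 \<or> E x v3" "E x v6 \<longrightarrow> E x v1 \<or> E x v4"
      using C7_neighbour(1)[OF C, of x] C7_neighbour(1)[OF C1, of x] C7_neighbour(1)[OF C2, of x] C7_neighbour(1)[OF C3, of x]
        C7_neighbour(1)[OF C4, of x] C7_neighbour(1)[OF C5', of x] C7_neighbour(1)[OF C6, of x] by blast+
    then have "(E x v6 \<and> E x v1) \<or> (E x v0 \<and> E x v2) \<or> (E x v1 \<and> E x v3) \<or> (E x v2 \<and> E x v4) \<or> (E x v3 \<and> E x v5)
      \<or> (E x v4 \<and> E x v6) \<or> (E x v5 \<and> E x v0) \<or> (\<forall>v\<in>set ?bs. \<not> E x v)" unfolding list.set ball_simps by argo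
    then consider "E x v6" "E x v1" | "E x v0" "E x v2" | "E x v1" "E x v3" | "E x v2" "E x v4" | "E x v3" "E x v5"
      | "E x v4" "E x v6" | "E x v5" "E x v0" | "\<forall>v\<in>set ?bs. \<not> E x v" by (elim disjE conjE)
    then show "E x y = E x' y'"
    proof cases
      case 1
      then have "E x' v6" "E x' v1" using x(1)[of v6] x(1)[of v1] by simp_all
      from C7_twin[OF C this, of y'] C7_twin[OF C 1, of y] show ?thesis using x(2)[of v0] by simp
    next
      case 2
      then have "E x' v0" "E x' v2" using x(1)[of v0] x(1)[of v2] by simp_all
      from C7_twin[OF C1 this, of y'] C7_twin[OF C1 2, of y] show ?thesis using x(2)[of v1] by simp
    next
      case 3
      then have "E x' v1" "E x' v3" using x(1)[of v1] x(1)[of v3] by simp_all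
      from C7_twin[OF C2 this, of y'] C7_twin[OF C2 3, of y] show ?thesis using x(2)[of v2] by simp
    next
      case 4
      then have "E x' v2" "E x' v4" using x(1)[of v2] x(1)[of v4] by simp_all
      from C7_twin[OF C3 this, of y'] C7_twin[OF C3 4, of y] show ?thesis using x(2)[of v3] by simp
    next
      case 5
      then have "E x' v3" "E x' v5" using x(1)[of v3] x(1)[of v5] by simp_all
      from C7_twin[OF C4 this, of y'] C7_twin[OF C4 5, of y] show ?thesis using x(2)[of v4] by simp
    next
      case 6
      then have "E x' v4" "E x' v6" using x(1)[of v4] x(1)[of v6] by simp_all
      from C7_twin[OF C5' this, of y'] C7_twin[OF C5' 6, of y] show ?thesis using x(2)[of v5] by simp
    next
      case 7
      then have "E x' v5" "E x' v0" using x(1)[of v5] x(1)[of v0] by simp_all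
      from C7_twin[OF C6 this, of y'] C7_twin[OF C6 7, of y] show ?thesis using x(2)[of v6] by simp
    next
      case 8
      then have "\<forall>v\<in>set ?bs. \<not> E x' v" using x(1) by blast
      then show ?thesis using 8 C7_none[OF C, of x y] C7_none[OF C, of x' y'] by auto
    qed
  qed
  then show ?thesis by (simp add: numeral_eq_Suc)
qed

lemma C5_free_decomposable:
  assumes fin: "finite V" and conn: "\<And>A B. \<lbrakk>A \<union> B = V; A \<inter> B = {}; A \<noteq> {}; B \<noteq> {}\<rbrakk> \<Longrightarrow> \<exists>a\<in>A. \<exists>b\<in>B. E a b"
  shows "bounded_decomposable (palette 7 + 4) E V"
proof (cases "\<exists>n x. odd n \<and> (E ^^ n) x x")
  case True
  then obtain n0 x0 where "odd n0" "(E ^^ n0) x0 x0" by blast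
  from odd_hole[OF this] noC5 obtain f n where n: "n \<ge> 7" "odd n" and
    f: "\<forall>i j. i < j \<longrightarrow> j < n \<longrightarrow> (E (f i) (f j) \<longleftrightarrow> j = Suc i \<or> i = 0 \<and> Suc j = n)" by blast
  note f = f[rule_format]
  \<comment> \<open>On an induced cycle of length at least nine the path on positions 0 to 3 and the
    edge 5-6 have no edges between them; for length seven the positions 6 and 0 are
    adjacent.\<close>
  have "n < 9"
  proof (rule ccontr)
    assume "\<not> n < 9"
    then show False using H[of "f 0" "f 1" "f 2" "f 3" "f 5" "f 6"]
      by (simp add: f)
  qed
  then have "n = 7" using n by presburger
  then have "C7 (f 0) (f 1) (f 2) (f 3) (f 4) (f 5) (f 6)"
    using commute[of "f 6" "f 0"] by (simp add: C7_def f)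
  then have "bounded_decomposable (palette 7) E V" by (rule C7_decomposable)
  then show ?thesis by (rule bounded_decomposable_mono) simp
next
  case False
  have "\<exists>P :: 'a \<Rightarrow> bool. \<forall>x\<in>V. \<forall>y\<in>V. P x = P y \<longrightarrow> \<not> E x y"
  proof (rule bipartite_or_odd_closed_walk)
    show "\<exists>a\<in>A. \<exists>b\<in>B. E a b" if "A \<union> B = V" "A \<inter> B = {}" "A \<noteq> {}" "B \<noteq> {}" for A B using that by (rule conn)
    show "\<not> (E ^^ n) x x" if "odd n" for n x using False that by blast
  qed
  then obtain P :: "'a \<Rightarrow> bool" where P: "\<forall>x\<in>V. \<forall>y\<in>V. P x = P y \<longrightarrow> \<not> E x y" by (elim exE)
  have "bounded_decomposable 2 E V"
  proof (rule bounded_decomposableI[where K = "{True, False}" and c = P])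
    show "decomposable E P V"
      unfolding decomposable_def
    proof (intro allI impI ballI)
      fix S x y assume S: "S \<subseteq> V" and xy: "x \<in> S" "y \<in> S" "x \<noteq> y"
      have "finite S" using S fin by (rule finite_subset)
      then show "splits E P S"
      proof (rule bipartite_splits[OF _ xy])
        show "\<not> E u v" if "u \<in> S" "v \<in> S" "P u = P v" for u v
          by (rule P[rule_format]) (use that S in auto)
      qed
    qed
  qed auto
  then show ?thesis by (rule bounded_decomposable_mono) simp
qed

end

end

context P1_P5_free
begin

lemma bipartite_decomposable:
  fixes P :: "'a \<Rightarrow> bool"
  assumes "finite V" "\<And>x y. \<lbrakk>x \<in> V; y \<in> V; P x = P y\<rbrakk> \<Longrightarrow> \<not> E x y"
  shows "bounded_decomposable 4 E V"
  by (rule bipartite_P1_P5_free[where P = P])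
    (erule sym, erule (14) H, rule assms(1), erule (2) assms(2))

end

section \<open>Seven-cycles in graphs without P1+P5 and without five-cycles\<close>

context P1_P5_free
begin

context
  assumes noC5: "\<And>a b c d e. \<not> C5 a b c d e"
begin

lemma C7_far:
  assumes "C7 v0 v1 v2 v3 v4 v5 v6" "E x v0" "E x v3"
  shows False
  using assms noC5[of v0 v1 v2 v3 x]
  by (auto simp: C7_def C5_def commute)

lemma C7_far2:
  assumes "C7 v0 v1 v2 v3 v4 v5 v6" "E x v0" "E x v4"
  shows False
  using assms noC5[of v0 v6 v5 v4 x]
  by (auto simp: C7_def C5_def commute)

lemma C7_single:
  assumes "C7 v0 v1 v2 v3 v4 v5 v6" "E x v0" "\<not> E x v2" "\<not> E x v5"
  shows False
  using assms K3[of v0 v1 x] noC5[of v0 v1 v2 v3 x] H[of v3 v2 v1 v0 x v5]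
  by (auto simp: C7_def C5_def commute)

lemma C7_double:
  assumes "C7 v0 v1 v2 v3 v4 v5 v6" "E x v0" "E x v2" "E x v5"
  shows False
  using assms noC5[of v2 v3 v4 v5 x]
  by (auto simp: C7_def C5_def commute)

lemma C7_adjacent:
  assumes "C7 v0 v1 v2 v3 v4 v5 v6" "E x v6" "E x v1" "E y v0" "\<not> E x y"
  shows False
  using assms K3[of v0 v1 x] K3[of v0 v1 y] K3[of v1 v2 x] noC5[of v3 v4 v5 v6 x] noC5[of v0 v1 v2 v3 y] noC5[of v1 v2 v3 v4 x] noC5[of v0 v6 v5 v4 y] H[of v0 y v2 v3 v4 x] H[of v4 v3 v2 v1 x y]
  by (auto simp: C7_def C5_def commute)

lemma C7_nonadjacent:
  assumes "C7 v0 v1 v2 v3 v4 v5 v6" "E x v6" "E x v1" "\<not> E y v0" "E x y"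
  shows False
  using assms K3[of v0 v1 x] K3[of v1 x y] K3[of v1 v2 x] noC5[of v3 v4 v5 v6 x] noC5[of v1 v2 v3 y x] noC5[of v1 v2 v3 v4 x] noC5[of v4 v5 v6 x y] H[of v4 v3 v2 y x v0] H[of v0 v1 v2 v3 v4 y]
  by (auto simp: C7_def C5_def commute)

text \<open>Here the cycle dominates: a vertex missing it would be isolated from the path v0 v1 v2
  v3 v4.\<close>

lemma C7_none:
  assumes "C7 v0 v1 v2 v3 v4 v5 v6" "\<not> E x v0" "\<not> E x v1" "\<not> E x v2" "\<not> E x v3" "\<not> E x v4" "\<not> E x v5" "\<not> E x v6"
  shows False
  using assms H[of v0 v1 v2 v3 v4 x]
  by (auto simp: C7_def C5_def commute)

lemma C7_neighbour:
  assumes "C7 v0 v1 v2 v3 v4 v5 v6" "E x v0"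
  shows "(E x v2 \<longleftrightarrow> \<not> E x v5)" "\<not> E x v1" "\<not> E x v3" "\<not> E x v4" "\<not> E x v6"
  using C7_far[OF assms] C7_far2[OF assms] C7_single[OF assms] C7_double[OF assms] K3[of x v0 v1] K3[of x v0 v6] assms
  by (auto simp: C7_def commute)

lemma C7_twin:
  assumes "C7 v0 v1 v2 v3 v4 v5 v6" "E x v6" "E x v1"
  shows "E x y \<longleftrightarrow> E y v0"
  using C7_adjacent[OF assms] C7_nonadjacent[OF assms] by blast

lemma C7_decomposable:
  assumes C: "C7 v0 v1 v2 v3 v4 v5 v6"
  shows "bounded_decomposable (palette 7) E V"
proof -
  let ?bs = "[v0, v1, v2, v3, v4, v5, v6]"
  note C1 = C7_rotate[OF C]
  note C2 = C7_rotate[OF C1]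
  note C3 = C7_rotate[OF C2]
  note C4 = C7_rotate[OF C3]
  note C5' = C7_rotate[OF C4]
  note C6 = C7_rotate[OF C5']
  have "bounded_decomposable (palette (length ?bs)) E V"
  proof (rule base_determines)
    fix x y x' y' assume "map (E x) ?bs = map (E x') ?bs" "map (E y) ?bs = map (E y') ?bs"
    then have x: "E x v = E x' v" "E y v = E y' v" if "v \<in> set ?bs" for v using that by auto
    have "E x v0 \<longrightarrow> E x v2 \<or> E x v5" "E x v1 \<longrightarrow> E x v3 \<or> E x v6" "E x v2 \<longrightarrow> E x v4 \<or> E x v0" "E x v3 \<longrightarrow> E x v5 \<or> E x v1"
      "E x v4 \<longrightarrow> E x v6 \<or> E x v2" "E x v5 \<longrightarrow> E x v0 \<or> E x v3" "E x v6 \<longrightarrow> E x v1 \<or> E x v4"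
      using C7_neighbour(1)[OF C, of x] C7_neighbour(1)[OF C1, of x] C7_neighbour(1)[OF C2, of x] C7_neighbour(1)[OF C3, of x]
        C7_neighbour(1)[OF C4, of x] C7_neighbour(1)[OF C5', of x] C7_neighbour(1)[OF C6, of x] by blast+
    then have "(E x v6 \<and> E x v1) \<or> (E x v0 \<and> E x v2) \<or> (E x v1 \<and> E x v3) \<or> (E x v2 \<and> E x v4) \<or> (E x v3 \<and> E x v5)
      \<or> (E x v4 \<and> E x v6) \<or> (E x v5 \<and> E x v0) \<or> (\<forall>v\<in>set ?bs. \<not> E x v)" unfolding list.set ball_simps by argo
    then consider "E x v6" "E x v1" | "E x v0" "E x v2" | "E x v1" "E x v3" | "E x v2" "E x v4" | "E x v3" "E x v5"
      | "E x v4" "E x v6" | "E x v5" "E x v0" | "\<forall>v\<in>set ?bs. \<not> E x v" by (elim disjE conjE)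
    then show "E x y = E x' y'"
    proof cases
      case 1
      then have "E x' v6" "E x' v1" using x(1)[of v6] x(1)[of v1] by simp_all
      from C7_twin[OF C this, of y'] C7_twin[OF C 1, of y] show ?thesis using x(2)[of v0] by simp
    next
      case 2
      then have "E x' v0" "E x' v2" using x(1)[of v0] x(1)[of v2] by simp_all
      from C7_twin[OF C1 this, of y'] C7_twin[OF C1 2, of y] show ?thesis using x(2)[of v1] by simp
    next
      case 3
      then have "E x' v1" "E x' v3" using x(1)[of v1] x(1)[of v3] by simp_all
      from C7_twin[OF C2 this, of y'] C7_twin[OF C2 3, of y] show ?thesis using x(2)[of v2] by simp
    next
      case 4
      then have "E x' v2" "E x' v4" using x(1)[of v2] x(1)[of v4] by simp_all
      from C7_twin[OF C3 this, of y'] C7_twin[OF C3 4, of y] show ?thesis using x(2)[of v3] by simp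
    next
      case 5
      then have "E x' v3" "E x' v5" using x(1)[of v3] x(1)[of v5] by simp_all
      from C7_twin[OF C4 this, of y'] C7_twin[OF C4 5, of y] show ?thesis using x(2)[of v4] by simp
    next
      case 6
      then have "E x' v4" "E x' v6" using x(1)[of v4] x(1)[of v6] by simp_all
      from C7_twin[OF C5' this, of y'] C7_twin[OF C5' 6, of y] show ?thesis using x(2)[of v5] by simp
    next
      case 7
      then have "E x' v5" "E x' v0" using x(1)[of v5] x(1)[of v0] by simp_all
      from C7_twin[OF C6 this, of y'] C7_twin[OF C6 7, of y] show ?thesis using x(2)[of v6] by simp
    next
      case 8
      then have "\<forall>v\<in>set ?bs. \<not> E x' v" using x(1) by blast
      then show ?thesis using 8 C7_none[OF C, of x] C7_none[OF C, of x'] by auto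
    qed
  qed
  then show ?thesis by (simp add: numeral_eq_Suc)
qed

lemma C5_free_decomposable:
  assumes fin: "finite V" and conn: "\<And>A B. \<lbrakk>A \<union> B = V; A \<inter> B = {}; A \<noteq> {}; B \<noteq> {}\<rbrakk> \<Longrightarrow> \<exists>a\<in>A. \<exists>b\<in>B. E a b"
  shows "bounded_decomposable (palette 7 + 4) E V"
proof (cases "\<exists>n x. odd n \<and> (E ^^ n) x x")
  case True
  then obtain n0 x0 where "odd n0" "(E ^^ n0) x0 x0" by blast
  from odd_hole[OF this] noC5 obtain f n where n: "n \<ge> 7" "odd n" and
    f: "\<forall>i j. i < j \<longrightarrow> j < n \<longrightarrow> (E (f i) (f j) \<longleftrightarrow> j = Suc i \<or> i = 0 \<and> Suc j = n)" by blast
  note f = f[rule_format]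
  have "n < 9"
  proof (rule ccontr)
    assume "\<not> n < 9"
    then show False using H[of "f 0" "f 1" "f 2" "f 3" "f 4" "f 6"]
      by (simp add: f)
  qed
  then have "n = 7" using n by presburger
  then have "C7 (f 0) (f 1) (f 2) (f 3) (f 4) (f 5) (f 6)"
    using commute[of "f 6" "f 0"] by (simp add: C7_def f)
  then have "bounded_decomposable (palette 7) E V" by (rule C7_decomposable)
  then show ?thesis by (rule bounded_decomposable_mono) simp
next
  case False
  have "\<exists>P :: 'a \<Rightarrow> bool. \<forall>x\<in>V. \<forall>y\<in>V. P x = P y \<longrightarrow> \<not> E x y"
  proof (rule bipartite_or_odd_closed_walk)
    show "\<exists>a\<in>A. \<exists>b\<in>B. E a b" if "A \<union> B = V" "A \<inter> B = {}" "A \<noteq> {}" "B \<noteq> {}" for A B using that by (rule conn)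
    show "\<not> (E ^^ n) x x" if "odd n" for n x using False that by blast
  qed
  then obtain P :: "'a \<Rightarrow> bool" where P: "\<forall>x\<in>V. \<forall>y\<in>V. P x = P y \<longrightarrow> \<not> E x y" by (elim exE)
  have "bounded_decomposable 4 E V"
  proof (rule bipartite_decomposable[OF fin])
    show "\<not> E x y" if "x \<in> V" "y \<in> V" "P x = P y" for x y by (rule P[rule_format]) (use that in auto)
  qed
  then show ?thesis by (rule bounded_decomposable_mono) simp
qed

end

end

section \<open>Graphs without induced $P_1+P_5$\<close>

text \<open>The absence of \<open>mid\<close> at the level of classes. It is directed from
  \<open>I\<close> to \<open>J\<close>; for settling the pairs between two classes one direction is
  enough.\<close>

definition nonmid :: "('a \<Rightarrow> 'a \<Rightarrow> bool) \<Rightarrow> 'a list \<Rightarrow> 'a set \<Rightarrow> nat list \<Rightarrow> nat list \<Rightarrow> bool" where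
  "nonmid E bs V I J \<longleftrightarrow> (\<forall>x\<in>V. \<forall>s\<in>V. \<forall>t\<in>V. att E bs I x \<longrightarrow> att E bs J s \<longrightarrow> att E bs J t \<longrightarrow> E x s \<longrightarrow> E x t)"

lemma nonmidI:
  assumes "\<And>x s t. \<lbrakk>x \<in> V; s \<in> V; t \<in> V; att E bs I x; att E bs J s; att E bs J t; E x s; \<not> E x t\<rbrakk> \<Longrightarrow> False"
  shows "nonmid E bs V I J"
  unfolding nonmid_def
proof (intro ballI impI, rule ccontr)
  fix x s t assume "x \<in> V" "s \<in> V" "t \<in> V" "att E bs I x" "att E bs J s" "att E bs J t" "E x s" "\<not> E x t"
  then show False by (rule assms)
qed

lemma nonmid_not_mid:
  assumes "nonmid E bs V I J" "x \<in> V" "att E bs I x" "att E bs J y"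
  shows "\<not> mid E bs V x y"
proof
  assume "mid E bs V x y"
  then obtain s t where st: "s \<in> V" "t \<in> V" "map (E s) bs = map (E y) bs" "map (E t) bs = map (E y) bs" "E x s" "\<not> E x t"
    unfolding mid_def by blast
  then have "att E bs J s" "att E bs J t" using assms(4) by (simp_all add: att_def del: map_eq_conv)
  then show False using assms(1-3) st unfolding nonmid_def by blast
qed

lemma att_nth:
  assumes "att E bs I x" "i \<in> set I" "i < length bs"
  shows "E x (bs ! i)"
  using assms nth_map[of i bs "E x"] nth_map[of i "[0..<length bs]" "\<lambda>j. j \<in> set I"] by (simp add: att_def del: nth_map map_eq_conv)

lemma (in triangle_free) C5_rotate: "C5 a b c d e \<Longrightarrow> C5 b c d e a"
  by (simp add: C5_def)

text \<open>Two adjacent vertices with a common base neighbour would be a triangle, so the classes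
  are anticomplete to each other.\<close>

lemma (in triangle_free) nonmid_common:
  assumes "i \<in> set I" "i \<in> set J" "i < length bs"
  shows "nonmid E bs V I J"
proof (rule nonmidI)
  fix x s t assume "att E bs I x" "att E bs J s" "E x s"
  then show False using K3[of x s "bs ! i"] att_nth[of E bs I x i] att_nth[of E bs J s i] assms by blast
qed

text \<open>Rank the classes so that related classes differ by at most two, the odd classes being unrelated to
  each other. Maximal out-neighbourhoods within the classes then have no directed cycle.\<close>

lemma source_exists:
  fixes D :: "'a \<Rightarrow> 'a \<Rightarrow> bool" and rk :: "'a \<Rightarrow> nat"
  defines "rel \<equiv> \<lambda>i j. i \<noteq> j \<and> i \<le> j + 2 \<and> j \<le> i + (2::nat) \<and> (even i \<or> even j)"
  assumes fin: "finite S" and ne: "S \<noteq> {}"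
    and tot: "\<And>x y. \<lbrakk>x \<in> S; y \<in> S; rel (rk x) (rk y)\<rbrakk> \<Longrightarrow> D x y \<longleftrightarrow> \<not> D y x"
    and nest: "\<And>a z b u. \<lbrakk>a \<in> S; b \<in> S; z \<in> S; u \<in> S; rk a = rk b; rel (rk a) (rk z); rel (rk a) (rk u);
      D a z; \<not> D b z; D b u; \<not> D a u\<rbrakk> \<Longrightarrow> False"
    and tri: "\<And>x y z. \<lbrakk>x \<in> S; y \<in> S; z \<in> S; even (rk x); rk y = rk x + 1; rk z = rk x + 2; D x y = D y z; D x z \<noteq> D x y\<rbrakk> \<Longrightarrow> False"
  shows "\<exists>x\<in>S. \<forall>y\<in>S. rel (rk x) (rk y) \<longrightarrow> D x y"
proof (rule ccontr)
  assume none: "\<not> ?thesis"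
  define out where "out x = {y \<in> S. rel (rk x) (rk y) \<and> D x y}" for x
  have finout: "finite (out x)" for x using fin by (simp add: out_def)
  have sym: "rel i j = rel j i" for i j by (auto simp: rel_def)
  \<comment> \<open>The out-neighbourhoods within a rank form a chain by \<open>nest\<close>, so
    each occurring rank has a vertex whose out-neighbourhood contains all others. The proof then
    looks only at these top vertices.\<close>
  define top where "top k x \<longleftrightarrow> x \<in> S \<and> rk x = k \<and> (\<forall>y\<in>S. rk y = k \<longrightarrow> out y \<subseteq> out x)" for k x
  have ex_top: "\<exists>x. top k x" if "y \<in> S" "rk y = k" for y k
  proof -
    let ?K = "{x \<in> S. rk x = k}"
    have K: "finite ((\<lambda>x. card (out x)) ` ?K)" "(\<lambda>x. card (out x)) ` ?K \<noteq> {}" using fin that by auto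
    from Max_in[OF this] obtain x where x: "x \<in> S" "rk x = k" "Max ((\<lambda>x. card (out x)) ` ?K) = card (out x)" by auto
    have "out y \<subseteq> out x" if y: "y \<in> S" "rk y = k" for y
    proof (rule ccontr)
      assume "\<not> out y \<subseteq> out x"
      then obtain u where u: "u \<in> out y" "u \<notin> out x" by blast
      have "out x \<subseteq> out y"
      proof
        fix z assume z: "z \<in> out x"
        show "z \<in> out y"
        proof (rule ccontr)
          assume "z \<notin> out y"
          then show False using nest[of x y z u] x y z u by (simp add: out_def)
        qed
      qed
      then have "card (out x) < card (out y)" using u by (intro psubset_card_mono finout) blast
      moreover have "card (out y) \<le> card (out x)" using Max_ge[OF K(1), of "card (out y)"] x(3) y by auto
      ultimately show False by simp
    qed
    then show ?thesis using x unfolding top_def by blast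
  qed
  define t where "t k = (SOME x. top k x)" for k
  define R where "R i j \<longleftrightarrow> (\<exists>x\<in>S. rk x = i) \<and> (\<exists>x\<in>S. rk x = j) \<and> rel i j \<and> D (t i) (t j)" for i j
  have t: "top k (t k)" if ne: "\<exists>x\<in>S. rk x = k" for k
  proof -
    obtain y where "y \<in> S" "rk y = k" using ne by blast
    from ex_top[OF this] show ?thesis unfolding t_def by (rule someI_ex)
  qed
  \<comment> \<open>The top vertex of rank \<open>k\<close> is not a source, so some
    \<open>y\<close> points to it, and then so does the top vertex of the rank of
    \<open>y\<close>.\<close>
  have pred: "\<exists>i. R i k" if k: "\<exists>x\<in>S. rk x = k" for k
  proof -
    have tk: "t k \<in> S" "rk (t k) = k" using t[OF k] by (simp_all add: top_def)
    have "\<not> (\<forall>y\<in>S. rel (rk (t k)) (rk y) \<longrightarrow> D (t k) y)" using none tk(1) by auto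
    then obtain y where y: "y \<in> S" "rel k (rk y)" "\<not> D (t k) y" unfolding tk(2) by auto
    then have "D y (t k)" using tot[of "t k" y] tk by simp
    then have "t k \<in> out y" using y tk sym[of k "rk y"] by (simp add: out_def)
    moreover have top: "top (rk y) (t (rk y))" using y(1) by (intro t bexI[of _ y]) simp
    ultimately have "t k \<in> out (t (rk y))" using y(1) by (auto simp: top_def)
    then have "D (t (rk y)) (t k)" by (simp add: out_def)
    then have "R (rk y) k" using y(1,2) k sym[of k "rk y"] by (auto simp: R_def)
    then show ?thesis by blast
  qed
  have asym: "\<not> R j i" if "R i j" for i j
  proof -
    have "top i (t i)" "top j (t j)" "rel i j" "D (t i) (t j)" using that t by (simp_all add: R_def)
    then show ?thesis using tot[of "t i" "t j"] by (simp add: top_def R_def)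
  qed
  have trans: "R i k" if ij: "R i j" "R j k" and c: "i = e \<and> k = e + 2 \<or> i = e + 2 \<and> k = e" "j = e + 1" "even e" for i j k e
  proof -
    have ne: "\<exists>x\<in>S. rk x = i" "\<exists>x\<in>S. rk x = j" "\<exists>x\<in>S. rk x = k" using ij by (auto simp: R_def)
    have T: "t i \<in> S" "rk (t i) = i" "t j \<in> S" "rk (t j) = j" "t k \<in> S" "rk (t k) = k"
      using t[OF ne(1)] t[OF ne(2)] t[OF ne(3)] by (simp_all add: top_def)
    have Dij: "D (t i) (t j)" "D (t j) (t k)" using ij by (simp_all add: R_def)
    have rel: "rel i k" "rel i j" "rel j k" using c by (auto simp: rel_def)
    have n: "\<not> D (t j) (t i)" "\<not> D (t k) (t j)"
      using Dij tot[OF T(1,3)] tot[OF T(3,5)] rel unfolding T(2,4,6) by blast+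
    have "D (t i) (t k)"
    proof (rule ccontr)
      assume a: "\<not> D (t i) (t k)"
      then have b: "D (t k) (t i)" using tot[OF T(1,5)] rel(1) unfolding T(2,6) by blast
      from c(1) show False
      proof
        assume "i = e \<and> k = e + 2"
        then show False using tri[OF T(1,3,5)] c(2,3) Dij a unfolding T(2,4,6) by simp
      next
        assume "i = e + 2 \<and> k = e"
        then show False using tri[OF T(5,3,1)] c(2,3) n b unfolding T(2,4,6) by simp
      qed
    qed
    then show ?thesis using ne rel by (simp add: R_def)
  qed
  \<comment> \<open>Each occurring even rank is pointed to from two above. A predecessor two below
    is excluded by the induction hypothesis and asymmetry. An odd predecessor has its own
    predecessor at an adjacent even rank different from \<open>k\<close>, and transitivity reduces
    to the even case. Hence the ranks would be unbounded.\<close>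
  have up: "R (k + 2) k" if "even k" "\<exists>x\<in>S. rk x = k" for k
    using that
  proof (induction k rule: less_induct)
    case (less k)
    have down: "\<not> R i k" if "k = i + 2" for i
    proof
      assume R: "R i k"
      then have "\<exists>x\<in>S. rk x = i" by (simp add: R_def)
      then have "R k i" using less.IH[of i] less.prems(1) that by simp
      then show False using asym R by blast
    qed
    obtain i where i: "R i k" using pred less.prems(2) by blast
    then have "rel i k" by (simp add: R_def)
    then have "k = i + 2 \<or> k = i + 1 \<or> i = k + 1 \<or> i = k + 2" unfolding rel_def by linarith
    then consider "k = i + 2" | "k = i + 1" | "i = k + 1" | "i = k + 2" by blast
    then show ?case
    proof cases
      case 1 then show ?thesis using down i by blast
    next
      case 2
      have "\<exists>x\<in>S. rk x = i" using i by (simp add: R_def)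
      then obtain j where j: "R j i" using pred by blast
      then have "rel j i" by (simp add: R_def)
      then have "j = k \<or> i = j + 1" using 2 less.prems(1) unfolding rel_def by presburger
      then have e: "i = j + 1" using asym[OF i] j by auto
      have "R j k" by (rule trans[OF j i, of j]) (use e 2 less.prems(1) in simp_all)
      then show ?thesis using down[of j] e 2 by simp
    next
      case 3
      have "\<exists>x\<in>S. rk x = i" using i by (simp add: R_def)
      then obtain j where j: "R j i" using pred by blast
      then have "rel j i" by (simp add: R_def)
      then have "j = k \<or> j = k + 2" using 3 less.prems(1) unfolding rel_def by presburger
      then have e: "j = k + 2" using asym[OF i] j by auto
      have "R j k" by (rule trans[OF j i, of k]) (use e 3 less.prems(1) in auto)
      then show ?thesis using e by simp
    qed (use i in simp)
  qed
  have unb: "\<exists>x\<in>S. rk x = k + 2 * n" if "even k" "\<exists>x\<in>S. rk x = k" for k n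
  proof (induction n)
    case (Suc n)
    have "R (k + 2 * n + 2) (k + 2 * n)" by (rule up) (use that Suc in auto)
    then show ?case by (auto simp: R_def)
  qed (use that in simp)
  obtain x where x: "x \<in> S" using ne by blast
  have "\<exists>k. even k \<and> (\<exists>x\<in>S. rk x = k)"
  proof (cases "even (rk x)")
    case False
    obtain j where j: "R j (rk x)" using pred[of "rk x"] x by blast
    then have "even j" using False by (auto simp: R_def rel_def)
    then show ?thesis using j by (auto simp: R_def)
  qed (use x in blast)
  then obtain k where k: "even k" "\<exists>x\<in>S. rk x = k" by blast
  have fk: "finite (rk ` S)" using fin by simp
  obtain y where y: "y \<in> S" "rk y = k + 2 * Suc (Max (rk ` S))" using unb[OF k] by blast
  have "rk y \<le> Max (rk ` S)" using fk y(1) by simp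
  then show False using y(2) by simp
qed

section \<open>Adjacency between the classes at a five-cycle, and nested out-neighbourhoods\<close>

context P1_P5_free
begin

text \<open>In these names \<open>V\<close> means attached like a cycle vertex, \<open>W\<close>
  attached to exactly one cycle vertex and \<open>Z\<close> to none. Every fact is stated at one
  position and transported by \<open>C5_rotate\<close>. Its proof exhibits the induced P1+P5: here
  the path v2 v3 v4 x s with \<open>t\<close> isolated.\<close>

lemma V_W_nonmid:
  assumes "C5 v0 v1 v2 v3 v4" "att E [v0, v1, v2, v3, v4] [1, 4] x" "att E [v0, v1, v2, v3, v4] [0] s" "att E [v0, v1, v2, v3, v4] [0] t" "E x s" "\<not> E x t"
  shows False
  using assms C5_induced[OF assms(1)] K3[of v0 s t] H[of v2 v3 v4 x s t]
  by (auto simp: att_simps commute)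

lemma V_Z_nonmid:
  assumes "C5 v0 v1 v2 v3 v4" "att E [v0, v1, v2, v3, v4] [1, 4] x" "att E [v0, v1, v2, v3, v4] [] s" "att E [v0, v1, v2, v3, v4] [] t" "E x s" "\<not> E x t"
  shows False
  using assms C5_induced[OF assms(1)] H[of v0 v1 x s t v3] H[of v2 v3 v4 x s t]
  by (auto simp: att_simps commute)

lemma W_W_complete:
  assumes "C5 v0 v1 v2 v3 v4" "att E [v0, v1, v2, v3, v4] [0] x" "att E [v0, v1, v2, v3, v4] [1] y" "\<not> E x y"
  shows False
  using assms C5_induced[OF assms(1)] H[of v2 v3 v4 v0 x y]
  by (auto simp: att_simps commute)

lemma W_W_nonmid:
  assumes "C5 v0 v1 v2 v3 v4" "att E [v0, v1, v2, v3, v4] [0] x" "att E [v0, v1, v2, v3, v4] [2] s" "att E [v0, v1, v2, v3, v4] [2] t" "E x s" "\<not> E x t"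
  shows False
  using assms C5_induced[OF assms(1)] K3[of v2 s t] H[of v3 v4 v0 x s t]
  by (auto simp: att_simps commute)

lemma W_Z_complete:
  assumes "C5 v0 v1 v2 v3 v4" "att E [v0, v1, v2, v3, v4] [0] x" "att E [v0, v1, v2, v3, v4] [] y" "\<not> E x y"
  shows False
  using assms C5_induced[OF assms(1)] H[of v2 v3 v4 v0 x y]
  by (auto simp: att_simps commute)

text \<open>With triangle-freeness, three vertices from these classes span neither a triangle nor an
  anti-triangle; this is what excludes directed triangles in the orientation below.\<close>

lemma V_V_W_anti:
  assumes "C5 v0 v1 v2 v3 v4" "att E [v0, v1, v2, v3, v4] [1, 4] x" "att E [v0, v1, v2, v3, v4] [0, 2] y" "att E [v0, v1, v2, v3, v4] [3] p" "\<not> E x y" "\<not> E y p" "\<not> E x p"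
  shows False
  using assms C5_induced[OF assms(1)] H[of v0 y v2 v3 p x]
  by (auto simp: att_simps commute)

text \<open>This fact and the next two depend on a fixed vertex \<open>w\<close> attached to
  \<open>v0\<close> only. They remove the undetermined pairs that would close the circle of classes
  again after it is cut open at \<open>w\<close>.\<close>

lemma V1_V2_nonmid:
  assumes "C5 v0 v1 v2 v3 v4" "att E [v0, v1, v2, v3, v4] [0] w" "att E [v0, v1, v2, v3, v4] [0, 2] x" "att E [v0, v1, v2, v3, v4] [1, 3] s" "att E [v0, v1, v2, v3, v4] [1, 3] t" "E s w" "E t w" "E x s" "\<not> E x t"
  shows False
  using assms C5_induced[OF assms(1)] K3[of v0 w x] H[of w t v1 v2 x v4]
  by (auto simp: att_simps commute)

lemma V4_V3_nonmid:
  assumes "C5 v0 v1 v2 v3 v4" "att E [v0, v1, v2, v3, v4] [0] w" "att E [v0, v1, v2, v3, v4] [0, 3] x" "att E [v0, v1, v2, v3, v4] [2, 4] s" "att E [v0, v1, v2, v3, v4] [2, 4] t" "E s w" "E t w" "E x s" "\<not> E x t"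
  shows False
  using assms C5_induced[OF assms(1)] K3[of v0 w x] H[of w t v4 v3 x v1]
  by (auto simp: att_simps commute)

lemma V2_V3_complete:
  assumes "C5 v0 v1 v2 v3 v4" "att E [v0, v1, v2, v3, v4] [0] w" "att E [v0, v1, v2, v3, v4] [1, 3] x" "att E [v0, v1, v2, v3, v4] [2, 4] y" "\<not> E x w" "\<not> E y w" "\<not> E x y"
  shows False
  using assms C5_induced[OF assms(1)] H[of v1 x v3 v4 y w]
  by (auto simp: att_simps commute)

text \<open>Out-neighbours of a vertex attached like \<open>v0\<close> are its neighbours attached
  to [0, 2] or [2] and its non-neighbours attached to [0, 3] or [3]. The ten facts treat the
  unordered pairs of these four classes and show that out-neighbourhoods are nested; the three facts
  for \<open>W\<close> do the same with two classes.\<close>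

lemma V_nest_1:
  assumes "C5 v0 v1 v2 v3 v4" "att E [v0, v1, v2, v3, v4] [1, 4] a" "att E [v0, v1, v2, v3, v4] [1, 4] b" "att E [v0, v1, v2, v3, v4] [0, 2] z" "att E [v0, v1, v2, v3, v4] [0, 2] u" "E a z" "\<not> E b z" "E b u" "\<not> E a u"
  shows False
  using assms C5_induced[OF assms(1)] K3[of v1 a b] K3[of v0 z u] H[of a z v0 u b v3]
  by (auto simp: att_simps commute)

lemma V_nest_2:
  assumes "C5 v0 v1 v2 v3 v4" "att E [v0, v1, v2, v3, v4] [1, 4] a" "att E [v0, v1, v2, v3, v4] [1, 4] b" "att E [v0, v1, v2, v3, v4] [0, 2] z" "att E [v0, v1, v2, v3, v4] [2] u" "E a z" "\<not> E b z" "E b u" "\<not> E a u"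
  shows False
  using assms C5_induced[OF assms(1)] K3[of v1 a b] K3[of v2 z u] H[of z v0 v1 b u v3]
  by (auto simp: att_simps commute)

lemma V_nest_3:
  assumes "C5 v0 v1 v2 v3 v4" "att E [v0, v1, v2, v3, v4] [1, 4] a" "att E [v0, v1, v2, v3, v4] [1, 4] b" "att E [v0, v1, v2, v3, v4] [0, 2] z" "att E [v0, v1, v2, v3, v4] [0, 3] u" "E a z" "\<not> E b z" "\<not> E b u" "E a u"
  shows False
  using assms C5_induced[OF assms(1)] K3[of v1 a b] K3[of v0 z u] H[of v1 b v4 v3 u z]
  by (auto simp: att_simps commute)

lemma V_nest_4:
  assumes "C5 v0 v1 v2 v3 v4" "att E [v0, v1, v2, v3, v4] [1, 4] a" "att E [v0, v1, v2, v3, v4] [1, 4] b" "att E [v0, v1, v2, v3, v4] [0, 2] z" "att E [v0, v1, v2, v3, v4] [3] u" "E a z" "\<not> E b z" "\<not> E b u" "E a u"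
  shows False
  using assms C5_induced[OF assms(1)] K3[of v1 a b] K3[of a z u] H[of v0 z v2 v3 u b]
  by (auto simp: att_simps commute)

lemma V_nest_5:
  assumes "C5 v0 v1 v2 v3 v4" "att E [v0, v1, v2, v3, v4] [1, 4] a" "att E [v0, v1, v2, v3, v4] [1, 4] b" "att E [v0, v1, v2, v3, v4] [2] z" "att E [v0, v1, v2, v3, v4] [2] u" "E a z" "\<not> E b z" "E b u" "\<not> E a u"
  shows False
  using assms C5_induced[OF assms(1)] K3[of v1 a b] K3[of v2 z u] H[of a z v2 u b v0]
  by (auto simp: att_simps commute)

lemma V_nest_6:
  assumes "C5 v0 v1 v2 v3 v4" "att E [v0, v1, v2, v3, v4] [1, 4] a" "att E [v0, v1, v2, v3, v4] [1, 4] b" "att E [v0, v1, v2, v3, v4] [2] z" "att E [v0, v1, v2, v3, v4] [0, 3] u" "E a z" "\<not> E b z" "\<not> E b u" "E a u"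
  shows False
  using assms C5_induced[OF assms(1)] K3[of v1 a b] K3[of a z u] H[of v0 u v3 v2 z b]
  by (auto simp: att_simps commute)

lemma V_nest_7:
  assumes "C5 v0 v1 v2 v3 v4" "att E [v0, v1, v2, v3, v4] [1, 4] a" "att E [v0, v1, v2, v3, v4] [1, 4] b" "att E [v0, v1, v2, v3, v4] [2] z" "att E [v0, v1, v2, v3, v4] [3] u" "E a z" "\<not> E b z" "\<not> E b u" "E a u"
  shows False
  using assms C5_induced[OF assms(1)] K3[of v1 a b] K3[of a z u] H[of v1 v0 v4 v3 u z]
  by (auto simp: att_simps commute)

lemma V_nest_8:
  assumes "C5 v0 v1 v2 v3 v4" "att E [v0, v1, v2, v3, v4] [1, 4] a" "att E [v0, v1, v2, v3, v4] [1, 4] b" "att E [v0, v1, v2, v3, v4] [0, 3] z" "att E [v0, v1, v2, v3, v4] [0, 3] u" "\<not> E a z" "E b z" "\<not> E b u" "E a u"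
  shows False
  using assms C5_induced[OF assms(1)] K3[of v1 a b] K3[of v0 z u] H[of a u v0 z b v2]
  by (auto simp: att_simps commute)

lemma V_nest_9:
  assumes "C5 v0 v1 v2 v3 v4" "att E [v0, v1, v2, v3, v4] [1, 4] a" "att E [v0, v1, v2, v3, v4] [1, 4] b" "att E [v0, v1, v2, v3, v4] [0, 3] z" "att E [v0, v1, v2, v3, v4] [3] u" "\<not> E a z" "E b z" "\<not> E b u" "E a u"
  shows False
  using assms C5_induced[OF assms(1)] K3[of v1 a b] K3[of v3 z u] H[of z v0 v4 a u v2]
  by (auto simp: att_simps commute)

lemma V_nest_10:
  assumes "C5 v0 v1 v2 v3 v4" "att E [v0, v1, v2, v3, v4] [1, 4] a" "att E [v0, v1, v2, v3, v4] [1, 4] b" "att E [v0, v1, v2, v3, v4] [3] z" "att E [v0, v1, v2, v3, v4] [3] u" "\<not> E a z" "E b z" "\<not> E b u" "E a u"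
  shows False
  using assms C5_induced[OF assms(1)] K3[of v1 a b] K3[of v3 z u] H[of a u v3 z b v0]
  by (auto simp: att_simps commute)

lemma W_nest_1:
  assumes "C5 v0 v1 v2 v3 v4" "att E [v0, v1, v2, v3, v4] [0] a" "att E [v0, v1, v2, v3, v4] [0] b" "att E [v0, v1, v2, v3, v4] [1, 3] z" "att E [v0, v1, v2, v3, v4] [1, 3] u" "E a z" "\<not> E b z" "E b u" "\<not> E a u"
  shows False
  using assms C5_induced[OF assms(1)] K3[of v0 a b] K3[of v1 z u] H[of a z v1 u b v4]
  by (auto simp: att_simps commute)

lemma W_nest_2:
  assumes "C5 v0 v1 v2 v3 v4" "att E [v0, v1, v2, v3, v4] [0] a" "att E [v0, v1, v2, v3, v4] [0] b" "att E [v0, v1, v2, v3, v4] [1, 3] z" "att E [v0, v1, v2, v3, v4] [2, 4] u" "E a z" "\<not> E b z" "\<not> E b u" "E a u"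
  shows False
  using assms C5_induced[OF assms(1)] K3[of v0 a b] K3[of a z u] H[of v1 z v3 v4 u b]
  by (auto simp: att_simps commute)

lemma W_nest_3:
  assumes "C5 v0 v1 v2 v3 v4" "att E [v0, v1, v2, v3, v4] [0] a" "att E [v0, v1, v2, v3, v4] [0] b" "att E [v0, v1, v2, v3, v4] [2, 4] z" "att E [v0, v1, v2, v3, v4] [2, 4] u" "\<not> E a z" "E b z" "\<not> E b u" "E a u"
  shows False
  using assms C5_induced[OF assms(1)] K3[of v0 a b] K3[of v2 z u] H[of a u v4 z b v1]
  by (auto simp: att_simps commute)


text \<open>The flag tells how an out-neighbour is recognised: on the true side by adjacency, on the
  false side by non-adjacency. So \<open>E a z = p\<close> reads as: \<open>z\<close> is an
  out-neighbour of \<open>a\<close>.\<close>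

definition side where
  "side p v0 v1 v2 v3 v4 z \<longleftrightarrow> (if p then att E [v0, v1, v2, v3, v4] [0, 2] z \<or> att E [v0, v1, v2, v3, v4] [2] z
     else att E [v0, v1, v2, v3, v4] [0, 3] z \<or> att E [v0, v1, v2, v3, v4] [3] z)"

lemma V_nest:
  assumes C: "C5 v0 v1 v2 v3 v4" and ab: "att E [v0, v1, v2, v3, v4] [1, 4] a" "att E [v0, v1, v2, v3, v4] [1, 4] b"
    and zu: "side p v0 v1 v2 v3 v4 z" "side q v0 v1 v2 v3 v4 u"
    and e: "E a z = p" "E b z = (\<not> p)" "E b u = q" "E a u = (\<not> q)"
  shows False
  using zu e V_nest_1[OF C ab, of z u] V_nest_1[OF C ab(2,1), of u z] V_nest_2[OF C ab, of z u] V_nest_2[OF C ab(2,1), of u z] V_nest_3[OF C ab, of z u] V_nest_3[OF C ab(2,1), of u z] V_nest_4[OF C ab, of z u] V_nest_4[OF C ab(2,1), of u z] V_nest_5[OF C ab, of z u] V_nest_5[OF C ab(2,1), of u z] V_nest_6[OF C ab, of z u] V_nest_6[OF C ab(2,1), of u z] V_nest_7[OF C ab, of z u] V_nest_7[OF C ab(2,1), of u z] V_nest_8[OF C ab, of z u] V_nest_8[OF C ab(2,1), of u z] V_nest_9[OF C ab, of z u] V_nest_9[OF C ab(2,1), of u z] V_nest_10[OF C ab, of z u] V_nest_10[OF C ab(2,1), of u z]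
  unfolding side_def by (cases p; cases q; simp only: if_True if_False simp_thms; elim disjE; simp)

lemma W_nest:
  assumes C: "C5 v0 v1 v2 v3 v4" and ab: "att E [v0, v1, v2, v3, v4] [0] a" "att E [v0, v1, v2, v3, v4] [0] b"
    and zu: "att E [v0, v1, v2, v3, v4] (if p then [1, 3] else [2, 4]) z" "att E [v0, v1, v2, v3, v4] (if q then [1, 3] else [2, 4]) u"
    and e: "E a z = p" "E b z = (\<not> p)" "E b u = q" "E a u = (\<not> q)"
  shows False
  using zu e W_nest_1[OF C ab, of z u] W_nest_1[OF C ab(2,1), of u z] W_nest_2[OF C ab, of z u] W_nest_2[OF C ab(2,1), of u z] W_nest_3[OF C ab, of z u] W_nest_3[OF C ab(2,1), of u z]
  by (cases p; cases q; simp)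

end

context P1_P5_free
begin

text \<open>The pendant \<open>w\<close> added to the base has an inclusion-maximal out-neighbourhood in its class; this
  determines the adjacency of its class to the classes that \<open>w\<close> splits.\<close>

lemma C5_pendant_decomposable:
  assumes C0: "C5 v0 v1 v2 v3 v4" and fin: "finite V" and w0: "w0 \<in> V" "att E [v0, v1, v2, v3, v4] [0] w0"
  shows "bounded_decomposable (palette 6) E V"
proof -
  note C1 = C5_rotate[OF C0]
  note C2 = C5_rotate[OF C1]
  note C3 = C5_rotate[OF C2]
  note C4 = C5_rotate[OF C3]
  let ?b5 = "[v0, v1, v2, v3, v4]"
  define out where "out a = {y \<in> V. att E ?b5 [1, 3] y \<and> E a y \<or> att E ?b5 [2, 4] y \<and> \<not> E a y}" for a
  let ?W = "{a \<in> V. att E ?b5 [0] a}"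
  have K: "finite ((\<lambda>a. card (out a)) ` ?W)" "(\<lambda>a. card (out a)) ` ?W \<noteq> {}" using fin w0 by auto
  from Max_in[OF this] obtain w where w: "w \<in> V" "att E ?b5 [0] w" and Mw: "Max ((\<lambda>a. card (out a)) ` ?W) = card (out w)" by auto
  have ext: "out a \<subseteq> out w" if a: "a \<in> V" "att E ?b5 [0] a" for a
  proof (rule ccontr)
    assume "\<not> out a \<subseteq> out w"
    then obtain u where u: "u \<in> out a" "u \<notin> out w" by blast
    have "out w \<subseteq> out a"
    proof
      fix z assume z: "z \<in> out w"
      show "z \<in> out a"
      proof (rule ccontr)
        assume n: "z \<notin> out a"
        show False
        proof (rule W_nest[OF C0 w(2) a(2)])
          show "att E ?b5 (if E w z then [1, 3] else [2, 4]) z" "E w z = E w z" "E a z = (\<not> E w z)"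
            using z n by (auto simp: out_def)
          show "att E ?b5 (if E a u then [1, 3] else [2, 4]) u" "E a u = E a u" "E w u = (\<not> E a u)"
            using u by (auto simp: out_def)
        qed
      qed
    qed
    then have "card (out w) < card (out a)" using u fin by (intro psubset_card_mono) (auto simp: out_def)
    moreover have "card (out a) \<le> card (out w)" using Max_ge[OF K(1), of "card (out a)"] Mw a by auto
    ultimately show False by simp
  qed
  define bs where "bs = [v0, v1, v2, v3, v4, w]"
  note base = C5_induced[OF C0]
  define Ms where "Ms = [[1, 3, 5], [0], [2, 4], [1, 5], [0, 3], [2], [2, 5], [1, 4], [1, 4, 5], [3], [3, 5], [0, 2], [4, 5], [1, 3], [2, 4, 5], [5] :: nat list]"
  \<comment> \<open>The circle of classes is V2 W0 V3 W1 V4 W2 V0 W3 V1 W4, indices denoting cycle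
    positions; even ranks are \<open>V\<close>, odd ranks \<open>W\<close>. It is cut open at
    \<open>w\<close>: neighbours of \<open>w\<close> in V2 get rank 0 and the others 10,
    non-neighbours of \<open>w\<close> in V3 get 2 and the others 12. The place 11, a second one for
    W0, stays empty. The value 99 for vertices without cycle neighbours is related to no other
    rank.\<close>
  define rank :: "nat list \<Rightarrow> nat" where "rank I = (if I = [1, 3, 5] then 0 else if I = [0] then 1 else if I = [2, 4] then 2 else if I = [1, 5] then 3 else if I = [0, 3] then 4 else if I = [2] \<or> I = [2, 5] then 5 else if I = [1, 4] \<or> I = [1, 4, 5] then 6 else if I = [3] \<or> I = [3, 5] then 7 else if I = [0, 2] then 8 else if I = [4, 5] then 9 else if I = [1, 3] then 10 else if I = [2, 4, 5] then 12 else 99)" for I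
  define rel where "rel i j \<longleftrightarrow> i \<noteq> j \<and> i \<le> j + 2 \<and> j \<le> i + (2::nat) \<and> (even i \<or> even j)" for i j
  define NM where "NM = [([1, 3, 5], [2]), ([0], [1, 5]), ([0], [2]), ([0], [2, 5]), ([0], [1, 3]), ([0], [2, 4, 5]), ([0], [5]), ([2, 4], [3]), ([2, 4], [3, 5]), ([2, 4], [5]), ([1, 5], [2]), ([1, 5], [3]), ([0, 3], [4, 5]), ([0, 3], [2, 4, 5]), ([0, 3], [5]), ([2], [3]), ([2], [3, 5]), ([2], [4, 5]), ([2], [5]), ([2, 5], [3]), ([1, 4], [0]), ([1, 4], [5]), ([1, 4, 5], [0]), ([3], [0]), ([3], [4, 5]), ([3], [5]), ([3, 5], [0]), ([0, 2], [1, 3, 5]), ([0, 2], [1, 5]), ([0, 2], [5]), ([4, 5], [0]), ([1, 3], [2, 4]), ([1, 3], [2]), ([1, 3], [2, 5]), ([1, 3], [5]), ([2, 4, 5], [3]) :: nat list \<times> nat list]"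
  \<comment> \<open>Every pair of classes is settled by a common base neighbour or by one direction
    in \<open>NM\<close>, or else its ranks are related. Only the last kind is left to the
    orientation.\<close>
  have table: "\<forall>I\<in>set Ms. \<forall>J\<in>set Ms. (\<exists>i\<in>set [0..<6]. i \<in> set I \<and> i \<in> set J) \<or> (I, J) \<in> set NM \<or> (J, I) \<in> set NM \<or> rel (rank I) (rank J)"
    unfolding Ms_def NM_def rank_def rel_def by code_simp
  have mask: "\<exists>I\<in>set Ms. att E bs I x" if "x \<in> V" for x
  proof -
    have i: "\<not> E x v0 \<or> \<not> E x v1" "\<not> E x v1 \<or> \<not> E x v2" "\<not> E x v2 \<or> \<not> E x v3" "\<not> E x v3 \<or> \<not> E x v4" "\<not> E x v4 \<or> \<not> E x v0" "\<not> E x v0 \<or> \<not> E x w"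
      using K3[of x v0 v1] K3[of x v1 v2] K3[of x v2 v3] K3[of x v3 v4] K3[of x v0 v4] K3[of x v0 w] base w(2) commute[of w v0] by (auto simp: att_simps)
    have c: "E x w" if "att E ?b5 [1] x \<or> att E ?b5 [4] x \<or> att E ?b5 [] x"
      using that W_W_complete[OF C0 w(2), of x] W_W_complete[OF C4, of x w] W_Z_complete[OF C0 w(2), of x] w(2) commute[of w x] by (auto simp: att_simps)
    show ?thesis
      using i c unfolding bs_def Ms_def
      by (cases "E x v0"; cases "E x v1"; cases "E x v2"; cases "E x v3"; cases "E x v4"; cases "E x w"; simp add: att_simps)
  qed
  have NM: "nonmid E bs V I J" if IJ: "(I, J) \<in> set NM" for I J
  proof -
    have n0: "nonmid E bs V [1, 3, 5] [2]"
    proof (rule nonmidI)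
      fix x s t assume a: "x \<in> V" "s \<in> V" "t \<in> V" "att E bs [1, 3, 5] x" "att E bs [2] s" "att E bs [2] t" "E x s" "\<not> E x t"
      then show False using V_W_nonmid[OF C2, of x s t] w(2) unfolding bs_def by (simp add: att_simps)
    qed
    have n1: "nonmid E bs V [0] [1, 5]"
    proof (rule nonmidI)
      fix x s t assume a: "x \<in> V" "s \<in> V" "t \<in> V" "att E bs [0] x" "att E bs [1, 5] s" "att E bs [1, 5] t" "E x s" "\<not> E x t"
      then show False using W_W_complete[OF C0, of x t] w(2) unfolding bs_def by (simp add: att_simps)
    qed
    have n2: "nonmid E bs V [0] [2]"
    proof (rule nonmidI)
      fix x s t assume a: "x \<in> V" "s \<in> V" "t \<in> V" "att E bs [0] x" "att E bs [2] s" "att E bs [2] t" "E x s" "\<not> E x t"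
      then show False using W_W_nonmid[OF C0, of x s t] w(2) unfolding bs_def by (simp add: att_simps)
    qed
    have n3: "nonmid E bs V [0] [2, 5]"
    proof (rule nonmidI)
      fix x s t assume a: "x \<in> V" "s \<in> V" "t \<in> V" "att E bs [0] x" "att E bs [2, 5] s" "att E bs [2, 5] t" "E x s" "\<not> E x t"
      then show False using W_W_nonmid[OF C0, of x s t] w(2) unfolding bs_def by (simp add: att_simps)
    qed
    have n4: "nonmid E bs V [0] [1, 3]"
    proof (rule nonmidI)
      fix x s t assume a: "x \<in> V" "s \<in> V" "t \<in> V" "att E bs [0] x" "att E bs [1, 3] s" "att E bs [1, 3] t" "E x s" "\<not> E x t"
      then show False using ext[of x] unfolding out_def bs_def by (auto simp: att_simps commute)
    qed
    have n5: "nonmid E bs V [0] [2, 4, 5]"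
    proof (rule nonmidI)
      fix x s t assume a: "x \<in> V" "s \<in> V" "t \<in> V" "att E bs [0] x" "att E bs [2, 4, 5] s" "att E bs [2, 4, 5] t" "E x s" "\<not> E x t"
      then show False using ext[of x] unfolding out_def bs_def by (auto simp: att_simps commute)
    qed
    have n6: "nonmid E bs V [0] [5]"
    proof (rule nonmidI)
      fix x s t assume a: "x \<in> V" "s \<in> V" "t \<in> V" "att E bs [0] x" "att E bs [5] s" "att E bs [5] t" "E x s" "\<not> E x t"
      then show False using W_Z_complete[OF C0, of x t] w(2) unfolding bs_def by (simp add: att_simps)
    qed
    have n7: "nonmid E bs V [2, 4] [3]"
    proof (rule nonmidI)
      fix x s t assume a: "x \<in> V" "s \<in> V" "t \<in> V" "att E bs [2, 4] x" "att E bs [3] s" "att E bs [3] t" "E x s" "\<not> E x t"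
      then show False using V_W_nonmid[OF C3, of x s t] w(2) unfolding bs_def by (simp add: att_simps)
    qed
    have n8: "nonmid E bs V [2, 4] [3, 5]"
    proof (rule nonmidI)
      fix x s t assume a: "x \<in> V" "s \<in> V" "t \<in> V" "att E bs [2, 4] x" "att E bs [3, 5] s" "att E bs [3, 5] t" "E x s" "\<not> E x t"
      then show False using V_W_nonmid[OF C3, of x s t] w(2) unfolding bs_def by (simp add: att_simps)
    qed
    have n9: "nonmid E bs V [2, 4] [5]"
    proof (rule nonmidI)
      fix x s t assume a: "x \<in> V" "s \<in> V" "t \<in> V" "att E bs [2, 4] x" "att E bs [5] s" "att E bs [5] t" "E x s" "\<not> E x t"
      then show False using V_Z_nonmid[OF C3, of x s t] w(2) unfolding bs_def by (simp add: att_simps)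
    qed
    have n10: "nonmid E bs V [1, 5] [2]"
    proof (rule nonmidI)
      fix x s t assume a: "x \<in> V" "s \<in> V" "t \<in> V" "att E bs [1, 5] x" "att E bs [2] s" "att E bs [2] t" "E x s" "\<not> E x t"
      then show False using W_W_complete[OF C1, of x t] w(2) unfolding bs_def by (simp add: att_simps)
    qed
    have n11: "nonmid E bs V [1, 5] [3]"
    proof (rule nonmidI)
      fix x s t assume a: "x \<in> V" "s \<in> V" "t \<in> V" "att E bs [1, 5] x" "att E bs [3] s" "att E bs [3] t" "E x s" "\<not> E x t"
      then show False using W_W_nonmid[OF C1, of x s t] w(2) unfolding bs_def by (simp add: att_simps)
    qed
    have n12: "nonmid E bs V [0, 3] [4, 5]"
    proof (rule nonmidI)
      fix x s t assume a: "x \<in> V" "s \<in> V" "t \<in> V" "att E bs [0, 3] x" "att E bs [4, 5] s" "att E bs [4, 5] t" "E x s" "\<not> E x t"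
      then show False using V_W_nonmid[OF C4, of x s t] w(2) unfolding bs_def by (simp add: att_simps)
    qed
    have n13: "nonmid E bs V [0, 3] [2, 4, 5]"
    proof (rule nonmidI)
      fix x s t assume a: "x \<in> V" "s \<in> V" "t \<in> V" "att E bs [0, 3] x" "att E bs [2, 4, 5] s" "att E bs [2, 4, 5] t" "E x s" "\<not> E x t"
      then show False using V4_V3_nonmid[OF C0 w(2), of x s t] w(2) unfolding bs_def by (simp add: att_simps)
    qed
    have n14: "nonmid E bs V [0, 3] [5]"
    proof (rule nonmidI)
      fix x s t assume a: "x \<in> V" "s \<in> V" "t \<in> V" "att E bs [0, 3] x" "att E bs [5] s" "att E bs [5] t" "E x s" "\<not> E x t"
      then show False using V_Z_nonmid[OF C4, of x s t] w(2) unfolding bs_def by (simp add: att_simps)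
    qed
    have n15: "nonmid E bs V [2] [3]"
    proof (rule nonmidI)
      fix x s t assume a: "x \<in> V" "s \<in> V" "t \<in> V" "att E bs [2] x" "att E bs [3] s" "att E bs [3] t" "E x s" "\<not> E x t"
      then show False using W_W_complete[OF C2, of x t] w(2) unfolding bs_def by (simp add: att_simps)
    qed
    have n16: "nonmid E bs V [2] [3, 5]"
    proof (rule nonmidI)
      fix x s t assume a: "x \<in> V" "s \<in> V" "t \<in> V" "att E bs [2] x" "att E bs [3, 5] s" "att E bs [3, 5] t" "E x s" "\<not> E x t"
      then show False using W_W_complete[OF C2, of x t] w(2) unfolding bs_def by (simp add: att_simps)
    qed
    have n17: "nonmid E bs V [2] [4, 5]"
    proof (rule nonmidI)
      fix x s t assume a: "x \<in> V" "s \<in> V" "t \<in> V" "att E bs [2] x" "att E bs [4, 5] s" "att E bs [4, 5] t" "E x s" "\<not> E x t"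
      then show False using W_W_nonmid[OF C2, of x s t] w(2) unfolding bs_def by (simp add: att_simps)
    qed
    have n18: "nonmid E bs V [2] [5]"
    proof (rule nonmidI)
      fix x s t assume a: "x \<in> V" "s \<in> V" "t \<in> V" "att E bs [2] x" "att E bs [5] s" "att E bs [5] t" "E x s" "\<not> E x t"
      then show False using W_Z_complete[OF C2, of x t] w(2) unfolding bs_def by (simp add: att_simps)
    qed
    have n19: "nonmid E bs V [2, 5] [3]"
    proof (rule nonmidI)
      fix x s t assume a: "x \<in> V" "s \<in> V" "t \<in> V" "att E bs [2, 5] x" "att E bs [3] s" "att E bs [3] t" "E x s" "\<not> E x t"
      then show False using W_W_complete[OF C2, of x t] w(2) unfolding bs_def by (simp add: att_simps)
    qed
    have n20: "nonmid E bs V [1, 4] [0]"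
    proof (rule nonmidI)
      fix x s t assume a: "x \<in> V" "s \<in> V" "t \<in> V" "att E bs [1, 4] x" "att E bs [0] s" "att E bs [0] t" "E x s" "\<not> E x t"
      then show False using V_W_nonmid[OF C0, of x s t] w(2) unfolding bs_def by (simp add: att_simps)
    qed
    have n21: "nonmid E bs V [1, 4] [5]"
    proof (rule nonmidI)
      fix x s t assume a: "x \<in> V" "s \<in> V" "t \<in> V" "att E bs [1, 4] x" "att E bs [5] s" "att E bs [5] t" "E x s" "\<not> E x t"
      then show False using V_Z_nonmid[OF C0, of x s t] w(2) unfolding bs_def by (simp add: att_simps)
    qed
    have n22: "nonmid E bs V [1, 4, 5] [0]"
    proof (rule nonmidI)
      fix x s t assume a: "x \<in> V" "s \<in> V" "t \<in> V" "att E bs [1, 4, 5] x" "att E bs [0] s" "att E bs [0] t" "E x s" "\<not> E x t"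
      then show False using V_W_nonmid[OF C0, of x s t] w(2) unfolding bs_def by (simp add: att_simps)
    qed
    have n23: "nonmid E bs V [3] [0]"
    proof (rule nonmidI)
      fix x s t assume a: "x \<in> V" "s \<in> V" "t \<in> V" "att E bs [3] x" "att E bs [0] s" "att E bs [0] t" "E x s" "\<not> E x t"
      then show False using W_W_nonmid[OF C3, of x s t] w(2) unfolding bs_def by (simp add: att_simps)
    qed
    have n24: "nonmid E bs V [3] [4, 5]"
    proof (rule nonmidI)
      fix x s t assume a: "x \<in> V" "s \<in> V" "t \<in> V" "att E bs [3] x" "att E bs [4, 5] s" "att E bs [4, 5] t" "E x s" "\<not> E x t"
      then show False using W_W_complete[OF C3, of x t] w(2) unfolding bs_def by (simp add: att_simps)
    qed
    have n25: "nonmid E bs V [3] [5]"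
    proof (rule nonmidI)
      fix x s t assume a: "x \<in> V" "s \<in> V" "t \<in> V" "att E bs [3] x" "att E bs [5] s" "att E bs [5] t" "E x s" "\<not> E x t"
      then show False using W_Z_complete[OF C3, of x t] w(2) unfolding bs_def by (simp add: att_simps)
    qed
    have n26: "nonmid E bs V [3, 5] [0]"
    proof (rule nonmidI)
      fix x s t assume a: "x \<in> V" "s \<in> V" "t \<in> V" "att E bs [3, 5] x" "att E bs [0] s" "att E bs [0] t" "E x s" "\<not> E x t"
      then show False using W_W_nonmid[OF C3, of x s t] w(2) unfolding bs_def by (simp add: att_simps)
    qed
    have n27: "nonmid E bs V [0, 2] [1, 3, 5]"
    proof (rule nonmidI)
      fix x s t assume a: "x \<in> V" "s \<in> V" "t \<in> V" "att E bs [0, 2] x" "att E bs [1, 3, 5] s" "att E bs [1, 3, 5] t" "E x s" "\<not> E x t"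
      then show False using V1_V2_nonmid[OF C0 w(2), of x s t] w(2) unfolding bs_def by (simp add: att_simps)
    qed
    have n28: "nonmid E bs V [0, 2] [1, 5]"
    proof (rule nonmidI)
      fix x s t assume a: "x \<in> V" "s \<in> V" "t \<in> V" "att E bs [0, 2] x" "att E bs [1, 5] s" "att E bs [1, 5] t" "E x s" "\<not> E x t"
      then show False using V_W_nonmid[OF C1, of x s t] w(2) unfolding bs_def by (simp add: att_simps)
    qed
    have n29: "nonmid E bs V [0, 2] [5]"
    proof (rule nonmidI)
      fix x s t assume a: "x \<in> V" "s \<in> V" "t \<in> V" "att E bs [0, 2] x" "att E bs [5] s" "att E bs [5] t" "E x s" "\<not> E x t"
      then show False using V_Z_nonmid[OF C1, of x s t] w(2) unfolding bs_def by (simp add: att_simps)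
    qed
    have n30: "nonmid E bs V [4, 5] [0]"
    proof (rule nonmidI)
      fix x s t assume a: "x \<in> V" "s \<in> V" "t \<in> V" "att E bs [4, 5] x" "att E bs [0] s" "att E bs [0] t" "E x s" "\<not> E x t"
      then show False using W_W_complete[OF C4, of x t] w(2) unfolding bs_def by (simp add: att_simps)
    qed
    have n31: "nonmid E bs V [1, 3] [2, 4]"
    proof (rule nonmidI)
      fix x s t assume a: "x \<in> V" "s \<in> V" "t \<in> V" "att E bs [1, 3] x" "att E bs [2, 4] s" "att E bs [2, 4] t" "E x s" "\<not> E x t"
      then show False using V2_V3_complete[OF C0 w(2), of x t] w(2) unfolding bs_def by (simp add: att_simps)
    qed
    have n32: "nonmid E bs V [1, 3] [2]"
    proof (rule nonmidI)
      fix x s t assume a: "x \<in> V" "s \<in> V" "t \<in> V" "att E bs [1, 3] x" "att E bs [2] s" "att E bs [2] t" "E x s" "\<not> E x t"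
      then show False using V_W_nonmid[OF C2, of x s t] w(2) unfolding bs_def by (simp add: att_simps)
    qed
    have n33: "nonmid E bs V [1, 3] [2, 5]"
    proof (rule nonmidI)
      fix x s t assume a: "x \<in> V" "s \<in> V" "t \<in> V" "att E bs [1, 3] x" "att E bs [2, 5] s" "att E bs [2, 5] t" "E x s" "\<not> E x t"
      then show False using V_W_nonmid[OF C2, of x s t] w(2) unfolding bs_def by (simp add: att_simps)
    qed
    have n34: "nonmid E bs V [1, 3] [5]"
    proof (rule nonmidI)
      fix x s t assume a: "x \<in> V" "s \<in> V" "t \<in> V" "att E bs [1, 3] x" "att E bs [5] s" "att E bs [5] t" "E x s" "\<not> E x t"
      then show False using V_Z_nonmid[OF C2, of x s t] w(2) unfolding bs_def by (simp add: att_simps)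
    qed
    have n35: "nonmid E bs V [2, 4, 5] [3]"
    proof (rule nonmidI)
      fix x s t assume a: "x \<in> V" "s \<in> V" "t \<in> V" "att E bs [2, 4, 5] x" "att E bs [3] s" "att E bs [3] t" "E x s" "\<not> E x t"
      then show False using V_W_nonmid[OF C3, of x s t] w(2) unfolding bs_def by (simp add: att_simps)
    qed
    note nms = n0 n1 n2 n3 n4 n5 n6 n7 n8 n9 n10 n11 n12 n13 n14 n15 n16 n17 n18 n19 n20 n21 n22 n23 n24 n25 n26 n27 n28 n29 n30 n31 n32 n33 n34 n35
    show ?thesis using IJ nms unfolding NM_def list.set insert_iff empty_iff prod.inject by (elim disjE conjE FalseE; simp only:)
  qed
  define m where "m x = (SOME I. I \<in> set Ms \<and> att E bs I x)" for x
  have m: "m x \<in> set Ms" "att E bs (m x) x" if "x \<in> V" for x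
  proof -
    have "\<exists>I. I \<in> set Ms \<and> att E bs I x" using mask[OF that] by blast
    from someI_ex[OF this] show "m x \<in> set Ms" "att E bs (m x) x" unfolding m_def by blast+
  qed
  define rk where "rk x = rank (m x)" for x
  define cl :: "nat \<Rightarrow> nat list" where "cl k = (if k = 0 then [1, 3] else if k = 1 then [0] else if k = 2 then [2, 4] else if k = 3 then [1] else if k = 4 then [0, 3] else if k = 5 then [2] else if k = 6 then [1, 4] else if k = 7 then [3] else if k = 8 then [0, 2] else if k = 9 then [4] else if k = 10 then [1, 3] else if k = 12 then [2, 4] else [])" for k
  have rk: "rk x = 99 \<or> rk x \<in> {0,1,2,3,4,5,6,7,8,9,10,12} \<and> att E ?b5 (cl (rk x)) x" if "x \<in> V" for x
    using m[OF that] unfolding rk_def Ms_def rank_def cl_def bs_def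
    by (simp only: list.set insert_iff empty_iff; elim disjE FalseE; simp add: att_simps)
  have le: "rk x = 99 \<or> rk x \<le> 12" if "x \<in> V" for x using rk[OF that] by auto
  \<comment> \<open>Between two \<open>V\<close> classes edges point to the higher rank and
    non-edges back; between a \<open>V\<close> and a \<open>W\<close> class it is the other way
    round. Then a directed triangle on three consecutive ranks is a triangle or an anti-triangle,
    and the out-neighbourhoods are those of \<open>V_nest\<close> and \<open>W_nest\<close>.\<close>
  define D where "D x y \<longleftrightarrow> (E x y \<longleftrightarrow> (even (rk x) \<and> even (rk y)) = (rk x < rk y))" for x y
  have unrel: "\<not> mid E bs V x y \<or> \<not> mid E bs V y x" if xy: "x \<in> V" "y \<in> V" "\<not> rel (rk x) (rk y)" for x y
  proof -
    consider i where "i < 6" "i \<in> set (m x)" "i \<in> set (m y)" | "(m x, m y) \<in> set NM" | "(m y, m x) \<in> set NM"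
      using table[rule_format, OF m(1)[OF xy(1)] m(1)[OF xy(2)]] xy(3) by (auto simp: rk_def)
    then show ?thesis
    proof cases
      case 1
      then have "nonmid E bs V (m x) (m y)" by (intro nonmid_common[of i]) (simp_all add: bs_def)
      then show ?thesis using nonmid_not_mid m(2) xy by metis
    next
      case 2 then show ?thesis using nonmid_not_mid[OF NM] m(2) xy by metis
    next
      case 3 then show ?thesis using nonmid_not_mid[OF NM] m(2) xy by metis
    qed
  qed
  have nest: False if "a \<in> V" "b \<in> V" "z \<in> V" "u \<in> V" "rk a = rk b" "rel (rk a) (rk z)" "rel (rk a) (rk u)"
      "D a z" "\<not> D b z" "D b u" "\<not> D a u" for a b z u
  proof -
    have "rk a \<noteq> 99" "rk b \<noteq> 99" "rk z \<noteq> 99" "rk u \<noteq> 99"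
      using le[of a] le[of z] le[of u] that(1-7) unfolding rel_def by linarith+
    then have att: "att E ?b5 (cl (rk a)) a" "att E ?b5 (cl (rk a)) b" "att E ?b5 (cl (rk z)) z" "att E ?b5 (cl (rk u)) u"
      and ranks: "rk a \<in> {0,1,2,3,4,5,6,7,8,9,10,12}" "rk z \<in> {0,1,2,3,4,5,6,7,8,9,10,12}" "rk u \<in> {0,1,2,3,4,5,6,7,8,9,10,12}"
      using rk[OF that(1)] rk[OF that(2)] rk[OF that(3)] rk[OF that(4)] that(5) by metis+
    define p where "p \<longleftrightarrow> E a z"
    define q where "q \<longleftrightarrow> E b u"
    have e: "E a z = p" "E b z = (\<not> p)" "E b u = q" "E a u = (\<not> q)"
      using that(5,8-11) by (auto simp: p_def q_def D_def)
    have p: "p \<longleftrightarrow> (even (rk a) \<and> even (rk z)) = (rk a < rk z)" and q: "q \<longleftrightarrow> (even (rk a) \<and> even (rk u)) = (rk a < rk u)"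
      using that(5,8,10) by (auto simp: p_def q_def D_def)
    \<comment> \<open>For each rank of \<open>a\<close> the cycle is rotated so that this class sits
      at \<open>v0\<close>. By the definition of \<open>D\<close>, the flags \<open>p\<close> and
      \<open>q\<close> then name exactly the sides on which \<open>z\<close> and \<open>u\<close>
      lie.\<close>
    show False
      using ranks(1) unfolding insert_iff empty_iff
    proof (elim disjE FalseE)
      assume k: "rk a = 0"
      have z: "rk z = 1 \<or> rk z = 2" using that(6) ranks(2) unfolding k rel_def insert_iff empty_iff by (elim disjE FalseE) simp_all
      have u: "rk u = 1 \<or> rk u = 2" using that(7) ranks(3) unfolding k rel_def insert_iff empty_iff by (elim disjE FalseE) simp_all
      have "att E [v2, v3, v4, v0, v1] [1, 4] a" "att E [v2, v3, v4, v0, v1] [1, 4] b" using att(1,2) k by (simp_all add: cl_def att_simps)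
      moreover have "side p v2 v3 v4 v0 v1 z" using z att(3) p k by (elim disjE) (simp_all add: cl_def att_simps side_def)
      moreover have "side q v2 v3 v4 v0 v1 u" using u att(4) q k by (elim disjE) (simp_all add: cl_def att_simps side_def)
      ultimately show False using V_nest[OF C2 _ _ _ _ e] by blast
    next
      assume k: "rk a = 1"
      have z: "rk z = 0 \<or> rk z = 2" using that(6) ranks(2) unfolding k rel_def insert_iff empty_iff by (elim disjE FalseE) simp_all
      have u: "rk u = 0 \<or> rk u = 2" using that(7) ranks(3) unfolding k rel_def insert_iff empty_iff by (elim disjE FalseE) simp_all
      have "att E [v0, v1, v2, v3, v4] [0] a" "att E [v0, v1, v2, v3, v4] [0] b" using att(1,2) k by (simp_all add: cl_def att_simps)
      moreover have "att E [v0, v1, v2, v3, v4] (if p then [1, 3] else [2, 4]) z" using z att(3) p k by (elim disjE) (simp_all add: cl_def att_simps)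
      moreover have "att E [v0, v1, v2, v3, v4] (if q then [1, 3] else [2, 4]) u" using u att(4) q k by (elim disjE) (simp_all add: cl_def att_simps)
      ultimately show False using W_nest[OF C0 _ _ _ _ e] by blast
    next
      assume k: "rk a = 2"
      have z: "rk z = 0 \<or> rk z = 1 \<or> rk z = 3 \<or> rk z = 4" using that(6) ranks(2) unfolding k rel_def insert_iff empty_iff by (elim disjE FalseE) simp_all
      have u: "rk u = 0 \<or> rk u = 1 \<or> rk u = 3 \<or> rk u = 4" using that(7) ranks(3) unfolding k rel_def insert_iff empty_iff by (elim disjE FalseE) simp_all
      have "att E [v3, v4, v0, v1, v2] [1, 4] a" "att E [v3, v4, v0, v1, v2] [1, 4] b" using att(1,2) k by (simp_all add: cl_def att_simps)
      moreover have "side p v3 v4 v0 v1 v2 z" using z att(3) p k by (elim disjE) (simp_all add: cl_def att_simps side_def)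
      moreover have "side q v3 v4 v0 v1 v2 u" using u att(4) q k by (elim disjE) (simp_all add: cl_def att_simps side_def)
      ultimately show False using V_nest[OF C3 _ _ _ _ e] by blast
    next
      assume k: "rk a = 3"
      have z: "rk z = 2 \<or> rk z = 4" using that(6) ranks(2) unfolding k rel_def insert_iff empty_iff by (elim disjE FalseE) simp_all
      have u: "rk u = 2 \<or> rk u = 4" using that(7) ranks(3) unfolding k rel_def insert_iff empty_iff by (elim disjE FalseE) simp_all
      have "att E [v1, v2, v3, v4, v0] [0] a" "att E [v1, v2, v3, v4, v0] [0] b" using att(1,2) k by (simp_all add: cl_def att_simps)
      moreover have "att E [v1, v2, v3, v4, v0] (if p then [1, 3] else [2, 4]) z" using z att(3) p k by (elim disjE) (simp_all add: cl_def att_simps)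
      moreover have "att E [v1, v2, v3, v4, v0] (if q then [1, 3] else [2, 4]) u" using u att(4) q k by (elim disjE) (simp_all add: cl_def att_simps)
      ultimately show False using W_nest[OF C1 _ _ _ _ e] by blast
    next
      assume k: "rk a = 4"
      have z: "rk z = 2 \<or> rk z = 3 \<or> rk z = 5 \<or> rk z = 6" using that(6) ranks(2) unfolding k rel_def insert_iff empty_iff by (elim disjE FalseE) simp_all
      have u: "rk u = 2 \<or> rk u = 3 \<or> rk u = 5 \<or> rk u = 6" using that(7) ranks(3) unfolding k rel_def insert_iff empty_iff by (elim disjE FalseE) simp_all
      have "att E [v4, v0, v1, v2, v3] [1, 4] a" "att E [v4, v0, v1, v2, v3] [1, 4] b" using att(1,2) k by (simp_all add: cl_def att_simps)
      moreover have "side p v4 v0 v1 v2 v3 z" using z att(3) p k by (elim disjE) (simp_all add: cl_def att_simps side_def)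
      moreover have "side q v4 v0 v1 v2 v3 u" using u att(4) q k by (elim disjE) (simp_all add: cl_def att_simps side_def)
      ultimately show False using V_nest[OF C4 _ _ _ _ e] by blast
    next
      assume k: "rk a = 5"
      have z: "rk z = 4 \<or> rk z = 6" using that(6) ranks(2) unfolding k rel_def insert_iff empty_iff by (elim disjE FalseE) simp_all
      have u: "rk u = 4 \<or> rk u = 6" using that(7) ranks(3) unfolding k rel_def insert_iff empty_iff by (elim disjE FalseE) simp_all
      have "att E [v2, v3, v4, v0, v1] [0] a" "att E [v2, v3, v4, v0, v1] [0] b" using att(1,2) k by (simp_all add: cl_def att_simps)
      moreover have "att E [v2, v3, v4, v0, v1] (if p then [1, 3] else [2, 4]) z" using z att(3) p k by (elim disjE) (simp_all add: cl_def att_simps)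
      moreover have "att E [v2, v3, v4, v0, v1] (if q then [1, 3] else [2, 4]) u" using u att(4) q k by (elim disjE) (simp_all add: cl_def att_simps)
      ultimately show False using W_nest[OF C2 _ _ _ _ e] by blast
    next
      assume k: "rk a = 6"
      have z: "rk z = 4 \<or> rk z = 5 \<or> rk z = 7 \<or> rk z = 8" using that(6) ranks(2) unfolding k rel_def insert_iff empty_iff by (elim disjE FalseE) simp_all
      have u: "rk u = 4 \<or> rk u = 5 \<or> rk u = 7 \<or> rk u = 8" using that(7) ranks(3) unfolding k rel_def insert_iff empty_iff by (elim disjE FalseE) simp_all
      have "att E [v0, v1, v2, v3, v4] [1, 4] a" "att E [v0, v1, v2, v3, v4] [1, 4] b" using att(1,2) k by (simp_all add: cl_def att_simps)
      moreover have "side p v0 v1 v2 v3 v4 z" using z att(3) p k by (elim disjE) (simp_all add: cl_def att_simps side_def)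
      moreover have "side q v0 v1 v2 v3 v4 u" using u att(4) q k by (elim disjE) (simp_all add: cl_def att_simps side_def)
      ultimately show False using V_nest[OF C0 _ _ _ _ e] by blast
    next
      assume k: "rk a = 7"
      have z: "rk z = 6 \<or> rk z = 8" using that(6) ranks(2) unfolding k rel_def insert_iff empty_iff by (elim disjE FalseE) simp_all
      have u: "rk u = 6 \<or> rk u = 8" using that(7) ranks(3) unfolding k rel_def insert_iff empty_iff by (elim disjE FalseE) simp_all
      have "att E [v3, v4, v0, v1, v2] [0] a" "att E [v3, v4, v0, v1, v2] [0] b" using att(1,2) k by (simp_all add: cl_def att_simps)
      moreover have "att E [v3, v4, v0, v1, v2] (if p then [1, 3] else [2, 4]) z" using z att(3) p k by (elim disjE) (simp_all add: cl_def att_simps)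
      moreover have "att E [v3, v4, v0, v1, v2] (if q then [1, 3] else [2, 4]) u" using u att(4) q k by (elim disjE) (simp_all add: cl_def att_simps)
      ultimately show False using W_nest[OF C3 _ _ _ _ e] by blast
    next
      assume k: "rk a = 8"
      have z: "rk z = 6 \<or> rk z = 7 \<or> rk z = 9 \<or> rk z = 10" using that(6) ranks(2) unfolding k rel_def insert_iff empty_iff by (elim disjE FalseE) simp_all
      have u: "rk u = 6 \<or> rk u = 7 \<or> rk u = 9 \<or> rk u = 10" using that(7) ranks(3) unfolding k rel_def insert_iff empty_iff by (elim disjE FalseE) simp_all
      have "att E [v1, v2, v3, v4, v0] [1, 4] a" "att E [v1, v2, v3, v4, v0] [1, 4] b" using att(1,2) k by (simp_all add: cl_def att_simps)
      moreover have "side p v1 v2 v3 v4 v0 z" using z att(3) p k by (elim disjE) (simp_all add: cl_def att_simps side_def)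
      moreover have "side q v1 v2 v3 v4 v0 u" using u att(4) q k by (elim disjE) (simp_all add: cl_def att_simps side_def)
      ultimately show False using V_nest[OF C1 _ _ _ _ e] by blast
    next
      assume k: "rk a = 9"
      have z: "rk z = 8 \<or> rk z = 10" using that(6) ranks(2) unfolding k rel_def insert_iff empty_iff by (elim disjE FalseE) simp_all
      have u: "rk u = 8 \<or> rk u = 10" using that(7) ranks(3) unfolding k rel_def insert_iff empty_iff by (elim disjE FalseE) simp_all
      have "att E [v4, v0, v1, v2, v3] [0] a" "att E [v4, v0, v1, v2, v3] [0] b" using att(1,2) k by (simp_all add: cl_def att_simps)
      moreover have "att E [v4, v0, v1, v2, v3] (if p then [1, 3] else [2, 4]) z" using z att(3) p k by (elim disjE) (simp_all add: cl_def att_simps)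
      moreover have "att E [v4, v0, v1, v2, v3] (if q then [1, 3] else [2, 4]) u" using u att(4) q k by (elim disjE) (simp_all add: cl_def att_simps)
      ultimately show False using W_nest[OF C4 _ _ _ _ e] by blast
    next
      assume k: "rk a = 10"
      have z: "rk z = 8 \<or> rk z = 9 \<or> rk z = 12" using that(6) ranks(2) unfolding k rel_def insert_iff empty_iff by (elim disjE FalseE) simp_all
      have u: "rk u = 8 \<or> rk u = 9 \<or> rk u = 12" using that(7) ranks(3) unfolding k rel_def insert_iff empty_iff by (elim disjE FalseE) simp_all
      have "att E [v2, v3, v4, v0, v1] [1, 4] a" "att E [v2, v3, v4, v0, v1] [1, 4] b" using att(1,2) k by (simp_all add: cl_def att_simps)
      moreover have "side p v2 v3 v4 v0 v1 z" using z att(3) p k by (elim disjE) (simp_all add: cl_def att_simps side_def)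
      moreover have "side q v2 v3 v4 v0 v1 u" using u att(4) q k by (elim disjE) (simp_all add: cl_def att_simps side_def)
      ultimately show False using V_nest[OF C2 _ _ _ _ e] by blast
    next
      assume k: "rk a = 12"
      have z: "rk z = 10" using that(6) ranks(2) unfolding k rel_def insert_iff empty_iff by (elim disjE FalseE) simp_all
      have u: "rk u = 10" using that(7) ranks(3) unfolding k rel_def insert_iff empty_iff by (elim disjE FalseE) simp_all
      have "att E [v3, v4, v0, v1, v2] [1, 4] a" "att E [v3, v4, v0, v1, v2] [1, 4] b" using att(1,2) k by (simp_all add: cl_def att_simps)
      moreover have "side p v3 v4 v0 v1 v2 z" using z att(3) p k by - (simp_all add: cl_def att_simps side_def)
      moreover have "side q v3 v4 v0 v1 v2 u" using u att(4) q k by - (simp_all add: cl_def att_simps side_def)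
      ultimately show False using V_nest[OF C3 _ _ _ _ e] by blast
    qed
  qed
  have tri: False if x: "x \<in> V" "y \<in> V" "z \<in> V" "even (rk x)" "rk y = rk x + 1" "rk z = rk x + 2" "D x y = D y z" "D x z \<noteq> D x y" for x y z
  proof -
    have n: "rk x \<noteq> 99" "rk y \<noteq> 99" "rk z \<noteq> 99" using le[OF x(1)] le[OF x(2)] le[OF x(3)] x(5,6) by linarith+
    then have att: "att E ?b5 (cl (rk x)) x" "att E ?b5 (cl (rk x + 1)) y" "att E ?b5 (cl (rk x + 2)) z"
      using rk[OF x(1)] rk[OF x(2)] rk[OF x(3)] x(5,6) by metis+
    have r: "rk x \<in> {0,1,2,3,4,5,6,7,8,9,10,12}" "rk y \<in> {0,1,2,3,4,5,6,7,8,9,10,12}" using rk[OF x(1)] rk[OF x(2)] n by blast+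
    have E: "E x z = E x y" "E y z = E x y" using x(4-8) by (auto simp: D_def)
    show False
    proof (cases "E x y")
      case True then show False using E K3[of x y z] by blast
    next
      case False
      have "rk x = 0 \<or> rk x = 2 \<or> rk x = 4 \<or> rk x = 6 \<or> rk x = 8"
        using r(1) unfolding insert_iff empty_iff by (elim disjE FalseE) (use r(2) x(4,5) in simp_all)
      then show False
        using att False E commute[of z y] V_V_W_anti[OF C2, of x z y] V_V_W_anti[OF C3, of x z y] V_V_W_anti[OF C4, of x z y] V_V_W_anti[OF C0, of x z y] V_V_W_anti[OF C1, of x z y]
        by (elim disjE) (simp_all add: cl_def att_simps)
    qed
  qed
  have "decomposable E (colour E bs V) V"
    unfolding decomposable_def
  proof (intro allI impI ballI)
    fix S u v assume S: "S \<subseteq> V" and uv: "u \<in> S" "v \<in> S" "u \<noteq> v"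
    have SV: "x \<in> V" if "x \<in> S" for x using that S by blast
    have "\<exists>x\<in>S. \<forall>y\<in>S. rk x \<noteq> rk y \<and> rk x \<le> rk y + 2 \<and> rk y \<le> rk x + 2 \<and> (even (rk x) \<or> even (rk y)) \<longrightarrow> D x y"
    proof (rule source_exists)
      show "finite S" using S fin by (rule finite_subset)
      show "S \<noteq> {}" using uv by blast
      show "D x y \<longleftrightarrow> \<not> D y x" if "rk x \<noteq> rk y \<and> rk x \<le> rk y + 2 \<and> rk y \<le> rk x + 2 \<and> (even (rk x) \<or> even (rk y))" for x y
        using that commute[of x y] by (auto simp: D_def)
    next
      fix a z b u assume "a \<in> S" "b \<in> S" "z \<in> S" "u \<in> S" "rk a = rk b"
        "rk a \<noteq> rk z \<and> rk a \<le> rk z + 2 \<and> rk z \<le> rk a + 2 \<and> (even (rk a) \<or> even (rk z))"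
        "rk a \<noteq> rk u \<and> rk a \<le> rk u + 2 \<and> rk u \<le> rk a + 2 \<and> (even (rk a) \<or> even (rk u))"
        "D a z" "\<not> D b z" "D b u" "\<not> D a u"
      then show False by (intro nest[of a b z u]) (simp_all add: SV rel_def)
    next
      fix x y z assume "x \<in> S" "y \<in> S" "z \<in> S" "even (rk x)" "rk y = rk x + 1" "rk z = rk x + 2" "D x y = D y z" "D x z \<noteq> D x y"
      then show False by (intro tri[of x y z]) (simp_all add: SV)
    qed
    then obtain x where x: "x \<in> S" and src: "\<And>y. \<lbrakk>y \<in> S; rel (rk x) (rk y)\<rbrakk> \<Longrightarrow> D x y" unfolding rel_def by blast
    obtain y where "y \<in> S" "x \<noteq> y" using uv by metis
    \<comment> \<open>The source is split off alone. Towards related ranks all pairs point away from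
      it, so adjacency follows from the ranks; all other pairs are settled by the colours.\<close>
    with x show "splits E (colour E bs V) S"
    proof (rule splits_homogeneous)
      fix s t assume st: "s \<in> S" "t \<in> S" "colour E bs V s = colour E bs V t"
      note b = colour_base[OF st(3)]
      have "m s = m t" unfolding m_def using colour_att[OF st(3)] by simp
      then have r: "rk s = rk t" by (simp add: rk_def)
      show "E x s = E x t"
      proof (cases "rel (rk x) (rk s)")
        case True
        then have "D x s" "D x t" using src st(1,2) r by auto
        then show ?thesis using r by (auto simp: D_def)
      next
        case False
        from unrel[OF SV[OF x] SV[OF st(1)] False] show ?thesis
        proof
          assume "\<not> mid E bs V x s"
          then show ?thesis using colour_determines[OF refl b SV[OF x] SV[OF st(1)] SV[OF st(2)]] by blast
        next
          assume "\<not> mid E bs V s x"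
          then have "E s x = E t x" by (rule colour_determines[OF st(3) refl SV[OF st(1)] SV[OF x] SV[OF x]])
          then show ?thesis using commute by blast
        qed
      qed
    qed
  qed
  from colour_bounded[OF this] show ?thesis by (simp add: bs_def numeral_eq_Suc)
qed

end

section \<open>Graphs without induced $P_2+P_4$: no pendant at a blown-up $C_5$\<close>

context P2_P4_free
begin

context
  assumes noH2: "\<And>a b c d e z y. \<lbrakk>C5 a b c d e; \<not> E z a; \<not> E z b; \<not> E z c; \<not> E z d; \<not> E z e; E z y\<rbrakk> \<Longrightarrow> False"
begin

text \<open>The assumption \<open>noH2\<close> says that a vertex missing some five-cycle is
  isolated. It is exploited by exchange: here \<open>x\<close> may replace \<open>v0\<close> in the
  cycle, and \<open>y\<close> would miss the new cycle although it sees \<open>v0\<close>.\<close>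

lemma V_W_complete:
  assumes "C5 v0 v1 v2 v3 v4" "att E [v0, v1, v2, v3, v4] [1, 4] x" "att E [v0, v1, v2, v3, v4] [0] y" "\<not> E x y"
  shows False
  using assms C5_induced[OF assms(1)] noH2[of v1 v2 v3 v4 x y v0]
  by (auto simp: att_simps C5_def commute)

lemma W_W_nonmid:
  assumes "C5 v0 v1 v2 v3 v4" "att E [v0, v1, v2, v3, v4] [0] x" "att E [v0, v1, v2, v3, v4] [1] s" "att E [v0, v1, v2, v3, v4] [1] t" "E x s" "\<not> E x t"
  shows False
  using assms C5_induced[OF assms(1)] K3[of v1 s t] H[of x s v1 t v3 v4]
  by (auto simp: att_simps C5_def commute)

text \<open>The five-cycle v0 y v2 v3 u would be missed by \<open>x\<close>, which sees
  \<open>v1\<close>. As a consequence no vertex distinguishes both neighbouring \<open>V\<close>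
  classes; the facts \<open>V_W_W\<close> to \<open>W_W_W\<close> provide the remaining exclusions
  of this kind.\<close>

lemma V_V_V:
  assumes "C5 v0 v1 v2 v3 v4" "att E [v0, v1, v2, v3, v4] [1, 4] x" "att E [v0, v1, v2, v3, v4] [0, 2] y" "att E [v0, v1, v2, v3, v4] [0, 3] u" "\<not> E x y" "\<not> E x u"
  shows False
  using assms C5_induced[OF assms(1)] noH2[of v0 y v2 v3 u x v1]
  by (auto simp: att_simps C5_def commute)

lemma V_W_W:
  assumes "C5 v0 v1 v2 v3 v4" "att E [v0, v1, v2, v3, v4] [1, 4] x" "att E [v0, v1, v2, v3, v4] [2] y" "att E [v0, v1, v2, v3, v4] [3] u" "E x y" "E x u"
  shows False
  using assms C5_induced[OF assms(1)] noH2[of v2 v3 u x y v0 v1]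
  by (auto simp: att_simps C5_def commute)

lemma W_V_W:
  assumes "C5 v0 v1 v2 v3 v4" "att E [v0, v1, v2, v3, v4] [0] x" "att E [v0, v1, v2, v3, v4] [1, 3] y" "att E [v0, v1, v2, v3, v4] [2] u" "E x y" "E x u"
  shows False
  using assms C5_induced[OF assms(1)] noH2[of v1 v2 u x y v4 v0]
  by (auto simp: att_simps C5_def commute)

lemma W_V_W2:
  assumes "C5 v0 v1 v2 v3 v4" "att E [v0, v1, v2, v3, v4] [0] x" "att E [v0, v1, v2, v3, v4] [2, 4] y" "att E [v0, v1, v2, v3, v4] [3] u" "E x y" "E x u"
  shows False
  using assms C5_induced[OF assms(1)] noH2[of v3 v4 y x u v1 v0]
  by (auto simp: att_simps C5_def commute)

text \<open>If \<open>t\<close> sees \<open>u\<close>, the path y v2 t u and the edge v0 v4 form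
  P2+P4; otherwise the path v4 v0 x u and the edge v2 t do.\<close>

lemma W_W_W:
  assumes "C5 v0 v1 v2 v3 v4" "att E [v0, v1, v2, v3, v4] [0] x" "att E [v0, v1, v2, v3, v4] [2] y" "att E [v0, v1, v2, v3, v4] [3] u" "att E [v0, v1, v2, v3, v4] [2] t" "E x y" "E x u" "\<not> E x t"
  shows False
  using assms C5_induced[OF assms(1)] K3[of x y u] K3[of v2 y t] H[of y v2 t u v0 v4] H[of v4 v0 x u v2 t]
  by (auto simp: att_simps C5_def commute)

text \<open>The path x v1 v0 y and the edge v3 p would form P2+P4. This is the co-triangle condition
  needed for \<open>curious_splits\<close>.\<close>

lemma V_V_W_anti:
  assumes "C5 v0 v1 v2 v3 v4" "att E [v0, v1, v2, v3, v4] [1, 4] x" "att E [v0, v1, v2, v3, v4] [0, 2] y" "att E [v0, v1, v2, v3, v4] [3] p" "\<not> E x y" "\<not> E y p" "\<not> E x p"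
  shows False
  using assms C5_induced[OF assms(1)] H[of x v1 v0 y v3 p]
  by (auto simp: att_simps C5_def commute)

text \<open>World \<open>(1, i)\<close> collects the vertices that distinguish vertices in both other classes of the triple
  \<open>V\<^sub>i, V\<^sub>i\<^sub>+\<^sub>1, W\<^sub>i\<^sub>+\<^sub>3\<close>, where \<open>V\<^sub>i\<close> is attached like the \<open>i\<close>-th vertex of the cycle and \<open>W\<^sub>i\<close> to that vertex only;
  world \<open>(0, i)\<close> is bipartite with sides \<open>V\<^sub>i \<union> W\<^sub>i\<^sub>+\<^sub>4\<close> and \<open>V\<^sub>i\<^sub>+\<^sub>1 \<union> W\<^sub>i\<^sub>+\<^sub>2\<close>.\<close>

lemma pendant_free_decomposable:
  assumes C0: "C5 v0 v1 v2 v3 v4" and fin: "finite V"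
  shows "bounded_decomposable (palette 5) E V"
proof -
  note C1 = C5_rotate[OF C0]
  note C2 = C5_rotate[OF C1]
  note C3 = C5_rotate[OF C2]
  note C4 = C5_rotate[OF C3]
  define bs where "bs = [v0, v1, v2, v3, v4]"
  note base = C5_induced[OF C0]
  define Ms where "Ms = [[1, 4], [0, 2], [1, 3], [2, 4], [0, 3], [0], [1], [2], [3], [4], [] :: nat list]"
  define NM where "NM = [([1, 4], [0]), ([0, 2], [1]), ([1, 3], [2]), ([2, 4], [3]), ([0, 3], [4]), ([0], [1]), ([1], [2]), ([2], [3]), ([3], [4]), ([4], [0]), ([], [1, 4]), ([], [0, 2]), ([], [1, 3]), ([], [2, 4]), ([], [0, 3]), ([], [0]), ([], [1]), ([], [2]), ([], [3]), ([], [4]), ([], []) :: nat list \<times> nat list]"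
  \<comment> \<open>What \<open>NM\<close> and common base neighbours leave over: the pairs of
    classes in which both sides may distinguish each other.\<close>
  define cand where "cand = [([1, 4], [0, 2]), ([1, 4], [2]), ([1, 4], [3]), ([0], [2]), ([0, 2], [1, 3]), ([0, 2], [3]), ([0, 2], [4]), ([1], [3]), ([1, 3], [2, 4]), ([1, 3], [4]), ([1, 3], [0]), ([2], [4]), ([2, 4], [0, 3]), ([2, 4], [0]), ([2, 4], [1]), ([3], [0]), ([0, 3], [1, 4]), ([0, 3], [1]), ([0, 3], [2]), ([4], [1]) :: nat list \<times> nat list]"
  \<comment> \<open>The five triples of classes V_i, V_(i+1), W_(i+3), each listed in all six
    orders.\<close>
  define TL where "TL = [([1, 4], [0, 2], [3]), ([1, 4], [3], [0, 2]), ([0, 2], [1, 4], [3]), ([0, 2], [3], [1, 4]), ([3], [1, 4], [0, 2]), ([3], [0, 2], [1, 4]), ([0, 2], [1, 3], [4]), ([0, 2], [4], [1, 3]), ([1, 3], [0, 2], [4]), ([1, 3], [4], [0, 2]), ([4], [0, 2], [1, 3]), ([4], [1, 3], [0, 2]), ([1, 3], [2, 4], [0]), ([1, 3], [0], [2, 4]), ([2, 4], [1, 3], [0]), ([2, 4], [0], [1, 3]), ([0], [1, 3], [2, 4]), ([0], [2, 4], [1, 3]), ([2, 4], [0, 3], [1]), ([2, 4], [1], [0, 3]), ([0, 3], [2, 4], [1]), ([0, 3], [1], [2, 4]), ([1], [2, 4], [0, 3]), ([1], [0, 3], [2, 4]), ([0, 3], [1, 4], [2]), ([0, 3], [2], [1,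 4]), ([1, 4], [0, 3], [2]), ([1, 4], [2], [0, 3]), ([2], [0, 3], [1, 4]), ([2], [1, 4], [0, 3]) :: nat list \<times> nat list \<times> nat list]"
  have table: "\<forall>I\<in>set Ms. \<forall>J\<in>set Ms. (\<exists>i\<in>set [0..<5]. i \<in> set I \<and> i \<in> set J) \<or> (I, J) \<in> set NM \<or> (J, I) \<in> set NM \<or> (I, J) \<in> set cand \<or> (J, I) \<in> set cand"
    unfolding Ms_def NM_def cand_def by code_simp
  have TL_fun: "\<forall>(X, Y, K)\<in>set TL. \<forall>(X', Y', K')\<in>set TL. X = X' \<longrightarrow> Y = Y' \<longrightarrow> K = K'"
    unfolding TL_def by code_simp
  have mask: "\<exists>I\<in>set Ms. att E bs I x" for x
  proof -
    have i: "\<not> E x v0 \<or> \<not> E x v1" "\<not> E x v1 \<or> \<not> E x v2" "\<not> E x v2 \<or> \<not> E x v3" "\<not> E x v3 \<or> \<not> E x v4" "\<not> E x v4 \<or> \<not> E x v0"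
      using K3[of x v0 v1] K3[of x v1 v2] K3[of x v2 v3] K3[of x v3 v4] K3[of x v0 v4] base by blast+
    show ?thesis
      using i unfolding bs_def Ms_def
      by (cases "E x v0"; cases "E x v1"; cases "E x v2"; cases "E x v3"; cases "E x v4"; simp add: att_simps)
  qed
  have NM: "nonmid E bs V I J" if IJ: "(I, J) \<in> set NM" for I J
  proof -
    have n0: "nonmid E bs V [1, 4] [0]"
    proof (rule nonmidI)
      fix x s t assume "att E bs [1, 4] x" "att E bs [0] s" "att E bs [0] t" "E x s" "\<not> E x t"
      then show False using V_W_complete[OF C0, of x t] unfolding bs_def by (simp add: att_simps)
    qed
    have n1: "nonmid E bs V [0, 2] [1]"
    proof (rule nonmidI)
      fix x s t assume "att E bs [0, 2] x" "att E bs [1] s" "att E bs [1] t" "E x s" "\<not> E x t"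
      then show False using V_W_complete[OF C1, of x t] unfolding bs_def by (simp add: att_simps)
    qed
    have n2: "nonmid E bs V [1, 3] [2]"
    proof (rule nonmidI)
      fix x s t assume "att E bs [1, 3] x" "att E bs [2] s" "att E bs [2] t" "E x s" "\<not> E x t"
      then show False using V_W_complete[OF C2, of x t] unfolding bs_def by (simp add: att_simps)
    qed
    have n3: "nonmid E bs V [2, 4] [3]"
    proof (rule nonmidI)
      fix x s t assume "att E bs [2, 4] x" "att E bs [3] s" "att E bs [3] t" "E x s" "\<not> E x t"
      then show False using V_W_complete[OF C3, of x t] unfolding bs_def by (simp add: att_simps)
    qed
    have n4: "nonmid E bs V [0, 3] [4]"
    proof (rule nonmidI)
      fix x s t assume "att E bs [0, 3] x" "att E bs [4] s" "att E bs [4] t" "E x s" "\<not> E x t"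
      then show False using V_W_complete[OF C4, of x t] unfolding bs_def by (simp add: att_simps)
    qed
    have n5: "nonmid E bs V [0] [1]"
    proof (rule nonmidI)
      fix x s t assume "att E bs [0] x" "att E bs [1] s" "att E bs [1] t" "E x s" "\<not> E x t"
      then show False using W_W_nonmid[OF C0, of x s t] unfolding bs_def by (simp add: att_simps)
    qed
    have n6: "nonmid E bs V [1] [2]"
    proof (rule nonmidI)
      fix x s t assume "att E bs [1] x" "att E bs [2] s" "att E bs [2] t" "E x s" "\<not> E x t"
      then show False using W_W_nonmid[OF C1, of x s t] unfolding bs_def by (simp add: att_simps)
    qed
    have n7: "nonmid E bs V [2] [3]"
    proof (rule nonmidI)
      fix x s t assume "att E bs [2] x" "att E bs [3] s" "att E bs [3] t" "E x s" "\<not> E x t"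
      then show False using W_W_nonmid[OF C2, of x s t] unfolding bs_def by (simp add: att_simps)
    qed
    have n8: "nonmid E bs V [3] [4]"
    proof (rule nonmidI)
      fix x s t assume "att E bs [3] x" "att E bs [4] s" "att E bs [4] t" "E x s" "\<not> E x t"
      then show False using W_W_nonmid[OF C3, of x s t] unfolding bs_def by (simp add: att_simps)
    qed
    have n9: "nonmid E bs V [4] [0]"
    proof (rule nonmidI)
      fix x s t assume "att E bs [4] x" "att E bs [0] s" "att E bs [0] t" "E x s" "\<not> E x t"
      then show False using W_W_nonmid[OF C4, of x s t] unfolding bs_def by (simp add: att_simps)
    qed
    have n10: "nonmid E bs V [] [1, 4]"
    proof (rule nonmidI)
      fix x s t assume "att E bs [] x" "att E bs [1, 4] s" "att E bs [1, 4] t" "E x s" "\<not> E x t"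
      then show False using noH2[OF C0, of x s] unfolding bs_def by (simp add: att_simps)
    qed
    have n11: "nonmid E bs V [] [0, 2]"
    proof (rule nonmidI)
      fix x s t assume "att E bs [] x" "att E bs [0, 2] s" "att E bs [0, 2] t" "E x s" "\<not> E x t"
      then show False using noH2[OF C0, of x s] unfolding bs_def by (simp add: att_simps)
    qed
    have n12: "nonmid E bs V [] [1, 3]"
    proof (rule nonmidI)
      fix x s t assume "att E bs [] x" "att E bs [1, 3] s" "att E bs [1, 3] t" "E x s" "\<not> E x t"
      then show False using noH2[OF C0, of x s] unfolding bs_def by (simp add: att_simps)
    qed
    have n13: "nonmid E bs V [] [2, 4]"
    proof (rule nonmidI)
      fix x s t assume "att E bs [] x" "att E bs [2, 4] s" "att E bs [2, 4] t" "E x s" "\<not> E x t"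
      then show False using noH2[OF C0, of x s] unfolding bs_def by (simp add: att_simps)
    qed
    have n14: "nonmid E bs V [] [0, 3]"
    proof (rule nonmidI)
      fix x s t assume "att E bs [] x" "att E bs [0, 3] s" "att E bs [0, 3] t" "E x s" "\<not> E x t"
      then show False using noH2[OF C0, of x s] unfolding bs_def by (simp add: att_simps)
    qed
    have n15: "nonmid E bs V [] [0]"
    proof (rule nonmidI)
      fix x s t assume "att E bs [] x" "att E bs [0] s" "att E bs [0] t" "E x s" "\<not> E x t"
      then show False using noH2[OF C0, of x s] unfolding bs_def by (simp add: att_simps)
    qed
    have n16: "nonmid E bs V [] [1]"
    proof (rule nonmidI)
      fix x s t assume "att E bs [] x" "att E bs [1] s" "att E bs [1] t" "E x s" "\<not> E x t"
      then show False using noH2[OF C0, of x s] unfolding bs_def by (simp add: att_simps)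
    qed
    have n17: "nonmid E bs V [] [2]"
    proof (rule nonmidI)
      fix x s t assume "att E bs [] x" "att E bs [2] s" "att E bs [2] t" "E x s" "\<not> E x t"
      then show False using noH2[OF C0, of x s] unfolding bs_def by (simp add: att_simps)
    qed
    have n18: "nonmid E bs V [] [3]"
    proof (rule nonmidI)
      fix x s t assume "att E bs [] x" "att E bs [3] s" "att E bs [3] t" "E x s" "\<not> E x t"
      then show False using noH2[OF C0, of x s] unfolding bs_def by (simp add: att_simps)
    qed
    have n19: "nonmid E bs V [] [4]"
    proof (rule nonmidI)
      fix x s t assume "att E bs [] x" "att E bs [4] s" "att E bs [4] t" "E x s" "\<not> E x t"
      then show False using noH2[OF C0, of x s] unfolding bs_def by (simp add: att_simps)
    qed
    have n20: "nonmid E bs V [] []"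
    proof (rule nonmidI)
      fix x s t assume "att E bs [] x" "att E bs [] s" "att E bs [] t" "E x s" "\<not> E x t"
      then show False using noH2[OF C0, of x s] unfolding bs_def by (simp add: att_simps)
    qed
    note nms = n0 n1 n2 n3 n4 n5 n6 n7 n8 n9 n10 n11 n12 n13 n14 n15 n16 n17 n18 n19 n20
    show ?thesis using IJ nms unfolding NM_def list.set insert_iff empty_iff prod.inject by (elim disjE conjE FalseE; simp only:)
  qed
  define m where "m x = (SOME I. I \<in> set Ms \<and> att E bs I x)" for x
  have m: "m x \<in> set Ms" "att E bs (m x) x" for x
  proof -
    have "\<exists>I. I \<in> set Ms \<and> att E bs I x" using mask by blast
    from someI_ex[OF this] show "m x \<in> set Ms" "att E bs (m x) x" unfolding m_def by blast+
  qed
  define md where "md x J \<longleftrightarrow> (\<exists>s\<in>V. att E bs J s \<and> E x s) \<and> (\<exists>t\<in>V. att E bs J t \<and> \<not> E x t)" for x J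
  have mid_md: "md x (m y)" if md: "mid E bs V x y" for x y
  proof -
    obtain s t where st: "s \<in> V" "t \<in> V" "map (E s) bs = map (E y) bs" "map (E t) bs = map (E y) bs" "E x s" "\<not> E x t"
      using md unfolding mid_def by blast
    have "att E bs (m y) s" "att E bs (m y) t" using st(3,4) m(2)[of y] by (simp_all add: att_def del: map_eq_conv)
    then show ?thesis using st unfolding md_def by blast
  qed
  \<comment> \<open>Five exclusions at each of the five positions, two for \<open>V\<close> and
    three for \<open>W\<close>. A \<open>V\<close> vertex distinguishes at most one of its two
    candidate \<open>V\<close> classes and at most one of its two \<open>W\<close> classes; this
    makes the assignment of worlds consistent.\<close>
  have e0: "\<not> (md x [0, 2] \<and> md x [0, 3])" if x: "x \<in> V" "m x = [1, 4]" for x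
  proof
    assume "md x [0, 2] \<and> md x [0, 3]"
    then obtain s1 t1 s2 t2 where "att E bs [0, 2] s1" "att E bs [0, 2] t1" "E x s1" "\<not> E x t1" "att E bs [0, 3] s2" "att E bs [0, 3] t2" "E x s2" "\<not> E x t2"
      unfolding md_def by blast
    then show False using m(2)[of x] x(2) V_V_V[OF C0, of x t1 t2] unfolding bs_def by (simp add: att_simps)
  qed
  have e1: "\<not> (md x [2] \<and> md x [3])" if x: "x \<in> V" "m x = [1, 4]" for x
  proof
    assume "md x [2] \<and> md x [3]"
    then obtain s1 t1 s2 t2 where "att E bs [2] s1" "att E bs [2] t1" "E x s1" "\<not> E x t1" "att E bs [3] s2" "att E bs [3] t2" "E x s2" "\<not> E x t2"
      unfolding md_def by blast
    then show False using m(2)[of x] x(2) V_W_W[OF C0, of x s1 s2] unfolding bs_def by (simp add: att_simps)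
  qed
  have e2: "\<not> (md x [1, 3] \<and> md x [2])" if x: "x \<in> V" "m x = [0]" for x
  proof
    assume "md x [1, 3] \<and> md x [2]"
    then obtain s1 t1 s2 t2 where "att E bs [1, 3] s1" "att E bs [1, 3] t1" "E x s1" "\<not> E x t1" "att E bs [2] s2" "att E bs [2] t2" "E x s2" "\<not> E x t2"
      unfolding md_def by blast
    then show False using m(2)[of x] x(2) W_V_W[OF C0, of x s1 s2] unfolding bs_def by (simp add: att_simps)
  qed
  have e3: "\<not> (md x [2, 4] \<and> md x [3])" if x: "x \<in> V" "m x = [0]" for x
  proof
    assume "md x [2, 4] \<and> md x [3]"
    then obtain s1 t1 s2 t2 where "att E bs [2, 4] s1" "att E bs [2, 4] t1" "E x s1" "\<not> E x t1" "att E bs [3] s2" "att E bs [3] t2" "E x s2" "\<not> E x t2"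
      unfolding md_def by blast
    then show False using m(2)[of x] x(2) W_V_W2[OF C0, of x s1 s2] unfolding bs_def by (simp add: att_simps)
  qed
  have e4: "\<not> (md x [2] \<and> md x [3])" if x: "x \<in> V" "m x = [0]" for x
  proof
    assume "md x [2] \<and> md x [3]"
    then obtain s1 t1 s2 t2 where "att E bs [2] s1" "att E bs [2] t1" "E x s1" "\<not> E x t1" "att E bs [3] s2" "att E bs [3] t2" "E x s2" "\<not> E x t2"
      unfolding md_def by blast
    then show False using m(2)[of x] x(2) W_W_W[OF C0, of x s1 s2 t1] unfolding bs_def by (simp add: att_simps)
  qed
  have e5: "\<not> (md x [1, 3] \<and> md x [1, 4])" if x: "x \<in> V" "m x = [0, 2]" for x
  proof
    assume "md x [1, 3] \<and> md x [1, 4]"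
    then obtain s1 t1 s2 t2 where "att E bs [1, 3] s1" "att E bs [1, 3] t1" "E x s1" "\<not> E x t1" "att E bs [1, 4] s2" "att E bs [1, 4] t2" "E x s2" "\<not> E x t2"
      unfolding md_def by blast
    then show False using m(2)[of x] x(2) V_V_V[OF C1, of x t1 t2] unfolding bs_def by (simp add: att_simps)
  qed
  have e6: "\<not> (md x [3] \<and> md x [4])" if x: "x \<in> V" "m x = [0, 2]" for x
  proof
    assume "md x [3] \<and> md x [4]"
    then obtain s1 t1 s2 t2 where "att E bs [3] s1" "att E bs [3] t1" "E x s1" "\<not> E x t1" "att E bs [4] s2" "att E bs [4] t2" "E x s2" "\<not> E x t2"
      unfolding md_def by blast
    then show False using m(2)[of x] x(2) V_W_W[OF C1, of x s1 s2] unfolding bs_def by (simp add: att_simps)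
  qed
  have e7: "\<not> (md x [2, 4] \<and> md x [3])" if x: "x \<in> V" "m x = [1]" for x
  proof
    assume "md x [2, 4] \<and> md x [3]"
    then obtain s1 t1 s2 t2 where "att E bs [2, 4] s1" "att E bs [2, 4] t1" "E x s1" "\<not> E x t1" "att E bs [3] s2" "att E bs [3] t2" "E x s2" "\<not> E x t2"
      unfolding md_def by blast
    then show False using m(2)[of x] x(2) W_V_W[OF C1, of x s1 s2] unfolding bs_def by (simp add: att_simps)
  qed
  have e8: "\<not> (md x [0, 3] \<and> md x [4])" if x: "x \<in> V" "m x = [1]" for x
  proof
    assume "md x [0, 3] \<and> md x [4]"
    then obtain s1 t1 s2 t2 where "att E bs [0, 3] s1" "att E bs [0, 3] t1" "E x s1" "\<not> E x t1" "att E bs [4] s2" "att E bs [4] t2" "E x s2" "\<not> E x t2"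
      unfolding md_def by blast
    then show False using m(2)[of x] x(2) W_V_W2[OF C1, of x s1 s2] unfolding bs_def by (simp add: att_simps)
  qed
  have e9: "\<not> (md x [3] \<and> md x [4])" if x: "x \<in> V" "m x = [1]" for x
  proof
    assume "md x [3] \<and> md x [4]"
    then obtain s1 t1 s2 t2 where "att E bs [3] s1" "att E bs [3] t1" "E x s1" "\<not> E x t1" "att E bs [4] s2" "att E bs [4] t2" "E x s2" "\<not> E x t2"
      unfolding md_def by blast
    then show False using m(2)[of x] x(2) W_W_W[OF C1, of x s1 s2 t1] unfolding bs_def by (simp add: att_simps)
  qed
  have e10: "\<not> (md x [2, 4] \<and> md x [0, 2])" if x: "x \<in> V" "m x = [1, 3]" for x
  proof
    assume "md x [2, 4] \<and> md x [0, 2]"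
    then obtain s1 t1 s2 t2 where "att E bs [2, 4] s1" "att E bs [2, 4] t1" "E x s1" "\<not> E x t1" "att E bs [0, 2] s2" "att E bs [0, 2] t2" "E x s2" "\<not> E x t2"
      unfolding md_def by blast
    then show False using m(2)[of x] x(2) V_V_V[OF C2, of x t1 t2] unfolding bs_def by (simp add: att_simps)
  qed
  have e11: "\<not> (md x [4] \<and> md x [0])" if x: "x \<in> V" "m x = [1, 3]" for x
  proof
    assume "md x [4] \<and> md x [0]"
    then obtain s1 t1 s2 t2 where "att E bs [4] s1" "att E bs [4] t1" "E x s1" "\<not> E x t1" "att E bs [0] s2" "att E bs [0] t2" "E x s2" "\<not> E x t2"
      unfolding md_def by blast
    then show False using m(2)[of x] x(2) V_W_W[OF C2, of x s1 s2] unfolding bs_def by (simp add: att_simps)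
  qed
  have e12: "\<not> (md x [0, 3] \<and> md x [4])" if x: "x \<in> V" "m x = [2]" for x
  proof
    assume "md x [0, 3] \<and> md x [4]"
    then obtain s1 t1 s2 t2 where "att E bs [0, 3] s1" "att E bs [0, 3] t1" "E x s1" "\<not> E x t1" "att E bs [4] s2" "att E bs [4] t2" "E x s2" "\<not> E x t2"
      unfolding md_def by blast
    then show False using m(2)[of x] x(2) W_V_W[OF C2, of x s1 s2] unfolding bs_def by (simp add: att_simps)
  qed
  have e13: "\<not> (md x [1, 4] \<and> md x [0])" if x: "x \<in> V" "m x = [2]" for x
  proof
    assume "md x [1, 4] \<and> md x [0]"
    then obtain s1 t1 s2 t2 where "att E bs [1, 4] s1" "att E bs [1, 4] t1" "E x s1" "\<not> E x t1" "att E bs [0] s2" "att E bs [0] t2" "E x s2" "\<not> E x t2"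
      unfolding md_def by blast
    then show False using m(2)[of x] x(2) W_V_W2[OF C2, of x s1 s2] unfolding bs_def by (simp add: att_simps)
  qed
  have e14: "\<not> (md x [4] \<and> md x [0])" if x: "x \<in> V" "m x = [2]" for x
  proof
    assume "md x [4] \<and> md x [0]"
    then obtain s1 t1 s2 t2 where "att E bs [4] s1" "att E bs [4] t1" "E x s1" "\<not> E x t1" "att E bs [0] s2" "att E bs [0] t2" "E x s2" "\<not> E x t2"
      unfolding md_def by blast
    then show False using m(2)[of x] x(2) W_W_W[OF C2, of x s1 s2 t1] unfolding bs_def by (simp add: att_simps)
  qed
  have e15: "\<not> (md x [0, 3] \<and> md x [1, 3])" if x: "x \<in> V" "m x = [2, 4]" for x
  proof
    assume "md x [0, 3] \<and> md x [1, 3]"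
    then obtain s1 t1 s2 t2 where "att E bs [0, 3] s1" "att E bs [0, 3] t1" "E x s1" "\<not> E x t1" "att E bs [1, 3] s2" "att E bs [1, 3] t2" "E x s2" "\<not> E x t2"
      unfolding md_def by blast
    then show False using m(2)[of x] x(2) V_V_V[OF C3, of x t1 t2] unfolding bs_def by (simp add: att_simps)
  qed
  have e16: "\<not> (md x [0] \<and> md x [1])" if x: "x \<in> V" "m x = [2, 4]" for x
  proof
    assume "md x [0] \<and> md x [1]"
    then obtain s1 t1 s2 t2 where "att E bs [0] s1" "att E bs [0] t1" "E x s1" "\<not> E x t1" "att E bs [1] s2" "att E bs [1] t2" "E x s2" "\<not> E x t2"
      unfolding md_def by blast
    then show False using m(2)[of x] x(2) V_W_W[OF C3, of x s1 s2] unfolding bs_def by (simp add: att_simps)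
  qed
  have e17: "\<not> (md x [1, 4] \<and> md x [0])" if x: "x \<in> V" "m x = [3]" for x
  proof
    assume "md x [1, 4] \<and> md x [0]"
    then obtain s1 t1 s2 t2 where "att E bs [1, 4] s1" "att E bs [1, 4] t1" "E x s1" "\<not> E x t1" "att E bs [0] s2" "att E bs [0] t2" "E x s2" "\<not> E x t2"
      unfolding md_def by blast
    then show False using m(2)[of x] x(2) W_V_W[OF C3, of x s1 s2] unfolding bs_def by (simp add: att_simps)
  qed
  have e18: "\<not> (md x [0, 2] \<and> md x [1])" if x: "x \<in> V" "m x = [3]" for x
  proof
    assume "md x [0, 2] \<and> md x [1]"
    then obtain s1 t1 s2 t2 where "att E bs [0, 2] s1" "att E bs [0, 2] t1" "E x s1" "\<not> E x t1" "att E bs [1] s2" "att E bs [1] t2" "E x s2" "\<not> E x t2"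
      unfolding md_def by blast
    then show False using m(2)[of x] x(2) W_V_W2[OF C3, of x s1 s2] unfolding bs_def by (simp add: att_simps)
  qed
  have e19: "\<not> (md x [0] \<and> md x [1])" if x: "x \<in> V" "m x = [3]" for x
  proof
    assume "md x [0] \<and> md x [1]"
    then obtain s1 t1 s2 t2 where "att E bs [0] s1" "att E bs [0] t1" "E x s1" "\<not> E x t1" "att E bs [1] s2" "att E bs [1] t2" "E x s2" "\<not> E x t2"
      unfolding md_def by blast
    then show False using m(2)[of x] x(2) W_W_W[OF C3, of x s1 s2 t1] unfolding bs_def by (simp add: att_simps)
  qed
  have e20: "\<not> (md x [1, 4] \<and> md x [2, 4])" if x: "x \<in> V" "m x = [0, 3]" for x
  proof
    assume "md x [1, 4] \<and> md x [2, 4]"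
    then obtain s1 t1 s2 t2 where "att E bs [1, 4] s1" "att E bs [1, 4] t1" "E x s1" "\<not> E x t1" "att E bs [2, 4] s2" "att E bs [2, 4] t2" "E x s2" "\<not> E x t2"
      unfolding md_def by blast
    then show False using m(2)[of x] x(2) V_V_V[OF C4, of x t1 t2] unfolding bs_def by (simp add: att_simps)
  qed
  have e21: "\<not> (md x [1] \<and> md x [2])" if x: "x \<in> V" "m x = [0, 3]" for x
  proof
    assume "md x [1] \<and> md x [2]"
    then obtain s1 t1 s2 t2 where "att E bs [1] s1" "att E bs [1] t1" "E x s1" "\<not> E x t1" "att E bs [2] s2" "att E bs [2] t2" "E x s2" "\<not> E x t2"
      unfolding md_def by blast
    then show False using m(2)[of x] x(2) V_W_W[OF C4, of x s1 s2] unfolding bs_def by (simp add: att_simps)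
  qed
  have e22: "\<not> (md x [0, 2] \<and> md x [1])" if x: "x \<in> V" "m x = [4]" for x
  proof
    assume "md x [0, 2] \<and> md x [1]"
    then obtain s1 t1 s2 t2 where "att E bs [0, 2] s1" "att E bs [0, 2] t1" "E x s1" "\<not> E x t1" "att E bs [1] s2" "att E bs [1] t2" "E x s2" "\<not> E x t2"
      unfolding md_def by blast
    then show False using m(2)[of x] x(2) W_V_W[OF C4, of x s1 s2] unfolding bs_def by (simp add: att_simps)
  qed
  have e23: "\<not> (md x [1, 3] \<and> md x [2])" if x: "x \<in> V" "m x = [4]" for x
  proof
    assume "md x [1, 3] \<and> md x [2]"
    then obtain s1 t1 s2 t2 where "att E bs [1, 3] s1" "att E bs [1, 3] t1" "E x s1" "\<not> E x t1" "att E bs [2] s2" "att E bs [2] t2" "E x s2" "\<not> E x t2"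
      unfolding md_def by blast
    then show False using m(2)[of x] x(2) W_V_W2[OF C4, of x s1 s2] unfolding bs_def by (simp add: att_simps)
  qed
  have e24: "\<not> (md x [1] \<and> md x [2])" if x: "x \<in> V" "m x = [4]" for x
  proof
    assume "md x [1] \<and> md x [2]"
    then obtain s1 t1 s2 t2 where "att E bs [1] s1" "att E bs [1] t1" "E x s1" "\<not> E x t1" "att E bs [2] s2" "att E bs [2] t2" "E x s2" "\<not> E x t2"
      unfolding md_def by blast
    then show False using m(2)[of x] x(2) W_W_W[OF C4, of x s1 s2 t1] unfolding bs_def by (simp add: att_simps)
  qed
  \<comment> \<open>The first tests of each line detect a vertex that distinguishes both other
    classes of a triple. The remaining tests choose between the two bipartite worlds of the class,
    with the last one as default. The value \<open>(2, 0)\<close> collects the vertices without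
    cycle neighbours, which are isolated by \<open>noH2\<close>.\<close>
  define w :: "'a \<Rightarrow> nat \<times> nat" where "w x = (if m x = [1, 4] then (if md x [0, 2] \<and> md x [3] then (1, 0) else if md x [0, 3] \<and> md x [2] then (1, 4) else if md x [0, 2] \<or> md x [2] then (0, 0) else (0, 4))
      else if m x = [0, 2] then (if md x [1, 3] \<and> md x [4] then (1, 1) else if md x [1, 4] \<and> md x [3] then (1, 0) else if md x [1, 3] \<or> md x [3] then (0, 1) else (0, 0))
      else if m x = [1, 3] then (if md x [2, 4] \<and> md x [0] then (1, 2) else if md x [0, 2] \<and> md x [4] then (1, 1) else if md x [2, 4] \<or> md x [4] then (0, 2) else (0, 1))
      else if m x = [2, 4] then (if md x [0, 3] \<and> md x [1] then (1, 3) else if md x [1, 3] \<and> md x [0] then (1, 2) else if md x [0, 3] \<or> md x [0] then (0, 3) else (0, 2))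
      else if m x = [0, 3] then (if md x [1, 4] \<and> md x [2] then (1, 4) else if md x [2, 4] \<and> md x [1] then (1, 3) else if md x [1, 4] \<or> md x [1] then (0, 4) else (0, 3))
      else if m x = [0] then (if md x [1, 3] \<and> md x [2, 4] then (1, 2) else if md x [1, 3] \<or> md x [3] then (0, 1) else (0, 3))
      else if m x = [1] then (if md x [2, 4] \<and> md x [0, 3] then (1, 3) else if md x [2, 4] \<or> md x [4] then (0, 2) else (0, 4))
      else if m x = [2] then (if md x [0, 3] \<and> md x [1, 4] then (1, 4) else if md x [0, 3] \<or> md x [0] then (0, 3) else (0, 0))
      else if m x = [3] then (if md x [1, 4] \<and> md x [0, 2] then (1, 0) else if md x [1, 4] \<or> md x [1] then (0, 4) else (0, 1))
      else if m x = [4] then (if md x [0, 2] \<and> md x [1, 3] then (1, 1) else if md x [0, 2] \<or> md x [2] then (0, 0) else (0, 2))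
      else (2, 0))" for x
  have inv: "m x = m x'" "md x = md x'" "w x = w x'" if c: "colour E bs V x = colour E bs V x'" for x x'
  proof -
    show 1: "m x = m x'" by (simp only: m_def colour_att[OF c])
    show 2: "md x = md x'" by (rule ext) (simp only: md_def colour_nbr[OF c])
    show "w x = w x'" by (simp only: w_def 1 2)
  qed
  \<comment> \<open>A mutually distinguishing pair in different worlds lies in a triple, and exactly
    one of the two also distinguishes the third class \<open>K\<close>. If both did, they would
    share a triple world, and if neither did, a bipartite one. Such pairs between two
    \<open>W\<close> classes always share a world.\<close>
  have pair: "\<exists>K. (m x, m y, K) \<in> set TL \<and> md x K \<noteq> md y K" if xy: "x \<in> V" "y \<in> V" "w x \<noteq> w y" "md x (m y)" "md y (m x)"
      "(m x, m y) \<in> set cand" for x y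
    using xy(6) unfolding cand_def list.set insert_iff empty_iff prod.inject
  proof (elim disjE conjE FalseE)
    assume q: "m x = [1, 4]" "m y = [0, 2]"
    moreover have "md x [3] \<noteq> md y [3]" using q xy(3-5) e0[OF xy(1) q(1)] e1[OF xy(1) q(1)] e5[OF xy(2) q(2)] e6[OF xy(2) q(2)] by (auto simp: w_def split: if_splits)
    ultimately show ?thesis unfolding TL_def by (intro exI[of _ "[3]"]) simp
  next
    assume q: "m x = [1, 4]" "m y = [2]"
    moreover have "md x [0, 3] \<noteq> md y [0, 3]" using q xy(3-5) e0[OF xy(1) q(1)] e1[OF xy(1) q(1)] e12[OF xy(2) q(2)] e13[OF xy(2) q(2)] e14[OF xy(2) q(2)] by (auto simp: w_def split: if_splits)
    ultimately show ?thesis unfolding TL_def by (intro exI[of _ "[0, 3]"]) simp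
  next
    assume q: "m x = [1, 4]" "m y = [3]"
    moreover have "md x [0, 2] \<noteq> md y [0, 2]" using q xy(3-5) e0[OF xy(1) q(1)] e1[OF xy(1) q(1)] e17[OF xy(2) q(2)] e18[OF xy(2) q(2)] e19[OF xy(2) q(2)] by (auto simp: w_def split: if_splits)
    ultimately show ?thesis unfolding TL_def by (intro exI[of _ "[0, 2]"]) simp
  next
    assume q: "m x = [0]" "m y = [2]"
    then show ?thesis using xy(3-5) e2[OF xy(1) q(1)] e3[OF xy(1) q(1)] e4[OF xy(1) q(1)] e12[OF xy(2) q(2)] e13[OF xy(2) q(2)] e14[OF xy(2) q(2)] by (simp add: w_def split: if_splits)
  next
    assume q: "m x = [0, 2]" "m y = [1, 3]"
    moreover have "md x [4] \<noteq> md y [4]" using q xy(3-5) e5[OF xy(1) q(1)] e6[OF xy(1) q(1)] e10[OF xy(2) q(2)] e11[OF xy(2) q(2)] by (auto simp: w_def split: if_splits)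
    ultimately show ?thesis unfolding TL_def by (intro exI[of _ "[4]"]) simp
  next
    assume q: "m x = [0, 2]" "m y = [3]"
    moreover have "md x [1, 4] \<noteq> md y [1, 4]" using q xy(3-5) e5[OF xy(1) q(1)] e6[OF xy(1) q(1)] e17[OF xy(2) q(2)] e18[OF xy(2) q(2)] e19[OF xy(2) q(2)] by (auto simp: w_def split: if_splits)
    ultimately show ?thesis unfolding TL_def by (intro exI[of _ "[1, 4]"]) simp
  next
    assume q: "m x = [0, 2]" "m y = [4]"
    moreover have "md x [1, 3] \<noteq> md y [1, 3]" using q xy(3-5) e5[OF xy(1) q(1)] e6[OF xy(1) q(1)] e22[OF xy(2) q(2)] e23[OF xy(2) q(2)] e24[OF xy(2) q(2)] by (auto simp: w_def split: if_splits)
    ultimately show ?thesis unfolding TL_def by (intro exI[of _ "[1, 3]"]) simp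
  next
    assume q: "m x = [1]" "m y = [3]"
    then show ?thesis using xy(3-5) e7[OF xy(1) q(1)] e8[OF xy(1) q(1)] e9[OF xy(1) q(1)] e17[OF xy(2) q(2)] e18[OF xy(2) q(2)] e19[OF xy(2) q(2)] by (simp add: w_def split: if_splits)
  next
    assume q: "m x = [1, 3]" "m y = [2, 4]"
    moreover have "md x [0] \<noteq> md y [0]" using q xy(3-5) e10[OF xy(1) q(1)] e11[OF xy(1) q(1)] e15[OF xy(2) q(2)] e16[OF xy(2) q(2)] by (auto simp: w_def split: if_splits)
    ultimately show ?thesis unfolding TL_def by (intro exI[of _ "[0]"]) simp
  next
    assume q: "m x = [1, 3]" "m y = [4]"
    moreover have "md x [0, 2] \<noteq> md y [0, 2]" using q xy(3-5) e10[OF xy(1) q(1)] e11[OF xy(1) q(1)] e22[OF xy(2) q(2)] e23[OF xy(2) q(2)] e24[OF xy(2) q(2)] by (auto simp: w_def split: if_splits)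
    ultimately show ?thesis unfolding TL_def by (intro exI[of _ "[0, 2]"]) simp
  next
    assume q: "m x = [1, 3]" "m y = [0]"
    moreover have "md x [2, 4] \<noteq> md y [2, 4]" using q xy(3-5) e2[OF xy(2) q(2)] e3[OF xy(2) q(2)] e4[OF xy(2) q(2)] e10[OF xy(1) q(1)] e11[OF xy(1) q(1)] by (auto simp: w_def split: if_splits)
    ultimately show ?thesis unfolding TL_def by (intro exI[of _ "[2, 4]"]) simp
  next
    assume q: "m x = [2]" "m y = [4]"
    then show ?thesis using xy(3-5) e12[OF xy(1) q(1)] e13[OF xy(1) q(1)] e14[OF xy(1) q(1)] e22[OF xy(2) q(2)] e23[OF xy(2) q(2)] e24[OF xy(2) q(2)] by (simp add: w_def split: if_splits)
  next
    assume q: "m x = [2, 4]" "m y = [0, 3]"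
    moreover have "md x [1] \<noteq> md y [1]" using q xy(3-5) e15[OF xy(1) q(1)] e16[OF xy(1) q(1)] e20[OF xy(2) q(2)] e21[OF xy(2) q(2)] by (auto simp: w_def split: if_splits)
    ultimately show ?thesis unfolding TL_def by (intro exI[of _ "[1]"]) simp
  next
    assume q: "m x = [2, 4]" "m y = [0]"
    moreover have "md x [1, 3] \<noteq> md y [1, 3]" using q xy(3-5) e2[OF xy(2) q(2)] e3[OF xy(2) q(2)] e4[OF xy(2) q(2)] e15[OF xy(1) q(1)] e16[OF xy(1) q(1)] by (auto simp: w_def split: if_splits)
    ultimately show ?thesis unfolding TL_def by (intro exI[of _ "[1, 3]"]) simp
  next
    assume q: "m x = [2, 4]" "m y = [1]"
    moreover have "md x [0, 3] \<noteq> md y [0, 3]" using q xy(3-5) e7[OF xy(2) q(2)] e8[OF xy(2) q(2)] e9[OF xy(2) q(2)] e15[OF xy(1) q(1)] e16[OF xy(1) q(1)] by (auto simp: w_def split: if_splits)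
    ultimately show ?thesis unfolding TL_def by (intro exI[of _ "[0, 3]"]) simp
  next
    assume q: "m x = [3]" "m y = [0]"
    then show ?thesis using xy(3-5) e2[OF xy(2) q(2)] e3[OF xy(2) q(2)] e4[OF xy(2) q(2)] e17[OF xy(1) q(1)] e18[OF xy(1) q(1)] e19[OF xy(1) q(1)] by (simp add: w_def split: if_splits)
  next
    assume q: "m x = [0, 3]" "m y = [1, 4]"
    moreover have "md x [2] \<noteq> md y [2]" using q xy(3-5) e0[OF xy(2) q(2)] e1[OF xy(2) q(2)] e20[OF xy(1) q(1)] e21[OF xy(1) q(1)] by (auto simp: w_def split: if_splits)
    ultimately show ?thesis unfolding TL_def by (intro exI[of _ "[2]"]) simp
  next
    assume q: "m x = [0, 3]" "m y = [1]"
    moreover have "md x [2, 4] \<noteq> md y [2, 4]" using q xy(3-5) e7[OF xy(2) q(2)] e8[OF xy(2) q(2)] e9[OF xy(2) q(2)] e20[OF xy(1) q(1)] e21[OF xy(1) q(1)] by (auto simp: w_def split: if_splits)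
    ultimately show ?thesis unfolding TL_def by (intro exI[of _ "[2, 4]"]) simp
  next
    assume q: "m x = [0, 3]" "m y = [2]"
    moreover have "md x [1, 4] \<noteq> md y [1, 4]" using q xy(3-5) e12[OF xy(2) q(2)] e13[OF xy(2) q(2)] e14[OF xy(2) q(2)] e20[OF xy(1) q(1)] e21[OF xy(1) q(1)] by (auto simp: w_def split: if_splits)
    ultimately show ?thesis unfolding TL_def by (intro exI[of _ "[1, 4]"]) simp
  next
    assume q: "m x = [4]" "m y = [1]"
    then show ?thesis using xy(3-5) e7[OF xy(2) q(2)] e8[OF xy(2) q(2)] e9[OF xy(2) q(2)] e22[OF xy(1) q(1)] e23[OF xy(1) q(1)] e24[OF xy(1) q(1)] by (simp add: w_def split: if_splits)
  qed
  have nn: "\<not> E x y" if "i \<in> set (m x)" "i \<in> set (m y)" "i < 5" for x y i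
  proof
    assume e: "E x y"
    have "E x (bs ! i)" "E y (bs ! i)" using att_nth[OF m(2)] that by (simp_all add: bs_def)
    then show False using K3[of x y "bs ! i"] e by blast
  qed
  have mutual: "(m x, m y) \<in> set cand \<or> (m y, m x) \<in> set cand" if "x \<in> V" "y \<in> V" "mid E bs V x y" "mid E bs V y x" for x y
  proof -
    consider i where "i < 5" "i \<in> set (m x)" "i \<in> set (m y)" | "(m x, m y) \<in> set NM" | "(m y, m x) \<in> set NM" | "(m x, m y) \<in> set cand \<or> (m y, m x) \<in> set cand"
      using table[rule_format, OF m(1)[of x] m(1)[of y]] by auto
    then show ?thesis
    proof cases
      case 1
      then have "nonmid E bs V (m x) (m y)" by (intro nonmid_common[of i]) (simp_all add: bs_def)
      then show ?thesis using nonmid_not_mid[OF _ that(1) m(2) m(2)] that by blast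
    next
      case 2 then show ?thesis using nonmid_not_mid[OF NM that(1) m(2) m(2)] that by blast
    next
      case 3 then show ?thesis using nonmid_not_mid[OF NM that(2) m(2) m(2)] that by blast
    qed
  qed
  have anti: False if "(X, Y, K) \<in> set TL" and a: "att E bs X x" "att E bs Y y" "att E bs K k" "\<not> E x y" "\<not> E y k" "\<not> E x k" for X Y K x y k
    using that(1) unfolding TL_def list.set insert_iff empty_iff prod.inject
  proof (elim disjE conjE FalseE)
      assume q: "X = [1, 4]" "Y = [0, 2]" "K = [3]"
      show False using a V_V_W_anti[OF C0, of x y k] unfolding bs_def q by (simp add: att_simps commute)
    next
      assume q: "X = [1, 4]" "Y = [3]" "K = [0, 2]"
      show False using a V_V_W_anti[OF C0, of x k y] unfolding bs_def q by (simp add: att_simps commute)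
    next
      assume q: "X = [0, 2]" "Y = [1, 4]" "K = [3]"
      show False using a V_V_W_anti[OF C0, of y x k] unfolding bs_def q by (simp add: att_simps commute)
    next
      assume q: "X = [0, 2]" "Y = [3]" "K = [1, 4]"
      show False using a V_V_W_anti[OF C0, of k x y] unfolding bs_def q by (simp add: att_simps commute)
    next
      assume q: "X = [3]" "Y = [1, 4]" "K = [0, 2]"
      show False using a V_V_W_anti[OF C0, of y k x] unfolding bs_def q by (simp add: att_simps commute)
    next
      assume q: "X = [3]" "Y = [0, 2]" "K = [1, 4]"
      show False using a V_V_W_anti[OF C0, of k y x] unfolding bs_def q by (simp add: att_simps commute)
    next
      assume q: "X = [0, 2]" "Y = [1, 3]" "K = [4]"
      show False using a V_V_W_anti[OF C1, of x y k] unfolding bs_def q by (simp add: att_simps commute)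
    next
      assume q: "X = [0, 2]" "Y = [4]" "K = [1, 3]"
      show False using a V_V_W_anti[OF C1, of x k y] unfolding bs_def q by (simp add: att_simps commute)
    next
      assume q: "X = [1, 3]" "Y = [0, 2]" "K = [4]"
      show False using a V_V_W_anti[OF C1, of y x k] unfolding bs_def q by (simp add: att_simps commute)
    next
      assume q: "X = [1, 3]" "Y = [4]" "K = [0, 2]"
      show False using a V_V_W_anti[OF C1, of k x y] unfolding bs_def q by (simp add: att_simps commute)
    next
      assume q: "X = [4]" "Y = [0, 2]" "K = [1, 3]"
      show False using a V_V_W_anti[OF C1, of y k x] unfolding bs_def q by (simp add: att_simps commute)
    next
      assume q: "X = [4]" "Y = [1, 3]" "K = [0, 2]"
      show False using a V_V_W_anti[OF C1, of k y x] unfolding bs_def q by (simp add: att_simps commute)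
    next
      assume q: "X = [1, 3]" "Y = [2, 4]" "K = [0]"
      show False using a V_V_W_anti[OF C2, of x y k] unfolding bs_def q by (simp add: att_simps commute)
    next
      assume q: "X = [1, 3]" "Y = [0]" "K = [2, 4]"
      show False using a V_V_W_anti[OF C2, of x k y] unfolding bs_def q by (simp add: att_simps commute)
    next
      assume q: "X = [2, 4]" "Y = [1, 3]" "K = [0]"
      show False using a V_V_W_anti[OF C2, of y x k] unfolding bs_def q by (simp add: att_simps commute)
    next
      assume q: "X = [2, 4]" "Y = [0]" "K = [1, 3]"
      show False using a V_V_W_anti[OF C2, of k x y] unfolding bs_def q by (simp add: att_simps commute)
    next
      assume q: "X = [0]" "Y = [1, 3]" "K = [2, 4]"
      show False using a V_V_W_anti[OF C2, of y k x] unfolding bs_def q by (simp add: att_simps commute)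
    next
      assume q: "X = [0]" "Y = [2, 4]" "K = [1, 3]"
      show False using a V_V_W_anti[OF C2, of k y x] unfolding bs_def q by (simp add: att_simps commute)
    next
      assume q: "X = [2, 4]" "Y = [0, 3]" "K = [1]"
      show False using a V_V_W_anti[OF C3, of x y k] unfolding bs_def q by (simp add: att_simps commute)
    next
      assume q: "X = [2, 4]" "Y = [1]" "K = [0, 3]"
      show False using a V_V_W_anti[OF C3, of x k y] unfolding bs_def q by (simp add: att_simps commute)
    next
      assume q: "X = [0, 3]" "Y = [2, 4]" "K = [1]"
      show False using a V_V_W_anti[OF C3, of y x k] unfolding bs_def q by (simp add: att_simps commute)
    next
      assume q: "X = [0, 3]" "Y = [1]" "K = [2, 4]"
      show False using a V_V_W_anti[OF C3, of k x y] unfolding bs_def q by (simp add: att_simps commute)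
    next
      assume q: "X = [1]" "Y = [2, 4]" "K = [0, 3]"
      show False using a V_V_W_anti[OF C3, of y k x] unfolding bs_def q by (simp add: att_simps commute)
    next
      assume q: "X = [1]" "Y = [0, 3]" "K = [2, 4]"
      show False using a V_V_W_anti[OF C3, of k y x] unfolding bs_def q by (simp add: att_simps commute)
    next
      assume q: "X = [0, 3]" "Y = [1, 4]" "K = [2]"
      show False using a V_V_W_anti[OF C4, of x y k] unfolding bs_def q by (simp add: att_simps commute)
    next
      assume q: "X = [0, 3]" "Y = [2]" "K = [1, 4]"
      show False using a V_V_W_anti[OF C4, of x k y] unfolding bs_def q by (simp add: att_simps commute)
    next
      assume q: "X = [1, 4]" "Y = [0, 3]" "K = [2]"
      show False using a V_V_W_anti[OF C4, of y x k] unfolding bs_def q by (simp add: att_simps commute)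
    next
      assume q: "X = [1, 4]" "Y = [2]" "K = [0, 3]"
      show False using a V_V_W_anti[OF C4, of k x y] unfolding bs_def q by (simp add: att_simps commute)
    next
      assume q: "X = [2]" "Y = [0, 3]" "K = [1, 4]"
      show False using a V_V_W_anti[OF C4, of y k x] unfolding bs_def q by (simp add: att_simps commute)
    next
      assume q: "X = [2]" "Y = [1, 4]" "K = [0, 3]"
      show False using a V_V_W_anti[OF C4, of k y x] unfolding bs_def q by (simp add: att_simps commute)
  qed
  have TL_sym: "(Y, X, K) \<in> set TL" if "(X, Y, K) \<in> set TL" for X Y K
  proof -
    have "\<forall>(X, Y, K)\<in>set TL. (Y, X, K) \<in> set TL" unfolding TL_def by code_simp
    then show ?thesis using that by blast
  qed
  \<comment> \<open>Here \<open>y\<close> is uniform to \<open>K\<close>. If it sees all of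
    \<open>K\<close>, an edge xy would make a triangle with a neighbour of \<open>x\<close> in
    \<open>K\<close>; if it sees none, a non-edge would make an anti-triangle with a non-neighbour
    of \<open>x\<close>. So adjacency can be read off the colour of \<open>y\<close>.\<close>
  have forced: "E x y \<longleftrightarrow> \<not> (\<exists>s\<in>V. att E bs K s \<and> E y s)" if K: "(m x, m y, K) \<in> set TL" "md x K" "\<not> md y K" for x y K
  proof -
    obtain k k' where k: "k \<in> V" "att E bs K k" "E x k" "k' \<in> V" "att E bs K k'" "\<not> E x k'" using K(2) unfolding md_def by blast
    show ?thesis
    proof (cases "\<exists>s\<in>V. att E bs K s \<and> E y s")
      case True
      then have "E y k" using K(3) k(1,2) unfolding md_def by blast
      then show ?thesis using True k(3) K3[of x y k] by blast
    next
      case False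
      then have "\<not> E y k'" using k by blast
      then show ?thesis using False anti[OF K(1) m(2) m(2) k(5)] k(6) by blast
    qed
  qed
  have "decomposable E (colour E bs V) V"
  proof (rule colour_worlds[where w = w])
    show "E y x" if "E x y" for x y using that by (rule sym)
  next
    fix x y x' y'
    assume V: "x \<in> V" "y \<in> V" "x' \<in> V" "y' \<in> V" and w: "w x \<noteq> w y" "w x' \<noteq> w y'"
      and c: "colour E bs V x = colour E bs V x'" "colour E bs V y = colour E bs V y'"
      and md: "mid E bs V x y" "mid E bs V y x"
    have "\<exists>K. (m x, m y, K) \<in> set TL \<and> md x K \<noteq> md y K"
      using mutual[OF V(1,2) md]
    proof
      assume "(m x, m y) \<in> set cand"
      then show ?thesis using pair[OF V(1,2) w(1) mid_md mid_md] md by blast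
    next
      assume "(m y, m x) \<in> set cand"
      then have "\<exists>K. (m y, m x, K) \<in> set TL \<and> md y K \<noteq> md x K" using pair[OF V(2,1) w(1)[symmetric] mid_md mid_md] md by blast
      then show ?thesis using TL_sym by metis
    qed
    then obtain K where K: "(m x, m y, K) \<in> set TL" "md x K \<noteq> md y K" by blast
    note K' = K[unfolded inv(1,2)[OF c(1)] inv(1,2)[OF c(2)]]
    show "E x y = E x' y'"
    proof (cases "md x K")
      case True
      have "E x y \<longleftrightarrow> \<not> (\<exists>s\<in>V. att E bs K s \<and> E y s)" using K True by (intro forced) auto
      moreover have "E x' y' \<longleftrightarrow> \<not> (\<exists>s\<in>V. att E bs K s \<and> E y' s)"
        using K' True inv(2)[OF c(1)] by (intro forced) auto
      ultimately show ?thesis using colour_nbr(1)[OF c(2), of K] by simp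
    next
      case False
      have "E y x \<longleftrightarrow> \<not> (\<exists>s\<in>V. att E bs K s \<and> E x s)" using K TL_sym False by (intro forced) auto
      moreover have "E y' x' \<longleftrightarrow> \<not> (\<exists>s\<in>V. att E bs K s \<and> E x' s)"
        using K' TL_sym False inv(2)[OF c(1)] by (intro forced) auto
      ultimately show ?thesis using colour_nbr(1)[OF c(1), of K] commute[of x y] commute[of x' y'] by simp
    qed
  next
    fix S u v assume S: "S \<subseteq> V" "u \<in> S" "v \<in> S" "u \<noteq> v" and wu: "\<And>x. x \<in> S \<Longrightarrow> w x = w u"
    have finS: "finite S" using S(1) fin by (rule finite_subset)
    have mc: "m x = m y" if "colour E bs V x = colour E bs V y" for x y using inv(1)[OF that] .
    have bip: "splits E (colour E bs V) S" if sep: "\<And>x. x \<in> S \<Longrightarrow> (i \<in> set (m x)) \<noteq> (j \<in> set (m x))" and ij: "i < 5" "j < 5" for i j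
    proof (rule bipartite_splits[OF finS S(2-4), of "\<lambda>x. i \<in> set (m x)"])
      show "\<not> E x y" if xy: "x \<in> S" "y \<in> S" "(i \<in> set (m x)) = (i \<in> set (m y))" for x y
        using nn[of i x y] nn[of j x y] sep[OF xy(1)] sep[OF xy(2)] xy(3) ij by blast
      show "(i \<in> set (m x)) = (i \<in> set (m y))" if "colour E bs V x = colour E bs V y" for x y using mc[OF that] by simp
    qed
    have tworld: "splits E (colour E bs V) S" if k: "\<And>x. x \<in> S \<Longrightarrow> m x \<in> {X, Y, K}" and T: "(X, Y, K) \<in> set TL" "X \<noteq> Y" "X \<noteq> K" "Y \<noteq> K" "X \<noteq> []" "Y \<noteq> []" "K \<noteq> []" for X Y K
    proof -
      define k :: "'a \<Rightarrow> nat" where "k x = (if m x = X then 0 else if m x = Y then 1 else 2)" for x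
      have kc: "m x = m y" if "x \<in> S" "y \<in> S" "k x = k y" for x y
        using that k[of x] k[of y] T(2-4) by (auto simp: k_def split: if_splits)
      have ind: "\<not> E x y" if xy: "x \<in> S" "y \<in> S" "k x = k y" for x y
      proof -
        obtain i where i: "i \<in> set (m x)" using k[OF xy(1)] T(5-7) by (cases "m x") auto
        have "i < 5" using m(1)[of x] i unfolding Ms_def by auto
        then show ?thesis using nn[of i x y] i kc[OF xy] by simp
      qed
      have kcol: "k x = k y" if "colour E bs V x = colour E bs V y" for x y using mc[OF that] by (simp add: k_def)
      show ?thesis
      proof (cases "\<forall>i<3. \<exists>x\<in>S. k x = i")
        case True
        show ?thesis
        proof (rule curious_splits[of E S k])
          show "E y x" if "E x y" for x y using that by (rule sym)
          show "finite S" by (rule finS)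
          show "k x < 3" for x by (simp add: k_def)
          show "\<exists>x\<in>S. k x = i" if "i < 3" for i using True that by blast
          show "\<not> E x y" if "x \<in> S" "y \<in> S" "k x = k y" for x y using that by (rule ind)
          show False if "E x y" "E y z" "E x z" for x y z using that by (rule K3)
          show "k x = k y" if "colour E bs V x = colour E bs V y" for x y using that by (rule kcol)
        next
          fix x y z assume xyz: "x \<in> S" "y \<in> S" "z \<in> S" "k x = 0" "k y = 1" "k z = 2" "\<not> E x y" "\<not> E y z" "\<not> E x z"
          then have "m x = X" "m y = Y" "m z = K" using k[of z] by (auto simp: k_def split: if_splits)
          then show False using anti[OF T(1), of x y z] m(2)[of x] m(2)[of y] m(2)[of z] xyz(7-9) by simp
        qed
      next
        case False
        then obtain i where i: "i < 3" "\<And>x. x \<in> S \<Longrightarrow> k x \<noteq> i" by blast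
        \<comment> \<open>One class of the triple is missing, namely \<open>i\<close>. The graph is
          then bipartite, and equality with \<open>j\<close> tells the other two classes
          apart.\<close>
        define j where "j = (i + 1) mod 3"
        have j: "k x = k y" if "x \<in> S" "y \<in> S" "(k x = j) = (k y = j)" for x y
        proof -
          have "k s = 0 \<or> k s = 1 \<or> k s = 2" for s by (simp add: k_def)
          then have "(k x = 0 \<or> k x = 1 \<or> k x = 2) \<and> (k y = 0 \<or> k y = 1 \<or> k y = 2)" by simp
          moreover have "i = 0 \<or> i = 1 \<or> i = 2" using i(1) by linarith
          then have "i = 0 \<and> j = 1 \<or> i = 1 \<and> j = 2 \<or> i = 2 \<and> j = 0" by (elim disjE) (simp_all add: j_def)
          ultimately show ?thesis using i(2)[OF that(1)] i(2)[OF that(2)] that(3) by (elim conjE disjE) simp_all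
        qed
        show ?thesis
        proof (rule bipartite_splits[OF finS S(2-4), of "\<lambda>x. k x = j"])
          show "\<not> E x y" if "x \<in> S" "y \<in> S" "(k x = j) = (k y = j)" for x y using ind j that by blast
          show "(k x = j) = (k y = j)" if "colour E bs V x = colour E bs V y" for x y using kcol[OF that] by simp
        qed
      qed
    qed
    have cases: "w x = (2, 0) \<and> m x = [] \<or> w x = (0, 0) \<and> m x \<in> {[1, 4], [4], [0, 2], [2]} \<or> w x = (1, 0) \<and> m x \<in> {[1, 4], [0, 2], [3]} \<or> w x = (0, 1) \<and> m x \<in> {[0, 2], [0], [1, 3], [3]} \<or> w x = (1, 1) \<and> m x \<in> {[0, 2], [1, 3], [4]} \<or> w x = (0, 2) \<and> m x \<in> {[1, 3], [1], [2, 4], [4]} \<or> w x = (1, 2) \<and> m x \<in> {[1, 3], [2, 4], [0]} \<or> w x = (0, 3) \<and> m x \<in> {[2, 4], [2], [0, 3], [0]} \<or> w x = (1, 3) \<and> m x \<in> {[2, 4], [0, 3], [1]} \<or> w x = (0, 4) \<and> m x \<in> {[0, 3], [3], [1, 4], [1]} \<or> w x = (1, 4) \<and> m x \<in> {[0, 3], [1, 4], [2]}" for x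
      using m(1)[of x] unfolding Ms_def list.set insert_iff empty_iff
      by (elim disjE FalseE) (simp_all add: w_def)
    consider (z) "w u = (2, 0)" | (g0) "w u = (0, 0)" | (t0) "w u = (1, 0)" | (g1) "w u = (0, 1)" | (t1) "w u = (1, 1)" | (g2) "w u = (0, 2)" | (t2) "w u = (1, 2)" | (g3) "w u = (0, 3)" | (t3) "w u = (1, 3)" | (g4) "w u = (0, 4)" | (t4) "w u = (1, 4)"
      using cases[of u] by auto
    then show "splits E (colour E bs V) S"
    proof cases
      case z
      then have "m x = []" if "x \<in> S" for x using cases[of x] wu[OF that] by auto
      then have "\<not> E x y" if "x \<in> S" for x y
        using noH2[OF C0, of x y] m(2)[of x] that unfolding bs_def by (auto simp: att_simps)
      then show ?thesis using S by (intro splits_homogeneous[OF S(2-4)]) auto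
    next
      case g0
      show ?thesis
      proof (rule bip[of 4 2])
        fix x assume "x \<in> S"
        then show "(4 \<in> set (m x)) \<noteq> (2 \<in> set (m x))" using cases[of x] wu g0 by auto
      qed simp_all
    next
      case t0
      show ?thesis
      proof (rule tworld[of "[1, 4]" "[0, 2]" "[3]"])
        fix x assume "x \<in> S"
        then show "m x \<in> {[1, 4], [0, 2], [3]}" using cases[of x] wu t0 by auto
      qed (simp_all add: TL_def)
    next
      case g1
      show ?thesis
      proof (rule bip[of 0 3])
        fix x assume "x \<in> S"
        then show "(0 \<in> set (m x)) \<noteq> (3 \<in> set (m x))" using cases[of x] wu g1 by auto
      qed simp_all
    next
      case t1
      show ?thesis
      proof (rule tworld[of "[0, 2]" "[1, 3]" "[4]"])
        fix x assume "x \<in> S"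
        then show "m x \<in> {[0, 2], [1, 3], [4]}" using cases[of x] wu t1 by auto
      qed (simp_all add: TL_def)
    next
      case g2
      show ?thesis
      proof (rule bip[of 1 4])
        fix x assume "x \<in> S"
        then show "(1 \<in> set (m x)) \<noteq> (4 \<in> set (m x))" using cases[of x] wu g2 by auto
      qed simp_all
    next
      case t2
      show ?thesis
      proof (rule tworld[of "[1, 3]" "[2, 4]" "[0]"])
        fix x assume "x \<in> S"
        then show "m x \<in> {[1, 3], [2, 4], [0]}" using cases[of x] wu t2 by auto
      qed (simp_all add: TL_def)
    next
      case g3
      show ?thesis
      proof (rule bip[of 2 0])
        fix x assume "x \<in> S"
        then show "(2 \<in> set (m x)) \<noteq> (0 \<in> set (m x))" using cases[of x] wu g3 by auto
      qed simp_all
    next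
      case t3
      show ?thesis
      proof (rule tworld[of "[2, 4]" "[0, 3]" "[1]"])
        fix x assume "x \<in> S"
        then show "m x \<in> {[2, 4], [0, 3], [1]}" using cases[of x] wu t3 by auto
      qed (simp_all add: TL_def)
    next
      case g4
      show ?thesis
      proof (rule bip[of 3 1])
        fix x assume "x \<in> S"
        then show "(3 \<in> set (m x)) \<noteq> (1 \<in> set (m x))" using cases[of x] wu g4 by auto
      qed simp_all
    next
      case t4
      show ?thesis
      proof (rule tworld[of "[0, 3]" "[1, 4]" "[2]"])
        fix x assume "x \<in> S"
        then show "m x \<in> {[0, 3], [1, 4], [2]}" using cases[of x] wu t4 by auto
      qed (simp_all add: TL_def)
    qed
  qed
  from colour_bounded[OF this] show ?thesis by (simp add: bs_def numeral_eq_Suc)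
qed

end

end

section \<open>Graphs without induced $P_2+P_4$: a blown-up $C_5$ with a pendant vertex\<close>

context P2_P4_free
begin

context
  fixes v0 v1 v2 v3 v4 h g and bs :: "'a list"
  assumes C: "C5 v0 v1 v2 v3 v4" and h: "E h v1" "E h v4"
    and g: "\<not> E g v0" "\<not> E g v1" "\<not> E g v2" "\<not> E g v3" "\<not> E g v4" "E g h"
  defines bs_def: "bs \<equiv> [v0, v1, v2, v3, v4, h, g]"
begin

lemma h_non: "\<not> E h v0" "\<not> E h v2" "\<not> E h v3"
  using K3[of h v1 v0] K3[of h v1 v2] K3[of h v4 v3] C5_induced[OF C] h commute by blast+

lemmas base = C5_induced[OF C] h g h_non

text \<open>Indices 5 and 6 stand for \<open>h\<close>, which is attached like \<open>v0\<close>,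
  and for its pendant \<open>g\<close>. The eleven facts of this form exclude attachments by
  exhibiting P2+P4, often with the edge h g as the P2 or as an end of the P4. In later names
  \<open>V\<close>, \<open>W\<close>, \<open>Z\<close> keep their meaning with respect to the cycle,
  and \<open>X\<close> means attached to \<open>h\<close> only.\<close>

lemma mask_bad_0:
  assumes "att E bs [2] a"
  shows False
  using assms[unfolded bs_def] H[of v0 v4 h g v2 a]
  by (auto simp: base att_simps commute)

lemma mask_bad_1:
  assumes "att E bs [0, 2] a"
  shows False
  using assms[unfolded bs_def] H[of v0 a v2 v3 h g]
  by (auto simp: base att_simps commute)

lemma mask_bad_2:
  assumes "att E bs [3] a"
  shows False
  using assms[unfolded bs_def] H[of v0 v1 h g v3 a]
  by (auto simp: base att_simps commute)

lemma mask_bad_3: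
  assumes "att E bs [0, 3] a"
  shows False
  using assms[unfolded bs_def] H[of v0 a v3 v2 h g]
  by (auto simp: base att_simps commute)

lemma mask_bad_4:
  assumes "att E bs [0, 5] a"
  shows False
  using assms[unfolded bs_def] H[of v0 a h g v2 v3]
  by (auto simp: base att_simps commute)

lemma mask_bad_5:
  assumes "att E bs [6] a"
  shows False
  using assms[unfolded bs_def] H[of v0 v1 v2 v3 g a]
  by (auto simp: base att_simps commute)

lemma mask_bad_6:
  assumes "att E bs [0, 6] a"
  shows False
  using assms[unfolded bs_def] H[of v0 a g h v2 v3]
  by (auto simp: base att_simps commute)

lemma mask_bad_7:
  assumes "att E bs [1, 6] a"
  shows False
  using assms[unfolded bs_def] H[of v0 v4 v3 v2 g a]
  by (auto simp: base att_simps commute)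

lemma mask_bad_8:
  assumes "att E bs [2, 6] a"
  shows False
  using assms[unfolded bs_def] H[of v1 v0 v4 v3 g a]
  by (auto simp: base att_simps commute)

lemma mask_bad_9:
  assumes "att E bs [3, 6] a"
  shows False
  using assms[unfolded bs_def] H[of v2 v1 v0 v4 g a]
  by (auto simp: base att_simps commute)

lemma mask_bad_10:
  assumes "att E bs [4, 6] a"
  shows False
  using assms[unfolded bs_def] H[of v0 v1 v2 v3 g a]
  by (auto simp: base att_simps commute)

lemma Z_Z:
  assumes "att E bs [] a" "att E bs [] b" "E a b"
  shows False
  using assms[unfolded bs_def] H[of v0 v1 v2 v3 a b]
  by (auto simp: base att_simps commute)

text \<open>Otherwise b c a d and the edge v2 v3 form P2+P4. So the graph between these two classes
  is a disjoint union of complete bipartite graphs, which are the cores of the blocks.\<close>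

lemma V0_Z_bic:
  assumes "att E bs [1, 4] a" "att E bs [1, 4] b" "att E bs [] c" "att E bs [] d" "E a c" "E b c" "E a d" "\<not> E b d"
  shows False
  using assms[unfolded bs_def] K3[of v1 a b] K3[of a c d] H[of b c a d v2 v3]
  by (auto simp: base att_simps commute)

text \<open>The neighbours \<open>p\<close> and \<open>r\<close> of \<open>a\<close> are not
  adjacent, so p v3 v2 r is an induced path that misses the edge h g. Hence \<open>a\<close>
  distinguishes at most one of the two classes.\<close>

lemma X_V2_V3:
  assumes "att E bs [5] a" "att E bs [1, 3] p" "att E bs [1, 3] q" "att E bs [2, 4] r" "att E bs [2, 4] s" "E a p" "\<not> E a q" "E a r" "\<not> E a s"
  shows False
  using assms[unfolded bs_def] K3[of v1 p q] K3[of a p r] H[of p v3 v2 r h g]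
  by (auto simp: base att_simps commute)

text \<open>Together with \<open>V0_V1_Z\<close>: non-adjacent vertices of these two classes have
  the same neighbours in \<open>Z\<close>. This lets a block extend from \<open>Z\<close> and the
  class of \<open>v0\<close> to the class of \<open>v1\<close>, and symmetrically to that of
  \<open>v4\<close>.\<close>

lemma V0_Z_V1:
  assumes "att E bs [1, 4] a" "att E bs [] c" "att E bs [0, 2, 5] y" "E a c" "\<not> E a y" "\<not> E c y"
  shows False
  using assms[unfolded bs_def] H[of v0 y v2 v3 a c]
  by (auto simp: base att_simps commute)

lemma V0_V1_Z:
  assumes "att E bs [1, 4] a" "att E bs [] c" "att E bs [0, 2, 5] y" "\<not> E a c" "\<not> E a y" "E y c"
  shows False
  using assms[unfolded bs_def] H[of v1 a v4 v3 c y]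
  by (auto simp: base att_simps commute)

lemma V0_W2:
  assumes "att E bs [1, 4] a" "att E bs [] c" "att E bs [2, 5] y" "E a c" "\<not> E a y"
  shows False
  using assms[unfolded bs_def] H[of v1 v0 v4 v3 c y] H[of v0 v4 a c v2 y]
  by (auto simp: base att_simps commute)

lemma V1_W:
  assumes "att E bs [0, 2, 5] a" "att E bs [] c" "att E bs [4] y" "E a c" "\<not> E a y"
  shows False
  using assms[unfolded bs_def] H[of v0 v1 v2 v3 c y] H[of v1 v2 a c v4 y]
  by (auto simp: base att_simps commute)

lemma V0_Z_V4:
  assumes "att E bs [1, 4] a" "att E bs [] c" "att E bs [0, 3, 5] y" "E a c" "\<not> E a y" "\<not> E c y"
  shows False
  using assms[unfolded bs_def] H[of v0 y v3 v2 a c]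
  by (auto simp: base att_simps commute)

lemma V0_V4_Z:
  assumes "att E bs [1, 4] a" "att E bs [] c" "att E bs [0, 3, 5] y" "\<not> E a c" "\<not> E a y" "E y c"
  shows False
  using assms[unfolded bs_def] H[of v2 v1 a v4 c y]
  by (auto simp: base att_simps commute)

lemma V0_W3:
  assumes "att E bs [1, 4] a" "att E bs [] c" "att E bs [3, 5] y" "E a c" "\<not> E a y"
  shows False
  using assms[unfolded bs_def] H[of v2 v1 v0 v4 c y] H[of v0 v1 a c v3 y]
  by (auto simp: base att_simps commute)

lemma V4_W:
  assumes "att E bs [0, 3, 5] a" "att E bs [] c" "att E bs [1] y" "E a c" "\<not> E a y"
  shows False
  using assms[unfolded bs_def] H[of v0 v4 v3 v2 c y] H[of v4 v3 a c v1 y]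
  by (auto simp: base att_simps commute)

text \<open>A vertex attached to \<open>v1\<close> only that has a neighbour attached to
  \<open>v4\<close> only takes part in no other undetermined pair. The facts from here on prove this
  in both mirror images, so these two classes can form a world of their own.\<close>

lemma W1_W_W:
  assumes "att E bs [1] a" "att E bs [4] p" "att E bs [3, 5] q" "att E bs [3, 5] t" "E a p" "\<not> E a q" "E a t"
  shows False
  using assms[unfolded bs_def] K3[of a p t] K3[of v3 q t] H[of p q v3 t v0 v1] H[of v0 v1 a p v3 q]
  by (auto simp: base att_simps commute)

lemma W1_W_V_1:
  assumes "att E bs [1] a" "att E bs [4] p" "att E bs [0, 3, 5] q" "att E bs [1] k" "E a p" "E q a" "\<not> E q k"
  shows False
  using assms[unfolded bs_def] K3[of v1 a k] K3[of a p q] H[of v0 q v3 v2 p k] H[of p v4 v3 q v1 k]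
  by (auto simp: base att_simps commute)

lemma W1_W_V_2:
  assumes "att E bs [1] a" "att E bs [4] p" "att E bs [0, 3, 5] q" "att E bs [1] k" "att E bs [0, 3, 5] t" "E a p" "\<not> E q a" "E q k" "E a t"
  shows False
  using assms[unfolded bs_def] K3[of v1 a k] K3[of p q k] K3[of a p t] K3[of v0 q t] H[of v2 v1 k t v4 p] H[of p v4 v3 t v1 k] H[of v0 q v3 v2 a p]
  by (auto simp: base att_simps commute)

lemma W4_W_W:
  assumes "att E bs [4] a" "att E bs [1] p" "att E bs [2, 5] q" "att E bs [2, 5] t" "E a p" "\<not> E a q" "E a t"
  shows False
  using assms[unfolded bs_def] K3[of a p t] K3[of v2 q t] H[of p q v2 t v0 v4] H[of v0 v4 a p v2 q]
  by (auto simp: base att_simps commute)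

lemma W4_W_V_1:
  assumes "att E bs [4] a" "att E bs [1] p" "att E bs [0, 2, 5] q" "att E bs [4] k" "E a p" "E q a" "\<not> E q k"
  shows False
  using assms[unfolded bs_def] K3[of v4 a k] K3[of a p q] H[of v0 q v2 v3 p k] H[of p v1 v2 q v4 k]
  by (auto simp: base att_simps commute)

lemma W4_W_V_2:
  assumes "att E bs [4] a" "att E bs [1] p" "att E bs [0, 2, 5] q" "att E bs [4] k" "att E bs [0, 2, 5] t" "E a p" "\<not> E q a" "E q k" "E a t"
  shows False
  using assms[unfolded bs_def] K3[of v4 a k] K3[of p q k] K3[of a p t] K3[of v0 q t] H[of v3 v4 k t v1 p] H[of p v1 v2 t v4 k] H[of v0 q v2 v3 a p]
  by (auto simp: base att_simps commute)

text \<open>Entries are directed: the first class does not distinguish vertices of the second. The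
  direction chosen is the one that P2+P4 excludes.\<close>

definition NM :: "(nat list \<times> nat list) list" where
  "NM = [([], []), ([], [0]), ([], [1]), ([], [1, 3]), ([], [4]), ([], [2, 4]), ([], [5]), ([], [2, 5]), ([], [3, 5]), ([], [0, 2, 6]), ([], [0, 3, 6]), ([], [1, 3, 6]), ([], [1, 4, 6]), ([], [2, 4, 6]), ([0], [1]), ([0], [1, 3]), ([0], [4]), ([1, 4], [0]), ([0], [2, 4]), ([0], [5]), ([0], [2, 5]), ([0], [3, 5]), ([0], [1, 3, 6]), ([0], [1, 4, 6]), ([0], [2, 4, 6]), ([1], [2, 4]), ([1], [5]), ([1], [2, 5]), ([0, 2, 5], [1]), ([1], [0, 2, 6]), ([1], [0, 3, 6]), ([1], [2, 4, 6]), ([1, 3], [4]), ([1, 3], [2, 4]), ([1, 3], [2, 5]), ([1, 3], [0, 2, 5]), ([1, 3], [0, 2, 6]), ([1, 3], [2, 4, 6]), ([4], [5]), ([4], [3, 5]), ([0, 3, 5], [4]), ([4], [0, 2, 6]), ([4], [0, 3, 6]), ([4], [1, 3, 6]), ([1, 4], [5]), ([1, 4], [0, 2, 6]), ([1, 4], [0, 3, 6]), ([2, 4], [3, 5]), ([2, 4], [0, 3, 5]), ([2, 4], [0, 3, 6]), ([2, 4], [1, 3, 6]), ([5], [0, 2, 6]), ([5], [0, 3, 6]), ([5], [1, 3, 6]), ([5], [1, 4, 6]), ([5], [2, 4, 6]), ([2, 5], [0, 3, 6]), ([2, 5], [1, 3, 6]), ([2, 5], [1, 4, 6]), ([0, 2,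 5], [1, 3, 6]), ([0, 2, 5], [1, 4, 6]), ([3, 5], [0, 2, 6]), ([3, 5], [1, 4, 6]), ([3, 5], [2, 4, 6]), ([0, 3, 5], [1, 4, 6]), ([0, 3, 5], [2, 4, 6])]"

lemma NM_nonmid:
  assumes IJ: "(I, J) \<in> set NM"
  shows "nonmid E bs V I J"
proof -
  have n0: "nonmid E bs V [] []"
  proof (rule nonmidI)
    fix a b t assume "att E bs [] a" "att E bs [] b" "att E bs [] t" "E a b" "\<not> E a t"
    then show False unfolding bs_def using H[of v0 v1 v2 v3 a b] by (auto simp: base att_simps commute)
  qed
  have n1: "nonmid E bs V [] [0]"
  proof (rule nonmidI)
    fix a b t assume "att E bs [] a" "att E bs [0] b" "att E bs [0] t" "E a b" "\<not> E a t"
    then show False unfolding bs_def using H[of v1 v2 v3 v4 a b] by (auto simp: base att_simps commute)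
  qed
  have n2: "nonmid E bs V [] [1]"
  proof (rule nonmidI)
    fix a b t assume "att E bs [] a" "att E bs [1] b" "att E bs [1] t" "E a b" "\<not> E a t"
    then show False unfolding bs_def using H[of v0 v4 v3 v2 a b] by (auto simp: base att_simps commute)
  qed
  have n3: "nonmid E bs V [] [1, 3]"
  proof (rule nonmidI)
    fix a b t assume "att E bs [] a" "att E bs [1, 3] b" "att E bs [1, 3] t" "E a b" "\<not> E a t"
    then show False unfolding bs_def using H[of v0 v4 h g a b] by (auto simp: base att_simps commute)
  qed
  have n4: "nonmid E bs V [] [4]"
  proof (rule nonmidI)
    fix a b t assume "att E bs [] a" "att E bs [4] b" "att E bs [4] t" "E a b" "\<not> E a t"
    then show False unfolding bs_def using H[of v0 v1 v2 v3 a b] by (auto simp: base att_simps commute)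
  qed
  have n5: "nonmid E bs V [] [2, 4]"
  proof (rule nonmidI)
    fix a b t assume "att E bs [] a" "att E bs [2, 4] b" "att E bs [2, 4] t" "E a b" "\<not> E a t"
    then show False unfolding bs_def using H[of v0 v1 h g a b] by (auto simp: base att_simps commute)
  qed
  have n6: "nonmid E bs V [] [5]"
  proof (rule nonmidI)
    fix a b t assume "att E bs [] a" "att E bs [5] b" "att E bs [5] t" "E a b" "\<not> E a t"
    then show False unfolding bs_def using H[of v0 v1 v2 v3 a b] by (auto simp: base att_simps commute)
  qed
  have n7: "nonmid E bs V [] [2, 5]"
  proof (rule nonmidI)
    fix a b t assume "att E bs [] a" "att E bs [2, 5] b" "att E bs [2, 5] t" "E a b" "\<not> E a t"
    then show False unfolding bs_def using H[of v1 v0 v4 v3 a b] by (auto simp: base att_simps commute)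
  qed
  have n8: "nonmid E bs V [] [3, 5]"
  proof (rule nonmidI)
    fix a b t assume "att E bs [] a" "att E bs [3, 5] b" "att E bs [3, 5] t" "E a b" "\<not> E a t"
    then show False unfolding bs_def using H[of v2 v1 v0 v4 a b] by (auto simp: base att_simps commute)
  qed
  have n9: "nonmid E bs V [] [0, 2, 6]"
  proof (rule nonmidI)
    fix a b t assume "att E bs [] a" "att E bs [0, 2, 6] b" "att E bs [0, 2, 6] t" "E a b" "\<not> E a t"
    then show False unfolding bs_def using H[of v1 h v4 v3 a b] by (auto simp: base att_simps commute)
  qed
  have n10: "nonmid E bs V [] [0, 3, 6]"
  proof (rule nonmidI)
    fix a b t assume "att E bs [] a" "att E bs [0, 3, 6] b" "att E bs [0, 3, 6] t" "E a b" "\<not> E a t"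
    then show False unfolding bs_def using H[of v2 v1 h v4 a b] by (auto simp: base att_simps commute)
  qed
  have n11: "nonmid E bs V [] [1, 3, 6]"
  proof (rule nonmidI)
    fix a b t assume "att E bs [] a" "att E bs [1, 3, 6] b" "att E bs [1, 3, 6] t" "E a b" "\<not> E a t"
    then show False unfolding bs_def using K3[of v1 b t] H[of a b g t v0 v4] by (auto simp: base att_simps commute)
  qed
  have n12: "nonmid E bs V [] [1, 4, 6]"
  proof (rule nonmidI)
    fix a b t assume "att E bs [] a" "att E bs [1, 4, 6] b" "att E bs [1, 4, 6] t" "E a b" "\<not> E a t"
    then show False unfolding bs_def using H[of h g b a v2 v3] by (auto simp: base att_simps commute)
  qed
  have n13: "nonmid E bs V [] [2, 4, 6]"
  proof (rule nonmidI)
    fix a b t assume "att E bs [] a" "att E bs [2, 4, 6] b" "att E bs [2, 4, 6] t" "E a b" "\<not> E a t"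
    then show False unfolding bs_def using K3[of v2 b t] H[of a b g t v0 v1] by (auto simp: base att_simps commute)
  qed
  have n14: "nonmid E bs V [0] [1]"
  proof (rule nonmidI)
    fix a b t assume "att E bs [0] a" "att E bs [1] b" "att E bs [1] t" "E a b" "\<not> E a t"
    then show False unfolding bs_def using H[of v2 v3 v4 h a b] by (auto simp: base att_simps commute)
  qed
  have n15: "nonmid E bs V [0] [1, 3]"
  proof (rule nonmidI)
    fix a b t assume "att E bs [0] a" "att E bs [1, 3] b" "att E bs [1, 3] t" "E a b" "\<not> E a t"
    then show False unfolding bs_def using H[of v0 a b v3 h g] by (auto simp: base att_simps commute)
  qed
  have n16: "nonmid E bs V [0] [4]"
  proof (rule nonmidI)
    fix a b t assume "att E bs [0] a" "att E bs [4] b" "att E bs [4] t" "E a b" "\<not> E a t"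
    then show False unfolding bs_def using H[of v2 v1 h g a b] by (auto simp: base att_simps commute)
  qed
  have n17: "nonmid E bs V [1, 4] [0]"
  proof (rule nonmidI)
    fix a b t assume "att E bs [1, 4] a" "att E bs [0] b" "att E bs [0] t" "E a b" "\<not> E a t"
    then show False unfolding bs_def using K3[of v0 b t] H[of a b v0 t v2 v3] by (auto simp: base att_simps commute)
  qed
  have n18: "nonmid E bs V [0] [2, 4]"
  proof (rule nonmidI)
    fix a b t assume "att E bs [0] a" "att E bs [2, 4] b" "att E bs [2, 4] t" "E a b" "\<not> E a t"
    then show False unfolding bs_def using H[of v0 a b v2 h g] by (auto simp: base att_simps commute)
  qed
  have n19: "nonmid E bs V [0] [5]"
  proof (rule nonmidI)
    fix a b t assume "att E bs [0] a" "att E bs [5] b" "att E bs [5] t" "E a b" "\<not> E a t"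
    then show False unfolding bs_def using H[of v0 a b h v2 v3] by (auto simp: base att_simps commute)
  qed
  have n20: "nonmid E bs V [0] [2, 5]"
  proof (rule nonmidI)
    fix a b t assume "att E bs [0] a" "att E bs [2, 5] b" "att E bs [2, 5] t" "E a b" "\<not> E a t"
    then show False unfolding bs_def using H[of v2 t h g v0 a] by (auto simp: base att_simps commute)
  qed
  have n21: "nonmid E bs V [0] [3, 5]"
  proof (rule nonmidI)
    fix a b t assume "att E bs [0] a" "att E bs [3, 5] b" "att E bs [3, 5] t" "E a b" "\<not> E a t"
    then show False unfolding bs_def using H[of v2 v3 t h v0 a] by (auto simp: base att_simps commute)
  qed
  have n22: "nonmid E bs V [0] [1, 3, 6]"
  proof (rule nonmidI)
    fix a b t assume "att E bs [0] a" "att E bs [1, 3, 6] b" "att E bs [1, 3, 6] t" "E a b" "\<not> E a t"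
    then show False unfolding bs_def using H[of v2 v3 t g v0 a] by (auto simp: base att_simps commute)
  qed
  have n23: "nonmid E bs V [0] [1, 4, 6]"
  proof (rule nonmidI)
    fix a b t assume "att E bs [0] a" "att E bs [1, 4, 6] b" "att E bs [1, 4, 6] t" "E a b" "\<not> E a t"
    then show False unfolding bs_def using H[of v0 a b g v2 v3] by (auto simp: base att_simps commute)
  qed
  have n24: "nonmid E bs V [0] [2, 4, 6]"
  proof (rule nonmidI)
    fix a b t assume "att E bs [0] a" "att E bs [2, 4, 6] b" "att E bs [2, 4, 6] t" "E a b" "\<not> E a t"
    then show False unfolding bs_def using H[of v2 t g h v0 a] by (auto simp: base att_simps commute)
  qed
  have n25: "nonmid E bs V [1] [2, 4]"
  proof (rule nonmidI)
    fix a b t assume "att E bs [1] a" "att E bs [2, 4] b" "att E bs [2, 4] t" "E a b" "\<not> E a t"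
    then show False unfolding bs_def using H[of v3 v2 b a h g] by (auto simp: base att_simps commute)
  qed
  have n26: "nonmid E bs V [1] [5]"
  proof (rule nonmidI)
    fix a b t assume "att E bs [1] a" "att E bs [5] b" "att E bs [5] t" "E a b" "\<not> E a t"
    then show False unfolding bs_def using H[of v0 v4 v3 v2 a b] by (auto simp: base att_simps commute)
  qed
  have n27: "nonmid E bs V [1] [2, 5]"
  proof (rule nonmidI)
    fix a b t assume "att E bs [1] a" "att E bs [2, 5] b" "att E bs [2, 5] t" "E a b" "\<not> E a t"
    then show False unfolding bs_def using K3[of v2 b t] H[of a b v2 t v0 v4] by (auto simp: base att_simps commute)
  qed
  have n28: "nonmid E bs V [0, 2, 5] [1]"
  proof (rule nonmidI)
    fix a b t assume "att E bs [0, 2, 5] a" "att E bs [1] b" "att E bs [1] t" "E a b" "\<not> E a t"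
    then show False unfolding bs_def using K3[of v1 b t] H[of a b v1 t v3 v4] by (auto simp: base att_simps commute)
  qed
  have n29: "nonmid E bs V [1] [0, 2, 6]"
  proof (rule nonmidI)
    fix a b t assume "att E bs [1] a" "att E bs [0, 2, 6] b" "att E bs [0, 2, 6] t" "E a b" "\<not> E a t"
    then show False unfolding bs_def using H[of v1 a b g v3 v4] by (auto simp: base att_simps commute)
  qed
  have n30: "nonmid E bs V [1] [0, 3, 6]"
  proof (rule nonmidI)
    fix a b t assume "att E bs [1] a" "att E bs [0, 3, 6] b" "att E bs [0, 3, 6] t" "E a b" "\<not> E a t"
    then show False unfolding bs_def using H[of v4 v3 t g v1 a] by (auto simp: base att_simps commute)
  qed
  have n31: "nonmid E bs V [1] [2, 4, 6]"
  proof (rule nonmidI)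
    fix a b t assume "att E bs [1] a" "att E bs [2, 4, 6] b" "att E bs [2, 4, 6] t" "E a b" "\<not> E a t"
    then show False unfolding bs_def using H[of v3 v4 t g v1 a] by (auto simp: base att_simps commute)
  qed
  have n32: "nonmid E bs V [1, 3] [4]"
  proof (rule nonmidI)
    fix a b t assume "att E bs [1, 3] a" "att E bs [4] b" "att E bs [4] t" "E a b" "\<not> E a t"
    then show False unfolding bs_def using H[of v2 v3 a b h g] by (auto simp: base att_simps commute)
  qed
  have n33: "nonmid E bs V [1, 3] [2, 4]"
  proof (rule nonmidI)
    fix a b t assume "att E bs [1, 3] a" "att E bs [2, 4] b" "att E bs [2, 4] t" "E a b" "\<not> E a t"
    then show False unfolding bs_def using H[of a v3 v2 t h g] by (auto simp: base att_simps commute)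
  qed
  have n34: "nonmid E bs V [1, 3] [2, 5]"
  proof (rule nonmidI)
    fix a b t assume "att E bs [1, 3] a" "att E bs [2, 5] b" "att E bs [2, 5] t" "E a b" "\<not> E a t"
    then show False unfolding bs_def using K3[of v2 b t] H[of a b v2 t v0 v4] by (auto simp: base att_simps commute)
  qed
  have n35: "nonmid E bs V [1, 3] [0, 2, 5]"
  proof (rule nonmidI)
    fix a b t assume "att E bs [1, 3] a" "att E bs [0, 2, 5] b" "att E bs [0, 2, 5] t" "E a b" "\<not> E a t"
    then show False unfolding bs_def using H[of v0 t h g v3 a] by (auto simp: base att_simps commute)
  qed
  have n36: "nonmid E bs V [1, 3] [0, 2, 6]"
  proof (rule nonmidI)
    fix a b t assume "att E bs [1, 3] a" "att E bs [0, 2, 6] b" "att E bs [0, 2, 6] t" "E a b" "\<not> E a t"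
    then show False unfolding bs_def using H[of v0 t g h v3 a] by (auto simp: base att_simps commute)
  qed
  have n37: "nonmid E bs V [1, 3] [2, 4, 6]"
  proof (rule nonmidI)
    fix a b t assume "att E bs [1, 3] a" "att E bs [2, 4, 6] b" "att E bs [2, 4, 6] t" "E a b" "\<not> E a t"
    then show False unfolding bs_def using H[of v0 v1 a v3 g t] by (auto simp: base att_simps commute)
  qed
  have n38: "nonmid E bs V [4] [5]"
  proof (rule nonmidI)
    fix a b t assume "att E bs [4] a" "att E bs [5] b" "att E bs [5] t" "E a b" "\<not> E a t"
    then show False unfolding bs_def using H[of v0 v1 v2 v3 a b] by (auto simp: base att_simps commute)
  qed
  have n39: "nonmid E bs V [4] [3, 5]"
  proof (rule nonmidI)
    fix a b t assume "att E bs [4] a" "att E bs [3, 5] b" "att E bs [3, 5] t" "E a b" "\<not> E a t"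
    then show False unfolding bs_def using K3[of v3 b t] H[of a b v3 t v0 v1] by (auto simp: base att_simps commute)
  qed
  have n40: "nonmid E bs V [0, 3, 5] [4]"
  proof (rule nonmidI)
    fix a b t assume "att E bs [0, 3, 5] a" "att E bs [4] b" "att E bs [4] t" "E a b" "\<not> E a t"
    then show False unfolding bs_def using K3[of v4 b t] H[of a b v4 t v1 v2] by (auto simp: base att_simps commute)
  qed
  have n41: "nonmid E bs V [4] [0, 2, 6]"
  proof (rule nonmidI)
    fix a b t assume "att E bs [4] a" "att E bs [0, 2, 6] b" "att E bs [0, 2, 6] t" "E a b" "\<not> E a t"
    then show False unfolding bs_def using H[of v1 v2 t g v4 a] by (auto simp: base att_simps commute)
  qed
  have n42: "nonmid E bs V [4] [0, 3, 6]"
  proof (rule nonmidI)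
    fix a b t assume "att E bs [4] a" "att E bs [0, 3, 6] b" "att E bs [0, 3, 6] t" "E a b" "\<not> E a t"
    then show False unfolding bs_def using H[of v4 a b g v1 v2] by (auto simp: base att_simps commute)
  qed
  have n43: "nonmid E bs V [4] [1, 3, 6]"
  proof (rule nonmidI)
    fix a b t assume "att E bs [4] a" "att E bs [1, 3, 6] b" "att E bs [1, 3, 6] t" "E a b" "\<not> E a t"
    then show False unfolding bs_def using H[of v2 v1 t g v4 a] by (auto simp: base att_simps commute)
  qed
  have n44: "nonmid E bs V [1, 4] [5]"
  proof (rule nonmidI)
    fix a b t assume "att E bs [1, 4] a" "att E bs [5] b" "att E bs [5] t" "E a b" "\<not> E a t"
    then show False unfolding bs_def using H[of g h b a v2 v3] by (auto simp: base att_simps commute)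
  qed
  have n45: "nonmid E bs V [1, 4] [0, 2, 6]"
  proof (rule nonmidI)
    fix a b t assume "att E bs [1, 4] a" "att E bs [0, 2, 6] b" "att E bs [0, 2, 6] t" "E a b" "\<not> E a t"
    then show False unfolding bs_def using H[of v1 a v4 v3 g t] by (auto simp: base att_simps commute)
  qed
  have n46: "nonmid E bs V [1, 4] [0, 3, 6]"
  proof (rule nonmidI)
    fix a b t assume "att E bs [1, 4] a" "att E bs [0, 3, 6] b" "att E bs [0, 3, 6] t" "E a b" "\<not> E a t"
    then show False unfolding bs_def using H[of v2 v1 a v4 g t] by (auto simp: base att_simps commute)
  qed
  have n47: "nonmid E bs V [2, 4] [3, 5]"
  proof (rule nonmidI)
    fix a b t assume "att E bs [2, 4] a" "att E bs [3, 5] b" "att E bs [3, 5] t" "E a b" "\<not> E a t"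
    then show False unfolding bs_def using K3[of v3 b t] H[of a b v3 t v0 v1] by (auto simp: base att_simps commute)
  qed
  have n48: "nonmid E bs V [2, 4] [0, 3, 5]"
  proof (rule nonmidI)
    fix a b t assume "att E bs [2, 4] a" "att E bs [0, 3, 5] b" "att E bs [0, 3, 5] t" "E a b" "\<not> E a t"
    then show False unfolding bs_def using H[of v0 t h g v2 a] by (auto simp: base att_simps commute)
  qed
  have n49: "nonmid E bs V [2, 4] [0, 3, 6]"
  proof (rule nonmidI)
    fix a b t assume "att E bs [2, 4] a" "att E bs [0, 3, 6] b" "att E bs [0, 3, 6] t" "E a b" "\<not> E a t"
    then show False unfolding bs_def using H[of v0 t g h v2 a] by (auto simp: base att_simps commute)
  qed
  have n50: "nonmid E bs V [2, 4] [1, 3, 6]"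
  proof (rule nonmidI)
    fix a b t assume "att E bs [2, 4] a" "att E bs [1, 3, 6] b" "att E bs [1, 3, 6] t" "E a b" "\<not> E a t"
    then show False unfolding bs_def using H[of v0 v4 a v2 g t] by (auto simp: base att_simps commute)
  qed
  have n51: "nonmid E bs V [5] [0, 2, 6]"
  proof (rule nonmidI)
    fix a b t assume "att E bs [5] a" "att E bs [0, 2, 6] b" "att E bs [0, 2, 6] t" "E a b" "\<not> E a t"
    then show False unfolding bs_def using H[of v0 t v2 v3 h a] by (auto simp: base att_simps commute)
  qed
  have n52: "nonmid E bs V [5] [0, 3, 6]"
  proof (rule nonmidI)
    fix a b t assume "att E bs [5] a" "att E bs [0, 3, 6] b" "att E bs [0, 3, 6] t" "E a b" "\<not> E a t"
    then show False unfolding bs_def using H[of v0 t v3 v2 h a] by (auto simp: base att_simps commute)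
  qed
  have n53: "nonmid E bs V [5] [1, 3, 6]"
  proof (rule nonmidI)
    fix a b t assume "att E bs [5] a" "att E bs [1, 3, 6] b" "att E bs [1, 3, 6] t" "E a b" "\<not> E a t"
    then show False unfolding bs_def using K3[of v1 b t] H[of a b g t v0 v4] by (auto simp: base att_simps commute)
  qed
  have n54: "nonmid E bs V [5] [1, 4, 6]"
  proof (rule nonmidI)
    fix a b t assume "att E bs [5] a" "att E bs [1, 4, 6] b" "att E bs [1, 4, 6] t" "E a b" "\<not> E a t"
    then show False unfolding bs_def using H[of a h g t v2 v3] by (auto simp: base att_simps commute)
  qed
  have n55: "nonmid E bs V [5] [2, 4, 6]"
  proof (rule nonmidI)
    fix a b t assume "att E bs [5] a" "att E bs [2, 4, 6] b" "att E bs [2, 4, 6] t" "E a b" "\<not> E a t"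
    then show False unfolding bs_def using K3[of v2 b t] H[of a b g t v0 v1] by (auto simp: base att_simps commute)
  qed
  have n56: "nonmid E bs V [2, 5] [0, 3, 6]"
  proof (rule nonmidI)
    fix a b t assume "att E bs [2, 5] a" "att E bs [0, 3, 6] b" "att E bs [0, 3, 6] t" "E a b" "\<not> E a t"
    then show False unfolding bs_def using H[of v4 v0 t g v2 a] by (auto simp: base att_simps commute)
  qed
  have n57: "nonmid E bs V [2, 5] [1, 3, 6]"
  proof (rule nonmidI)
    fix a b t assume "att E bs [2, 5] a" "att E bs [1, 3, 6] b" "att E bs [1, 3, 6] t" "E a b" "\<not> E a t"
    then show False unfolding bs_def using H[of v2 a b g v0 v4] by (auto simp: base att_simps commute)
  qed
  have n58: "nonmid E bs V [2, 5] [1, 4, 6]"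
  proof (rule nonmidI)
    fix a b t assume "att E bs [2, 5] a" "att E bs [1, 4, 6] b" "att E bs [1, 4, 6] t" "E a b" "\<not> E a t"
    then show False unfolding bs_def using H[of v0 v4 t g v2 a] by (auto simp: base att_simps commute)
  qed
  have n59: "nonmid E bs V [0, 2, 5] [1, 3, 6]"
  proof (rule nonmidI)
    fix a b t assume "att E bs [0, 2, 5] a" "att E bs [1, 3, 6] b" "att E bs [1, 3, 6] t" "E a b" "\<not> E a t"
    then show False unfolding bs_def using H[of v2 a v0 v4 g t] by (auto simp: base att_simps commute)
  qed
  have n60: "nonmid E bs V [0, 2, 5] [1, 4, 6]"
  proof (rule nonmidI)
    fix a b t assume "att E bs [0, 2, 5] a" "att E bs [1, 4, 6] b" "att E bs [1, 4, 6] t" "E a b" "\<not> E a t"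
    then show False unfolding bs_def using H[of v0 a v2 v3 g t] by (auto simp: base att_simps commute)
  qed
  have n61: "nonmid E bs V [3, 5] [0, 2, 6]"
  proof (rule nonmidI)
    fix a b t assume "att E bs [3, 5] a" "att E bs [0, 2, 6] b" "att E bs [0, 2, 6] t" "E a b" "\<not> E a t"
    then show False unfolding bs_def using H[of v1 v0 t g v3 a] by (auto simp: base att_simps commute)
  qed
  have n62: "nonmid E bs V [3, 5] [1, 4, 6]"
  proof (rule nonmidI)
    fix a b t assume "att E bs [3, 5] a" "att E bs [1, 4, 6] b" "att E bs [1, 4, 6] t" "E a b" "\<not> E a t"
    then show False unfolding bs_def using H[of v0 v1 t g v3 a] by (auto simp: base att_simps commute)
  qed
  have n63: "nonmid E bs V [3, 5] [2, 4, 6]"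
  proof (rule nonmidI)
    fix a b t assume "att E bs [3, 5] a" "att E bs [2, 4, 6] b" "att E bs [2, 4, 6] t" "E a b" "\<not> E a t"
    then show False unfolding bs_def using H[of v3 a b g v0 v1] by (auto simp: base att_simps commute)
  qed
  have n64: "nonmid E bs V [0, 3, 5] [1, 4, 6]"
  proof (rule nonmidI)
    fix a b t assume "att E bs [0, 3, 5] a" "att E bs [1, 4, 6] b" "att E bs [1, 4, 6] t" "E a b" "\<not> E a t"
    then show False unfolding bs_def using H[of v0 a v3 v2 g t] by (auto simp: base att_simps commute)
  qed
  have n65: "nonmid E bs V [0, 3, 5] [2, 4, 6]"
  proof (rule nonmidI)
    fix a b t assume "att E bs [0, 3, 5] a" "att E bs [2, 4, 6] b" "att E bs [2, 4, 6] t" "E a b" "\<not> E a t"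
    then show False unfolding bs_def using H[of v1 v0 a v3 g t] by (auto simp: base att_simps commute)
  qed
  show ?thesis
    using IJ n0 n1 n2 n3 n4 n5 n6 n7 n8 n9 n10 n11 n12 n13 n14 n15 n16 n17 n18 n19 n20 n21 n22 n23 n24 n25 n26 n27 n28 n29 n30 n31 n32 n33 n34 n35 n36 n37 n38 n39 n40 n41 n42 n43 n44 n45 n46 n47 n48 n49 n50 n51 n52 n53 n54 n55 n56 n57 n58 n59 n60 n61 n62 n63 n64 n65
    unfolding NM_def list.set insert_iff empty_iff prod.inject by (elim disjE conjE FalseE; simp only:)
qed

definition Ms :: "nat list list" where
  "Ms = [[], [0], [1], [1, 3], [4], [1, 4], [2, 4], [5], [2, 5], [0, 2, 5], [3, 5], [0, 3, 5], [0, 2, 6], [0, 3, 6], [1, 3, 6], [1, 4, 6], [2, 4, 6]]"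

text \<open>The fourteen pairs of classes that remain undetermined after \<open>NM\<close> and
  common base neighbours; the worlds are designed around exactly these.\<close>

definition cand :: "(nat list \<times> nat list) list" where
  "cand = [([], [1, 4]), ([], [0, 2, 5]), ([], [0, 3, 5]), ([1, 4], [0, 2, 5]), ([1, 4], [0, 3, 5]), ([1, 4], [2, 5]), ([1, 4], [3, 5]), ([1], [3, 5]), ([1], [0, 3, 5]), ([1], [4]), ([4], [2, 5]), ([4], [0, 2, 5]), ([5], [1, 3]), ([5], [2, 4])]"

lemma table: "\<forall>I\<in>set Ms. \<forall>J\<in>set Ms. (\<exists>i\<in>set [0..<7]. i \<in> set I \<and> i \<in> set J) \<or> (I, J) \<in> set NM \<or> (J, I) \<in> set NM \<or> (I, J) \<in> set cand \<or> (J, I) \<in> set cand"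
  unfolding Ms_def NM_def cand_def by code_simp

lemma mask: "\<exists>I\<in>set Ms. att E bs I x"
proof -
  have i: "\<not> E x v0 \<or> \<not> E x v1" "\<not> E x v1 \<or> \<not> E x v2" "\<not> E x v2 \<or> \<not> E x v3" "\<not> E x v3 \<or> \<not> E x v4" "\<not> E x v4 \<or> \<not> E x v0"
    "\<not> E x h \<or> \<not> E x v1" "\<not> E x h \<or> \<not> E x v4" "\<not> E x h \<or> \<not> E x g"
    using K3[of x v0 v1] K3[of x v1 v2] K3[of x v2 v3] K3[of x v3 v4] K3[of x v0 v4] K3[of x h v1] K3[of x h v4] K3[of x g h] base by blast+
  have b: "\<not> att E bs [2] x" "\<not> att E bs [0, 2] x" "\<not> att E bs [3] x" "\<not> att E bs [0, 3] x" "\<not> att E bs [0, 5] x" "\<not> att E bs [6] x" "\<not> att E bs [0, 6] x" "\<not> att E bs [1, 6] x" "\<not> att E bs [2, 6] x" "\<not> att E bs [3, 6] x" "\<not> att E bs [4, 6] x"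
    using mask_bad_0[of x] mask_bad_1[of x] mask_bad_2[of x] mask_bad_3[of x] mask_bad_4[of x] mask_bad_5[of x] mask_bad_6[of x] mask_bad_7[of x] mask_bad_8[of x] mask_bad_9[of x] mask_bad_10[of x] by blast+
  \<comment> \<open>Triangle-freeness alone leaves 28 attachments to the seven base vertices.
    Removing the eleven impossible ones gives the 17 classes of \<open>Ms\<close>.\<close>
  have "\<exists>I\<in>set (Ms @ [[2], [0, 2], [3], [0, 3], [0, 5], [6], [0, 6], [1, 6], [2, 6], [3, 6], [4, 6]]). att E bs I x"
  proof (cases "E x h")
    case True
    then have "\<not> E x v1" "\<not> E x v4" "\<not> E x g" using i by simp_all
    then show ?thesis using True i(1-5) unfolding bs_def Ms_def
      by (cases "E x v0"; cases "E x v2"; cases "E x v3"; simp add: att_simps)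
  next
    case False
    show ?thesis
    proof (cases "E x g")
      case True
      then show ?thesis using False i(1-5) unfolding bs_def Ms_def
        by (cases "E x v0"; cases "E x v1"; simp; cases "E x v2"; cases "E x v3"; cases "E x v4"; simp add: att_simps)
    next
      case gF: False
      then show ?thesis using False i(1-5) unfolding bs_def Ms_def
        by (cases "E x v0"; cases "E x v1"; simp; cases "E x v2"; cases "E x v3"; cases "E x v4"; simp add: att_simps)
    qed
  qed
  then show ?thesis using b unfolding set_append list.set bex_Un by blast
qed

text \<open>Vertices without neighbours in the base, together with the adjacent vertices attached like \<open>v0\<close>, \<open>v1\<close>
  or \<open>v4\<close>, fall into blocks: across two blocks and within a block adjacency depends only on the classes. The
  sets \<open>B0\<close>, \<open>B1\<close>, \<open>B2\<close> read off the vertices attached like \<open>v0\<close> in the block of a given vertex.\<close>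

lemma pendant_decomposable:
  assumes fin: "finite V"
  shows "bounded_decomposable (palette 7) E V"
proof -
  define m where "m x = (SOME I. I \<in> set Ms \<and> att E bs I x)" for x
  have m: "m x \<in> set Ms" "att E bs (m x) x" for x
  proof -
    have "\<exists>I. I \<in> set Ms \<and> att E bs I x" using mask by blast
    from someI_ex[OF this] show "m x \<in> set Ms" "att E bs (m x) x" unfolding m_def by blast+
  qed
  have mI: "att E bs I x" if "m x = I" for x I using m(2)[of x] that by simp
  define nbr where "nbr x I \<longleftrightarrow> (\<exists>s\<in>V. att E bs I s \<and> E x s)" for x I
  define non where "non x I \<longleftrightarrow> (\<exists>s\<in>V. att E bs I s \<and> \<not> E x s)" for x I
  have mid: "nbr x (m y)" "non x (m y)" if md: "mid E bs V x y" for x y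
  proof -
    obtain s t where st: "s \<in> V" "t \<in> V" "map (E s) bs = map (E y) bs" "map (E t) bs = map (E y) bs" "E x s" "\<not> E x t"
      using md unfolding mid_def by blast
    have "att E bs (m y) s" "att E bs (m y) t" using st(3,4) m(2)[of y] by (simp_all add: att_def del: map_eq_conv)
    then show "nbr x (m y)" "non x (m y)" using st unfolding nbr_def non_def by blast+
  qed
  define B0 where "B0 x = {p \<in> V. att E bs [1, 4] p \<and> E x p}" for x
  define B1 where "B1 x = {p \<in> V. att E bs [1, 4] p \<and> (\<exists>c\<in>V. att E bs [] c \<and> E x c \<and> E p c)}" for x
  define B2 where "B2 x = {p \<in> V. att E bs [1, 4] p \<and> \<not> E x p}" for x
  define w :: "'a \<Rightarrow> nat \<times> 'a set" where "w x =
    (if m x = [] then (if nbr x [1, 4] then (1, B0 x) else (2, {}))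
     else if m x = [1, 4] then (if nbr x [] then (1, B1 x) else (0, {}))
     else if m x = [0, 2, 5] \<or> m x = [0, 3, 5] then (if nbr x [] then (if non x [1, 4] then (1, B2 x) else (2, {})) else (0, {}))
     else if m x = [1] then (if nbr x [4] then (3, {}) else (0, {}))
     else if m x = [4] then (if nbr x [1] then (3, {}) else (0, {}))
     else if m x = [2, 5] \<or> m x = [3, 5] then (0, {})
     else if m x = [5] then (if nbr x [1, 3] \<and> non x [1, 3] then (4, {}) else (5, {}))
     else if m x = [1, 3] then (4, {})
     else if m x = [2, 4] then (5, {})
     else (6, {}))" for x
  have mc: "m x = m x'" if c: "colour E bs V x = colour E bs V x'" for x x'
    by (simp only: m_def colour_att[OF c])
  have nn: "\<not> E x y" if "i \<in> set (m x)" "i \<in> set (m y)" "i < 7" for x y i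
  proof
    assume e: "E x y"
    have "E x (bs ! i)" "E y (bs ! i)" using att_nth[OF m(2)] that by (simp_all add: bs_def)
    then show False using K3[of x y "bs ! i"] e by blast
  qed
  have mutual: "(m x, m y) \<in> set cand \<or> (m y, m x) \<in> set cand" if xy: "x \<in> V" "y \<in> V" "mid E bs V x y" "mid E bs V y x" for x y
  proof -
    consider i where "i < 7" "i \<in> set (m x)" "i \<in> set (m y)" | "(m x, m y) \<in> set NM" | "(m y, m x) \<in> set NM" | "(m x, m y) \<in> set cand \<or> (m y, m x) \<in> set cand"
      using table[rule_format, OF m(1)[of x] m(1)[of y]] by auto
    then show ?thesis
    proof cases
      case 1
      then have "nonmid E bs V (m x) (m y)" by (intro nonmid_common[of i]) (simp_all add: bs_def)
      then show ?thesis using nonmid_not_mid[OF _ xy(1) m(2) m(2)] xy by blast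
    next
      case 2 then show ?thesis using nonmid_not_mid[OF NM_nonmid xy(1) m(2) m(2)] xy by blast
    next
      case 3 then show ?thesis using nonmid_not_mid[OF NM_nonmid xy(2) m(2) m(2)] xy by blast
    qed
  qed
  \<comment> \<open>By \<open>V0_Z_bic\<close> the neighbourhood of \<open>x\<close> in the class of
    \<open>v0\<close> is the whole side of a complete bipartite component, so it coincides with the
    set computed from \<open>y\<close>.\<close>
  have ZV0: "w x = w y" if x: "x \<in> V" "m x = []" and y: "y \<in> V" "m y = [1, 4]" and e: "E x y" for x y
  proof -
    have "B0 x = B1 y"
    proof (intro subset_antisym subsetI)
      fix p assume "p \<in> B0 x" then show "p \<in> B1 y" using mI[OF x(2)] x(1) e commute unfolding B0_def B1_def by blast
    next
      fix p assume "p \<in> B1 y"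
      then obtain c where p: "p \<in> V" "att E bs [1, 4] p" and c: "att E bs [] c" "E y c" "E p c" unfolding B1_def by blast
      have "E p x" using V0_Z_bic[OF mI[OF y(2)] p(2) c(1) mI[OF x(2)] c(2,3)] e commute by blast
      then show "p \<in> B0 x" using p commute unfolding B0_def by blast
    qed
    moreover have "nbr x [1, 4]" "nbr y []" using x y e mI commute unfolding nbr_def by blast+
    ultimately show ?thesis using x(2) y(2) by (simp add: w_def)
  qed
  have ZV1: "w x = w y" if x: "x \<in> V" "m x = []" and y: "y \<in> V" "m y = [0, 2, 5]" and e: "E x y" for x y
  proof -
    have ny: "nbr y []" using x y e mI commute unfolding nbr_def by blast
    have t: "E p x" if "att E bs [1, 4] p" "\<not> E p y" for p
      using V0_V1_Z[OF that(1) mI[OF x(2)] mI[OF y(2)] _ that(2)] e commute by blast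
    have k: "\<not> E p y" if "E p x" for p using K3[of p x y] that e by blast
    show ?thesis
    proof (cases "non y [1, 4]")
      case True
      then have "nbr x [1, 4]" using t commute unfolding nbr_def non_def by blast
      moreover have "B0 x = B2 y" using t k commute unfolding B0_def B2_def by blast
      ultimately show ?thesis using True ny x(2) y(2) by (simp add: w_def)
    next
      case False
      then have "\<not> nbr x [1, 4]" using k commute unfolding nbr_def non_def by blast
      then show ?thesis using False ny x(2) y(2) by (simp add: w_def)
    qed
  qed
  \<comment> \<open>Non-adjacent \<open>x\<close> and \<open>y\<close> have the same neighbours in
    \<open>Z\<close>. Every member of the block of \<open>x\<close> shares such a neighbour with
    \<open>y\<close> and so is not adjacent to \<open>y\<close>; conversely a non-neighbour of
    \<open>y\<close> inherits its neighbours in \<open>Z\<close>.\<close>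
  have V0V1: "w x = w y" if x: "x \<in> V" "m x = [1, 4]" and y: "y \<in> V" "m y = [0, 2, 5]" and e: "\<not> E x y" for x y
  proof (cases "nbr x []")
    case True
    have t: "E c y" if "att E bs [] c" "E x c" for c
      using V0_Z_V1[OF mI[OF x(2)] that(1) mI[OF y(2)] that(2) e] by blast
    have ny: "nbr y []" using True t commute unfolding nbr_def by blast
    have nony: "non y [1, 4]" using x mI e commute unfolding non_def by blast
    obtain c where c: "c \<in> V" "att E bs [] c" "E x c" using True unfolding nbr_def by blast
    have "B1 x = B2 y"
    proof (intro subset_antisym subsetI)
      fix p assume "p \<in> B1 x"
      then obtain c' where p: "p \<in> V" "att E bs [1, 4] p" and c': "att E bs [] c'" "E x c'" "E p c'" unfolding B1_def by blast
      then have "\<not> E p y" using t[of c'] K3[of p c' y] by blast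
      then show "p \<in> B2 y" using p commute unfolding B2_def by blast
    next
      fix p assume "p \<in> B2 y"
      then have p: "p \<in> V" "att E bs [1, 4] p" "\<not> E p y" using commute unfolding B2_def by blast+
      have "E y c" using t[OF c(2,3)] commute by blast
      then have "E p c" using V0_V1_Z[OF p(2) c(2) mI[OF y(2)] _ p(3)] by blast
      then show "p \<in> B1 x" using p c unfolding B1_def by blast
    qed
    then show ?thesis using True ny nony x(2) y(2) by (simp add: w_def)
  next
    case False
    have "\<not> nbr y []"
    proof
      assume "nbr y []"
      then obtain c where c: "c \<in> V" "att E bs [] c" "E y c" unfolding nbr_def by blast
      then have "E x c" using V0_V1_Z[OF mI[OF x(2)] c(2) mI[OF y(2)] _ e] by blast
      then show False using False c unfolding nbr_def by blast
    qed
    then show ?thesis using False x(2) y(2) by (simp add: w_def)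
  qed
  have ZV4: "w x = w y" if x: "x \<in> V" "m x = []" and y: "y \<in> V" "m y = [0, 3, 5]" and e: "E x y" for x y
  proof -
    have ny: "nbr y []" using x y e mI commute unfolding nbr_def by blast
    have t: "E p x" if "att E bs [1, 4] p" "\<not> E p y" for p
      using V0_V4_Z[OF that(1) mI[OF x(2)] mI[OF y(2)] _ that(2)] e commute by blast
    have k: "\<not> E p y" if "E p x" for p using K3[of p x y] that e by blast
    show ?thesis
    proof (cases "non y [1, 4]")
      case True
      then have "nbr x [1, 4]" using t commute unfolding nbr_def non_def by blast
      moreover have "B0 x = B2 y" using t k commute unfolding B0_def B2_def by blast
      ultimately show ?thesis using True ny x(2) y(2) by (simp add: w_def)
    next
      case False
      then have "\<not> nbr x [1, 4]" using k commute unfolding nbr_def non_def by blast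
      then show ?thesis using False ny x(2) y(2) by (simp add: w_def)
    qed
  qed
  have V0V4: "w x = w y" if x: "x \<in> V" "m x = [1, 4]" and y: "y \<in> V" "m y = [0, 3, 5]" and e: "\<not> E x y" for x y
  proof (cases "nbr x []")
    case True
    have t: "E c y" if "att E bs [] c" "E x c" for c
      using V0_Z_V4[OF mI[OF x(2)] that(1) mI[OF y(2)] that(2) e] by blast
    have ny: "nbr y []" using True t commute unfolding nbr_def by blast
    have nony: "non y [1, 4]" using x mI e commute unfolding non_def by blast
    obtain c where c: "c \<in> V" "att E bs [] c" "E x c" using True unfolding nbr_def by blast
    have "B1 x = B2 y"
    proof (intro subset_antisym subsetI)
      fix p assume "p \<in> B1 x"
      then obtain c' where p: "p \<in> V" "att E bs [1, 4] p" and c': "att E bs [] c'" "E x c'" "E p c'" unfolding B1_def by blast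
      then have "\<not> E p y" using t[of c'] K3[of p c' y] by blast
      then show "p \<in> B2 y" using p commute unfolding B2_def by blast
    next
      fix p assume "p \<in> B2 y"
      then have p: "p \<in> V" "att E bs [1, 4] p" "\<not> E p y" using commute unfolding B2_def by blast+
      have "E y c" using t[OF c(2,3)] commute by blast
      then have "E p c" using V0_V4_Z[OF p(2) c(2) mI[OF y(2)] _ p(3)] by blast
      then show "p \<in> B1 x" using p c unfolding B1_def by blast
    qed
    then show ?thesis using True ny nony x(2) y(2) by (simp add: w_def)
  next
    case False
    have "\<not> nbr y []"
    proof
      assume "nbr y []"
      then obtain c where c: "c \<in> V" "att E bs [] c" "E y c" unfolding nbr_def by blast
      then have "E x c" using V0_V4_Z[OF mI[OF x(2)] c(2) mI[OF y(2)] _ e] by blast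
      then show False using False c unfolding nbr_def by blast
    qed
    then show ?thesis using False x(2) y(2) by (simp add: w_def)
  qed
  \<comment> \<open>Pairs inside blocks leave only one possible adjacency across worlds: a vertex of
    class \<open>[]\<close> is not adjacent, and the others are adjacent. All remaining pairs of
    \<open>cand\<close> would force equal worlds, so they do not occur here.\<close>
  have cross: "E x y \<longleftrightarrow> m x \<noteq> [] \<and> m y \<noteq> []" if xy: "x \<in> V" "y \<in> V" "w x \<noteq> w y" "mid E bs V x y" "mid E bs V y x" "(m x, m y) \<in> set cand" for x y
  proof -
    have md: "nbr x (m y)" "non x (m y)" "nbr y (m x)" "non y (m x)" using mid[OF xy(4)] mid[OF xy(5)] by simp_all
    show ?thesis
      using xy(6) unfolding cand_def list.set insert_iff empty_iff prod.inject
    proof (elim disjE conjE FalseE)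
      assume q: "m x = []" "m y = [1, 4]"
      note ix = mI[OF q(1)] and iy = mI[OF q(2)]
      show ?thesis using ZV0[OF xy(1) q(1) xy(2) q(2)] xy(3) q by auto
    next
      assume q: "m x = []" "m y = [0, 2, 5]"
      note ix = mI[OF q(1)] and iy = mI[OF q(2)]
      show ?thesis using ZV1[OF xy(1) q(1) xy(2) q(2)] xy(3) q by auto
    next
      assume q: "m x = []" "m y = [0, 3, 5]"
      note ix = mI[OF q(1)] and iy = mI[OF q(2)]
      show ?thesis using ZV4[OF xy(1) q(1) xy(2) q(2)] xy(3) q by auto
    next
      assume q: "m x = [1, 4]" "m y = [0, 2, 5]"
      note ix = mI[OF q(1)] and iy = mI[OF q(2)]
      show ?thesis using V0V1[OF xy(1) q(1) xy(2) q(2)] xy(3) q by auto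
    next
      assume q: "m x = [1, 4]" "m y = [0, 3, 5]"
      note ix = mI[OF q(1)] and iy = mI[OF q(2)]
      show ?thesis using V0V4[OF xy(1) q(1) xy(2) q(2)] xy(3) q by auto
    next
      assume q: "m x = [1, 4]" "m y = [2, 5]"
      note ix = mI[OF q(1)] and iy = mI[OF q(2)]
      have "\<not> nbr x []" using V0_W2[OF ix] md(2)[unfolded q(2)] unfolding nbr_def non_def by blast
      then show ?thesis using xy(3) q by (simp add: w_def)
    next
      assume q: "m x = [1, 4]" "m y = [3, 5]"
      note ix = mI[OF q(1)] and iy = mI[OF q(2)]
      have "\<not> nbr x []" using V0_W3[OF ix] md(2)[unfolded q(2)] unfolding nbr_def non_def by blast
      then show ?thesis using xy(3) q by (simp add: w_def)
    next
      assume q: "m x = [1]" "m y = [3, 5]"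
      note ix = mI[OF q(1)] and iy = mI[OF q(2)]
      have "\<not> nbr x [4]" using W1_W_W[OF ix] md(1,2)[unfolded q(2)] unfolding nbr_def non_def by blast
      then show ?thesis using xy(3) q by (simp add: w_def)
    next
      assume q: "m x = [1]" "m y = [0, 3, 5]"
      note ix = mI[OF q(1)] and iy = mI[OF q(2)]
      have "\<not> nbr x [4]"
      proof
        assume "nbr x [4]"
        then obtain p where p: "att E bs [4] p" "E x p" unfolding nbr_def by blast
        obtain k k' where k: "att E bs [1] k" "E y k" "att E bs [1] k'" "\<not> E y k'" using md(3,4)[unfolded q(1)] unfolding nbr_def non_def by blast
        obtain t where t: "att E bs [0, 3, 5] t" "E x t" using md(1)[unfolded q(2)] unfolding nbr_def by blast
        show False
        proof (cases "E y x")
          case True then show False using W1_W_V_1[OF ix p(1) iy k(3) p(2) _ k(4)] by blast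
        next
          case False then show False using W1_W_V_2[OF ix p(1) iy k(1) t(1) p(2) _ k(2) t(2)] by blast
        qed
      qed
      moreover have "\<not> nbr y []" using V4_W[OF iy] md(4)[unfolded q(1)] unfolding nbr_def non_def by blast
      ultimately show ?thesis using xy(3) q by (simp add: w_def)
    next
      assume q: "m x = [1]" "m y = [4]"
      note ix = mI[OF q(1)] and iy = mI[OF q(2)]
      show ?thesis using xy(3) q md by (simp add: w_def)
    next
      assume q: "m x = [4]" "m y = [2, 5]"
      note ix = mI[OF q(1)] and iy = mI[OF q(2)]
      have "\<not> nbr x [1]" using W4_W_W[OF ix] md(1,2)[unfolded q(2)] unfolding nbr_def non_def by blast
      then show ?thesis using xy(3) q by (simp add: w_def)
    next
      assume q: "m x = [4]" "m y = [0, 2, 5]"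
      note ix = mI[OF q(1)] and iy = mI[OF q(2)]
      have "\<not> nbr x [1]"
      proof
        assume "nbr x [1]"
        then obtain p where p: "att E bs [1] p" "E x p" unfolding nbr_def by blast
        obtain k k' where k: "att E bs [4] k" "E y k" "att E bs [4] k'" "\<not> E y k'" using md(3,4)[unfolded q(1)] unfolding nbr_def non_def by blast
        obtain t where t: "att E bs [0, 2, 5] t" "E x t" using md(1)[unfolded q(2)] unfolding nbr_def by blast
        show False
        proof (cases "E y x")
          case True then show False using W4_W_V_1[OF ix p(1) iy k(3) p(2) _ k(4)] by blast
        next
          case False then show False using W4_W_V_2[OF ix p(1) iy k(1) t(1) p(2) _ k(2) t(2)] by blast
        qed
      qed
      moreover have "\<not> nbr y []" using V1_W[OF iy] md(4)[unfolded q(1)] unfolding nbr_def non_def by blast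
      ultimately show ?thesis using xy(3) q by (simp add: w_def)
    next
      assume q: "m x = [5]" "m y = [1, 3]"
      note ix = mI[OF q(1)] and iy = mI[OF q(2)]
      show ?thesis using xy(3) q md by (simp add: w_def)
    next
      assume q: "m x = [5]" "m y = [2, 4]"
      note ix = mI[OF q(1)] and iy = mI[OF q(2)]
      have "\<not> (nbr x [1, 3] \<and> non x [1, 3])" using X_V2_V3[OF ix] md(1,2)[unfolded q(2)] unfolding nbr_def non_def by blast
      then show ?thesis using xy(3) q by (auto simp: w_def)
    qed
  qed
  have "decomposable E (colour E bs V) V"
  proof (rule colour_worlds[where w = w])
    show "E y x" if "E x y" for x y using that by (rule sym)
  next
    fix x y x' y'
    assume V: "x \<in> V" "y \<in> V" "x' \<in> V" "y' \<in> V" and w: "w x \<noteq> w y" "w x' \<noteq> w y'"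
      and c: "colour E bs V x = colour E bs V x'" "colour E bs V y = colour E bs V y'"
      and md: "mid E bs V x y" "mid E bs V y x"
    have mid_inv: "mid E bs V a b = mid E bs V a' b'" if "colour E bs V a = colour E bs V a'" "colour E bs V b = colour E bs V b'" for a a' b b'
    proof -
      have "mid E bs V u v \<longleftrightarrow> nbr u (m v) \<and> non u (m v)" for u v
      proof
        assume "nbr u (m v) \<and> non u (m v)"
        then obtain s t where st: "s \<in> V" "t \<in> V" "att E bs (m v) s" "att E bs (m v) t" "E u s" "\<not> E u t" unfolding nbr_def non_def by blast
        then have "map (E s) bs = map (E v) bs" "map (E t) bs = map (E v) bs" using m(2)[of v] by (simp_all add: att_def del: map_eq_conv)
        then show "mid E bs V u v" using st unfolding mid_def by blast
      qed (simp add: mid)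
      then show ?thesis by (simp only: nbr_def non_def mc[OF that(1)] mc[OF that(2)] colour_nbr[OF that(1)])
    qed
    have md': "mid E bs V x' y'" "mid E bs V y' x'" using md mid_inv[OF c] mid_inv[OF c(2,1)] by simp_all
    have eq: "E a b \<longleftrightarrow> m a \<noteq> [] \<and> m b \<noteq> []" if "a \<in> V" "b \<in> V" "w a \<noteq> w b" "mid E bs V a b" "mid E bs V b a" for a b
      using mutual[OF that(1,2,4,5)]
    proof
      assume "(m a, m b) \<in> set cand" then show ?thesis by (rule cross[OF that])
    next
      assume "(m b, m a) \<in> set cand"
      then show ?thesis using cross[OF that(2,1) that(3)[symmetric] that(5,4)] commute[of a b] by blast
    qed
    show "E x y = E x' y'" using eq[OF V(1,2) w(1) md] eq[OF V(3,4) w(2) md'] mc[OF c(1)] mc[OF c(2)] by simp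
  next
    fix S u v assume S: "S \<subseteq> V" "u \<in> S" "v \<in> S" "u \<noteq> v" and wu: "\<And>x. x \<in> S \<Longrightarrow> w x = w u"
    have finS: "finite S" using S(1) fin by (rule finite_subset)
    have SV: "x \<in> V" if "x \<in> S" for x using S(1) that by blast
    have bip: "splits E (colour E bs V) S" if "\<And>x y. \<lbrakk>x \<in> S; y \<in> S; Q (m x) = Q (m y)\<rbrakk> \<Longrightarrow> \<not> E x y" for Q :: "nat list \<Rightarrow> bool"
    proof (rule bipartite_splits[OF finS S(2-4), of "\<lambda>x. Q (m x)"])
      show "\<not> E x y" if xy: "x \<in> S" "y \<in> S" "Q (m x) = Q (m y)" for x y using xy by (rule \<open>\<And>x y. \<lbrakk>x \<in> S; y \<in> S; Q (m x) = Q (m y)\<rbrakk> \<Longrightarrow> \<not> E x y\<close>)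
      show "Q (m x) = Q (m y)" if "colour E bs V x = colour E bs V y" for x y using mc[OF that] by simp
    qed
    have cases: "fst (w x) = 0 \<and> (m x \<in> {[1, 4], [4]} \<or> m x = [1] \<and> \<not> nbr x [4] \<or> m x \<in> {[0, 2, 5], [0, 3, 5], [2, 5], [3, 5]}) \<or>
      fst (w x) = 1 \<and> (m x = [] \<and> nbr x [1, 4] \<and> w x = (1, B0 x) \<or> m x = [1, 4] \<and> nbr x [] \<and> w x = (1, B1 x) \<or> m x \<in> {[0, 2, 5], [0, 3, 5]} \<and> w x = (1, B2 x)) \<or>
      fst (w x) = 2 \<and> m x \<in> {[], [0, 2, 5], [0, 3, 5]} \<or> fst (w x) = 3 \<and> m x \<in> {[1], [4]} \<or> fst (w x) = 4 \<and> m x \<in> {[5], [1, 3]} \<or>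
      fst (w x) = 5 \<and> m x \<in> {[5], [2, 4]} \<or> fst (w x) = 6 \<and> m x \<in> {[0], [0, 2, 6], [0, 3, 6], [1, 3, 6], [1, 4, 6], [2, 4, 6]}" for x
      using m(1)[of x] unfolding Ms_def list.set insert_iff empty_iff
      by (elim disjE FalseE) (simp_all add: w_def)
    have ZZ: "\<not> E x y" if "m x = []" "m y = []" for x y using Z_Z[OF mI[OF that(1)] mI[OF that(2)]] by blast
    have "fst (w u) \<in> {0, 1, 2, 3, 4, 5, 6}" using cases[of u] by (elim disjE) simp_all
    then consider "fst (w u) = 0" | "fst (w u) = 1" | "fst (w u) = 2" | "fst (w u) = 3" | "fst (w u) = 4" | "fst (w u) = 5" | "fst (w u) = 6"
      unfolding insert_iff empty_iff by (elim disjE FalseE)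
    then show "splits E (colour E bs V) S"
    proof cases
      case 1
      show ?thesis
      proof (rule bip[of "\<lambda>I. 5 \<in> set I"])
        fix x y assume xy: "x \<in> S" "y \<in> S" "(5 \<in> set (m x)) = (5 \<in> set (m y))"
        have c: "m s \<in> {[1, 4], [4]} \<or> m s = [1] \<and> \<not> nbr s [4] \<or> m s \<in> {[0, 2, 5], [0, 3, 5], [2, 5], [3, 5]}" if "s \<in> S" for s
          using cases[of s] wu[OF that] 1 by simp
        have W: "\<not> E s t" if "s \<in> S" "t \<in> S" "m s = [1]" "m t = [4]" for s t
          using c[OF that(1)] that(3) mI[OF that(4)] SV[OF that(2)] unfolding nbr_def by auto
        show "\<not> E x y"
        proof (cases "5 \<in> set (m x)")
          case True then show ?thesis using nn[of 5 x y] xy by simp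
        next
          case False
          then have "m x \<in> {[1, 4], [4], [1]}" "m y \<in> {[1, 4], [4], [1]}" using c[OF xy(1)] c[OF xy(2)] xy(3) by auto
          then consider "1 \<in> set (m x)" "1 \<in> set (m y)" | "4 \<in> set (m x)" "4 \<in> set (m y)" | "m x = [1]" "m y = [4]" | "m x = [4]" "m y = [1]"
            by (elim insertE emptyE) simp_all
          then show ?thesis using nn[of 1 x y] nn[of 4 x y] W[of x y] W[of y x] xy commute[of x y] by cases simp_all
        qed
      qed
    next
      case 2
      have c: "m s = [] \<and> nbr s [1, 4] \<and> snd (w u) = B0 s \<or> m s = [1, 4] \<and> nbr s [] \<and> snd (w u) = B1 s \<or> m s \<in> {[0, 2, 5], [0, 3, 5]} \<and> snd (w u) = B2 s" if "s \<in> S" for s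
        using cases[of s] wu[OF that] 2 by auto
      have ezp: "E s t" if st: "s \<in> S" "t \<in> S" "m s = []" "m t = [1, 4]" for s t
      proof -
        have "nbr t []" "snd (w u) = B1 t" using c[OF st(2)] st(4) by auto
        then obtain q where "q \<in> V" "att E bs [] q" "E t q" unfolding nbr_def by blast
        then have "t \<in> B1 t" using mI[OF st(4)] SV[OF st(2)] unfolding B1_def by blast
        moreover have "snd (w u) = B0 s" using c[OF st(1)] st(3) by auto
        ultimately have "t \<in> B0 s" using \<open>snd (w u) = B1 t\<close> by simp
        then show ?thesis unfolding B0_def by blast
      qed
      have npy: "\<not> E s t" if st: "s \<in> S" "t \<in> S" "m s \<in> {[0, 2, 5], [0, 3, 5]}" "m t = [1, 4]" for s t
      proof -
        have "nbr t []" "snd (w u) = B1 t" using c[OF st(2)] st(4) by auto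
        then obtain q where "q \<in> V" "att E bs [] q" "E t q" unfolding nbr_def by blast
        then have "t \<in> B1 t" using mI[OF st(4)] SV[OF st(2)] unfolding B1_def by blast
        moreover have "snd (w u) = B2 s" using c[OF st(1)] st(3) unfolding insert_iff empty_iff by (elim disjE conjE FalseE) simp_all
        ultimately have "t \<in> B2 s" using \<open>snd (w u) = B1 t\<close> by simp
        then show ?thesis unfolding B2_def by blast
      qed
      have ezy: "E s t" if st: "s \<in> S" "t \<in> S" "m s = []" "m t \<in> {[0, 2, 5], [0, 3, 5]}" for s t
      proof -
        have n: "nbr s [1, 4]" "snd (w u) = B0 s" using c[OF st(1)] st(3) by auto
        then obtain p where p: "p \<in> V" "att E bs [1, 4] p" "E s p" unfolding nbr_def by blast
        then have "p \<in> B0 s" unfolding B0_def by blast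
        moreover have "snd (w u) = B2 t" using c[OF st(2)] st(4) unfolding insert_iff empty_iff by (elim disjE conjE FalseE) simp_all
        ultimately have "p \<in> B2 t" using n(2) by simp
        then have pt: "\<not> E p t" unfolding B2_def using commute[of p t] by blast
        have ps: "E p s" using p(3) commute[of p s] by blast
        show ?thesis
        proof (rule ccontr)
          assume st': "\<not> E s t"
          from st(4) have "m t = [0, 2, 5] \<or> m t = [0, 3, 5]" by simp
          then show False
          proof
            assume "m t = [0, 2, 5]"
            then show False using V0_Z_V1[OF p(2) mI[OF st(3)] mI ps pt st'] by blast
          next
            assume "m t = [0, 3, 5]"
            then show False using V0_Z_V4[OF p(2) mI[OF st(3)] mI ps pt st'] by blast
          qed
        qed
      qed
      \<comment> \<open>A block is a complete bipartite graph with the vertices of class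
        \<open>[]\<close> on one side: the vertices attached like \<open>v0\<close> are not adjacent
        to those attached like \<open>v1\<close> or \<open>v4\<close>, and all of them see every
        vertex of class \<open>[]\<close>.\<close>
      have det: "E s t \<longleftrightarrow> (m s = []) \<noteq> (m t = [])" if st: "s \<in> S" "t \<in> S" for s t
      proof -
        have t: "m r = [] \<or> m r = [1, 4] \<or> m r \<in> {[0, 2, 5], [0, 3, 5]}" if "r \<in> S" for r
          using c[OF that] by (elim disjE conjE) simp_all
        consider (zz) "m s = []" "m t = []" | (zp) "m s = []" "m t = [1, 4]" | (zy) "m s = []" "m t \<in> {[0, 2, 5], [0, 3, 5]}"
          | (pz) "m s = [1, 4]" "m t = []" | (pp) "m s = [1, 4]" "m t = [1, 4]" | (py) "m s = [1, 4]" "m t \<in> {[0, 2, 5], [0, 3, 5]}"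
          | (yz) "m s \<in> {[0, 2, 5], [0, 3, 5]}" "m t = []" | (yp) "m s \<in> {[0, 2, 5], [0, 3, 5]}" "m t = [1, 4]" | (yy) "m s \<in> {[0, 2, 5], [0, 3, 5]}" "m t \<in> {[0, 2, 5], [0, 3, 5]}"
          using t[OF st(1)] t[OF st(2)] by (elim disjE) simp_all
        then show ?thesis
        proof cases
          case zz then show ?thesis using ZZ[of s t] by simp
        next
          case zp then show ?thesis using ezp[OF st zp] by simp
        next
          case zy
          then have "m t \<noteq> []" by auto
          then show ?thesis using ezy[OF st zy] zy(1) by simp
        next
          case pz then show ?thesis using ezp[OF st(2,1) pz(2,1)] commute[of s t] by simp
        next
          case pp then show ?thesis using nn[of 1 s t] by simp
        next
          case py
          then have "m t \<noteq> []" by auto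
          then show ?thesis using npy[OF st(2,1) py(2,1)] py(1) commute[of s t] by simp
        next
          case yz
          then have "m s \<noteq> []" by auto
          then show ?thesis using ezy[OF st(2,1) yz(2,1)] yz(2) commute[of s t] by simp
        next
          case yp
          then have "m s \<noteq> []" by auto
          then show ?thesis using npy[OF st yp] yp(2) by simp
        next
          case yy
          then have "m s \<noteq> []" "m t \<noteq> []" "5 \<in> set (m s)" "5 \<in> set (m t)" by auto
          then show ?thesis using nn[of 5 s t] by simp
        qed
      qed
      show ?thesis
      proof (rule splits_homogeneous[OF S(2-4)])
        fix s t assume "s \<in> S" "t \<in> S" "colour E bs V s = colour E bs V t"
        then show "E u s = E u t" using det[OF S(2), of s] det[OF S(2), of t] mc[of s t] by simp
      qed
    next
      case 3
      have c: "m s \<in> {[], [0, 2, 5], [0, 3, 5]}" if "s \<in> S" for s using cases[of s] wu[OF that] 3 by simp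
      show ?thesis
      proof (rule bip[of "\<lambda>I. I = []"])
        show "\<not> E x y" if "x \<in> S" "y \<in> S" "(m x = []) = (m y = [])" for x y
          using c[OF that(1)] c[OF that(2)] that(3) ZZ[of x y] nn[of 5 x y] by auto
      qed
    next
      case 4
      have c: "m s \<in> {[1], [4]}" if "s \<in> S" for s using cases[of s] wu[OF that] 4 by simp
      show ?thesis
      proof (rule bip[of "\<lambda>I. I = [1]"])
        show "\<not> E x y" if "x \<in> S" "y \<in> S" "(m x = [1]) = (m y = [1])" for x y
          using c[OF that(1)] c[OF that(2)] that(3) nn[of 1 x y] nn[of 4 x y] by auto
      qed
    next
      case 5
      have c: "m s \<in> {[5], [1, 3]}" if "s \<in> S" for s using cases[of s] wu[OF that] 5 by simp
      show ?thesis
      proof (rule bip[of "\<lambda>I. I = [5]"])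
        show "\<not> E x y" if "x \<in> S" "y \<in> S" "(m x = [5]) = (m y = [5])" for x y
          using c[OF that(1)] c[OF that(2)] that(3) nn[of 5 x y] nn[of 1 x y] by auto
      qed
    next
      case 6
      have c: "m s \<in> {[5], [2, 4]}" if "s \<in> S" for s using cases[of s] wu[OF that] 6 by simp
      show ?thesis
      proof (rule bip[of "\<lambda>I. I = [5]"])
        show "\<not> E x y" if "x \<in> S" "y \<in> S" "(m x = [5]) = (m y = [5])" for x y
          using c[OF that(1)] c[OF that(2)] that(3) nn[of 5 x y] nn[of 2 x y] by auto
      qed
    next
      case 7
      have c: "m s \<in> {[0], [0, 2, 6], [0, 3, 6], [1, 3, 6], [1, 4, 6], [2, 4, 6]}" if "s \<in> S" for s using cases[of s] wu[OF that] 7 by simp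
      \<comment> \<open>No two of these classes form a pair of \<open>cand\<close>, so each pair of
        vertices is settled in one direction and any vertex may be split off.\<close>
      have nm: "\<not> mid E bs V s t \<or> \<not> mid E bs V t s" if st: "s \<in> S" "t \<in> S" for s t
      proof -
        have "\<forall>I\<in>set [[0], [0, 2, 6], [0, 3, 6], [1, 3, 6], [1, 4, 6], [2, 4, 6]]. \<forall>J\<in>set [[0], [0, 2, 6], [0, 3, 6], [1, 3, 6], [1, 4, 6], [2, 4, 6]]. (I, J) \<notin> set cand"
          unfolding cand_def by code_simp
        then have "(m s, m t) \<notin> set cand" "(m t, m s) \<notin> set cand" using c[OF st(1)] c[OF st(2)] unfolding list.set by blast+
        then show ?thesis using mutual[OF SV[OF st(1)] SV[OF st(2)]] by blast
      qed
      show ?thesis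
      proof (rule splits_homogeneous[OF S(2-4)])
        fix s t assume st: "s \<in> S" "t \<in> S" "colour E bs V s = colour E bs V t"
        note b = colour_base[OF st(3)]
        from nm[OF S(2) st(1)] show "E u s = E u t"
        proof
          assume "\<not> mid E bs V u s"
          then show ?thesis by (rule colour_determines[OF refl b SV[OF S(2)] SV[OF st(1)] SV[OF st(2)]])
        next
          assume "\<not> mid E bs V s u"
          then have "E s u = E t u" by (rule colour_determines[OF st(3) refl SV[OF st(1)] SV[OF S(2)] SV[OF S(2)]])
          then show ?thesis using commute by blast
        qed
      qed
    qed
  qed
  from colour_bounded[OF this] show ?thesis by (simp add: bs_def numeral_eq_Suc)
qed

end

end

section \<open>The structure theorems\<close>

context P1_P5_free
begin

text \<open>Without vertices having just one neighbour on a five-cycle, a vertex that sees a cycle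
  vertex also sees another one at distance two. Applied to the given cycle and to the cycle with
  \<open>x\<close> in place of \<open>a\<close>, this transfers adjacency between \<open>a\<close>
  and \<open>x\<close> in both directions.\<close>

lemma C5_twin:
  assumes noW: "\<And>a b c d e u. \<lbrakk>u \<in> V; C5 a b c d e; E u a; \<not> E u c; \<not> E u d\<rbrakk> \<Longrightarrow> False"
    and C: "C5 a b c d e" and x: "E x b" "E x e" and y: "y \<in> V"
  shows "E x y \<longleftrightarrow> E y a"
proof -
  have C': "C5 x b c d e" using C x commute[of e x] by (simp add: C5_def)
  note C1 = C5_rotate[OF C5_rotate[OF C]]
  note C2 = C5_rotate[OF C1]
  note C1' = C5_rotate[OF C5_rotate[OF C']]
  note C2' = C5_rotate[OF C1']
  note ind = C5_induced[OF C] C5_induced[OF C']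
  show ?thesis
  proof
    assume "E x y"
    then have yx: "E y x" by (rule sym)
    have n: "\<not> E y b" "\<not> E y e" using K3[of y x b] K3[of y x e] yx x by blast+
    have "E y c \<or> E y d" using noW[OF y C' yx] by blast
    then show "E y a"
    proof
      assume "E y c" then show ?thesis using noW[OF y C1] n by blast
    next
      assume "E y d" then show ?thesis using noW[OF y C2] n by blast
    qed
  next
    assume ya: "E y a"
    have n: "\<not> E y b" "\<not> E y e" using K3[of y a b] K3[of y a e] ya ind by blast+
    have "E y c \<or> E y d" using noW[OF y C ya] by blast
    then have "E y x"
    proof
      assume "E y c" then show ?thesis using noW[OF y C1'] n by blast
    next
      assume "E y d" then show ?thesis using noW[OF y C2'] n by blast
    qed
    then show "E x y" by (rule sym)
  qed
qed

text \<open>The graph is a blow-up of the five-cycle, so attachment to the cycle determines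
  adjacency. The cycle may lie outside \<open>V\<close>; the vertex \<open>r\<close> ensures that
  \<open>V\<close> touches it at all.\<close>

lemma C5_no_pendant_decomposable:
  assumes C0: "C5 v0 v1 v2 v3 v4"
    and conn: "\<And>A B. \<lbrakk>A \<union> B = V; A \<inter> B = {}; A \<noteq> {}; B \<noteq> {}\<rbrakk> \<Longrightarrow> \<exists>a\<in>A. \<exists>b\<in>B. E a b"
    and r: "r \<in> V" "E r v1"
    and noW: "\<And>a b c d e u. \<lbrakk>u \<in> V; C5 a b c d e; E u a; \<not> E u c; \<not> E u d\<rbrakk> \<Longrightarrow> False"
  shows "bounded_decomposable (palette 5) E V"
proof -
  let ?bs = "[v0, v1, v2, v3, v4]"
  note C1 = C5_rotate[OF C0]
  note C2 = C5_rotate[OF C1]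
  note C3 = C5_rotate[OF C2]
  note C4 = C5_rotate[OF C3]
  have nb: "E x v4 \<and> E x v1 \<or> E x v0 \<and> E x v2 \<or> E x v1 \<and> E x v3 \<or> E x v2 \<and> E x v4 \<or> E x v3 \<and> E x v0"
    if x: "x \<in> V" and v: "\<exists>v\<in>set ?bs. E x v" for x
  proof -
    have "(E x v0 \<longrightarrow> E x v2 \<or> E x v3) \<and> (E x v1 \<longrightarrow> E x v3 \<or> E x v4) \<and> (E x v2 \<longrightarrow> E x v4 \<or> E x v0) \<and>
      (E x v3 \<longrightarrow> E x v0 \<or> E x v1) \<and> (E x v4 \<longrightarrow> E x v1 \<or> E x v2)"
      using noW[OF x C0] noW[OF x C1] noW[OF x C2] noW[OF x C3] noW[OF x C4] by blast
    then show ?thesis using v unfolding list.set bex_simps by argo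
  qed
  have tw: "E x y \<longleftrightarrow> E y a" if "C5 a b c d e" "E x b" "E x e" "y \<in> V" for a b c d e x y
    by (rule C5_twin[OF _ that]) (erule (4) noW)
  have att: "E x y \<longleftrightarrow> E y v" if "x \<in> V" "y \<in> V" "(v, a, b) \<in> set [(v0, v4, v1), (v1, v0, v2), (v2, v1, v3), (v3, v2, v4), (v4, v3, v0)]" "E x a" "E x b" for x y v a b
    using that(3) unfolding list.set insert_iff empty_iff prod.inject
  proof (elim disjE conjE FalseE)
    assume "v = v0" "a = v4" "b = v1" then show ?thesis using tw[OF C0, of x y] that by blast
  next
    assume "v = v1" "a = v0" "b = v2" then show ?thesis using tw[OF C1, of x y] that by blast
  next
    assume "v = v2" "a = v1" "b = v3" then show ?thesis using tw[OF C2, of x y] that by blast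
  next
    assume "v = v3" "a = v2" "b = v4" then show ?thesis using tw[OF C3, of x y] that by blast
  next
    assume "v = v4" "a = v3" "b = v0" then show ?thesis using tw[OF C4, of x y] that by blast
  qed
  have twin: "\<exists>v a b. (v, a, b) \<in> set [(v0, v4, v1), (v1, v0, v2), (v2, v1, v3), (v3, v2, v4), (v4, v3, v0)] \<and> E x a \<and> E x b"
    if "x \<in> V" "\<exists>v\<in>set ?bs. E x v" for x
    using nb[OF that] by auto
  \<comment> \<open>By connectedness a vertex \<open>z\<close> missing the cycle may be taken with a
    neighbour \<open>y\<close> that touches it. Since \<open>y\<close> has the same neighbours in
    \<open>V\<close> as some cycle vertex \<open>v\<close>, also \<open>z\<close> sees
    \<open>v\<close>.\<close>
  have touch: "\<exists>v\<in>set ?bs. E x v" if x: "x \<in> V" for x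
  proof (rule ccontr)
    assume n: "\<not> ?thesis"
    let ?A = "{x \<in> V. \<not> (\<exists>v\<in>set ?bs. E x v)}"
    have "?A \<union> (V - ?A) = V" "?A \<inter> (V - ?A) = {}" "?A \<noteq> {}" "V - ?A \<noteq> {}" using x n r by auto
    from conn[OF this] obtain z y where z: "z \<in> ?A" and y: "y \<in> V - ?A" and e: "E z y" by (elim bexE)
    have yV: "y \<in> V" "\<exists>v\<in>set ?bs. E y v" using y by blast+
    from twin[OF yV] obtain v a b where t: "(v, a, b) \<in> set [(v0, v4, v1), (v1, v0, v2), (v2, v1, v3), (v3, v2, v4), (v4, v3, v0)]" "E y a" "E y b"
      by (elim exE conjE)
    have "E y z \<longleftrightarrow> E z v" by (rule att[OF yV(1) _ t]) (use z in blast)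
    moreover have "v \<in> set ?bs" using t(1) by auto
    ultimately show False using e z sym by blast
  qed
  have "bounded_decomposable (palette (length ?bs)) E V"
  proof (rule base_determines)
    fix x y x' y' assume V: "x \<in> V" "y \<in> V" "x' \<in> V" "y' \<in> V" and m: "map (E x) ?bs = map (E x') ?bs" "map (E y) ?bs = map (E y') ?bs"
    from twin[OF V(1) touch[OF V(1)]] obtain v a b where t: "(v, a, b) \<in> set [(v0, v4, v1), (v1, v0, v2), (v2, v1, v3), (v3, v2, v4), (v4, v3, v0)]" "E x a" "E x b"
      by (elim exE conjE)
    have s: "v \<in> set ?bs" "a \<in> set ?bs" "b \<in> set ?bs" using t(1) by auto
    then have "E x' a" "E x' b" "E y v = E y' v" using m t(2,3) unfolding map_eq_conv by blast+
    then show "E x y = E x' y'" using att[OF V(1,2) t] att[OF V(3,4) t(1)] by blast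
  qed
  then show ?thesis by (simp add: numeral_eq_Suc)
qed

lemma connected_decomposable:
  assumes fin: "finite V" and conn: "\<And>A B. \<lbrakk>A \<union> B = V; A \<inter> B = {}; A \<noteq> {}; B \<noteq> {}\<rbrakk> \<Longrightarrow> \<exists>a\<in>A. \<exists>b\<in>B. E a b"
    and rep: "\<And>x. \<exists>y\<in>V. \<forall>u. E x u = E y u"
  shows "bounded_decomposable (palette 5 + palette 6 + palette 7 + 4) E V"
proof -
  consider (no) "\<And>a b c d e. \<not> C5 a b c d e" | (W) a b c d e u where "u \<in> V" "C5 a b c d e" "E u a" "\<not> E u c" "\<not> E u d"
    | (noW) v0 v1 v2 v3 v4 where "C5 v0 v1 v2 v3 v4" "\<And>a b c d e u. \<lbrakk>u \<in> V; C5 a b c d e; E u a; \<not> E u c; \<not> E u d\<rbrakk> \<Longrightarrow> False"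
    by metis
  then show ?thesis
  proof cases
    case no
    have "bounded_decomposable (palette 7 + 4) E V" by (rule C5_free_decomposable[OF no fin]) (rule conn)
    then show ?thesis by (rule bounded_decomposable_mono) simp
  next
    case W
    have "\<not> E u b" "\<not> E u e" using K3[of u a b] K3[of u a e] W C5_induced[OF W(2)] by blast+
    then have "att E [a, b, c, d, e] [0] u" using W by (simp add: att_simps)
    then have "bounded_decomposable (palette 6) E V" by (rule C5_pendant_decomposable[OF W(2) fin W(1)])
    then show ?thesis by (rule bounded_decomposable_mono) simp
  next
    case noW
    \<comment> \<open>The cycle need not lie in \<open>V\<close>, but \<open>rep\<close> supplies a
      vertex of \<open>V\<close> with the same neighbours as \<open>v0\<close>.\<close>
    obtain r where r: "r \<in> V" "\<forall>u. E v0 u = E r u" using rep by blast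
    have "E r v1" using r(2) C5_induced[OF noW(1)] by blast
    have "bounded_decomposable (palette 5) E V"
      by (rule C5_no_pendant_decomposable[OF noW(1) _ r(1) \<open>E r v1\<close>]) (erule (3) conn, erule (4) noW(2))
    then show ?thesis by (rule bounded_decomposable_mono) simp
  qed
qed

end

context P2_P4_free
begin

lemma connected_decomposable:
  assumes fin: "finite V" and conn: "\<And>A B. \<lbrakk>A \<union> B = V; A \<inter> B = {}; A \<noteq> {}; B \<noteq> {}\<rbrakk> \<Longrightarrow> \<exists>a\<in>A. \<exists>b\<in>B. E a b"
  shows "bounded_decomposable (palette 5 + palette 6 + palette 7 + 4) E V"
proof -
  consider (no) "\<And>a b c d e. \<not> C5 a b c d e"
    | (H2) a b c d e z y where "C5 a b c d e" "\<not> E z a" "\<not> E z b" "\<not> E z c" "\<not> E z d" "\<not> E z e" "E z y"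
    | (noH2) v0 v1 v2 v3 v4 where "C5 v0 v1 v2 v3 v4"
      "\<And>a b c d e z y. \<lbrakk>C5 a b c d e; \<not> E z a; \<not> E z b; \<not> E z c; \<not> E z d; \<not> E z e; E z y\<rbrakk> \<Longrightarrow> False"
    by metis
  then show ?thesis
  proof cases
    case no
    have "bounded_decomposable (palette 7 + 4) E V" by (rule C5_free_decomposable[OF no fin]) (rule conn)
    then show ?thesis by (rule bounded_decomposable_mono) simp
  next
    case H2
    note C1 = C5_rotate[OF H2(1)]
    note C2 = C5_rotate[OF C1]
    note C3 = C5_rotate[OF C2]
    note C4 = C5_rotate[OF C3]
    note ind = C5_induced[OF H2(1)]
    \<comment> \<open>The edge zy and a path on four cycle vertices missed by \<open>y\<close> would
      be P2+P4. So \<open>y\<close> meets each of the five such paths, which with triangle-freeness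
      gives two neighbours at distance two. After a rotation \<open>y\<close> serves as
      \<open>h\<close> and \<open>z\<close> as \<open>g\<close>.\<close>
    have P: False if p: "E p q" "E q r" "E r s" "\<not> E p r" "\<not> E p s" "\<not> E q s"
      and z: "\<not> E z p" "\<not> E z q" "\<not> E z r" "\<not> E z s" and y: "\<not> E y p" "\<not> E y q" "\<not> E y r" "\<not> E y s" for p q r s
      using H[of p q r s z y] p z y H2(7) commute by blast
    have "\<not> (E y a \<and> E y b)" "\<not> (E y b \<and> E y c)" "\<not> (E y c \<and> E y d)" "\<not> (E y d \<and> E y e)" "\<not> (E y e \<and> E y a)"
      using K3[of y a b] K3[of y b c] K3[of y c d] K3[of y d e] K3[of y a e] ind by blast+
    moreover have "E y a \<or> E y b \<or> E y c \<or> E y d" "E y b \<or> E y c \<or> E y d \<or> E y e" "E y c \<or> E y d \<or> E y e \<or> E y a"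
      "E y d \<or> E y e \<or> E y a \<or> E y b" "E y e \<or> E y a \<or> E y b \<or> E y c"
      using P[of a b c d] P[of b c d e] P[of c d e a] P[of d e a b] P[of e a b c] ind H2(2-6) commute by blast+
    ultimately have "E y b \<and> E y e \<or> E y c \<and> E y a \<or> E y d \<and> E y b \<or> E y e \<and> E y c \<or> E y a \<and> E y d" by argo
    then have "bounded_decomposable (palette 7) E V"
    proof (elim disjE conjE)
      assume "E y b" "E y e" then show ?thesis by (rule pendant_decomposable[OF H2(1) _ _ H2(2-7) fin])
    next
      assume "E y c" "E y a" then show ?thesis by (rule pendant_decomposable[OF C1 _ _ H2(3-6,2,7) fin])
    next
      assume "E y d" "E y b" then show ?thesis by (rule pendant_decomposable[OF C2 _ _ H2(4-6,2,3,7) fin])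
    next
      assume "E y e" "E y c" then show ?thesis by (rule pendant_decomposable[OF C3 _ _ H2(5,6,2-4,7) fin])
    next
      assume "E y a" "E y d" then show ?thesis by (rule pendant_decomposable[OF C4 _ _ H2(6,2-5,7) fin])
    qed
    then show ?thesis by (rule bounded_decomposable_mono) simp
  next
    case noH2
    have "bounded_decomposable (palette 5) E V" by (rule pendant_free_decomposable[OF noH2(2) noH2(1) fin])
    then show ?thesis by (rule bounded_decomposable_mono) simp
  qed
qed

end

section \<open>Graphs\<close>

text \<open>Composing with \<open>\<pi>\<close> turns the vertices outside \<open>U\<close> into false twins of vertices of \<open>U\<close>. The excluded
  graphs have no false twins, so the composed relation satisfies the locale assumptions on the whole type.\<close>

lemma hereditary_decomposable:
  assumes sym: "\<And>x y. R x y \<Longrightarrow> R y x" and fin: "finite V"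
    and conn: "\<And>U \<pi>. \<lbrakk>U \<subseteq> V; U \<noteq> {}; \<And>x. x \<in> U \<Longrightarrow> \<pi> x = x; range \<pi> \<subseteq> U;
      \<And>A B. \<lbrakk>A \<union> B = U; A \<inter> B = {}; A \<noteq> {}; B \<noteq> {}\<rbrakk> \<Longrightarrow> \<exists>a\<in>A. \<exists>b\<in>B. R a b\<rbrakk>
      \<Longrightarrow> bounded_decomposable N (\<lambda>x y. R (\<pi> x) (\<pi> y)) U"
  shows "bounded_decomposable N R V"
  using fin conn
proof (induction V rule: finite_psubset_induct)
  case (psubset V)
  show ?case
  proof (cases "V = {}")
    case True
    then show ?thesis unfolding bounded_decomposable_def decomposable_def by auto
  next
    case False
    then obtain u0 where u0: "u0 \<in> V" by blast
    show ?thesis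
    proof (cases "\<exists>A B. A \<union> B = V \<and> A \<inter> B = {} \<and> A \<noteq> {} \<and> B \<noteq> {} \<and> \<not> (\<exists>a\<in>A. \<exists>b\<in>B. R a b)")
      case True
      then obtain A B where AB: "A \<union> B = V" "A \<inter> B = {}" "A \<noteq> {}" "B \<noteq> {}" "\<not> (\<exists>a\<in>A. \<exists>b\<in>B. R a b)" by blast
      have IH: "bounded_decomposable N R X" if X: "X \<subset> V" for X
      proof (rule psubset.IH[OF X])
        fix U \<pi> assume U: "U \<subseteq> X" "U \<noteq> {}" "\<And>x. x \<in> U \<Longrightarrow> \<pi> x = x" "range \<pi> \<subseteq> U"
          "\<And>A B. \<lbrakk>A \<union> B = U; A \<inter> B = {}; A \<noteq> {}; B \<noteq> {}\<rbrakk> \<Longrightarrow> \<exists>a\<in>A. \<exists>b\<in>B. R a b"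
        have "U \<subseteq> V" using U(1) X by blast
        then show "bounded_decomposable N (\<lambda>x y. R (\<pi> x) (\<pi> y)) U" by (rule psubset.prems[OF _ U(2-5)])
      qed
      have "A \<subset> V" "B \<subset> V" using AB(1-4) by blast+
      then have "bounded_decomposable N R (A \<union> B)"
        using AB(2,5) sym by (intro bounded_decomposable_disjoint_union IH) blast+
      then show ?thesis by (simp add: AB(1))
    next
      case False
      let ?\<pi> = "\<lambda>x. if x \<in> V then x else u0"
      have "bounded_decomposable N (\<lambda>x y. R (?\<pi> x) (?\<pi> y)) V"
      proof (rule psubset.prems)
        show "V \<subseteq> V" "V \<noteq> {}" "range ?\<pi> \<subseteq> V" using u0 by auto
        show "?\<pi> x = x" if "x \<in> V" for x using that by simp
        show "\<exists>a\<in>A. \<exists>b\<in>B. R a b" if "A \<union> B = V" "A \<inter> B = {}" "A \<noteq> {}" "B \<noteq> {}" for A B using False that by blast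
      qed
      then show ?thesis by (rule bounded_decomposable_cong) simp
    qed
  qed
qed

section \<open>Translation from induced subgraphs of graphs to patterns of a relation\<close>

lemma free_ofD:
  assumes "free_of H G" "inj_on f (verts H)" "f ` verts H \<subseteq> verts G"
    and "\<And>u v. \<lbrakk>u \<in> verts H; v \<in> verts H\<rbrakk> \<Longrightarrow> {u, v} \<in> edges H \<longleftrightarrow> {f u, f v} \<in> edges G"
  shows False
proof -
  have "graph_iso f H (induced_subgraph G (f ` verts H))"
    using assms(2,4) by (auto simp: graph_iso_def induced_subgraph_def bij_betw_def)
  then show False using assms(1,3) unfolding free_of_def by blast
qed

lemma path_graph_edge: "{i, j} \<in> edges (path_graph r) \<longleftrightarrow> j = Suc i \<and> j < r \<or> i = Suc j \<and> i < r"
  by (auto simp: path_graph_def doubleton_eq_iff)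

lemma disjoint_union_edges:
  "{Inl i, Inl j} \<in> edges (disjoint_union G H) \<longleftrightarrow> {i, j} \<in> edges G"
  "{Inr k, Inr l} \<in> edges (disjoint_union G H) \<longleftrightarrow> {k, l} \<in> edges H"
  "{Inl i, Inr k} \<notin> edges (disjoint_union G H)"
  "{Inr k, Inl i} \<notin> edges (disjoint_union G H)"
proof -
  have l: "{Inl i, Inl j} = Inl ` X \<longleftrightarrow> {i, j} = X" for X :: "'a set" and i j :: 'a
    using inj_image_eq_iff[OF inj_Inl, of "{i, j}" X] by simp
  have r: "{Inr k, Inr l} = Inr ` X \<longleftrightarrow> {k, l} = X" for X :: "'b set" and k l :: 'b
    using inj_image_eq_iff[OF inj_Inr, of "{k, l}" X] by simp
  show "{Inl i, Inl j} \<in> edges (disjoint_union G H) \<longleftrightarrow> {i, j} \<in> edges G"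
    "{Inr k, Inr l} \<in> edges (disjoint_union G H) \<longleftrightarrow> {k, l} \<in> edges H"
    by (auto simp: disjoint_union_def image_iff l r)
  show "{Inl i, Inr k} \<notin> edges (disjoint_union G H)" "{Inr k, Inl i} \<notin> edges (disjoint_union G H)"
    by (auto simp: disjoint_union_def)
qed

lemma no_loops:
  "{Inl i} \<in> edges (disjoint_union G H) \<longleftrightarrow> {i} \<in> edges G" "{Inr k} \<in> edges (disjoint_union G H) \<longleftrightarrow> {k} \<in> edges H"
  "{n} \<notin> edges (path_graph r)"
  using disjoint_union_edges(1)[of i i G H] disjoint_union_edges(2)[of k k G H] path_graph_edge[of n n r] by simp_all

lemma simple_graph_edge:
  assumes "simple_graph G" "{u, v} \<in> edges G"
  shows "u \<in> verts G" "v \<in> verts G" "u \<noteq> v"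
  using assms by (auto simp: simple_graph_def doubleton_eq_iff dest!: subsetD)

lemma lessThan_unfold: "{..<2} = {0, Suc 0}" "{..<Suc 0} = {0}" "{..<4} = {0, Suc 0, 2, 3}" "{..<5} = {0, Suc 0, 2, 3, 4}" "{..<3} = {0, Suc 0, 2::nat}"
  by auto

lemma free_graphs_decomposable:
  fixes G :: "'a graph"
  assumes H: "H \<in> {disjoint_union (path_graph 2) (path_graph 4), disjoint_union (path_graph 1) (path_graph 5)}"
    and G: "G \<in> free_graphs (complete_graph 3) H"
  shows "bounded_decomposable (palette 5 + palette 6 + palette 7 + 4) (\<lambda>x y. {x, y} \<in> edges G) (verts G)"
proof (rule hereditary_decomposable)
  have simple: "simple_graph G" and noK: "free_of (complete_graph 3) G" and noH: "free_of H G"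
    using G by (simp_all add: free_graphs_def)
  note vert = simple_graph_edge[OF simple]
  show "finite (verts G)" using simple by (simp add: simple_graph_def)
  show "{y, x} \<in> edges G" if "{x, y} \<in> edges G" for x y using that by (simp add: insert_commute)
  fix U and \<pi> :: "'a \<Rightarrow> 'a"
  assume U: "U \<subseteq> verts G" "U \<noteq> {}" "\<And>x. x \<in> U \<Longrightarrow> \<pi> x = x" "range \<pi> \<subseteq> U"
    and conn: "\<And>A B. \<lbrakk>A \<union> B = U; A \<inter> B = {}; A \<noteq> {}; B \<noteq> {}\<rbrakk> \<Longrightarrow> \<exists>a\<in>A. \<exists>b\<in>B. {a, b} \<in> edges G"
  let ?E = "\<lambda>x y. {\<pi> x, \<pi> y} \<in> edges G"
  have finU: "finite U" using U(1) simple by (auto simp: simple_graph_def intro: finite_subset)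
  have pv: "\<pi> x \<in> verts G" for x using U(1,4) by blast
  have nl: "{x, x} \<notin> edges G" for x using vert(3)[of x x] by blast
  have R: "{x, y} \<in> edges G \<longleftrightarrow> {y, x} \<in> edges G" for x y by (simp add: insert_commute)
  have K3: False if e: "{a, b} \<in> edges G" "{b, c} \<in> edges G" "{a, c} \<in> edges G" for a b c
  proof (rule free_ofD[OF noK, of "\<lambda>i. if i = 0 then a else if i = Suc 0 then b else c"])
    have "a \<noteq> b" "b \<noteq> c" "a \<noteq> c" "a \<in> verts G" "b \<in> verts G" "c \<in> verts G" using vert[OF e(1)] vert[OF e(2)] vert[OF e(3)] by auto
    then show "inj_on (\<lambda>i. if i = 0 then a else if i = Suc 0 then b else c) (verts (complete_graph 3))"
      "(\<lambda>i. if i = 0 then a else if i = Suc 0 then b else c) ` verts (complete_graph 3) \<subseteq> verts G"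
      by (auto simp: complete_graph_def lessThan_unfold inj_on_def)
  next
    fix u v assume uv: "u \<in> verts (complete_graph 3)" "v \<in> verts (complete_graph 3)"
    have "{u, v} \<in> edges (complete_graph 3) \<longleftrightarrow> u \<noteq> v"
      using uv by (auto simp: complete_graph_def doubleton_eq_iff)
    then show "{u, v} \<in> edges (complete_graph 3) \<longleftrightarrow> {if u = 0 then a else if u = Suc 0 then b else c, if v = 0 then a else if v = Suc 0 then b else c} \<in> edges G"
      using uv e e[unfolded R[of a b] R[of b c] R[of a c]] nl by (auto simp: complete_graph_def lessThan_unfold)
  qed
  have tf: "triangle_free ?E"
  proof
    show "?E y x" if "?E x y" for x y using that by (simp add: insert_commute)
    show False if "?E a b" "?E b c" "?E a c" for a b c using K3 that by blast
  qed
  have conn': "\<exists>a\<in>A. \<exists>b\<in>B. ?E a b" if AB: "A \<union> B = U" "A \<inter> B = {}" "A \<noteq> {}" "B \<noteq> {}" for A B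
  proof -
    obtain a b where ab: "a \<in> A" "b \<in> B" "{a, b} \<in> edges G" using conn[OF AB] by blast
    moreover have "\<pi> a = a" "\<pi> b = b" using ab(1,2) AB(1) U(3) by blast+
    ultimately show ?thesis by (intro bexI[of _ a] bexI[of _ b]) simp_all
  qed
  from H show "bounded_decomposable (palette 5 + palette 6 + palette 7 + 4) ?E U"
    unfolding insert_iff empty_iff
  proof (elim disjE FalseE)
    assume H: "H = disjoint_union (path_graph 2) (path_graph 4)"
    have loc: "P2_P4_free ?E"
    proof (intro P2_P4_free.intro tf P2_P4_free_axioms.intro)
      fix a b c d e f
      assume a: "?E a b" "?E b c" "?E c d" "?E e f" "\<not> ?E a c" "\<not> ?E a d" "\<not> ?E b d" "\<not> ?E a e" "\<not> ?E a f"
        "\<not> ?E b e" "\<not> ?E b f" "\<not> ?E c e" "\<not> ?E c f" "\<not> ?E d e" "\<not> ?E d f"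
      note s = a[unfolded R[of "\<pi> a" "\<pi> b"] R[of "\<pi> b" "\<pi> c"] R[of "\<pi> c" "\<pi> d"] R[of "\<pi> e" "\<pi> f"] R[of "\<pi> a" "\<pi> c"] R[of "\<pi> a" "\<pi> d"] R[of "\<pi> b" "\<pi> d"]
        R[of "\<pi> a" "\<pi> e"] R[of "\<pi> a" "\<pi> f"] R[of "\<pi> b" "\<pi> e"] R[of "\<pi> b" "\<pi> f"] R[of "\<pi> c" "\<pi> e"] R[of "\<pi> c" "\<pi> f"] R[of "\<pi> d" "\<pi> e"] R[of "\<pi> d" "\<pi> f"]]
      \<comment> \<open>Two positions of the pattern are either adjacent, and there are no loops, or
        some third position is adjacent to exactly one of them. So their images under \<pi>
        differ.\<close>
      have ne: "\<pi> a \<noteq> \<pi> b" "\<pi> a \<noteq> \<pi> c" "\<pi> a \<noteq> \<pi> d" "\<pi> a \<noteq> \<pi> e" "\<pi> a \<noteq> \<pi> f" "\<pi> b \<noteq> \<pi> c" "\<pi> b \<noteq> \<pi> d" "\<pi> b \<noteq> \<pi> e" "\<pi> b \<noteq> \<pi> f"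
        "\<pi> c \<noteq> \<pi> d" "\<pi> c \<noteq> \<pi> e" "\<pi> c \<noteq> \<pi> f" "\<pi> d \<noteq> \<pi> e" "\<pi> d \<noteq> \<pi> f" "\<pi> e \<noteq> \<pi> f"
        using a s nl by metis+
      let ?f = "case_sum (\<lambda>i. if i = 0 then \<pi> e else \<pi> f) (\<lambda>i. if i = 0 then \<pi> a else if i = Suc 0 then \<pi> b else if i = 2 then \<pi> c else \<pi> d)"
      have V: "verts H = {Inl 0, Inl (Suc 0), Inr 0, Inr (Suc 0), Inr 2, Inr 3}"
        unfolding H disjoint_union_def path_graph_def graph.sel lessThan_unfold by auto
      show False
      proof (rule free_ofD[OF noH, of ?f])
        show "inj_on ?f (verts H)" unfolding V inj_on_def by (simp add: ne ne[symmetric])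
        show "?f ` verts H \<subseteq> verts G" unfolding V using pv by auto
        have "\<forall>u\<in>verts H. \<forall>v\<in>verts H. {u, v} \<in> edges H \<longleftrightarrow> {?f u, ?f v} \<in> edges G"
          unfolding V unfolding H by (simp add: disjoint_union_edges no_loops path_graph_edge a s nl nl[simplified])
        then show "{u, v} \<in> edges H \<longleftrightarrow> {?f u, ?f v} \<in> edges G" if "u \<in> verts H" "v \<in> verts H" for u v
          using that by blast
      qed
    qed
    show ?thesis by (rule P2_P4_free.connected_decomposable[OF loc finU]) (rule conn')
  next
    assume H: "H = disjoint_union (path_graph 1) (path_graph 5)"
    have loc: "P1_P5_free ?E"
    proof (intro P1_P5_free.intro tf P1_P5_free_axioms.intro)
      fix a b c d e f
      assume a: "?E a b" "?E b c" "?E c d" "?E d e" "\<not> ?E a c" "\<not> ?E a d" "\<not> ?E a e" "\<not> ?E b d" "\<not> ?E b e" "\<not> ?E c e"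
        "\<not> ?E a f" "\<not> ?E b f" "\<not> ?E c f" "\<not> ?E d f" "\<not> ?E e f"
      note s = a[unfolded R[of "\<pi> a" "\<pi> b"] R[of "\<pi> b" "\<pi> c"] R[of "\<pi> c" "\<pi> d"] R[of "\<pi> d" "\<pi> e"] R[of "\<pi> a" "\<pi> c"] R[of "\<pi> a" "\<pi> d"] R[of "\<pi> a" "\<pi> e"]
        R[of "\<pi> b" "\<pi> d"] R[of "\<pi> b" "\<pi> e"] R[of "\<pi> c" "\<pi> e"] R[of "\<pi> a" "\<pi> f"] R[of "\<pi> b" "\<pi> f"] R[of "\<pi> c" "\<pi> f"] R[of "\<pi> d" "\<pi> f"] R[of "\<pi> e" "\<pi> f"]]
      have ne: "\<pi> a \<noteq> \<pi> b" "\<pi> a \<noteq> \<pi> c" "\<pi> a \<noteq> \<pi> d" "\<pi> a \<noteq> \<pi> e" "\<pi> a \<noteq> \<pi> f" "\<pi> b \<noteq> \<pi> c" "\<pi> b \<noteq> \<pi> d" "\<pi> b \<noteq> \<pi> e" "\<pi> b \<noteq> \<pi> f"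
        "\<pi> c \<noteq> \<pi> d" "\<pi> c \<noteq> \<pi> e" "\<pi> c \<noteq> \<pi> f" "\<pi> d \<noteq> \<pi> e" "\<pi> d \<noteq> \<pi> f" "\<pi> e \<noteq> \<pi> f"
        using a s nl by metis+
      let ?f = "case_sum (\<lambda>_. \<pi> f) (\<lambda>i. if i = 0 then \<pi> a else if i = Suc 0 then \<pi> b else if i = 2 then \<pi> c else if i = 3 then \<pi> d else \<pi> e)"
      have V: "verts H = {Inl 0, Inr 0, Inr (Suc 0), Inr 2, Inr 3, Inr 4}"
        unfolding H disjoint_union_def path_graph_def graph.sel lessThan_unfold by auto
      show False
      proof (rule free_ofD[OF noH, of ?f])
        show "inj_on ?f (verts H)" unfolding V inj_on_def by (simp add: ne ne[symmetric])
        show "?f ` verts H \<subseteq> verts G" unfolding V using pv by auto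
        have "\<forall>u\<in>verts H. \<forall>v\<in>verts H. {u, v} \<in> edges H \<longleftrightarrow> {?f u, ?f v} \<in> edges G"
          unfolding V unfolding H by (simp add: disjoint_union_edges no_loops path_graph_edge a s nl nl[simplified])
        then show "{u, v} \<in> edges H \<longleftrightarrow> {?f u, ?f v} \<in> edges G" if "u \<in> verts H" "v \<in> verts H" for u v
          using that by blast
      qed
    qed
    have rep: "\<exists>y\<in>U. \<forall>u. ?E x u = ?E y u" for x
    proof
      show "\<pi> x \<in> U" using U(4) by blast
      then show "\<forall>u. ?E x u = ?E (\<pi> x) u" by (simp add: U(3))
    qed
    show ?thesis by (rule P1_P5_free.connected_decomposable[OF loc finU _ rep]) (rule conn')
  qed
qed

section \<open>From decomposability to clique-width and well-quasi-ordering\<close>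

lemma decomposable_clique_width:
  assumes G: "simple_graph G" and dec: "bounded_decomposable N (\<lambda>x y. {x, y} \<in> edges G) (verts G)"
  shows "clique_width G \<le> N + N"
proof (cases "verts G = {}")
  case False
  obtain c where c: "c ` verts G \<subseteq> {..<N}" "decomposable (\<lambda>x y. {x, y} \<in> edges G) c (verts G)"
    using dec unfolding bounded_decomposable_def by blast
  have "symp (\<lambda>x y. {x, y} \<in> edges G)" by (rule sympI) (simp add: insert_commute)
  moreover have "irreflp (\<lambda>x y. {x, y} \<in> edges G)" using simple_graph_edge(3)[OF G] by (intro irreflpI) blast
  moreover have "finite (verts G)" using G by (simp add: simple_graph_def)
  ultimately obtain l where l: "cw_construct (N + N) (Graph (verts G) {{u, v} | u v. u \<in> verts G \<and> v \<in> verts G \<and> {u, v} \<in> edges G}) l"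
    using cw_construct_decomposable[OF _ _ _ False c(2,1)] by blast
  have "{{u, v} | u v. u \<in> verts G \<and> v \<in> verts G \<and> {u, v} \<in> edges G} = edges G"
    using G unfolding simple_graph_def by blast
  then have "cw_construct (N + N) G l" using l by simp
  then have "(LEAST k. \<exists>l. cw_construct k G l) \<le> N + N" by (intro Least_le exI)
  then show ?thesis using False by (simp add: clique_width_def)
qed (simp add: clique_width_def)

lemma obj_emb_labelled:
  assumes G: "simple_graph G" and emb: "obj_emb le ((\<lambda>x y. {x, y} \<in> edges G), c, l, verts G) ((\<lambda>x y. {x, y} \<in> edges G'), c', l', verts G')"
    and G': "simple_graph G'"
  shows "labelled_induced_subgraph le (G, l) (G', l')"
proof -
  obtain h where h: "inj_on h (verts G)" "h ` verts G \<subseteq> verts G'" "\<forall>x\<in>verts G. le (l x) (l' (h x))"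
    "\<forall>x\<in>verts G. \<forall>y\<in>verts G. x \<noteq> y \<longrightarrow> ({x, y} \<in> edges G) = ({h x, h y} \<in> edges G')"
    using emb unfolding obj_emb_def prod.case by blast
  have "{x, y} \<in> edges G \<longleftrightarrow> {h x, h y} \<in> edges G'" if "x \<in> verts G" "y \<in> verts G" for x y
    using h(4) that simple_graph_edge(3)[OF G, of x x] simple_graph_edge(3)[OF G', of "h x" "h x"] by (cases "x = y") auto
  then have "graph_iso h G (induced_subgraph G' (h ` verts G))"
    using h(1) by (auto simp: graph_iso_def induced_subgraph_def bij_betw_def)
  then show ?thesis unfolding labelled_induced_subgraph_def prod.case using h(2,3) by blast
qed

lemma decomposable_labelled_wqo:
  fixes X :: "'a graph set"
  assumes X: "\<And>G. G \<in> X \<Longrightarrow> simple_graph G \<and> bounded_decomposable N (\<lambda>x y. {x, y} \<in> edges G) (verts G)"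
  shows "labelled_wqo TYPE('w) X"
  unfolding labelled_wqo_def
proof (intro allI impI notI)
  fix W :: "'w set" and le assume W: "well_quasi_order_on W le"
  assume "\<exists>A. A \<subseteq> labelled_graphs X W \<and> infinite A \<and> antichain_wrt (labelled_induced_subgraph le) A"
  then obtain A where A: "A \<subseteq> labelled_graphs X W" "infinite A" "antichain_wrt (labelled_induced_subgraph le) A" by blast
  have anti: "\<not> labelled_induced_subgraph le p q" if "p \<in> A" "q \<in> A" "p \<noteq> q" for p q
    using A(3) that unfolding antichain_wrt_def by blast
  \<comment> \<open>The graph without vertices embeds into every labelled graph, so it cannot belong
    to an infinite antichain. This is needed because \<open>objs\<close> admits only nonempty vertex
    sets.\<close>
  have nonempty: "verts (fst p) \<noteq> {}" if p: "p \<in> A" for p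
  proof
    assume e: "verts (fst p) = {}"
    have "infinite (A - {p})" using A(2) by simp
    then obtain q where q: "q \<in> A" "p \<noteq> q" using infinite_imp_nonempty by blast
    have "labelled_induced_subgraph le p q"
      using e unfolding labelled_induced_subgraph_def
      by (cases p; cases q) (auto simp: graph_iso_def induced_subgraph_def bij_betw_def intro!: exI[of _ "{}"])
    then show False using anti[OF p q] by blast
  qed
  obtain s :: "nat \<Rightarrow> 'a graph \<times> ('a \<Rightarrow> 'w)" where s: "inj s" "range s \<subseteq> A" using infinite_countable_subset[OF A(2)] by blast
  have sA: "s n \<in> A" for n using s(2) by blast
  have G: "fst (s n) \<in> X" "snd (s n) ` verts (fst (s n)) \<subseteq> W" for n
    using subsetD[OF A(1) sA[of n]] unfolding labelled_graphs_def by (auto simp: case_prod_beta)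
  have "\<forall>n. \<exists>c. c ` verts (fst (s n)) \<subseteq> {..<N} \<and> decomposable (\<lambda>x y. {x, y} \<in> edges (fst (s n))) c (verts (fst (s n)))"
    using X[OF G(1)] unfolding bounded_decomposable_def by blast
  from choice[OF this] obtain c where c: "\<forall>n. c n ` verts (fst (s n)) \<subseteq> {..<N} \<and> decomposable (\<lambda>x y. {x, y} \<in> edges (fst (s n))) (c n) (verts (fst (s n)))" ..
  let ?o = "\<lambda>n. ((\<lambda>x y. {x, y} \<in> edges (fst (s n))), c n, snd (s n), verts (fst (s n)))"
  have "?o n \<in> objs N W" for n
  proof -
    have "symp (\<lambda>x y. {x, y} \<in> edges (fst (s n)))" by (rule sympI) (simp add: insert_commute)
    moreover have "finite (verts (fst (s n)))" using X[OF G(1)[of n]] by (simp add: simple_graph_def)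
    ultimately show ?thesis using c nonempty[OF sA[of n]] G(2)[of n] unfolding objs_def by blast
  qed
  then have "range ?o \<subseteq> objs N W" by blast
  from objs_good[OF W this] obtain i j where ij: "i < j" "obj_emb le (?o i) (?o j)" unfolding good_seq_def by blast
  have "labelled_induced_subgraph le (fst (s i), snd (s i)) (fst (s j), snd (s j))"
    using obj_emb_labelled[OF _ ij(2)] X[OF G(1)] by blast
  moreover have "s i \<noteq> s j" using s(1) ij(1) by (simp add: inj_eq)
  ultimately show False using anti[OF sA sA, of i j] by simp
qed

theorem theorem5:
  fixes H :: "(nat + nat) graph"
  assumes "H \<in> {disjoint_union (path_graph 2) (path_graph 4),
                disjoint_union (path_graph 1) (path_graph 5)}"
  shows "labelled_wqo TYPE('w) (free_graphs (complete_graph 3) H :: 'a graph set) \<and>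
         bounded_clique_width (free_graphs (complete_graph 3) H :: 'a graph set)"
proof
  note dec = free_graphs_decomposable[OF assms]
  have simple: "simple_graph G" if "G \<in> free_graphs (complete_graph 3) H" for G :: "'a graph"
    using that by (simp add: free_graphs_def)
  show "labelled_wqo TYPE('w) (free_graphs (complete_graph 3) H :: 'a graph set)"
    by (rule decomposable_labelled_wqo) (use simple dec in blast)
  show "bounded_clique_width (free_graphs (complete_graph 3) H :: 'a graph set)"
    unfolding bounded_clique_width_def using decomposable_clique_width[OF simple dec] by blast
qed

end
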